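(* Let $0<\beta<2\pi/\sqrt3$ and let $a_-<a_+$ be the two (positive) real roots of $$3a^2-\frac{4\pi}{\beta}a+1=0 .$$ Let $g_{\mathrm{sbh}}$ and $g_{\mathrm{lbh}}$ be the small and large AdS–Schwarzschild black hole metrics on $M_1=S^2\times\mathbb R^2$ with horizon radii $a_-$ and $a_+$ respectively and conformal infinity $(S^2\times S^1,[\gamma])$, and let $g_h$ be the thermal hyperbolic metric on $M_2=B^3\times S^1$ with the same conformal infinity, where $\gamma$ is the product of the curvature $+1$ metric on $S^2$ and a circle of length $\beta$. Then $$\mathrm{RenV}(M_2,g_h)=0,$$ $$\mathrm{RenV}(M_1,g_{\mathrm{lbh}})=\frac{8\pi^2}{3}\,\frac{a_+^2(1-a_+^2)}{1+3a_+^2},\qquad \mathrm{RenV}(M_1,g_{\mathrm{sbh}})=\frac{8\pi^2}{3}\,\frac{a_-^2(1-a_-^2)}{1+3a_-^2}.$$ If $\beta<\pi$, then $\mathrm{RenV}(M_1,g_{\mathrm{lbh}})<\mathrm{RenV}(M_2,g_h)=0<\mathrm{RenV}(M_1,g_{\mathrm{sbh}})$; if $\beta>\pi$, then $g_h$ has the smallest renormalized volume among the three metrics. Moreover, for $a=a_\pm$ and the corresponding mass $m$ defined by $a^3+a-2m=0$, $$\frac{3}{8\pi\beta}\,\mathrm{RenV}(M_1,g_{\mathrm{lbh/sbh}})=m-\frac1\beta\,\pi a_\pm^2 ,$$ where $a_+$ corresponds to lbh and $a_-$ to sbh.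
   Context: Metrics. For $a>0$ put $m=(a^3+a)/2$ and $F(r)=1+r^2-2m/r$, so $F(a)=0$. The black hole metric with horizon radius $a$ is $$g=F(r)\,d\tau^2+\frac{dr^2}{F(r)}+r^2 g_{S^2},\qquad r\ge a,$$ where $g_{S^2}$ is the round metric of curvature $+1$ and $\tau$ is periodic with period $\beta$; it extends smoothly across $r=a$ to an Einstein metric ($\mathrm{Rc}=-3g$) on $S^2\times\mathbb R^2$ exactly when $3a^2-\frac{4\pi}{\beta}a+1=0$. The thermal hyperbolic metric $g_h$ on $B^3\times S^1$ is $(1+r^2)d\tau^2+\frac{dr^2}{1+r^2}+r^2g_{S^2}$, $r\ge0$, $\tau$ of period $\beta$ (a quotient of $\mathbb H^4$ by a hyperbolic dilation). Renormalized volume. Let $g$ be an asymptotically hyperbolic Einstein metric on the interior $M$ of a compact $4$-manifold with boundary (i.e. for a boundary defining function $\rho$, $\rho^2g$ extends smoothly to the boundary and $|d\rho|^2_{\rho^2g}=1$ there). For each metric $g_0$ in the conformal class induced on $\partial M$ there is a special boundary defining function $x$, unique near $\partial M$, with $g=x^{-2}(dx^2+\hat g_x)$ near $\partial M$ and $\hat g_0=g_0$ (extend $x$ to a positive smooth function on $M$). The function $\zeta_x(z)=\int_Mx^z\,dV_g$, defined for $\mathrm{Re}\,z>3$, extends meromorphically to $\mathbb C$, and $\mathrm{RenV}(M,g)$ is its finite part (constant Laurent coefficient) at $z=0$; equivalently the constant term in the expansion of $\mathrm{Vol}_g(\{x>\varepsilon\})$ as $\varepsilon\to0$. It does not depend on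 the choice of $g_0$ in the conformal class. *)

theory Defs
  imports "HOL-Complex_Analysis.Complex_Analysis"
begin

section \<open>Smooth maps and tangent vectors on subsets of Euclidean space\<close>

text \<open>Manifolds (with boundary) are embedded in a Euclidean space. On an open set \<open>S\<close>,
  \<open>C_k_on k f S\<close> says that all iterated directional derivatives of \<open>f\<close> of order at most \<open>k\<close>
  exist and are continuous.\<close>

primrec C_k_on ::
  "nat \<Rightarrow> ('a::real_normed_vector \<Rightarrow> 'b::real_normed_vector) \<Rightarrow> 'a set \<Rightarrow> bool" where
  "C_k_on 0 f S \<longleftrightarrow> continuous_on S f"
| "C_k_on (Suc k) f S \<longleftrightarrow>
     (\<forall>x\<in>S. f differentiable (at x)) \<and> (\<forall>v. C_k_on k (\<lambda>x. frechet_derivative f (at x) v) S)"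

definition smooth_on :: "('a::real_normed_vector \<Rightarrow> 'b::real_normed_vector) \<Rightarrow> 'a set \<Rightarrow> bool" where
  "smooth_on f S \<longleftrightarrow> (\<forall>k. C_k_on k f S)"

text \<open>On an arbitrary subset \<open>N\<close> (for instance a manifold with boundary), smooth means: locally
  the restriction of a smooth map on an open subset of the ambient space.\<close>

definition smooth_map :: "'a set \<Rightarrow> ('a::real_normed_vector \<Rightarrow> 'b::real_normed_vector) \<Rightarrow> bool" where
  "smooth_map N f \<longleftrightarrow>
     (\<forall>p\<in>N. \<exists>U h. open U \<and> p \<in> U \<and> smooth_on h U \<and> (\<forall>q\<in>U \<inter> N. h q = f q))"

definition tangent_space :: "'a::real_normed_vector set \<Rightarrow> 'a \<Rightarrow> 'a set" where
  "tangent_space S p =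
     {v. \<exists>c :: real \<Rightarrow> 'a. c 0 = p \<and> (\<forall>\<^sub>F t in nhds 0. c t \<in> S) \<and>
           (c has_vector_derivative v) (at 0)}"


section \<open>Riemannian volume\<close>

text \<open>A metric assigns to a point \<open>p\<close> a bilinear form, of which only the values on tangent
  vectors at \<open>p\<close> matter.\<close>

type_synonym 'a metric_field = "'a \<Rightarrow> 'a \<Rightarrow> 'a \<Rightarrow> real"

definition local_param :: "'a::euclidean_space set \<Rightarrow> (real^4) set \<Rightarrow> (real^4 \<Rightarrow> 'a) \<Rightarrow> bool" where
  "local_param M U \<phi> \<longleftrightarrow>
     open U \<and> smooth_on \<phi> U \<and> (\<forall>u\<in>U. inj (frechet_derivative \<phi> (at u))) \<and>
     openin (top_of_set M) (\<phi> ` U) \<and> (\<exists>\<psi>. homeomorphism U (\<phi> ` U) \<phi> \<psi>)"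

definition gram :: "'a::euclidean_space metric_field \<Rightarrow> (real^4 \<Rightarrow> 'a) \<Rightarrow> real^4 \<Rightarrow> real^4^4" where
  "gram g \<phi> u = (\<chi> i j. g (\<phi> u) (frechet_derivative \<phi> (at u) (axis i 1))
                               (frechet_derivative \<phi> (at u) (axis j 1)))"

definition riemannian_volume ::
  "'a::euclidean_space set \<Rightarrow> 'a metric_field \<Rightarrow> 'a measure" where
  "riemannian_volume M g =
     (THE \<mu>. space \<mu> = M \<and> sets \<mu> = sets (restrict_space borel M) \<and>
        (\<forall>U \<phi> A. local_param M U \<phi> \<and> A \<in> sets borel \<and> A \<subseteq> U \<longrightarrow>
           emeasure \<mu> (\<phi> ` A) = (\<integral>\<^sup>+u\<in>A. ennreal (sqrt (det (gram g \<phi> u))) \<partial>lborel)))"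


section \<open>Renormalized volume\<close>

text \<open>\<open>M\<close> is the interior of the compact manifold with boundary \<open>closure M\<close>, so that the boundary
  is \<open>closure M - M\<close>.\<close>

definition manifold_boundary :: "'a::euclidean_space set \<Rightarrow> 'a set" where
  "manifold_boundary M = closure M - M"

text \<open>The normal form \<open>g = x\<^sup>-\<^sup>2 (dx\<^sup>2 + g\<^sub>x)\<close> near the boundary, spelled out by a collar \<open>\<Phi>\<close> whose
  first coordinate is \<open>x\<close> and a family \<open>h t\<close> of metrics on the boundary that is smooth up to
  \<open>t = 0\<close>; \<open>h 0\<close> is the representative of the conformal infinity that \<open>x\<close> belongs to. \<open>D\<close> is only
  determined on tangent vectors, which is where it is used.\<close>

definition special_bdf ::
  "'a::euclidean_space set \<Rightarrow> 'a metric_field \<Rightarrow> ('a \<Rightarrow> real) \<Rightarrow> bool" where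
  "special_bdf M g x \<longleftrightarrow>
     smooth_map (closure M) x \<and> (\<forall>p\<in>M. 0 < x p) \<and> (\<forall>p\<in>manifold_boundary M. x p = 0) \<and>
     (\<exists>\<epsilon>>0. \<exists>(\<Phi> :: real \<times> 'a \<Rightarrow> 'a) (h :: real \<Rightarrow> 'a metric_field).
        let B = manifold_boundary M; C = {0..<\<epsilon>} \<times> B in
        smooth_map C \<Phi> \<and> inj_on \<Phi> C \<and> openin (top_of_set (closure M)) (\<Phi> ` C) \<and>
        smooth_map (\<Phi> ` C) (the_inv_into C \<Phi>) \<and>
        (\<forall>y\<in>B. \<Phi> (0, y) = y) \<and>
        (\<forall>t\<in>{0..<\<epsilon>}. \<forall>y\<in>B. x (\<Phi> (t, y)) = t) \<and>
        (\<forall>v w. smooth_map C (\<lambda>(t, y). h t y v w)) \<and>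
        (\<forall>t\<in>{0..<\<epsilon>}. \<forall>y\<in>B. bilinear (h t y) \<and> (\<forall>v w. h t y v w = h t y w v) \<and>
           (\<forall>v\<in>tangent_space B y - {0}. 0 < h t y v v)) \<and>
        (\<forall>t\<in>{0<..<\<epsilon>}. \<forall>y\<in>B. \<forall>D. (\<Phi> has_derivative D) (at (t, y) within C) \<longrightarrow>
           (\<forall>s s'. \<forall>v\<in>tangent_space B y. \<forall>v'\<in>tangent_space B y.
              g (\<Phi> (t, y)) (D (s, v)) (D (s', v')) = (s * s' + h t y v v') / t\<^sup>2)))"

text \<open>\<open>Z\<close> is the meromorphic continuation of \<open>\<integral>\<^bsub>M\<^esub> x\<^sup>z dV\<^sub>g\<close>, which converges for \<open>Re z > 3\<close>.\<close>

definition volume_zeta_continuation ::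
  "'a::euclidean_space set \<Rightarrow> 'a metric_field \<Rightarrow> ('a \<Rightarrow> real) \<Rightarrow> (complex \<Rightarrow> complex) \<Rightarrow> bool" where
  "volume_zeta_continuation M g x Z \<longleftrightarrow>
     Z meromorphic_on UNIV \<and>
     (\<forall>z. Re z > 3 \<longrightarrow>
        has_bochner_integral (riemannian_volume M g) (\<lambda>p. complex_of_real (x p) powr z) (Z z))"

text \<open>By the definite description, a value of \<open>RenV\<close> can only be established by showing
  that it is the same for all special boundary defining functions.\<close>

definition RenV :: "'a::euclidean_space set \<Rightarrow> 'a metric_field \<Rightarrow> real" where
  "RenV M g =
     (THE V. \<exists>x Z. special_bdf M g x \<and> volume_zeta_continuation M g x Z \<and>
        complex_of_real V = fls_nth (laurent_expansion Z 0) 0)"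


section \<open>AdS--Schwarzschild and thermal hyperbolic metrics\<close>

type_synonym R32 = "(real^3) \<times> (real^2)"

definition extend_metric :: "'a::euclidean_space set \<Rightarrow> 'a metric_field \<Rightarrow> 'a metric_field" where
  "extend_metric S g p v w = (if p \<in> S then g p v w else Lim (at p within S) (\<lambda>q. g q v w))"

text \<open>The form \<open>d\<tau>\<close> at \<open>w \<noteq> 0\<close> in the plane, where \<open>\<tau> = \<beta> \<theta> / 2\<pi>\<close> and \<open>\<theta>\<close> is the polar angle.\<close>

definition dtau :: "real \<Rightarrow> real^2 \<Rightarrow> real^2 \<Rightarrow> real" where
  "dtau \<beta> w v = \<beta> / (2 * pi) * ((w $ 1 * v $ 2 - w $ 2 * v $ 1) / (norm w)\<^sup>2)"

definition bh_mass :: "real \<Rightarrow> real" where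
  "bh_mass a = (a ^ 3 + a) / 2"

definition bh_F :: "real \<Rightarrow> real \<Rightarrow> real" where
  "bh_F m r = 1 + r\<^sup>2 - 2 * m / r"

text \<open>The plane factor of \<open>S\<^sup>2 \<times> \<real>\<^sup>2\<close> is modelled on the open unit disc, so that the closure is the
  compactification \<open>S\<^sup>2 \<times> D\<^sup>2\<close>. The radial coordinate is chosen such that \<open>r - a\<close> vanishes
  quadratically at the horizon \<open>w = 0\<close> (then the metric extends smoothly across it) and \<open>1 / r\<close>
  is a smooth boundary defining function.\<close>

definition bh_space :: "R32 set" where
  "bh_space = sphere 0 1 \<times> ball 0 1"

definition bh_radius :: "real \<Rightarrow> real^2 \<Rightarrow> real" where
  "bh_radius a w = a / (1 - (norm w)\<^sup>2)"

definition bh_metric_off_horizon :: "real \<Rightarrow> real \<Rightarrow> R32 metric_field" where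
  "bh_metric_off_horizon \<beta> a = (\<lambda>(\<omega>, w) (\<xi>, v) (\<xi>', v').
     let r = bh_radius a w;
         F = bh_F (bh_mass a) r;
         dr = frechet_derivative (bh_radius a) (at w)
     in F * (dtau \<beta> w v * dtau \<beta> w v') + (dr v * dr v') / F + r\<^sup>2 * (\<xi> \<bullet> \<xi>'))"

definition bh_metric :: "real \<Rightarrow> real \<Rightarrow> R32 metric_field" where
  "bh_metric \<beta> a = extend_metric {(\<omega>, w) \<in> bh_space. w \<noteq> 0} (bh_metric_off_horizon \<beta> a)"

text \<open>Here \<open>r = 2\<bar>u\<bar> / (1 - \<bar>u\<bar>\<^sup>2)\<close> is the radius in the Poincare ball model, and the direction
  \<open>\<omega> = u / \<bar>u\<bar>\<close> is the library function \<open>sgn\<close>.\<close>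

definition thermal_space :: "R32 set" where
  "thermal_space = ball 0 1 \<times> sphere 0 1"

definition thermal_radius :: "real^3 \<Rightarrow> real" where
  "thermal_radius u = 2 * norm u / (1 - (norm u)\<^sup>2)"

definition thermal_metric_off_axis :: "real \<Rightarrow> R32 metric_field" where
  "thermal_metric_off_axis \<beta> = (\<lambda>(u, w) (\<xi>, v) (\<xi>', v').
     let r = thermal_radius u;
         dr = frechet_derivative thermal_radius (at u);
         d\<omega> = frechet_derivative sgn (at u)
     in (1 + r\<^sup>2) * (dtau \<beta> w v * dtau \<beta> w v') + (dr \<xi> * dr \<xi>') / (1 + r\<^sup>2)
          + r\<^sup>2 * (d\<omega> \<xi> \<bullet> d\<omega> \<xi>'))"

definition thermal_metric :: "real \<Rightarrow> R32 metric_field" where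
  "thermal_metric \<beta> =
     extend_metric {(u, w) \<in> thermal_space. u \<noteq> 0} (thermal_metric_off_axis \<beta>)"

end

theory Submission
  imports Defs
begin

text \<open>In the coordinate \<rho> = 1/r both model metrics have the form g = \<rho>^-2
  (d\<rho>^2/P + P d\<tau>^2 + g_S), where g_S is the round metric and P = 1 + \<rho>^2 - 2m\<rho>^3
  is \<open>lapse m\<close>; the thermal metric is the case m = 0. In the determinant P cancels, so
  the volume form is \<rho>^-4 d\<rho> d\<tau> dA, and the region where \<rho> \<ge> \<delta> has
  volume 4\<pi>\<beta> (\<delta>^-3 - c)/3, with c = a^3 for the black hole of horizon radius a
  (there \<rho> stops at 1/a) and c = 0 for the thermal metric. The locale \<open>ah_end\<close>
  records exactly this common structure.

  The cut-off is governed by the boundary defining function. The normal form of g says that the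
  collar is the gradient flow of x (\<open>gradient\<close>), so x solves the eikonal equation
  |dx|^2 = x^2 for the norm of g. Comparing Taylor coefficients at \<rho> = 0
  (\<open>eikonal_local_expansion\<close>) gives ln (x/\<rho>) = l0(y) + c2(y) \<rho>^2 + (m/3)
  \<rho>^3 + O(\<rho>^4). The functions l0 and c2 depend on the representative of the conformal
  class, but the linear term vanishes and the cubic coefficient is universal.

  Insert this into the integral of x^z. Near the boundary the integrand is \<rho>^(z-4) exp(z
  ln(x/\<rho>)). At z = 0 the factor exp(z l0) becomes 1, the c2 term carries a factor z against a
  pole at z = 1 and disappears, while the cubic term carries a factor z against the pole of
  \<delta>^z/z and leaves m/3. Together with the volume of the rest
  (\<open>zeta_of_expansion\<close>) the finite part is 4\<pi>\<beta> (m - c)/3, whatever x and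
  whatever continuation is chosen (\<open>finite_part_of_expansion\<close>,
  \<open>finite_part_special_bdf\<close>).

  As \<open>RenV\<close> is a definite description, one special boundary defining function with a
  meromorphic zeta function has to be exhibited as well. Near the boundary it is the radial solution
  \<rho> exp(G(\<rho>)) of the eikonal equation (\<open>profile_exists\<close>), interpolated to the
  constant 1 (\<open>special_bdf_bdf\<close>). Its zeta function reduces to a one-dimensional
  integral, which integration by parts continues to the whole plane
  (\<open>bdf_zeta_continuation\<close>). This proves \<open>RenV_eq\<close>. The Riemannian volume
  is a definite description too; it is identified in polar coordinates, which miss only a null set
  (\<open>riemannian_volume_eq\<close>, \<open>volume_eq\<close>).

  For the black hole m = (a^3 + a)/2, hence RenV = (2\<pi>\<beta>/3) a (1 - a^2), and the quadratic
  equation for a, rewritten as \<beta> (1 + 3a^2) = 4\<pi>a, gives the stated form. The sign is that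
  of 1 - a. The roots have product 1/3, so the smaller one lies below 1, and 3 (a_+ - 1)(a_- - 1) =
  4 - 4\<pi>/\<beta> shows that the larger one passes 1 exactly at \<beta> = \<pi>.\<close>

no_notation fps_nth (infixl "$" 75)

section \<open>Analysis background: smooth maps, mixed derivatives, cut-off functions\<close>

subsection \<open>Calculus of smooth maps\<close>

lemma C_k_on_cong:
  assumes "open S" "C_k_on k f S" "\<And>x. x \<in> S \<Longrightarrow> f x = g x"
  shows "C_k_on k g S"
  using assms(2,3)
proof (induction k arbitrary: f g)
  case 0
  then show ?case by (metis C_k_on.simps(1) continuous_on_cong)
next
  case (Suc k)
  have d: "(g has_derivative frechet_derivative f (at x)) (at x)" if "x \<in> S" for x
  proof -
    have "(f has_derivative frechet_derivative f (at x)) (at x)"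
      using Suc.prems that frechet_derivative_works by auto
    then show ?thesis
      using has_derivative_transform_within_open[OF _ assms(1) that] Suc.prems(2) by blast
  qed
  have eq: "frechet_derivative g (at x) = frechet_derivative f (at x)" if "x \<in> S" for x
    using frechet_derivative_at[OF d[OF that]] by simp
  show ?case
    unfolding C_k_on.simps
  proof (intro conjI ballI allI)
    show "g differentiable at x" if "x \<in> S" for x using d[OF that] by (rule differentiableI)
    show "C_k_on k (\<lambda>x. frechet_derivative g (at x) v) S" for v
      by (rule Suc.IH[of "\<lambda>x. frechet_derivative f (at x) v"]) (use Suc.prems eq in auto)
  qed
qed

lemma C_k_on_subset: "C_k_on k f S \<Longrightarrow> T \<subseteq> S \<Longrightarrow> C_k_on k f T"
  by (induction k arbitrary: f) (auto intro: continuous_on_subset)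

lemma C_k_on_pred: "C_k_on (Suc k) f S \<Longrightarrow> C_k_on k f S"
proof (induction k arbitrary: f)
  case 0
  then show ?case
    by (auto intro!: continuous_at_imp_continuous_on differentiable_imp_continuous_within)
next
  case (Suc k)
  then show ?case by auto
qed

text \<open>Lets an explicit derivative stand in for \<open>frechet_derivative\<close>, so that each
  closure rule below becomes an induction on the order with the usual rule of differentiation as its
  step.\<close>

lemma C_k_on_SucI:
  assumes "open S" "\<And>x. x \<in> S \<Longrightarrow> (f has_derivative f' x) (at x)"
    "\<And>v. C_k_on k (\<lambda>x. f' x v) S"
  shows "C_k_on (Suc k) f S"
proof -
  have "frechet_derivative f (at x) = f' x" if "x \<in> S" for x
    using frechet_derivative_at assms(2)[OF that] by fastforce
  then have "C_k_on k (\<lambda>x. frechet_derivative f (at x) v) S" for v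
    by (intro C_k_on_cong[OF assms(1,3)]) auto
  with assms(2) show ?thesis by (auto intro: differentiableI)
qed

lemma C_k_on_derivative:
  assumes "C_k_on (Suc k) f S" "x \<in> S"
  shows "(f has_derivative frechet_derivative f (at x)) (at x)"
  using assms frechet_derivative_works by auto

lemma C_k_on_const: "open S \<Longrightarrow> C_k_on k (\<lambda>x. c) S"
proof (induction k arbitrary: c)
  case (Suc k)
  show ?case by (rule C_k_on_SucI[where f'="\<lambda>x v. 0"]) (use Suc in auto)
qed simp

lemma C_k_on_bounded_linear:
  assumes "open S" "bounded_linear h" "C_k_on k f S"
  shows "C_k_on k (\<lambda>x. h (f x)) S"
  using assms(3)
proof (induction k arbitrary: f)
  case 0
  then show ?case using bounded_linear.continuous_on[OF assms(2)] by auto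
next
  case (Suc k)
  show ?case
    by (rule C_k_on_SucI[OF assms(1)
          bounded_linear.has_derivative[OF assms(2) C_k_on_derivative[OF Suc.prems]]])
      (use Suc in auto)
qed

lemma C_k_on_id: "open S \<Longrightarrow> C_k_on k (\<lambda>x. x) S"
proof (cases k)
  case (Suc j)
  assume "open S"
  then show ?thesis unfolding Suc
    by (intro C_k_on_SucI[where f'="\<lambda>x v. v"]) (auto intro: C_k_on_const)
qed simp

lemma C_k_on_add:
  assumes "open S" "C_k_on k f S" "C_k_on k g S"
  shows "C_k_on k (\<lambda>x. f x + g x) S"
  using assms(2,3)
proof (induction k arbitrary: f g)
  case (Suc k)
  show ?case
    by (rule C_k_on_SucI[OF assms(1) has_derivative_add[OF C_k_on_derivative[OF Suc.prems(1)]
            C_k_on_derivative[OF Suc.prems(2)]]]) (use Suc in auto)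
qed (auto intro: continuous_on_add)

lemma C_k_on_bilinear:
  assumes "open S" "bounded_bilinear pr" "C_k_on k f S" "C_k_on k g S"
  shows "C_k_on k (\<lambda>x. pr (f x) (g x)) S"
  using assms(3,4)
proof (induction k arbitrary: f g)
  case 0
  then show ?case using bounded_bilinear.continuous_on[OF assms(2)] by auto
next
  case (Suc k)
  show ?case
  proof (rule C_k_on_SucI[OF assms(1) bounded_bilinear.FDERIV[OF assms(2)
           C_k_on_derivative[OF Suc.prems(1)] C_k_on_derivative[OF Suc.prems(2)]]])
    fix v
    show "C_k_on k (\<lambda>x. pr (f x) (frechet_derivative g (at x) v)
        + pr (frechet_derivative f (at x) v) (g x)) S"
      by (intro C_k_on_add assms(1) Suc.IH C_k_on_pred[OF Suc.prems(1)] C_k_on_pred[OF Suc.prems(2)])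
        (use Suc.prems in auto)
  qed
qed

lemma C_k_on_sum:
  assumes "open S" "\<And>i. i \<in> I \<Longrightarrow> C_k_on k (f i) S"
  shows "C_k_on k (\<lambda>x. \<Sum>i\<in>I. f i x) S"
  using assms(2)
  by (induction I rule: infinite_finite_induct) (auto intro: C_k_on_const C_k_on_add assms(1))

lemma linear_basis_expansion:
  fixes L :: "'a::euclidean_space \<Rightarrow> 'b::real_normed_vector"
  assumes "linear L"
  shows "L v = (\<Sum>b\<in>Basis. (v \<bullet> b) *\<^sub>R L b)"
  by (metis (no_types, lifting) assms euclidean_representation linear_scale linear_sum sum.cong)

text \<open>The chain rule produces the derivative of g at f x in a direction that varies with x,
  whereas \<open>C_k_on\<close> speaks of fixed directions. Expanding the direction in a basis of
  the finite-dimensional middle space leaves finitely many fixed directions with coefficients of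
  class C^k.\<close>

lemma C_k_on_compose:
  fixes f :: "'a::real_normed_vector \<Rightarrow> 'b::euclidean_space" and g :: "'b \<Rightarrow> 'c::real_normed_vector"
  assumes "open S" "open T" "f ` S \<subseteq> T" "C_k_on k f S" "C_k_on k g T"
  shows "C_k_on k (\<lambda>x. g (f x)) S"
  using assms(4,5)
proof (induction k arbitrary: g)
  case 0
  then show ?case using continuous_on_compose2[of T g S f] assms(3) by simp
next
  case (Suc k)
  have fk: "C_k_on k f S" by (rule C_k_on_pred[OF Suc.prems(1)])
  have mem: "f x \<in> T" if "x \<in> S" for x using that assms(3) by auto
  show ?case
  proof (rule C_k_on_SucI[OF assms(1) has_derivative_compose[OF C_k_on_derivative[OF Suc.prems(1)]
          C_k_on_derivative[OF Suc.prems(2) mem]]])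
    fix v
    have "C_k_on k (\<lambda>x. \<Sum>b\<in>Basis. (frechet_derivative f (at x) v \<bullet> b) *\<^sub>R
         frechet_derivative g (at (f x)) b) S"
    proof (intro C_k_on_sum assms(1) C_k_on_bilinear[OF assms(1) bounded_bilinear_scaleR])
      fix b :: 'b
      show "C_k_on k (\<lambda>x. frechet_derivative f (at x) v \<bullet> b) S"
        by (rule C_k_on_bounded_linear[OF assms(1) bounded_linear_inner_left]) (use Suc.prems(1) in auto)
      show "C_k_on k (\<lambda>x. frechet_derivative g (at (f x)) b) S"
        by (rule Suc.IH[OF fk]) (use Suc.prems(2) in auto)
    qed
    then show "C_k_on k (\<lambda>x. frechet_derivative g (at (f x)) (frechet_derivative f (at x) v)) S"
    proof (rule C_k_on_cong[OF assms(1)])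
      fix x assume "x \<in> S"
      then have "linear (frechet_derivative g (at (f x)))"
        by (rule has_derivative_linear[OF C_k_on_derivative[OF Suc.prems(2) mem]])
      then show "(\<Sum>b\<in>Basis. (frechet_derivative f (at x) v \<bullet> b) *\<^sub>R frechet_derivative g (at (f x)) b)
        = frechet_derivative g (at (f x)) (frechet_derivative f (at x) v)"
        by (rule linear_basis_expansion[symmetric])
    qed
  qed
qed

lemma smooth_on_cong:
  "open S \<Longrightarrow> smooth_on f S \<Longrightarrow> (\<And>x. x \<in> S \<Longrightarrow> f x = g x) \<Longrightarrow> smooth_on g S"
  unfolding smooth_on_def by (intro allI) (rule C_k_on_cong[of S _ f], auto)

lemma smooth_on_subset: "smooth_on f S \<Longrightarrow> T \<subseteq> S \<Longrightarrow> smooth_on f T"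
  unfolding smooth_on_def using C_k_on_subset by blast

lemma smooth_on_const: "open S \<Longrightarrow> smooth_on (\<lambda>x. c) S"
  unfolding smooth_on_def using C_k_on_const by blast

lemma smooth_on_id: "open S \<Longrightarrow> smooth_on (\<lambda>x. x) S"
  unfolding smooth_on_def using C_k_on_id by blast

lemma smooth_on_bounded_linear:
  "open S \<Longrightarrow> bounded_linear h \<Longrightarrow> smooth_on f S \<Longrightarrow> smooth_on (\<lambda>x. h (f x)) S"
  unfolding smooth_on_def by (intro allI) (rule C_k_on_bounded_linear[of S h _ f], auto)

lemma smooth_on_add: "open S \<Longrightarrow> smooth_on f S \<Longrightarrow> smooth_on g S \<Longrightarrow> smooth_on (\<lambda>x. f x + g x) S"
  unfolding smooth_on_def by (intro allI) (rule C_k_on_add, auto)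

lemma smooth_on_bilinear:
  "open S \<Longrightarrow> bounded_bilinear pr \<Longrightarrow> smooth_on f S \<Longrightarrow> smooth_on g S
    \<Longrightarrow> smooth_on (\<lambda>x. pr (f x) (g x)) S"
  unfolding smooth_on_def by (intro allI) (rule C_k_on_bilinear[of S pr _ f g], auto)

lemmas smooth_on_scaleR = smooth_on_bilinear[OF _ bounded_bilinear_scaleR]
lemmas smooth_on_mult = smooth_on_bilinear[OF _ bounded_bilinear_mult]
lemmas smooth_on_inner = smooth_on_bilinear[OF _ bounded_bilinear_inner]

lemma smooth_on_minus: "open S \<Longrightarrow> smooth_on f S \<Longrightarrow> smooth_on (\<lambda>x. - f x) S"
  by (rule smooth_on_bounded_linear[OF _ bounded_linear_minus[OF bounded_linear_ident]])

lemma smooth_on_diff: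
  "open S \<Longrightarrow> smooth_on f S \<Longrightarrow> smooth_on g S \<Longrightarrow> smooth_on (\<lambda>x. f x - g x) S"
  using smooth_on_add[of S f "\<lambda>x. - g x"] smooth_on_minus[of S g] by simp

lemma smooth_on_power:
  fixes f :: "'a::real_normed_vector \<Rightarrow> real"
  shows "open S \<Longrightarrow> smooth_on f S \<Longrightarrow> smooth_on (\<lambda>x. f x ^ n) S"
  by (induction n) (auto intro: smooth_on_const smooth_on_mult)

lemma smooth_on_Pair:
  fixes f :: "'a::real_normed_vector \<Rightarrow> 'b::real_normed_vector"
    and g :: "'a \<Rightarrow> 'c::real_normed_vector"
  assumes "open S" "smooth_on f S" "smooth_on g S"
  shows "smooth_on (\<lambda>x. (f x, g x)) S"
proof -
  have "bounded_linear (\<lambda>a::'b. (a, 0::'c))" "bounded_linear (\<lambda>a::'c. (0::'b, a))"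
    by (auto intro!: bounded_linear_Pair bounded_linear_ident bounded_linear_zero)
  then have "smooth_on (\<lambda>x. (f x, 0) + (0, g x)) S"
    using assms by (intro smooth_on_add smooth_on_bounded_linear[of S "\<lambda>a. (a, 0)" f]
        smooth_on_bounded_linear[of S "\<lambda>a. (0, a)" g]) auto
  then show ?thesis by simp
qed

lemmas smooth_on_fst = smooth_on_bounded_linear[OF _ bounded_linear_fst]
lemmas smooth_on_snd = smooth_on_bounded_linear[OF _ bounded_linear_snd]

lemma smooth_on_compose:
  fixes f :: "'a::real_normed_vector \<Rightarrow> 'b::euclidean_space" and g :: "'b \<Rightarrow> 'c::real_normed_vector"
  shows "open S \<Longrightarrow> open T \<Longrightarrow> (\<And>x. x \<in> S \<Longrightarrow> f x \<in> T) \<Longrightarrow> smooth_on f S \<Longrightarrow> smooth_on g T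
    \<Longrightarrow> smooth_on (\<lambda>x. g (f x)) S"
  unfolding smooth_on_def by (intro allI) (rule C_k_on_compose[of S T f _ g], auto)

lemma smooth_on_has_derivative:
  "smooth_on f S \<Longrightarrow> x \<in> S \<Longrightarrow> (f has_derivative frechet_derivative f (at x)) (at x)"
  unfolding smooth_on_def using C_k_on_derivative by blast

lemma smooth_on_dir_deriv: "smooth_on f S \<Longrightarrow> smooth_on (\<lambda>x. frechet_derivative f (at x) v) S"
  unfolding smooth_on_def by (metis C_k_on.simps(2))

lemma smooth_on_imp_continuous_on: "smooth_on f S \<Longrightarrow> continuous_on S f"
  unfolding smooth_on_def by (metis C_k_on.simps(1))

lemma C_k_on_real_SucI:
  fixes f :: "real \<Rightarrow> real"
  assumes "open S" "\<And>x. x \<in> S \<Longrightarrow> (f has_real_derivative f' x) (at x)" "C_k_on k f' S"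
  shows "C_k_on (Suc k) f S"
  by (rule C_k_on_SucI[OF assms(1) assms(2)[unfolded has_field_derivative_def]])
    (auto intro: C_k_on_bilinear[OF assms(1) bounded_bilinear_mult] assms(3) C_k_on_const[OF assms(1)])

text \<open>Bootstrapping for solutions of a differential equation: when f' is an expression in f,
  regularity of order k passes from f to f' and so raises the order of f by one. It serves
  \<open>exp\<close>, \<open>inverse\<close>, \<open>sqrt\<close>, the exponent G and the inverse k
  of the radial profile.\<close>

lemma smooth_on_realI:
  fixes f :: "real \<Rightarrow> real"
  assumes "open S" "\<And>x. x \<in> S \<Longrightarrow> (f has_real_derivative f' x) (at x)"
    "\<And>k. C_k_on k f S \<Longrightarrow> C_k_on k f' S"
  shows "smooth_on f S"
proof -
  have "C_k_on k f S" for k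
  proof (induction k)
    case 0
    show ?case
      unfolding C_k_on.simps
      by (intro continuous_at_imp_continuous_on ballI) (rule DERIV_isCont[OF assms(2)])
  next
    case (Suc k)
    show ?case using C_k_on_real_SucI[OF assms(1,2) assms(3)[OF Suc]] .
  qed
  then show ?thesis by (simp add: smooth_on_def)
qed

lemma smooth_on_exp_real: "open S \<Longrightarrow> smooth_on (exp :: real \<Rightarrow> real) S"
  by (rule smooth_on_realI[of S exp exp]) (auto intro: derivative_eq_intros)

lemma smooth_on_inverse_real: "smooth_on (inverse :: real \<Rightarrow> real) (- {0})"
proof (rule smooth_on_realI[where f'="\<lambda>x::real. - (inverse x * inverse x)"])
  fix x :: real assume "x \<in> - {0}"
  then show "(inverse has_real_derivative - (inverse x * inverse x)) (at x)"
    using DERIV_inverse[of x UNIV] by (simp add: power2_eq_square)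
next
  fix k assume "C_k_on k (inverse::real\<Rightarrow>real) (- {0})"
  then show "C_k_on k (\<lambda>x::real. - (inverse x * inverse x)) (- {0})"
    by (intro C_k_on_bounded_linear[of _ uminus] C_k_on_bilinear[OF _ bounded_bilinear_mult])
      (auto intro: bounded_linear_minus)
qed auto

lemma smooth_on_inverse:
  fixes f :: "'a::real_normed_vector \<Rightarrow> real"
  shows "open S \<Longrightarrow> smooth_on f S \<Longrightarrow> (\<And>x. x \<in> S \<Longrightarrow> f x \<noteq> 0) \<Longrightarrow> smooth_on (\<lambda>x. inverse (f x)) S"
  by (rule smooth_on_compose[OF _ _ _ _ smooth_on_inverse_real]) auto

lemma smooth_on_divide:
  fixes f g :: "'a::real_normed_vector \<Rightarrow> real"
  shows "open S \<Longrightarrow> smooth_on f S \<Longrightarrow> smooth_on g S \<Longrightarrow> (\<And>x. x \<in> S \<Longrightarrow> g x \<noteq> 0)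
    \<Longrightarrow> smooth_on (\<lambda>x. f x / g x) S"
  unfolding divide_inverse by (intro smooth_on_mult smooth_on_inverse)

lemma smooth_on_sqrt_real: "smooth_on sqrt {0<..}"
proof (rule smooth_on_realI[where f'="\<lambda>x. inverse (sqrt x) * (1/2)"])
  fix x :: real assume "x \<in> {0<..}"
  then show "(sqrt has_real_derivative inverse (sqrt x) * (1/2)) (at x)"
    using DERIV_real_sqrt[of x] by simp
next
  fix k assume "C_k_on k sqrt {0<..}"
  then show "C_k_on k (\<lambda>x. inverse (sqrt x) * (1/2)) {0<..}"
    by (intro C_k_on_bilinear[OF _ bounded_bilinear_mult] C_k_on_const
        C_k_on_compose[of _ "- {0}" sqrt _ inverse])
      (use smooth_on_inverse_real in \<open>auto simp: smooth_on_def\<close>)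
qed auto

lemma smooth_on_sqrt:
  fixes f :: "'a::real_normed_vector \<Rightarrow> real"
  shows "open S \<Longrightarrow> smooth_on f S \<Longrightarrow> (\<And>x. x \<in> S \<Longrightarrow> 0 < f x) \<Longrightarrow> smooth_on (\<lambda>x. sqrt (f x)) S"
  by (rule smooth_on_compose[OF _ _ _ _ smooth_on_sqrt_real]) auto

lemma smooth_on_exp:
  fixes f :: "'a::real_normed_vector \<Rightarrow> real"
  shows "open S \<Longrightarrow> smooth_on f S \<Longrightarrow> smooth_on (\<lambda>x. exp (f x)) S"
  by (rule smooth_on_compose[OF _ open_UNIV _ _ smooth_on_exp_real]) auto

lemma smooth_on_norm:
  fixes f :: "'a::real_normed_vector \<Rightarrow> 'b::real_inner"
  assumes "open S" "smooth_on f S" "\<And>x. x \<in> S \<Longrightarrow> f x \<noteq> 0"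
  shows "smooth_on (\<lambda>x. norm (f x)) S"
  unfolding norm_eq_sqrt_inner by (intro smooth_on_sqrt smooth_on_inner) (use assms in auto)

lemma smooth_on_sgn:
  fixes f :: "'a::real_normed_vector \<Rightarrow> 'b::real_inner"
  assumes "open S" "smooth_on f S" "\<And>x. x \<in> S \<Longrightarrow> f x \<noteq> 0"
  shows "smooth_on (\<lambda>x. sgn (f x)) S"
  unfolding sgn_div_norm
  by (intro smooth_on_scaleR smooth_on_inverse smooth_on_norm) (use assms in auto)

lemma smooth_on_UN:
  assumes "\<And>x. x \<in> S \<Longrightarrow> \<exists>U. open U \<and> x \<in> U \<and> smooth_on f U"
  shows "smooth_on f S"
proof -
  have "C_k_on k f S" if "\<And>x. x \<in> S \<Longrightarrow> \<exists>U. open U \<and> x \<in> U \<and> C_k_on k f U" for k and f :: "'a \<Rightarrow> 'b"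
    using that
  proof (induction k arbitrary: f)
    case 0
    show ?case
      unfolding C_k_on.simps
    proof (intro continuous_at_imp_continuous_on ballI)
      fix x assume "x \<in> S"
      then obtain U where "open U" "x \<in> U" "continuous_on U f" using 0 by auto
      then show "isCont f x" by (simp add: continuous_on_eq_continuous_at)
    qed
  next
    case (Suc k)
    show ?case
      unfolding C_k_on.simps
    proof (intro conjI ballI allI)
      show "f differentiable at x" if "x \<in> S" for x using Suc.prems[OF that] by auto
      show "C_k_on k (\<lambda>x. frechet_derivative f (at x) v) S" for v
      proof (rule Suc.IH)
        fix x assume "x \<in> S"
        from Suc.prems[OF this] obtain U where "open U" "x \<in> U" "C_k_on (Suc k) f U" by blast
        then show "\<exists>U. open U \<and> x \<in> U \<and> C_k_on k (\<lambda>x. frechet_derivative f (at x) v) U"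
          by (intro exI[of _ U]) simp
      qed
    qed
  qed
  then show ?thesis using assms unfolding smooth_on_def by metis
qed

subsection \<open>Symmetry of second derivatives\<close>

lemma mean_value_segment:
  fixes f :: "'a::real_normed_vector \<Rightarrow> real"
  assumes "0 < h" "\<And>s. 0 \<le> s \<Longrightarrow> s \<le> h \<Longrightarrow> (f has_derivative f' (p + s *\<^sub>R v)) (at (p + s *\<^sub>R v))"
  obtains s where "0 < s" "s < h" "f (p + h *\<^sub>R v) - f p = h * f' (p + s *\<^sub>R v) v"
proof -
  have "((\<lambda>s. f (p + s *\<^sub>R v)) has_real_derivative f' (p + s *\<^sub>R v) v) (at s)"
    if "0 \<le> s" "s \<le> h" for s
  proof -
    have "((\<lambda>s. p + s *\<^sub>R v) has_derivative (\<lambda>s. s *\<^sub>R v)) (at s)"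
      by (auto intro!: derivative_eq_intros)
    from has_derivative_compose[OF this assms(2)[OF that]]
    have "((\<lambda>s. f (p + s *\<^sub>R v)) has_derivative (\<lambda>r. f' (p + s *\<^sub>R v) (r *\<^sub>R v))) (at s)" .
    moreover have "linear (f' (p + s *\<^sub>R v))" using assms(2)[OF that] has_derivative_linear by blast
    ultimately show ?thesis
      by (simp add: has_field_derivative_def linear_scale mult.commute[of _ "f' (p + s *\<^sub>R v) v"])
  qed
  from MVT2[OF assms(1) this] that show thesis by force
qed

text \<open>The mean value theorem is applied twice: in direction v to the increment of f along w,
  then in direction w to the derivative along v.\<close>

lemma second_difference:
  fixes f :: "'a::real_normed_vector \<Rightarrow> real"
  assumes f: "smooth_on f S" and h: "0 < h"
    and sub: "\<And>s t. 0 \<le> s \<Longrightarrow> s \<le> h \<Longrightarrow> 0 \<le> t \<Longrightarrow> t \<le> h \<Longrightarrow> p + s *\<^sub>R v + t *\<^sub>R w \<in> S"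
  obtains s t where "0 < s" "s < h" "0 < t" "t < h"
    "f (p + h *\<^sub>R v + h *\<^sub>R w) - f (p + h *\<^sub>R v) - f (p + h *\<^sub>R w) + f p
       = h * (h * frechet_derivative (\<lambda>x. frechet_derivative f (at x) v) (at (p + s *\<^sub>R v + t *\<^sub>R w)) w)"
proof -
  let ?g = "\<lambda>x. frechet_derivative f (at x) v"
  have 1: "((\<lambda>x. f (x + h *\<^sub>R w) - f x) has_derivative
      (\<lambda>r. frechet_derivative f (at (p + s *\<^sub>R v + h *\<^sub>R w)) r - frechet_derivative f (at (p + s *\<^sub>R v)) r))
      (at (p + s *\<^sub>R v))" if "0 \<le> s" "s \<le> h" for s
  proof (intro has_derivative_diff)
    have "((\<lambda>x. x + h *\<^sub>R w) has_derivative (\<lambda>r. r)) (at (p + s *\<^sub>R v))"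
      by (auto intro!: derivative_eq_intros)
    moreover have "(f has_derivative frechet_derivative f (at (p + s *\<^sub>R v + h *\<^sub>R w))) (at (p + s *\<^sub>R v + h *\<^sub>R w))"
      using smooth_on_has_derivative[OF f sub] that h by auto
    ultimately show "((\<lambda>x. f (x + h *\<^sub>R w)) has_derivative
        frechet_derivative f (at (p + s *\<^sub>R v + h *\<^sub>R w))) (at (p + s *\<^sub>R v))"
      using has_derivative_compose by blast
    show "(f has_derivative frechet_derivative f (at (p + s *\<^sub>R v))) (at (p + s *\<^sub>R v))"
      using smooth_on_has_derivative[OF f sub[of s 0]] that h by auto
  qed
  obtain s where s: "0 < s" "s < h"
    "(f (p + h *\<^sub>R v + h *\<^sub>R w) - f (p + h *\<^sub>R v)) - (f (p + h *\<^sub>R w) - f p)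
      = h * (?g (p + s *\<^sub>R v + h *\<^sub>R w) - ?g (p + s *\<^sub>R v))"
    using mean_value_segment[OF h 1, of thesis] by auto
  have "(?g has_derivative frechet_derivative ?g (at (p + s *\<^sub>R v + t *\<^sub>R w))) (at (p + s *\<^sub>R v + t *\<^sub>R w))"
    if "0 \<le> t" "t \<le> h" for t
    using smooth_on_has_derivative[OF smooth_on_dir_deriv[OF f] sub] that s by simp
  then obtain t where "0 < t" "t < h" "?g (p + s *\<^sub>R v + h *\<^sub>R w) - ?g (p + s *\<^sub>R v)
      = h * frechet_derivative ?g (at (p + s *\<^sub>R v + t *\<^sub>R w)) w"
    using mean_value_segment[OF h, of ?g "\<lambda>x. frechet_derivative ?g (at x)" "p + s *\<^sub>R v" w thesis] by blast
  with s that show thesis by (simp add: algebra_simps)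
qed

text \<open>The second difference over the parallelogram spanned by hv and hw is symmetric in v and
  w and equals h^2 times either mixed derivative at some nearby point; continuity of both mixed
  derivatives then identifies them at p. The lemma is what allows radial and tangential derivatives
  to be exchanged in the eikonal equation.\<close>

lemma smooth_on_symmetric:
  fixes f :: "'a::real_normed_vector \<Rightarrow> real"
  assumes "open S" "smooth_on f S" "p \<in> S"
  shows "frechet_derivative (\<lambda>x. frechet_derivative f (at x) v) (at p) w
       = frechet_derivative (\<lambda>x. frechet_derivative f (at x) w) (at p) v" (is "?A p = ?B p")
proof -
  have cont: "isCont ?A p" "isCont ?B p"
    using smooth_on_imp_continuous_on[OF smooth_on_dir_deriv[OF smooth_on_dir_deriv[OF assms(2)]]]
      assms continuous_on_eq_continuous_at by blast+
  obtain e where e: "e > 0" "ball p e \<subseteq> S" using assms openE by blast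
  have "\<bar>?A p - ?B p\<bar> \<le> d" if "d > 0" for d
  proof -
    obtain r1 where r1: "r1 > 0" "\<And>x. dist x p < r1 \<Longrightarrow> \<bar>?A x - ?A p\<bar> < d / 2"
      using cont(1) \<open>d > 0\<close> unfolding continuous_at_eps_delta dist_real_def by (metis half_gt_zero)
    obtain r2 where r2: "r2 > 0" "\<And>x. dist x p < r2 \<Longrightarrow> \<bar>?B x - ?B p\<bar> < d / 2"
      using cont(2) \<open>d > 0\<close> unfolding continuous_at_eps_delta dist_real_def by (metis half_gt_zero)
    define r where "r = Min {e, r1, r2}"
    \<comment> \<open>This keeps the whole parallelogram within distance r/2 of p; the summand 1
      avoids a zero denominator when v and w both vanish.\<close>
    define h where "h = r / 2 / (norm v + norm w + 1)"
    have r: "r > 0" "r \<le> e" "r \<le> r1" "r \<le> r2" using e r1 r2 by (auto simp: r_def)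
    have h: "h > 0" using r by (simp add: h_def add_nonneg_pos)
    have near: "dist (p + s *\<^sub>R v + t *\<^sub>R w) p < r" if "0 \<le> s" "s \<le> h" "0 \<le> t" "t \<le> h" for s t
    proof -
      have "dist (p + s *\<^sub>R v + t *\<^sub>R w) p \<le> s * norm v + t * norm w"
        using that norm_triangle_ineq[of "s *\<^sub>R v" "t *\<^sub>R w"] by (simp add: dist_norm)
      also have "\<dots> \<le> h * norm v + h * norm w" using that by (intro add_mono mult_right_mono) auto
      also have "\<dots> \<le> h * (norm v + norm w + 1)" using h by (simp add: algebra_simps)
      also have "\<dots> = r / 2" 
        unfolding h_def by (rule nonzero_eq_divide_eq[THEN iffD1, OF _ refl])
          (use add_nonneg_pos[of "norm v + norm w" 1] in auto)
      also have "\<dots> < r" using r by simp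
      finally show ?thesis .
    qed
    have sub: "p + s *\<^sub>R v + t *\<^sub>R w \<in> S" if "0 \<le> s" "s \<le> h" "0 \<le> t" "t \<le> h" for s t
      using near[OF that] e r by (auto simp: dist_commute)
    obtain s t where st: "0 < s" "s < h" "0 < t" "t < h"
      "f (p + h *\<^sub>R v + h *\<^sub>R w) - f (p + h *\<^sub>R v) - f (p + h *\<^sub>R w) + f p
       = h * (h * ?A (p + s *\<^sub>R v + t *\<^sub>R w))"
      using second_difference[OF assms(2) h sub, of thesis] by blast
    have sub': "p + s *\<^sub>R w + t *\<^sub>R v \<in> S" if "0 \<le> s" "s \<le> h" "0 \<le> t" "t \<le> h" for s t
      using sub[of t s] that by (simp add: algebra_simps)
    obtain s' t' where st': "0 < s'" "s' < h" "0 < t'" "t' < h"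
      "f (p + h *\<^sub>R w + h *\<^sub>R v) - f (p + h *\<^sub>R w) - f (p + h *\<^sub>R v) + f p
       = h * (h * ?B (p + s' *\<^sub>R w + t' *\<^sub>R v))"
      using second_difference[OF assms(2) h sub', of thesis] by blast
    have "?A (p + s *\<^sub>R v + t *\<^sub>R w) = ?B (p + t' *\<^sub>R v + s' *\<^sub>R w)"
    proof -
      have c: "p + h *\<^sub>R w + h *\<^sub>R v = p + h *\<^sub>R v + h *\<^sub>R w" "p + s' *\<^sub>R w + t' *\<^sub>R v = p + t' *\<^sub>R v + s' *\<^sub>R w"
        by (simp_all add: add_ac)
      have "h * (h * ?A (p + s *\<^sub>R v + t *\<^sub>R w)) = h * (h * ?B (p + t' *\<^sub>R v + s' *\<^sub>R w))"
        using st(5) st'(5) unfolding c by linarith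
      then show ?thesis using h by simp
    qed
    moreover have "\<bar>?A (p + s *\<^sub>R v + t *\<^sub>R w) - ?A p\<bar> < d / 2"
      using r1(2) near[of s t] st r by force
    moreover have "\<bar>?B (p + t' *\<^sub>R v + s' *\<^sub>R w) - ?B p\<bar> < d / 2"
      using r2(2) near[of t' s'] st' r by force
    ultimately show ?thesis by linarith
  qed
  then have "\<bar>?A p - ?B p\<bar> \<le> 0" by (rule field_le_epsilon) simp
  then show ?thesis by simp
qed

subsection \<open>Smooth maps on subsets\<close>

lemma smooth_mapI:
  assumes "\<And>p. p \<in> N \<Longrightarrow> p \<in> U" "open U" "smooth_on h U" "\<And>p. p \<in> N \<Longrightarrow> h p = f p"
  shows "smooth_map N f"
  unfolding smooth_map_def using assms by blast

lemma smooth_map_imp_continuous_on: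
  assumes "smooth_map N f"
  shows "continuous_on N f"
proof (rule continuous_on_eq_continuous_within[THEN iffD2], rule ballI)
  fix p assume "p \<in> N"
  then obtain U h where U: "open U" "p \<in> U" "smooth_on h U" "\<forall>q\<in>U \<inter> N. h q = f q"
    using assms unfolding smooth_map_def by blast
  have "isCont h p" using U smooth_on_imp_continuous_on continuous_on_eq_continuous_at by blast
  then have "continuous (at p within N) h" by (rule continuous_at_imp_continuous_at_within)
  moreover have "\<forall>\<^sub>F q in at p within N. h q = f q"
    using U by (auto simp: eventually_at_topological)
  ultimately show "continuous (at p within N) f"
    using U \<open>p \<in> N\<close> by (auto simp: continuous_within intro: Lim_transform_eventually)
qed

text \<open>\<open>bump_aux n t = t\<^sup>-\<^sup>n exp (-1/t)\<close> for \<open>t > 0\<close>: a family closed under differentiation.\<close>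

definition bump_aux :: "nat \<Rightarrow> real \<Rightarrow> real" where
  "bump_aux n t = (if t > 0 then exp (- inverse t) * inverse t ^ n else 0)"

lemma bump_aux_tendsto: "(bump_aux n \<longlongrightarrow> 0) (at 0)"
proof -
  have "((\<lambda>t::real. inverse t ^ n / exp (inverse t)) \<longlongrightarrow> 0) (at_right 0)"
    by (rule filterlim_compose[OF tendsto_power_div_exp_0 filterlim_inverse_at_top_right])
  moreover have "\<forall>\<^sub>F t in at_right 0. inverse t ^ n / exp (inverse t) = bump_aux n t"
    by (rule eventually_at_rightI[of 0 1]) (auto simp: bump_aux_def exp_minus field_simps)
  ultimately have "(bump_aux n \<longlongrightarrow> 0) (at_right 0)" by (rule Lim_transform_eventually)
  moreover have "(bump_aux n \<longlongrightarrow> 0) (at_left 0)"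
    by (rule tendsto_eventually, rule eventually_at_leftI[of "-1" 0]) (auto simp: bump_aux_def)
  ultimately show ?thesis by (simp add: filterlim_split_at)
qed

lemma bump_aux_deriv:
  "(bump_aux n has_real_derivative bump_aux (n + 2) t - n * bump_aux (n + 1) t) (at t)"
proof -
  consider "t > 0" | "t = 0" | "t < 0" by linarith
  then show ?thesis
  proof cases
    case 1
    have e: "((\<lambda>t. exp (- inverse t)) has_real_derivative exp (- inverse t) * inverse t ^ 2) (at t)"
      using 1 by (auto intro!: derivative_eq_intros simp: field_simps power2_eq_square)
    have "((\<lambda>t. inverse t ^ n) has_real_derivative - (real n * inverse t ^ (n + 1))) (at t)"
      using DERIV_power[OF DERIV_inverse[of t UNIV], of n] 1
      by (cases n) (simp_all add: power2_eq_square mult_ac)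
    from DERIV_mult[OF e this]
    have "((\<lambda>t. exp (- inverse t) * inverse t ^ n) has_real_derivative
        bump_aux (n + 2) t - n * bump_aux (n + 1) t) (at t)"
      using 1 by (simp add: bump_aux_def power_add algebra_simps power2_eq_square)
    then show ?thesis
      by (rule has_field_derivative_transform_within_open[of _ _ _ "{0<..}"])
        (use 1 in \<open>auto simp: bump_aux_def\<close>)
  next
    case 2
    have "((\<lambda>h. bump_aux n h / h) \<longlongrightarrow> 0) (at 0)"
      by (rule Lim_transform_eventually[OF bump_aux_tendsto[of "n + 1"]])
        (auto simp: eventually_at_filter bump_aux_def divide_inverse)
    then show ?thesis using 2 by (simp add: has_field_derivative_iff bump_aux_def)
  next
    case 3
    have "((\<lambda>t. 0) has_real_derivative 0) (at t)" by simp
    then have "(bump_aux n has_real_derivative 0) (at t)"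
      by (rule has_field_derivative_transform_within_open[of _ _ _ "{..<0}"])
        (use 3 in \<open>auto simp: bump_aux_def\<close>)
    then show ?thesis using 3 by (simp add: bump_aux_def)
  qed
qed

lemma smooth_on_bump_aux: "smooth_on (bump_aux n) UNIV"
proof -
  have "C_k_on k (bump_aux n) UNIV" for k
  proof (induction k arbitrary: n)
    case 0
    show ?case
      unfolding C_k_on.simps
      by (intro continuous_at_imp_continuous_on ballI) (rule DERIV_isCont[OF bump_aux_deriv])
  next
    case (Suc k)
    have "C_k_on k (\<lambda>t. bump_aux (n + 2) t + (- real n) * bump_aux (n + 1) t) UNIV"
      by (intro C_k_on_add C_k_on_bilinear[OF _ bounded_bilinear_mult] C_k_on_const Suc) auto
    then show ?case
      by (intro C_k_on_real_SucI[OF _ bump_aux_deriv]) auto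
  qed
  then show ?thesis by (simp add: smooth_on_def)
qed

lemma smooth_transition_exists:
  fixes a b :: real
  assumes "a < b"
  obtains cut :: "real \<Rightarrow> real" where "smooth_on cut UNIV" "\<And>t. t \<le> a \<Longrightarrow> cut t = 0" "\<And>t. b \<le> t \<Longrightarrow> cut t = 1"
    "\<And>t. 0 \<le> cut t" "\<And>t. cut t \<le> 1"
proof
  let ?F = "bump_aux 0"
  let ?cut = "\<lambda>t. ?F (t - a) / (?F (t - a) + ?F (b - t))"
  have pos: "?F t \<ge> 0" for t by (simp add: bump_aux_def)
  have pos': "?F (t - a) + ?F (b - t) > 0" for t
    using assms by (auto simp: bump_aux_def add_pos_pos)
  have s: "smooth_on (\<lambda>t. ?F (t - a)) UNIV" "smooth_on (\<lambda>t. ?F (b - t)) UNIV"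
    by (rule smooth_on_compose[OF _ _ _ _ smooth_on_bump_aux, of UNIV],
        auto intro!: smooth_on_diff smooth_on_id smooth_on_const)+
  show "smooth_on ?cut UNIV"
    by (rule smooth_on_divide[OF open_UNIV s(1) smooth_on_add[OF open_UNIV s]])
      (use pos' in \<open>simp add: less_imp_neq[symmetric]\<close>)
  show "?cut t = 0" if "t \<le> a" for t using that by (simp add: bump_aux_def)
  show "?cut t = 1" if "b \<le> t" for t using that assms by (simp add: bump_aux_def)
  show "0 \<le> ?cut t" "?cut t \<le> 1" for t using pos[of "t - a"] pos[of "b - t"] pos'[of t] by auto
qed

section \<open>The radial solution of the eikonal equation and its inverse function\<close>

subsection \<open>The geodesic boundary coordinate as a function of \<open>\<rho> = 1 / r\<close>\<close>

text \<open>In the coordinate \<open>\<rho> = 1 / r\<close> the function \<open>F\<close> becomes \<open>lapse m \<rho> / \<rho>\<^sup>2\<close>.\<close>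

definition lapse :: "real \<Rightarrow> real \<Rightarrow> real" where
  "lapse m \<rho> = 1 + \<rho>\<^sup>2 - 2 * m * \<rho> ^ 3"

lemma smooth_on_lapse: "open S \<Longrightarrow> smooth_on f S \<Longrightarrow> smooth_on (\<lambda>x. lapse m (f x)) S"
  for f :: "'a::real_normed_vector \<Rightarrow> real"
  unfolding lapse_def
  by (intro smooth_on_add smooth_on_diff smooth_on_mult smooth_on_power smooth_on_const)

lemma isCont_lapse: "isCont (lapse m) x"
  unfolding lapse_def by (intro continuous_intros)

text \<open>For x = \<rho> exp(G(\<rho>)) the eikonal equation reads P x'^2 = (x/\<rho>)^2, that is,
  x' = exp(G)/sqrt(P), or \<rho> G' = 1/sqrt(P) - 1. The right side vanishes at 0, so G' is a smooth
  function on both sides of \<rho> = 0 and G is obtained by integration. Smoothness across 0 is what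
  later gives smoothness of x up to the boundary.\<close>

lemma profile_exists:
  fixes m \<delta> :: real
  assumes "\<delta> > 0"
  obtains \<eta> G where "0 < \<eta>" "\<eta> \<le> \<delta>" "\<And>\<rho>. \<bar>\<rho>\<bar> < \<eta> \<Longrightarrow> 0 < lapse m \<rho>"
    "smooth_on G {-\<eta><..<\<eta>}" "G 0 = 0"
    "\<And>\<rho>. \<bar>\<rho>\<bar> < \<eta> \<Longrightarrow> ((\<lambda>\<rho>. \<rho> * exp (G \<rho>)) has_real_derivative exp (G \<rho>) / sqrt (lapse m \<rho>)) (at \<rho>)"
proof -
  have "lapse m 0 > 0" by (simp add: lapse_def)
  then have "\<exists>e>0. \<forall>x. dist x 0 < e \<longrightarrow> dist (lapse m x) (lapse m 0) < lapse m 0"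
    using isCont_lapse[of 0 m] unfolding continuous_at_eps_delta by blast
  then obtain e where e: "e > 0" "\<And>x. \<bar>x\<bar> < e \<Longrightarrow> \<bar>lapse m x - lapse m 0\<bar> < lapse m 0"
    by (auto simp: dist_real_def)
  define \<eta> where "\<eta> = min \<delta> e / 2"
  have \<eta>: "0 < \<eta>" "\<eta> \<le> \<delta>" "\<eta> < e" using e assms by (auto simp: \<eta>_def min_def)
  have pos: "0 < lapse m \<rho>" if "\<bar>\<rho>\<bar> \<le> \<eta>" for \<rho> using e(2)[of \<rho>] that \<eta> by linarith
  \<comment> \<open>This is (1/sqrt(P) - 1)/\<rho> multiplied out with the conjugate 1 + sqrt(P):
    since 1 - P = \<rho> (2m\<rho>^2 - \<rho>), the division by \<rho> disappears.\<close>
  define D where "D = (\<lambda>\<rho>. (2 * m * \<rho>\<^sup>2 - \<rho>) / (sqrt (lapse m \<rho>) * (1 + sqrt (lapse m \<rho>))))"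
  have ne: "sqrt (lapse m \<rho>) * (1 + sqrt (lapse m \<rho>)) \<noteq> 0" if "\<bar>\<rho>\<bar> \<le> \<eta>" for \<rho>
    using pos[OF that] real_sqrt_gt_zero[OF pos[OF that]]
    by (metis add_pos_pos mult_pos_pos order_less_irrefl zero_less_one)
  have "continuous_on {-\<eta>..\<eta>} D"
    unfolding D_def
    by (intro continuous_intros continuous_at_imp_continuous_on ballI)
      (use isCont_lapse ne in \<open>auto simp: lapse_def\<close>)
  then obtain G0 where G0: "\<And>x. x \<in> {-\<eta>..\<eta>} \<Longrightarrow> (G0 has_vector_derivative D x) (at x within {-\<eta>..\<eta>})"
    using antiderivative_continuous by blast
  define G where "G = (\<lambda>x. G0 x - G0 0)"
  have dG: "(G has_real_derivative D x) (at x)" if "\<bar>x\<bar> < \<eta>" for x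
  proof -
    have "(G0 has_real_derivative D x) (at x within {-\<eta>..\<eta>})"
      using G0[of x] that by (auto simp: abs_less_iff has_real_derivative_iff_has_vector_derivative)
    then have "(G0 has_real_derivative D x) (at x)"
      using at_within_interior[of x "{-\<eta>..\<eta>}"] that by (auto simp: abs_less_iff)
    then show ?thesis unfolding G_def by (auto intro!: derivative_eq_intros)
  qed
  have o: "open {-\<eta><..<\<eta>}" by simp
  have sD: "smooth_on D {-\<eta><..<\<eta>}"
    unfolding D_def
    by (intro smooth_on_divide smooth_on_mult smooth_on_add smooth_on_diff smooth_on_const smooth_on_power
        smooth_on_id smooth_on_sqrt smooth_on_lapse o)
      (use ne pos in \<open>auto simp: abs_less_iff\<close>)
  have "smooth_on G {-\<eta><..<\<eta>}"
    by (rule smooth_on_realI[OF o dG]) (use sD in \<open>auto simp: smooth_on_def abs_less_iff\<close>)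
  moreover have "((\<lambda>\<rho>. \<rho> * exp (G \<rho>)) has_real_derivative exp (G \<rho>) / sqrt (lapse m \<rho>)) (at \<rho>)"
    if "\<bar>\<rho>\<bar> < \<eta>" for \<rho>
  proof -
    let ?s = "sqrt (lapse m \<rho>)"
    have s: "?s > 0" "?s * ?s = lapse m \<rho>" using pos[of \<rho>] that by auto
    have "\<rho> * (2 * m * \<rho>\<^sup>2 - \<rho>) = (1 - ?s) * (1 + ?s)"
      using s(2) by (simp add: algebra_simps lapse_def power2_eq_square power3_eq_cube)
    then have "\<rho> * D \<rho> = (1 - ?s) * (1 + ?s) / (?s * (1 + ?s))"
      by (simp add: D_def)
    also have "\<dots> = (1 - ?s) / ?s"
      by (rule mult_divide_mult_cancel_right) (use s(1) in linarith)
    finally have D: "1 + \<rho> * D \<rho> = 1 / ?s" using s(1) by (simp add: field_simps)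
    have "((\<lambda>\<rho>. \<rho> * exp (G \<rho>)) has_real_derivative exp (G \<rho>) * (1 + \<rho> * D \<rho>)) (at \<rho>)"
      using dG[OF that] by (auto intro!: derivative_eq_intros simp: algebra_simps)
    then show ?thesis by (simp add: D)
  qed
  moreover have "G 0 = 0" by (simp add: G_def)
  ultimately show thesis using that[of \<eta> G] \<eta> pos by (meson order_less_imp_le)
qed

text \<open>\<open>k\<close> is the inverse of the geodesic boundary coordinate \<open>\<rho> exp (G \<rho>)\<close>.\<close>

lemma profile_inverse_exists:
  fixes \<eta> :: real
  assumes \<eta>: "0 < \<eta>" and P: "\<And>\<rho>. \<bar>\<rho>\<bar> < \<eta> \<Longrightarrow> 0 < lapse m \<rho>"
    and G: "smooth_on G {-\<eta><..<\<eta>}"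
    and df: "\<And>\<rho>. \<bar>\<rho>\<bar> < \<eta> \<Longrightarrow> ((\<lambda>\<rho>. \<rho> * exp (G \<rho>)) has_real_derivative exp (G \<rho>) / sqrt (lapse m \<rho>)) (at \<rho>)"
  obtains \<epsilon> k where "0 < \<epsilon>" "smooth_on k {-\<epsilon><..<\<epsilon>}" "k 0 = 0"
    "\<And>t. \<bar>t\<bar> < \<epsilon> \<Longrightarrow> \<bar>k t\<bar> < \<eta> / 2 \<and> k t * exp (G (k t)) = t"
    "\<And>\<rho>. \<bar>\<rho>\<bar> < \<eta> \<Longrightarrow> \<bar>\<rho> * exp (G \<rho>)\<bar> < \<epsilon> \<Longrightarrow> k (\<rho> * exp (G \<rho>)) = \<rho>"
    "\<And>t. \<bar>t\<bar> < \<epsilon> \<Longrightarrow> (k has_real_derivative sqrt (lapse m (k t)) * exp (- G (k t))) (at t)"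
proof -
  define f where "f = (\<lambda>\<rho>. \<rho> * exp (G \<rho>))"
  have mono: "f x < f y" if "-\<eta> < x" "x < y" "y < \<eta>" for x y
  proof (rule DERIV_pos_imp_increasing[OF \<open>x < y\<close>])
    fix z assume "x \<le> z" "z \<le> y"
    then show "\<exists>d. (f has_real_derivative d) (at z) \<and> 0 < d"
      using df[of z] P[of z] that unfolding f_def by (intro exI[of _ "exp (G z) / sqrt (lapse m z)"]) auto
  qed
  have f0: "f 0 = 0" by (simp add: f_def)
  \<comment> \<open>Values below \<epsilon> in modulus are attained on (-\<eta>/2, \<eta>/2). The
    halved interval matters later: there the cut-off is still 0 and the interpolated function equals
    the profile.\<close>
  define \<epsilon> where "\<epsilon> = min (f (\<eta>/2)) (- f (- \<eta>/2))"
  have \<epsilon>: "0 < \<epsilon>" using mono[of 0 "\<eta>/2"] mono[of "-\<eta>/2" 0] \<eta> f0 by (simp add: \<epsilon>_def)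
  have cont: "isCont f z" if "\<bar>z\<bar> < \<eta>" for z using df[OF that] DERIV_isCont unfolding f_def by blast
  have ex: "\<exists>z. \<bar>z\<bar> < \<eta>/2 \<and> f z = t" if t: "\<bar>t\<bar> < \<epsilon>" for t
  proof -
    have "\<exists>z\<ge>-\<eta>/2. z \<le> \<eta>/2 \<and> f z = t"
      by (rule IVT') (use t \<eta> cont in \<open>auto simp: \<epsilon>_def intro!: continuous_at_imp_continuous_on\<close>)
    then obtain z where z: "-\<eta>/2 \<le> z" "z \<le> \<eta>/2" "f z = t" by blast
    moreover have "z \<noteq> \<eta>/2" "z \<noteq> -\<eta>/2" using t z by (auto simp: \<epsilon>_def)
    ultimately show ?thesis by (intro exI[of _ z]) auto
  qed
  define k where "k = (\<lambda>t. THE z. \<bar>z\<bar> < \<eta> \<and> f z = t)"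
  have uniq: "x = y" if "\<bar>x\<bar> < \<eta>" "\<bar>y\<bar> < \<eta>" "f x = f y" for x y
    using mono[of x y] mono[of y x] that by (cases x y rule: linorder_cases) (auto simp: abs_less_iff)
  have kf: "k (f z) = z" if "\<bar>z\<bar> < \<eta>" for z
    unfolding k_def using that uniq by (intro the_equality) auto
  have k: "\<bar>k t\<bar> < \<eta>/2 \<and> f (k t) = t" if t: "\<bar>t\<bar> < \<epsilon>" for t
    using ex[OF t] kf by (metis \<eta> field_sum_of_halves less_add_same_cancel1 half_gt_zero less_trans)
  have dk: "(k has_real_derivative sqrt (lapse m (k t)) * exp (- G (k t))) (at t)" if t: "\<bar>t\<bar> < \<epsilon>" for t
  proof -
    have kt: "\<bar>k t\<bar> < \<eta>" using k[OF t] \<eta> by linarith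
    have "(f has_real_derivative exp (G (k t)) / sqrt (lapse m (k t))) (at (k t))"
      using df[OF kt] unfolding f_def .
    moreover have "f (k t) = t" "open {-\<eta><..<\<eta>}" "k t \<in> {-\<eta><..<\<eta>}" "continuous_on {-\<eta><..<\<eta>} f"
      using k[OF t] kt cont by (auto intro!: continuous_at_imp_continuous_on simp: abs_less_iff)
    ultimately have "(k has_real_derivative inverse (exp (G (k t)) / sqrt (lapse m (k t)))) (at (f (k t)))"
      using P[OF kt] kf
      by (intro has_field_derivative_inverse_strong[of f _ "k t" "{-\<eta><..<\<eta>}"]) (auto simp: abs_less_iff)
    then show ?thesis using k[OF t] by (simp add: exp_minus field_simps)
  qed
  have o: "open {-\<epsilon><..<\<epsilon>}" "open {-\<eta><..<\<eta>}" by simp_all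
  have sP: "smooth_on (\<lambda>\<rho>. sqrt (lapse m \<rho>) * exp (- G \<rho>)) {-\<eta><..<\<eta>}"
    by (intro smooth_on_mult smooth_on_sqrt smooth_on_exp smooth_on_minus smooth_on_lapse smooth_on_id G o)
      (use P in \<open>auto simp: abs_less_iff\<close>)
  \<comment> \<open>k solves the autonomous equation k' = sqrt(P(k)) exp(-G(k)), hence bootstraps to
    all orders.\<close>
  have "smooth_on k {-\<epsilon><..<\<epsilon>}"
  proof (rule smooth_on_realI[OF o(1) dk])
    fix j assume kj: "C_k_on j k {-\<epsilon><..<\<epsilon>}"
    show "C_k_on j (\<lambda>t. sqrt (lapse m (k t)) * exp (- G (k t))) {-\<epsilon><..<\<epsilon>}"
      by (rule C_k_on_compose[OF o _ kj sP[unfolded smooth_on_def, rule_format]])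
        (use k \<eta> in \<open>fastforce simp: abs_less_iff\<close>)
  qed (auto simp: abs_less_iff)
  moreover have "k 0 = 0" using kf[of 0] \<eta> f0 by simp
  ultimately show thesis using that[of \<epsilon> k] \<epsilon> k kf dk unfolding f_def by blast
qed

section \<open>Zeta integrals: holomorphic dependence, poles, meromorphic continuation\<close>

subsection \<open>Integrals depending holomorphically on a parameter\<close>

text \<open>Differentiation under the integral sign from a local integrable bound on f alone:
  Cauchy's inequality on circles of radius r/2 turns the bound on f into one on its z-derivative,
  the mean value inequality turns that into one on difference quotients, and dominated convergence
  applies along every sequence tending to z0.\<close>

lemma holomorphic_on_integral_param:
  fixes f :: "complex \<Rightarrow> 'a \<Rightarrow> complex"
  assumes S: "open S"
    and meas: "\<And>z. z \<in> S \<Longrightarrow> f z \<in> borel_measurable N"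
    and hol: "\<And>y. y \<in> space N \<Longrightarrow> (\<lambda>z. f z y) holomorphic_on S"
    and bd: "\<And>z0. z0 \<in> S \<Longrightarrow> \<exists>r>0. \<exists>w. cball z0 r \<subseteq> S \<and> integrable N w
              \<and> (\<forall>z\<in>cball z0 r. \<forall>y\<in>space N. norm (f z y) \<le> w y)"
  shows "(\<lambda>z. \<integral>y. f z y \<partial>N) holomorphic_on S"
  unfolding holomorphic_on_open[OF S]
proof (intro ballI)
  fix z0 assume z0: "z0 \<in> S"
  obtain r w where r: "r > 0" "cball z0 r \<subseteq> S" and w: "integrable N w"
    "\<And>z y. z \<in> cball z0 r \<Longrightarrow> y \<in> space N \<Longrightarrow> norm (f z y) \<le> w y"
    using bd[OF z0] by blast
  have int: "integrable N (f z)" if "z \<in> cball z0 r" for z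
    by (rule Bochner_Integration.integrable_bound[OF w(1) meas])
      (use that r w(2) in \<open>fastforce intro!: AE_I2\<close>)+
  define d where "d = (\<lambda>y. deriv (\<lambda>z. f z y) z0)"
  have dif: "((\<lambda>z. f z y) has_field_derivative deriv (\<lambda>z. f z y) z) (at z)"
    if "y \<in> space N" "z \<in> S" for z y
    using hol[OF that(1)] that(2) S holomorphic_derivI by blast
  have dbound: "norm (deriv (\<lambda>z. f z y) z) \<le> w y / (r / 2)" if "y \<in> space N" "z \<in> cball z0 (r/2)" for z y
  proof -
    have sub: "cball z (r/2) \<subseteq> cball z0 r"
    proof
      fix x assume "x \<in> cball z (r/2)"
      then show "x \<in> cball z0 r" using that(2) dist_triangle[of z0 x z] by auto
    qed
    have "norm ((deriv ^^ 1) (\<lambda>z. f z y) z) \<le> fact 1 * w y / (r/2) ^ 1"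
    proof (rule Cauchy_inequality)
      show "(\<lambda>z. f z y) holomorphic_on ball z (r/2)"
        by (rule holomorphic_on_subset[OF hol[OF that(1)]]) (use sub r ball_subset_cball in blast)
      show "continuous_on (cball z (r/2)) (\<lambda>z. f z y)"
        by (rule holomorphic_on_imp_continuous_on, rule holomorphic_on_subset[OF hol[OF that(1)]])
          (use sub r in blast)
      show "norm (f x y) \<le> w y" if "norm (z - x) = r/2" for x
        by (rule w(2)[OF _ \<open>y \<in> space N\<close>]) (use sub that in \<open>auto simp: dist_norm\<close>)
    qed (use r in auto)
    then show ?thesis by simp
  qed
  have quot: "norm ((f z y - f z0 y) / (z - z0)) \<le> w y / (r / 2)"
    if "y \<in> space N" "z \<in> cball z0 (r/2)" "z \<noteq> z0" for z y
  proof -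
    have "norm (f z y - f z0 y) \<le> (w y / (r/2)) * norm (z - z0)"
    proof (rule field_differentiable_bound[of "cball z0 (r/2)" _ "deriv (\<lambda>z. f z y)"])
      show "((\<lambda>z. f z y) has_field_derivative deriv (\<lambda>z. f z y) x) (at x within cball z0 (r/2))"
        if "x \<in> cball z0 (r/2)" for x
        by (rule has_field_derivative_at_within[OF dif[OF \<open>y \<in> space N\<close>]]) (use that r in auto)
    qed (use that r dbound in auto)
    then show ?thesis using that(3) by (simp add: norm_divide divide_le_eq)
  qed
  have lim: "(\<lambda>i. \<integral>y. (f (X i) y - f z0 y) / (X i - z0) \<partial>N) \<longlonglongrightarrow> (\<integral>y. d y \<partial>N)"
    if X: "\<And>i. X i \<in> cball z0 (r/2) - {z0}" "X \<longlonglongrightarrow> z0" for X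
  proof (rule integral_dominated_convergence[where w="\<lambda>y. w y / (r/2)"])
    have mX: "f (X i) \<in> borel_measurable N" for i using X(1)[of i] r by (intro meas) auto
    show "(\<lambda>y. (f (X i) y - f z0 y) / (X i - z0)) \<in> borel_measurable N" for i
      using mX[of i] meas[OF z0] by measurable
    have ptw: "(\<lambda>i. (f (X i) y - f z0 y) / (X i - z0)) \<longlonglongrightarrow> d y" if "y \<in> space N" for y
    proof -
      have "((\<lambda>z. (f z y - f z0 y) / (z - z0)) \<longlongrightarrow> d y) (at z0)"
        using dif[OF that z0] unfolding d_def has_field_derivative_iff .
      moreover have "filterlim X (at z0) sequentially"
        using X by (auto simp: filterlim_at)
      ultimately show ?thesis by (rule filterlim_compose)
    qed
    then show "AE y in N. (\<lambda>i. (f (X i) y - f z0 y) / (X i - z0)) \<longlonglongrightarrow> d y" by (rule AE_I2)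
    show "d \<in> borel_measurable N"
      by (rule borel_measurable_LIMSEQ_metric[of "\<lambda>i y. (f (X i) y - f z0 y) / (X i - z0)"])
        (use mX meas[OF z0] ptw in \<open>auto intro!: borel_measurable_divide borel_measurable_diff\<close>)
    show "integrable N (\<lambda>y. w y / (r/2))" using w(1) by simp
    show "AE y in N. norm ((f (X i) y - f z0 y) / (X i - z0)) \<le> w y / (r/2)" for i
      by (rule AE_I2) (use quot X(1)[of i] in auto)
  qed
  have "((\<lambda>z. (integral\<^sup>L N (f z) - integral\<^sup>L N (f z0)) / (z - z0)) \<longlongrightarrow> integral\<^sup>L N d)
     (at z0 within cball z0 (r/2))"
    unfolding tendsto_at_iff_sequentially
  proof (intro allI impI)
    fix X assume X: "\<forall>i. X i \<in> cball z0 (r/2) - {z0}" "X \<longlonglongrightarrow> z0"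
    have "(\<integral>y. (f (X i) y - f z0 y) / (X i - z0) \<partial>N)
      = (integral\<^sup>L N (f (X i)) - integral\<^sup>L N (f z0)) / (X i - z0)" for i
      using X(1)[rule_format, of i] r by (simp add: int)
    then show "((\<lambda>z. (integral\<^sup>L N (f z) - integral\<^sup>L N (f z0)) / (z - z0)) \<circ> X) \<longlonglongrightarrow> integral\<^sup>L N d"
      using lim[of X] X by (simp add: o_def)
  qed
  moreover have "at z0 within cball z0 (r/2) = at z0"
    by (rule at_within_interior) (use r in simp)
  ultimately show "\<exists>f'. ((\<lambda>z. integral\<^sup>L N (f z)) has_field_derivative f') (at z0)"
    unfolding has_field_derivative_iff by auto
qed

text \<open>A bounded exponent L makes exp(zL) bounded locally uniformly in z. Used for the
  coefficient functions of the boundary expansion and for the whole contribution of the region away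
  from the boundary.\<close>

lemma entire_integral_exp:
  fixes L :: "'a \<Rightarrow> real" and a :: "'a \<Rightarrow> complex"
  assumes "L \<in> borel_measurable N" "integrable N a" "\<And>y. y \<in> space N \<Longrightarrow> \<bar>L y\<bar> \<le> C"
  shows "integrable N (\<lambda>y. exp (z * of_real (L y)) * a y)"
    and "(\<lambda>z. \<integral>y. exp (z * of_real (L y)) * a y \<partial>N) holomorphic_on UNIV"
proof -
  note [measurable] = assms(1) borel_measurable_integrable[OF assms(2)]
  have b: "norm (exp (z * of_real (L y)) * a y) \<le> exp ((norm z0 + 1) * C) * norm (a y)"
    if "y \<in> space N" "z \<in> cball z0 1" for z z0 y
  proof -
    have "norm z \<le> norm z0 + 1"
      using that norm_triangle_ineq2[of z z0] by (simp add: dist_norm norm_minus_commute)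
    moreover have "Re z * L y \<le> norm z * \<bar>L y\<bar>"
      using abs_ge_self[of "Re z * L y"] mult_right_mono[OF abs_Re_le_cmod[of z] abs_ge_zero[of "L y"]]
      by (simp add: abs_mult)
    ultimately have "Re z * L y \<le> (norm z0 + 1) * C"
      using mult_mono[of "norm z" "norm z0 + 1" "\<bar>L y\<bar>" C] assms(3)[OF that(1)] by simp
    then show ?thesis by (simp add: norm_mult mult_right_mono)
  qed
  show "integrable N (\<lambda>y. exp (z * of_real (L y)) * a y)"
    by (rule Bochner_Integration.integrable_bound[of N "\<lambda>y. exp ((norm z + 1) * C) * norm (a y)"])
      (use b[of _ z z] assms(2) in \<open>auto intro!: AE_I2\<close>)
  show "(\<lambda>z. \<integral>y. exp (z * of_real (L y)) * a y \<partial>N) holomorphic_on UNIV"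
  proof (rule holomorphic_on_integral_param)
    fix z0 :: complex
    show "\<exists>r>0. \<exists>w. cball z0 r \<subseteq> UNIV \<and> integrable N w
        \<and> (\<forall>z\<in>cball z0 r. \<forall>y\<in>space N. norm (exp (z * of_real (L y)) * a y) \<le> w y)"
      using b assms(2) by (intro exI[of _ 1] conjI exI[of _ "\<lambda>y. exp ((norm z0 + 1) * C) * norm (a y)"]) auto
  qed (auto intro!: holomorphic_intros)
qed

lemma has_bochner_integral_pair_mult:
  fixes f :: "'a \<Rightarrow> complex" and g :: "'b \<Rightarrow> complex"
  assumes "sigma_finite_measure A" "sigma_finite_measure N"
    and f: "has_bochner_integral A f u" and g: "has_bochner_integral N g v"
  shows "has_bochner_integral (A \<Otimes>\<^sub>M N) (\<lambda>(x, y). f x * g y) (u * v)"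
proof -
  interpret N: sigma_finite_measure N by fact
  interpret pair_sigma_finite A N using assms by (simp add: pair_sigma_finite_def)
  have fi: "integrable A f" "integrable N g" "integral\<^sup>L A f = u" "integral\<^sup>L N g = v"
    using f g by (auto simp: has_bochner_integral_iff)
  note [measurable] = borel_measurable_integrable[OF fi(1)] borel_measurable_integrable[OF fi(2)]
  have i: "integrable (A \<Otimes>\<^sub>M N) (\<lambda>(x, y). f x * g y)"
    by (rule Fubini_integrable) (use fi in \<open>auto simp: norm_mult intro!: AE_I2\<close>)
  moreover have "integral\<^sup>L (A \<Otimes>\<^sub>M N) (\<lambda>(x, y). f x * g y) = (\<integral>x. \<integral>y. f x * g y \<partial>N \<partial>A)"
    by (rule integral_fst[OF i, symmetric])
  ultimately show ?thesis using fi by (simp add: has_bochner_integral_iff)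
qed

subsection \<open>Integrals of powers over an interval at \<open>0\<close>\<close>

abbreviation interval_measure_at_0 :: "real \<Rightarrow> real measure" where
  "interval_measure_at_0 \<delta> \<equiv> restrict_space lborel {0<..<\<delta>}"

lemma sigma_finite_interval_measure_at_0: "sigma_finite_measure (interval_measure_at_0 \<delta>)"
proof -
  interpret finite_measure "interval_measure_at_0 \<delta>"
    by (rule finite_measureI, cases "0 \<le> \<delta>") (auto simp: emeasure_restrict_space space_restrict_space)
  show ?thesis by unfold_locales
qed

lemma has_bochner_integral_FTC:
  fixes u U :: "real \<Rightarrow> complex"
  assumes "0 < \<delta>" "continuous_on {0..\<delta>} U"
    "\<And>\<rho>. \<rho> \<in> {0<..<\<delta>} \<Longrightarrow> (U has_vector_derivative u \<rho>) (at \<rho>)"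
    "integrable (interval_measure_at_0 \<delta>) u"
  shows "has_bochner_integral (interval_measure_at_0 \<delta>) u (U \<delta> - U 0)"
proof -
  have si: "set_integrable lborel {0<..<\<delta>} u"
    using assms(4) by (simp add: integrable_restrict_space set_integrable_def)
  have "(u has_integral (U \<delta> - U 0)) {0..\<delta>}"
    by (rule fundamental_theorem_of_calculus_interior) (use assms in auto)
  then have "integral {0<..<\<delta>} u = U \<delta> - U 0"
    by (simp add: has_integral_Icc_iff_Ioo integral_unique)
  then have "integral\<^sup>L (interval_measure_at_0 \<delta>) u = U \<delta> - U 0"
    using set_borel_integral_eq_integral(2)[OF si]
    by (simp add: integral_restrict_space set_lebesgue_integral_def)
  then show ?thesis using assms(4) by (simp add: has_bochner_integral_iff)
qed

lemma integrable_powr_at_0: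
  fixes p :: real
  assumes "0 < \<delta>" "p > -1"
  shows "integrable (interval_measure_at_0 \<delta>) (\<lambda>\<rho>. \<rho> powr p)"
proof -
  have "(\<lambda>\<rho>. \<rho> powr p) integrable_on {0<..<\<delta>}"
    using integrable_on_powr_from_0[OF assms(2), of \<delta>] assms by (simp add: integrable_on_Icc_iff_Ioo)
  then have "(\<lambda>\<rho>. \<rho> powr p) absolutely_integrable_on {0<..<\<delta>}"
    by (intro nonnegative_absolutely_integrable_1) auto
  then have "integrable lebesgue (\<lambda>\<rho>. indicator {0<..<\<delta>} \<rho> *\<^sub>R \<rho> powr p)"
    by (simp add: set_integrable_def)
  then have "integrable lborel (\<lambda>\<rho>. indicator {0<..<\<delta>} \<rho> *\<^sub>R \<rho> powr p)"
    by (subst (asm) integrable_completion) auto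
  then show ?thesis by (simp add: integrable_restrict_space)
qed

lemma norm_of_real_powr: "\<rho> > 0 \<Longrightarrow> norm (complex_of_real \<rho> powr z) = \<rho> powr Re z"
  by (simp add: norm_powr_real_powr)

lemma of_real_powr_measurable [measurable]:
  "(\<lambda>\<rho>. complex_of_real \<rho> powr z) \<in> borel_measurable borel"
  unfolding powr_def by measurable

lemma has_vector_derivative_of_real_powr:
  assumes "\<rho> > 0"
  shows "((\<lambda>\<rho>. complex_of_real \<rho> powr s) has_vector_derivative s * of_real \<rho> powr (s - 1)) (at \<rho>)"
proof -
  have "((\<lambda>w. w powr s) has_field_derivative s * of_real \<rho> powr (s - 1)) (at (complex_of_real \<rho>))"
    by (rule has_field_derivative_powr) (use assms in \<open>auto simp: complex_nonpos_Reals_iff\<close>)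
  then show ?thesis by (rule has_vector_derivative_real_field)
qed

lemma continuous_on_of_real_powr:
  assumes "Re s > 0"
  shows "continuous_on {0..} (\<lambda>\<rho>. complex_of_real \<rho> powr s)"
proof (rule continuous_on_eq_continuous_within[THEN iffD2], rule ballI)
  fix \<rho> :: real assume r: "\<rho> \<in> {0..}"
  show "continuous (at \<rho> within {0..}) (\<lambda>\<rho>. complex_of_real \<rho> powr s)"
  proof (cases "\<rho> = 0")
    case True
    have "((\<lambda>\<rho>. \<rho> powr Re s) \<longlongrightarrow> 0) (at (0::real) within {0..})"
      using assms by (auto intro!: tendsto_eq_intros simp: eventually_at_filter)
    then have "((\<lambda>\<rho>. complex_of_real \<rho> powr s) \<longlongrightarrow> 0) (at (0::real) within {0..})"
      by (rule Lim_null_comparison[rotated]) (auto simp: eventually_at_filter norm_of_real_powr)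
    then show ?thesis using True by (simp add: continuous_within)
  next
    case False
    then have "isCont (\<lambda>\<rho>. complex_of_real \<rho> powr s) \<rho>"
      using r by (intro has_vector_derivative_continuous[OF has_vector_derivative_of_real_powr]) auto
    then show ?thesis by (rule continuous_at_imp_continuous_at_within)
  qed
qed

text \<open>The source of the poles; it is used with s = z - 3, s = z - 1 and s = z.\<close>

lemma has_bochner_integral_powr_at_0:
  assumes "0 < \<delta>" "Re s > 0"
  shows "has_bochner_integral (interval_measure_at_0 \<delta>) (\<lambda>\<rho>. complex_of_real \<rho> powr (s - 1))
    (of_real \<delta> powr s / s)"
proof -
  have s: "s \<noteq> 0" using assms by auto
  have "integrable (interval_measure_at_0 \<delta>) (\<lambda>\<rho>. complex_of_real \<rho> powr (s - 1))"
    by (rule Bochner_Integration.integrable_bound[OF integrable_powr_at_0[OF assms(1), of "Re s - 1"]])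
      (use assms in \<open>auto intro!: AE_I2 measurable_restrict_space1 simp: norm_of_real_powr space_restrict_space\<close>)
  then have "has_bochner_integral (interval_measure_at_0 \<delta>) (\<lambda>\<rho>. complex_of_real \<rho> powr (s - 1))
     (of_real \<delta> powr s / s - of_real 0 powr s / s)"
  proof (intro has_bochner_integral_FTC assms)
    show "continuous_on {0..\<delta>} (\<lambda>\<rho>. complex_of_real \<rho> powr s / s)"
      by (intro continuous_on_divide continuous_on_const
          continuous_on_subset[OF continuous_on_of_real_powr[OF assms(2)]]) (use s in auto)
    show "((\<lambda>\<rho>. complex_of_real \<rho> powr s / s) has_vector_derivative of_real \<rho> powr (s - 1)) (at \<rho>)"
      if "\<rho> \<in> {0<..<\<delta>}" for \<rho>
      using has_vector_derivative_divide[OF has_vector_derivative_of_real_powr, of \<rho> s s] that s by simp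
  qed
  then show ?thesis by simp
qed

subsection \<open>The singular part of the zeta function\<close>

text \<open>Here l + e stands for ln (x/\<rho>), with l its boundary value and t the terms of e of
  orders 2 and 3. Since e = O(\<rho>^2), everything in exp(ze) beyond the linear term is
  O(\<rho>^4), and so is e - t. Multiplied by \<rho>^(z-4), such a remainder is integrable for Re z
  > -1, which brings z = 0 into reach.\<close>

lemma zeta_remainder_bound:
  fixes e :: real and w z :: complex
  assumes "\<bar>e\<bar> \<le> K * \<rho>\<^sup>2" "\<bar>e - t\<bar> \<le> C * \<rho> ^ 4" "\<bar>l\<bar> \<le> C" "norm z \<le> Z" "0 \<le> \<rho>" "\<rho> \<le> \<delta>" "0 \<le> C" "0 \<le> K"
  shows "norm (exp (z * of_real (l + e)) - exp (z * of_real l) * (1 + z * of_real t))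
    \<le> exp (Z * C) * (exp (Z * (K * \<delta>\<^sup>2)) * (Z * K)\<^sup>2 + Z * C) * \<rho> ^ 4"
proof -
  have Z: "0 \<le> Z" using assms(4) norm_ge_zero order_trans by blast
  let ?w = "z * of_real e"
  have nw: "norm ?w \<le> Z * (K * \<rho>\<^sup>2)"
    using mult_mono[OF assms(4,1)] Z by (simp add: norm_mult)
  have nw': "norm ?w \<le> Z * (K * \<delta>\<^sup>2)"
    using nw mult_left_mono[OF mult_left_mono[OF power_mono[OF assms(6,5), of 2] assms(8)] Z] by linarith
  have 1: "norm (exp ?w - 1 - ?w) \<le> exp (Z * (K * \<delta>\<^sup>2)) * (Z * K)\<^sup>2 * \<rho> ^ 4"
  proof -
    have "norm (exp ?w - (\<Sum>i\<le>1. ?w ^ i / fact i)) \<le> exp (norm ?w) * (norm ?w ^ Suc 1) / fact 1"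
      by (rule Taylor_exp_field)
    then have "norm (exp ?w - 1 - ?w) \<le> exp (norm ?w) * (norm ?w)\<^sup>2"
      by (simp add: power2_eq_square diff_diff_eq)
    also have "\<dots> \<le> exp (Z * (K * \<delta>\<^sup>2)) * (Z * (K * \<rho>\<^sup>2))\<^sup>2"
      by (intro mult_mono power_mono) (use nw nw' in auto)
    finally show ?thesis by (simp add: power_mult_distrib mult_ac flip: power_mult)
  qed
  have 2: "norm (z * of_real (e - t)) \<le> Z * C * \<rho> ^ 4"
    using mult_mono[OF assms(4,2)] Z by (simp add: norm_mult mult_ac del: of_real_diff)
  have 3: "norm (exp (z * of_real l)) \<le> exp (Z * C)"
  proof -
    have "norm (exp (z * of_real l)) \<le> exp (norm (z * of_real l))" by (rule norm_exp)
    also have "\<dots> \<le> exp (Z * C)" using mult_mono[OF assms(4,3)] Z by (simp add: norm_mult)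
    finally show ?thesis .
  qed
  have "exp (z * of_real (l + e)) - exp (z * of_real l) * (1 + z * of_real t)
     = exp (z * of_real l) * ((exp ?w - 1 - ?w) + z * of_real (e - t))"
    by (simp add: algebra_simps exp_add)
  also have "norm \<dots> \<le> exp (Z * C) * (exp (Z * (K * \<delta>\<^sup>2)) * (Z * K)\<^sup>2 * \<rho> ^ 4 + Z * C * \<rho> ^ 4)"
    unfolding norm_mult
    by (intro mult_mono 3 order_trans[OF norm_triangle_ineq] add_mono 1 2) auto
  finally show ?thesis by (simp add: algebra_simps)
qed

text \<open>Dominates a power over a compact range of exponents by its two end values, whether
  \<rho> lies below or above 1.\<close>

lemma powr_le_sum_powr:
  fixes \<rho> :: real
  assumes "0 < \<rho>" "p \<le> x" "x \<le> q"
  shows "\<rho> powr x \<le> \<rho> powr p + \<rho> powr q"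
proof (cases "\<rho> \<le> 1")
  case True
  then have "\<rho> powr x \<le> \<rho> powr p" using assms by (intro powr_mono') auto
  then show ?thesis using powr_ge_zero[of \<rho> q] by linarith
next
  case False
  then have "\<rho> powr x \<le> \<rho> powr q" using assms by (intro powr_mono) auto
  then show ?thesis using powr_ge_zero[of \<rho> p] by linarith
qed

text \<open>The coefficient of \<open>\<rho>\<^sup>3\<close> in the expansion of the logarithm \<open>lam\<close> is cancelled
  against the pole of \<open>\<integral> \<rho>\<^sup>z\<^sup>-\<^sup>1 d\<rho> = \<delta>\<^sup>z / z\<close>; this is the only contribution of \<open>lam\<close> at \<open>z = 0\<close>.\<close>

lemma zeta_near_boundary:
  fixes lam :: "real \<Rightarrow> 'b \<Rightarrow> real" and l0 c2 :: "'b \<Rightarrow> real"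
  assumes \<delta>: "0 < \<delta>" and N: "finite_measure N"
    and lam: "(\<lambda>(\<rho>, y). lam \<rho> y) \<in> borel_measurable (interval_measure_at_0 \<delta> \<Otimes>\<^sub>M N)"
    and l0: "l0 \<in> borel_measurable N" and c2: "c2 \<in> borel_measurable N"
    and bd: "\<And>y. y \<in> space N \<Longrightarrow> \<bar>l0 y\<bar> \<le> C" "\<And>y. y \<in> space N \<Longrightarrow> \<bar>c2 y\<bar> \<le> C"
    and exp: "\<And>\<rho> y. 0 < \<rho> \<Longrightarrow> \<rho> < \<delta> \<Longrightarrow> y \<in> space N \<Longrightarrow>
       \<bar>lam \<rho> y - l0 y - (c2 y * \<rho>\<^sup>2 + c3 * \<rho> ^ 3)\<bar> \<le> C * \<rho> ^ 4"
  obtains G where "G holomorphic_on ({z. -1 < Re z} - {1, 3})"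
    "G 0 = of_real (measure N (space N) * (c3 - 1 / (3 * \<delta> ^ 3)))"
    "\<And>z. 3 < Re z \<Longrightarrow> has_bochner_integral (interval_measure_at_0 \<delta> \<Otimes>\<^sub>M N)
        (\<lambda>(\<rho>, y). of_real \<rho> powr (z - 4) * exp (z * of_real (lam \<rho> y))) (G z)"
proof (cases "space N = {}")
  \<comment> \<open>An empty \<open>N\<close> gives no information on the sign of \<open>C\<close>;
    all integrals are 0 then, and so is the required value.\<close>
  case True
  then have s: "space (interval_measure_at_0 \<delta> \<Otimes>\<^sub>M N) = {}" by (simp add: space_pair_measure)
  have "has_bochner_integral (interval_measure_at_0 \<delta> \<Otimes>\<^sub>M N) f 0" for f :: "_ \<Rightarrow> complex"
    by (rule has_bochner_integral_cong[THEN iffD1, OF refl _ refl has_bochner_integral_zero]) (simp add: s)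
  then show thesis using that[of "\<lambda>_. 0"] True by simp
next
  case False
  then obtain y0 where y0: "y0 \<in> space N" by blast
  interpret N: finite_measure N by fact
  let ?A = "interval_measure_at_0 \<delta>"
  have sA: "sigma_finite_measure ?A" by (rule sigma_finite_interval_measure_at_0)
  have sN: "sigma_finite_measure N" by unfold_locales
  interpret pair_sigma_finite ?A N using sA sN by (simp add: pair_sigma_finite_def)
  have C: "0 \<le> C" using bd(1)[OF y0] by linarith
  note [measurable] = l0 c2 lam
  define K where "K = C + \<bar>c3\<bar> * \<delta> + C * \<delta>\<^sup>2"
  have K: "0 \<le> K" using C \<delta> by (simp add: K_def)
  define t where "t = (\<lambda>\<rho> y. c2 y * \<rho>\<^sup>2 + c3 * \<rho> ^ 3)"
  have eb: "\<bar>lam \<rho> y - l0 y\<bar> \<le> K * \<rho>\<^sup>2" if "0 < \<rho>" "\<rho> < \<delta>" "y \<in> space N" for \<rho> y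
  proof -
    have "\<bar>lam \<rho> y - l0 y\<bar> \<le> \<bar>c2 y * \<rho>\<^sup>2\<bar> + \<bar>c3 * \<rho> ^ 3\<bar> + C * \<rho> ^ 4"
      using exp[OF that] by linarith
    also have "\<dots> = \<bar>c2 y\<bar> * \<rho>\<^sup>2 + \<bar>c3\<bar> * \<rho> * \<rho>\<^sup>2 + C * \<rho>\<^sup>2 * \<rho>\<^sup>2"
      using that by (simp add: abs_mult power2_eq_square power3_eq_cube power4_eq_xxxx)
    also have "\<dots> \<le> C * \<rho>\<^sup>2 + \<bar>c3\<bar> * \<delta> * \<rho>\<^sup>2 + C * \<delta>\<^sup>2 * \<rho>\<^sup>2"
      using that bd(2) C by (intro add_mono mult_right_mono mult_left_mono power_mono) auto
    finally show ?thesis by (simp add: K_def algebra_simps)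
  qed
  define R where "R = (\<lambda>(z::complex) \<rho> y. exp (z * of_real (lam \<rho> y)) - exp (z * of_real (l0 y)) * (1 + z * of_real (t \<rho> y)))"
  define B where "B = (\<lambda>Z. exp (Z * C) * (exp (Z * (K * \<delta>\<^sup>2)) * (Z * K)\<^sup>2 + Z * C))"
  have B0: "0 \<le> B Z" if "0 \<le> Z" for Z using that C by (simp add: B_def)
  have Rb: "norm (R z \<rho> y) \<le> B Z * \<rho> ^ 4" if "0 < \<rho>" "\<rho> < \<delta>" "y \<in> space N" "norm z \<le> Z" for z \<rho> y Z
    using zeta_remainder_bound[of "lam \<rho> y - l0 y" K \<rho> "t \<rho> y" C "l0 y" z Z \<delta>] eb[OF that(1-3)]
      exp[OF that(1-3)] bd(1)[OF that(3)] that C K by (simp add: R_def B_def t_def)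
  let ?r = "\<lambda>z (\<rho>, y). of_real \<rho> powr (z - 4) * R z \<rho> y"
  have rb: "norm (of_real \<rho> powr (z - 4) * R z \<rho> y) \<le> B Z * (\<rho> powr p + \<rho> powr q)"
    if "0 < \<rho>" "\<rho> < \<delta>" "y \<in> space N" "norm z \<le> Z" "p \<le> Re z" "Re z \<le> q" for z \<rho> y Z p q
  proof -
    have Z: "0 \<le> Z" using that(4) norm_ge_zero order_trans by blast
    have "norm (of_real \<rho> powr (z - 4) * R z \<rho> y) \<le> \<rho> powr (Re z - 4) * (B Z * \<rho> ^ 4)"
      unfolding norm_mult using Rb[OF that(1-4)] that(1) by (simp add: norm_of_real_powr mult_left_mono)
    also have "\<dots> = B Z * (\<rho> powr Re z)"
      using that(1) powr_realpow[of \<rho> 4] by (simp add: powr_diff)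
    also have "\<dots> \<le> B Z * (\<rho> powr p + \<rho> powr q)"
      by (intro mult_left_mono powr_le_sum_powr B0) (use that Z in auto)
    finally show ?thesis .
  qed
  have spA: "space ?A = {0<..<\<delta>}" by (simp add: space_restrict_space)
  have powA [measurable]: "(\<lambda>\<rho>. complex_of_real \<rho> powr z) \<in> borel_measurable ?A" for z
    by (rule measurable_restrict_space1) simp
  have idA [measurable]: "(\<lambda>\<rho>. \<rho>) \<in> borel_measurable ?A"
    by (rule measurable_restrict_space1) simp
  have rm: "?r z \<in> borel_measurable (?A \<Otimes>\<^sub>M N)" for z
    unfolding R_def t_def by measurable
  have wi: "integrable (?A \<Otimes>\<^sub>M N) (\<lambda>(\<rho>, y). c * (\<rho> powr p + \<rho> powr q))" if "-1 < p" "-1 < q" for c p q :: real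
  proof -
    have iA: "integrable ?A (\<lambda>\<rho>. c * (\<rho> powr p + \<rho> powr q))"
      using integrable_powr_at_0[OF \<delta>] that by simp
    note [measurable] = borel_measurable_integrable[OF iA]
    show ?thesis
      by (rule Fubini_integrable) (use iA in \<open>auto intro!: AE_I2\<close>)
  qed
  have rint: "integrable (?A \<Otimes>\<^sub>M N) (?r z)" if "-1 < Re z" for z
    by (rule Bochner_Integration.integrable_bound[OF wi[OF that that, of "B (norm z)"] rm])
      (use rb[where z=z and Z="norm z" and p="Re z" and q="Re z"] in
        \<open>fastforce intro!: AE_I2 simp: space_pair_measure spA\<close>)
  define Rem where "Rem = (\<lambda>z. \<integral>x. ?r z x \<partial>(?A \<Otimes>\<^sub>M N))"
  have Remhol: "Rem holomorphic_on {z. -1 < Re z}"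
    unfolding Rem_def
  proof (rule holomorphic_on_integral_param[OF open_halfspace_Re_gt rm])
    show "(\<lambda>z. ?r z x) holomorphic_on {z. -1 < Re z}" if "x \<in> space (?A \<Otimes>\<^sub>M N)" for x
      using that unfolding R_def
      by (cases x) (auto intro!: holomorphic_intros simp: space_pair_measure spA)
    fix z0 :: complex assume "z0 \<in> {z. -1 < Re z}"
    then have z0: "-1 < Re z0" by simp
    define r where "r = (Re z0 + 1) / 2"
    have r: "r > 0" "-1 < Re z0 - r" using z0 by (simp_all add: r_def field_simps)
    have cb: "Re z0 - r \<le> Re z \<and> Re z \<le> Re z0 + r \<and> norm z \<le> norm z0 + r" if "z \<in> cball z0 r" for z
    proof -
      have "\<bar>Re (z0 - z)\<bar> \<le> r" using that abs_Re_le_cmod[of "z0 - z"] by (simp add: dist_norm del: minus_complex.simps)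
      moreover have "norm z \<le> norm z0 + r"
        using that norm_triangle_ineq2[of z z0] by (simp add: dist_norm norm_minus_commute)
      ultimately show ?thesis by auto
    qed
    let ?w = "\<lambda>(\<rho>::real, y::'b). B (norm z0 + r) * (\<rho> powr (Re z0 - r) + \<rho> powr (Re z0 + r))"
    have "integrable (?A \<Otimes>\<^sub>M N) ?w" using r z0 by (intro wi) auto
    moreover have "cball z0 r \<subseteq> {z. -1 < Re z}" using cb r by fastforce
    moreover have "norm (?r z x) \<le> ?w x" if "z \<in> cball z0 r" "x \<in> space (?A \<Otimes>\<^sub>M N)" for z x
      using that rb[where z=z and Z="norm z0 + r" and p="Re z0 - r" and q="Re z0 + r"] cb[OF that(1)]
      by (cases x) (auto simp: space_pair_measure spA)
    ultimately show "\<exists>r>0. \<exists>w. cball z0 r \<subseteq> {z. -1 < Re z} \<and> integrable (?A \<Otimes>\<^sub>M N) w \<and>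
         (\<forall>z\<in>cball z0 r. \<forall>x\<in>space (?A \<Otimes>\<^sub>M N). norm (?r z x) \<le> w x)"
      using r by blast
  qed
  define A0 where "A0 = (\<lambda>z::complex. \<integral>y. exp (z * of_real (l0 y)) * 1 \<partial>N)"
  define A2 where "A2 = (\<lambda>z::complex. \<integral>y. exp (z * of_real (l0 y)) * of_real (c2 y) \<partial>N)"
  have i1: "integrable N (\<lambda>y. 1 :: complex)" by simp
  have i2: "integrable N (\<lambda>y. complex_of_real (c2 y))"
    by (rule N.integrable_const_bound[of _ C]) (use bd(2) in \<open>auto intro!: AE_I2\<close>)
  note e0 = entire_integral_exp[OF l0 i1 bd(1)] and e2 = entire_integral_exp[OF l0 i2 bd(1)]
  have A0hol: "A0 holomorphic_on UNIV" and A2hol: "A2 holomorphic_on UNIV"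
    using e0(2) e2(2) unfolding A0_def A2_def by auto
  \<comment> \<open>Three model integrals and the remainder. In the second term the factor z
    survives and kills the term at 0; in the third it has been cancelled against \<delta>^z/z, so
    that c3 remains; the first contributes \<delta>^-3/(-3), and the remainder vanishes at z = 0
    together with its integrand.\<close>
  define G where "G = (\<lambda>z. of_real \<delta> powr (z - 3) / (z - 3) * A0 z + z * (of_real \<delta> powr (z - 1) / (z - 1) * A2 z)
     + of_real c3 * (of_real \<delta> powr z * A0 z) + Rem z)"
  show thesis
  proof (rule that[of G])
    show "G holomorphic_on ({z. -1 < Re z} - {1, 3})"
      unfolding G_def using \<delta>
      by (intro holomorphic_intros holomorphic_on_subset[OF A0hol] holomorphic_on_subset[OF A2hol]
          holomorphic_on_subset[OF Remhol]) auto
    have "Rem 0 = 0" unfolding Rem_def R_def by (simp add: case_prod_unfold)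
    moreover have "A0 0 = of_real (measure N (space N))" unfolding A0_def by (simp add: scaleR_conv_of_real)
    moreover have "complex_of_real \<delta> powr (-3) = of_real (1 / \<delta> ^ 3)"
      using \<delta> powr_realpow[of \<delta> 3] by (simp add: powr_minus powr_of_real[symmetric] field_simps)
    ultimately show "G 0 = of_real (measure N (space N) * (c3 - 1 / (3 * \<delta> ^ 3)))"
      using \<delta> by (simp add: G_def field_simps)
  next
    fix z :: complex assume z: "3 < Re z"
    then have z0: "z \<noteq> 0" by auto
    let ?p = "\<lambda>s \<rho>. complex_of_real \<rho> powr s"
    have b0: "has_bochner_integral N (\<lambda>y. exp (z * of_real (l0 y)) * 1) (A0 z)"
      and b2: "has_bochner_integral N (\<lambda>y. exp (z * of_real (l0 y)) * of_real (c2 y)) (A2 z)"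
      unfolding A0_def A2_def using e0(1) e2(1) by (auto simp: has_bochner_integral_integrable)
    have p: "has_bochner_integral ?A (?p (z - 3 - 1)) (of_real \<delta> powr (z - 3) / (z - 3))"
       "has_bochner_integral ?A (?p (z - 1 - 1)) (of_real \<delta> powr (z - 1) / (z - 1))"
       "has_bochner_integral ?A (?p (z - 1)) (of_real \<delta> powr z / z)"
      by (intro has_bochner_integral_powr_at_0; use z \<delta> in simp)+
    note pm = has_bochner_integral_pair_mult[OF sA sN]
    have sum: "has_bochner_integral (?A \<Otimes>\<^sub>M N)
       (\<lambda>x. (case x of (\<rho>, y) \<Rightarrow> ?p (z - 3 - 1) \<rho> * (exp (z * of_real (l0 y)) * 1))
         + z * (case x of (\<rho>, y) \<Rightarrow> ?p (z - 1 - 1) \<rho> * (exp (z * of_real (l0 y)) * of_real (c2 y)))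
         + (z * of_real c3) * (case x of (\<rho>, y) \<Rightarrow> ?p (z - 1) \<rho> * (exp (z * of_real (l0 y)) * 1))
         + ?r z x)
       (of_real \<delta> powr (z - 3) / (z - 3) * A0 z + z * (of_real \<delta> powr (z - 1) / (z - 1) * A2 z)
         + (z * of_real c3) * (of_real \<delta> powr z / z * A0 z) + Rem z)"
      using rint[of z] z unfolding Rem_def
      by (intro has_bochner_integral_add has_bochner_integral_mult_right has_bochner_integral_integrable
          pm p b0 b2) auto
    have eq: "(case x of (\<rho>, y) \<Rightarrow> ?p (z - 3 - 1) \<rho> * (exp (z * of_real (l0 y)) * 1))
         + z * (case x of (\<rho>, y) \<Rightarrow> ?p (z - 1 - 1) \<rho> * (exp (z * of_real (l0 y)) * of_real (c2 y)))
         + (z * of_real c3) * (case x of (\<rho>, y) \<Rightarrow> ?p (z - 1) \<rho> * (exp (z * of_real (l0 y)) * 1))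
         + ?r z x = (case x of (\<rho>, y) \<Rightarrow> ?p (z - 4) \<rho> * exp (z * of_real (lam \<rho> y)))"
      if "x \<in> space (?A \<Otimes>\<^sub>M N)" for x
    proof -
      obtain \<rho> y where x: "x = (\<rho>, y)" "0 < \<rho>" using \<open>x \<in> _\<close> by (cases x) (auto simp: space_pair_measure spA)
      have "?p (z - 2) \<rho> = ?p (z - 4) \<rho> * of_real \<rho> ^ 2" "?p (z - 1) \<rho> = ?p (z - 4) \<rho> * of_real \<rho> ^ 3"
        using x(2) powr_add[of "of_real \<rho>" "z - 4" 2] powr_add[of "of_real \<rho>" "z - 4" 3] by simp_all
      then show ?thesis unfolding x(1) by (simp add: R_def t_def algebra_simps)
    qed
    have "G z = of_real \<delta> powr (z - 3) / (z - 3) * A0 z + z * (of_real \<delta> powr (z - 1) / (z - 1) * A2 z)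
         + (z * of_real c3) * (of_real \<delta> powr z / z * A0 z) + Rem z"
      using z0 by (simp add: G_def)
    then show "has_bochner_integral (?A \<Otimes>\<^sub>M N) (\<lambda>(\<rho>, y). ?p (z - 4) \<rho> * exp (z * of_real (lam \<rho> y))) (G z)"
      using has_bochner_integral_cong[THEN iffD1, OF refl eq refl sum] by simp
  qed
qed

subsection \<open>Meromorphic continuation\<close>

text \<open>The identity theorem. After \<open>remove_sings\<close> the function is nicely
  meromorphic and vanishes on all of S; the original f may still take stray values at isolated
  points, so the conclusion speaks of punctured neighbourhoods.\<close>

lemma meromorphic_eventually_zero:
  fixes f :: "complex \<Rightarrow> complex"
  assumes f: "f meromorphic_on S" and S: "open S" "connected S"
    and U: "open U" "U \<noteq> {}" "U \<subseteq> S" "\<And>z. z \<in> U \<Longrightarrow> f z = 0" and w: "w \<in> S"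
  shows "\<forall>\<^sub>F z in at w. f z = 0"
proof -
  have iso: "isolated_singularity_at f z" if "z \<in> S" for z
    using f that meromorphic_on_isolated_singularity meromorphic_on_subset by blast
  obtain u where u: "u \<in> U" using U by blast
  have "\<forall>\<^sub>F z in at u. z \<in> U" using U(1) u by (intro eventually_at_in_open')
  then have "\<forall>\<^sub>F z in at u. remove_sings f z = 0"
    using eventually_remove_sings_eq_at[OF iso, of u] u U by (auto elim!: eventually_elim2)
  then have fr: "\<exists>\<^sub>F z in at u. remove_sings f z = 0" by (intro eventually_frequently) auto
  have z: "remove_sings f z = 0" if "z \<in> S" for z
    using frequently_eq_meromorphic_imp_constant[OF fr remove_sings_nicely_meromorphic[OF f] S _ that] u U by blast
  have "\<forall>\<^sub>F z in at w. z \<in> S" using S w by (intro eventually_at_in_open')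
  with eventually_remove_sings_eq_at[OF iso[OF w]] show ?thesis
    by eventually_elim (use z in force)
qed

lemma meromorphic_eventually_eq:
  fixes f g :: "complex \<Rightarrow> complex"
  assumes "f meromorphic_on S" "g meromorphic_on S" "open S" "connected S"
    "open U" "U \<noteq> {}" "U \<subseteq> S" "\<And>z. z \<in> U \<Longrightarrow> f z = g z" "w \<in> S"
  shows "\<forall>\<^sub>F z in at w. f z = g z"
  using meromorphic_eventually_zero[OF meromorphic_on_diff[OF assms(1,2)] assms(3-7) _ assms(9)] assms(8)
  by simp

text \<open>The continuations to larger and larger half planes are given independently and need only
  agree up to isolated points. Removing singularities makes their values canonical, so the value at
  z may be taken from any half plane containing z.\<close>

lemma meromorphic_glue:
  fixes Z :: "nat \<Rightarrow> complex \<Rightarrow> complex"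
  assumes Z: "\<And>n. Z n meromorphic_on {z. c - real n < Re z}"
    and eq: "\<And>n z. c < Re z \<Longrightarrow> Z n z = f z"
  obtains Y where "Y meromorphic_on UNIV"
    "\<And>n w. c - real n < Re w \<Longrightarrow> \<forall>\<^sub>F z in at w. Y z = Z n z"
proof -
  let ?S = "\<lambda>n::nat. {z. c - real n < Re z}"
  define N where "N = (\<lambda>z. nat \<lceil>c - Re z\<rceil> + 1)"
  have N: "z \<in> ?S (N z)" for z by (simp add: N_def) linarith
  define Y where "Y = (\<lambda>z. remove_sings (Z (N z)) z)"
  have ev: "\<forall>\<^sub>F z in at w. Z n z = Z k z" if "w \<in> ?S n" "n \<le> k" for n k w
  proof (rule meromorphic_eventually_eq)
    show "Z k meromorphic_on ?S n"
      by (rule meromorphic_on_subset[OF Z]) (use that in auto)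
    show "open (?S n)" "open {z. c < Re z}" by (simp_all add: open_halfspace_Re_gt)
    show "connected (?S n)" by (intro convex_connected convex_halfspace_Re_gt)
    show "{z. c < Re z} \<noteq> {}" by (rule ex_in_conv[THEN iffD1], rule exI[of _ "of_real (c + 1)"]) simp
  qed (use Z eq that in auto)
  have same: "remove_sings (Z n) w = remove_sings (Z k) w" if "w \<in> ?S n" "w \<in> ?S k" for n k w
  proof (cases "n \<le> k")
    case True
    show ?thesis by (rule remove_sings_cong[OF ev[OF that(1) True] refl])
  next
    case False
    then show ?thesis using remove_sings_cong[OF ev[OF that(2)] refl, of n] by simp
  qed
  have Yn: "\<forall>\<^sub>F z in at w. Y z = Z n z" if w: "w \<in> ?S n" for n w
  proof -
    have "\<forall>\<^sub>F z in at w. z \<in> ?S n" using w by (intro eventually_at_in_open') (simp_all add: open_halfspace_Re_gt)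
    moreover have "isolated_singularity_at (Z n) w"
      using Z w meromorphic_on_isolated_singularity meromorphic_on_subset by blast
    then have "\<forall>\<^sub>F z in at w. remove_sings (Z n) z = Z n z" by (rule eventually_remove_sings_eq_at)
    ultimately show ?thesis
    proof eventually_elim
      case (elim z)
      then show ?case using same[of z "N z" n] N[of z] by (simp add: Y_def)
    qed
  qed
  have "Y meromorphic_on {w}" for w
  proof -
    have "Y meromorphic_on {w} \<longleftrightarrow> Z (N w) meromorphic_on {w}"
      by (rule meromorphic_on_cong) (use Yn[OF N] in auto)
    moreover have "Z (N w) meromorphic_on {w}"
      by (rule meromorphic_on_subset[OF Z[of "N w"]]) (use N[of w] in auto)
    ultimately show ?thesis by simp
  qed
  then have "Y meromorphic_on UNIV" using meromorphic_on_meromorphic_at by blast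
  then show thesis using that[of Y] Yn by blast
qed

text \<open>The start of the continuation: the half plane of absolute convergence when j powers of
  \<rho> have been gained.\<close>

lemma zeta_integral_holomorphic:
  fixes G q :: "real \<Rightarrow> real"
  assumes \<delta>: "0 < \<delta>" and S: "open S" "{0..\<delta>} \<subseteq> S" and G: "smooth_on G S" and q: "smooth_on q S"
  shows "\<exists>Z. Z meromorphic_on {z. 3 - real j < Re z} \<and>
    (\<forall>z. 3 - real j < Re z \<longrightarrow> has_bochner_integral (interval_measure_at_0 \<delta>)
       (\<lambda>\<rho>. of_real \<rho> powr (z - 4 + of_nat j) * (exp (z * of_real (G \<rho>)) * of_real (q \<rho>))) (Z z))"
proof -
  let ?A = "interval_measure_at_0 \<delta>"
  let ?f = "\<lambda>z \<rho>. of_real \<rho> powr (z - 4 + of_nat j) * (exp (z * of_real (G \<rho>)) * of_real (q \<rho>)) :: complex"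
  let ?H = "{z. 3 - real j < Re z}"
  have cG: "continuous_on {0..\<delta>} G" "continuous_on {0..\<delta>} q"
    using continuous_on_subset[OF smooth_on_imp_continuous_on S(2)] G q by auto
  obtain C where C: "\<And>\<rho>. \<rho> \<in> {0..\<delta>} \<Longrightarrow> \<bar>G \<rho>\<bar> \<le> C"
    using compact_imp_bounded[OF compact_continuous_image[OF cG(1) compact_Icc]]
    unfolding bounded_iff by (metis imageI real_norm_def)
  obtain D where D: "\<And>\<rho>. \<rho> \<in> {0..\<delta>} \<Longrightarrow> \<bar>q \<rho>\<bar> \<le> D"
    using compact_imp_bounded[OF compact_continuous_image[OF cG(2) compact_Icc]]
    unfolding bounded_iff by (metis imageI real_norm_def)
  have C0: "0 \<le> C" "0 \<le> D" using C[of 0] D[of 0] \<delta> by auto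
  have spA: "space ?A = {0<..<\<delta>}" by (simp add: space_restrict_space)
  have mA: "G \<in> borel_measurable ?A" "q \<in> borel_measurable ?A"
    unfolding measurable_cong_sets[OF sets_restrict_space_cong[OF sets_lborel] refl]
    by (rule borel_measurable_continuous_on_restrict, rule continuous_on_subset, rule cG, force)+
  have powA [measurable]: "(\<lambda>\<rho>. complex_of_real \<rho> powr z) \<in> borel_measurable ?A" for z
    by (rule measurable_restrict_space1) simp
  note [measurable] = mA
  have b: "norm (?f z \<rho>) \<le> exp (Z * C) * D * (\<rho> powr (p - 4 + j) + \<rho> powr (p' - 4 + j))"
    if "\<rho> \<in> {0<..<\<delta>}" "norm z \<le> Z" "p \<le> Re z" "Re z \<le> p'" for \<rho> z Z p p'
  proof -
    have "norm (exp (z * of_real (G \<rho>))) \<le> exp (norm (z * of_real (G \<rho>)))" by (rule norm_exp)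
    also have "\<dots> \<le> exp (Z * C)"
      using mult_mono[OF that(2) C[of \<rho>]] order_trans[OF norm_ge_zero that(2)] that(1) by (simp add: norm_mult)
    finally have e: "norm (exp (z * of_real (G \<rho>))) \<le> exp (Z * C)" .
    have "norm (?f z \<rho>) \<le> (\<rho> powr (p - 4 + j) + \<rho> powr (p' - 4 + j)) * (exp (Z * C) * D)"
      unfolding norm_mult using that e D[of \<rho>] powr_le_sum_powr[of \<rho> "p - 4 + j" "Re z - 4 + j" "p' - 4 + j"]
      by (intro mult_mono) (auto simp: norm_of_real_powr)
    then show ?thesis by (simp add: mult_ac)
  qed
  have wi: "integrable ?A (\<lambda>\<rho>. c * (\<rho> powr (p - 4 + j) + \<rho> powr (p' - 4 + j)))"
    if "3 - real j < p" "3 - real j < p'" for c p p'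
    using integrable_powr_at_0[OF \<delta>] that by simp
  have m: "?f z \<in> borel_measurable ?A" for z by measurable
  have "integrable ?A (?f z)" if "z \<in> ?H" for z
    by (rule Bochner_Integration.integrable_bound[OF wi[of "Re z" "Re z" "exp (norm z * C) * D"] m])
      (use b[where z=z and Z="norm z" and p="Re z" and p'="Re z"] that in
        \<open>fastforce intro!: AE_I2 simp: spA\<close>)+
  then have I: "has_bochner_integral ?A (?f z) (integral\<^sup>L ?A (?f z))" if "z \<in> ?H" for z
    using that by (simp add: has_bochner_integral_integrable)
  have "(\<lambda>z. integral\<^sup>L ?A (?f z)) holomorphic_on ?H"
  proof (rule holomorphic_on_integral_param[OF open_halfspace_Re_gt m])
    show "(\<lambda>z. ?f z \<rho>) holomorphic_on ?H" if "\<rho> \<in> space ?A" for \<rho>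
      using that by (auto intro!: holomorphic_intros simp: spA)
    fix z0 :: complex assume "z0 \<in> ?H"
    then have z0: "3 - real j < Re z0" by simp
    define r where "r = (Re z0 - (3 - real j)) / 2"
    have r: "r > 0" "3 - real j < Re z0 - r" using z0 unfolding r_def by (simp_all add: field_simps)
    have cb: "Re z0 - r \<le> Re z \<and> Re z \<le> Re z0 + r \<and> norm z \<le> norm z0 + r" if "z \<in> cball z0 r" for z
    proof -
      have "\<bar>Re (z0 - z)\<bar> \<le> r" using that abs_Re_le_cmod[of "z0 - z"] by (simp add: dist_norm del: minus_complex.simps)
      moreover have "norm z \<le> norm z0 + r"
        using that norm_triangle_ineq2[of z z0] by (simp add: dist_norm norm_minus_commute)
      ultimately show ?thesis by auto
    qed
    let ?w = "\<lambda>\<rho>. exp ((norm z0 + r) * C) * D * (\<rho> powr (Re z0 - r - 4 + j) + \<rho> powr (Re z0 + r - 4 + j))"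
    have "integrable ?A ?w" using r z0 by (intro wi) auto
    moreover have "cball z0 r \<subseteq> ?H" using cb r by fastforce
    moreover have "norm (?f z x) \<le> ?w x" if "z \<in> cball z0 r" "x \<in> space ?A" for z x
      using that cb[OF that(1)] by (intro b) (auto simp: spA)
    ultimately show "\<exists>r>0. \<exists>w. cball z0 r \<subseteq> ?H \<and> integrable ?A w \<and>
         (\<forall>z\<in>cball z0 r. \<forall>x\<in>space ?A. norm (?f z x) \<le> w x)"
      using r by blast
  qed
  then have "(\<lambda>z. integral\<^sup>L ?A (?f z)) analytic_on ?H"
    by (simp add: analytic_on_open open_halfspace_Re_gt)
  then have "(\<lambda>z. integral\<^sup>L ?A (?f z)) meromorphic_on ?H" by (rule analytic_on_imp_meromorphic_on)
  then show ?thesis using I by (intro exI[of _ "\<lambda>z. integral\<^sup>L ?A (?f z)"]) auto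
qed

text \<open>Integration by parts shifts the half plane by one.\<close>

lemma zeta_integrals_continue:
  fixes G q :: "real \<Rightarrow> real"
  assumes \<delta>: "0 < \<delta>" and S: "open S" "{0..\<delta>} \<subseteq> S" and G: "smooth_on G S" and q: "smooth_on q S"
  shows "\<exists>Z. Z meromorphic_on {z. 3 - real j - real n < Re z} \<and>
    (\<forall>z. 3 - real j < Re z \<longrightarrow> has_bochner_integral (interval_measure_at_0 \<delta>)
       (\<lambda>\<rho>. of_real \<rho> powr (z - 4 + of_nat j) * (exp (z * of_real (G \<rho>)) * of_real (q \<rho>))) (Z z))"
  using q
proof (induction n arbitrary: j q)
  case 0
  show ?case using zeta_integral_holomorphic[OF \<delta> S G 0] by simp
next
  case (Suc n)
  let ?A = "interval_measure_at_0 \<delta>"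
  let ?f = "\<lambda>j q z \<rho>. of_real \<rho> powr (z - 4 + of_nat j) * (exp (z * of_real (G \<rho>)) * of_real (q \<rho>)) :: complex"
  define G' where "G' = (\<lambda>x. frechet_derivative G (at x) 1)"
  define q' where "q' = (\<lambda>x. frechet_derivative q (at x) 1)"
  have sm: "smooth_on (\<lambda>x. G' x * q x) S" "smooth_on q' S"
    unfolding G'_def q'_def using G Suc.prems by (auto intro!: smooth_on_mult S smooth_on_dir_deriv)
  have der: "(h has_vector_derivative frechet_derivative h (at x) 1) (at x)" if "smooth_on h S" "x \<in> S" for h :: "real \<Rightarrow> real" and x
  proof -
    have d: "(h has_derivative frechet_derivative h (at x)) (at x)" by (rule smooth_on_has_derivative[OF that])
    have "frechet_derivative h (at x) s = s *\<^sub>R frechet_derivative h (at x) 1" for s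
      using linear_scale[OF has_derivative_linear[OF d], of s 1] by simp
    then show ?thesis unfolding has_vector_derivative_def
      by (intro has_derivative_eq_rhs[OF d] ext)
  qed
  obtain Z1 where Z1: "Z1 meromorphic_on {z. 3 - real (Suc j) - real n < Re z}"
    "\<And>z. 3 - real (Suc j) < Re z \<Longrightarrow> has_bochner_integral ?A (?f (Suc j) (\<lambda>x. G' x * q x) z) (Z1 z)"
    using Suc.IH[OF sm(1), of "Suc j"] by auto
  obtain Z2 where Z2: "Z2 meromorphic_on {z. 3 - real (Suc j) - real n < Re z}"
    "\<And>z. 3 - real (Suc j) < Re z \<Longrightarrow> has_bochner_integral ?A (?f (Suc j) q' z) (Z2 z)"
    using Suc.IH[OF sm(2), of "Suc j"] by auto
  obtain Z0 where Z0: "Z0 meromorphic_on {z. 3 - real j < Re z}"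
    "\<And>z. 3 - real j < Re z \<Longrightarrow> has_bochner_integral ?A (?f j q z) (Z0 z)"
    using zeta_integral_holomorphic[OF \<delta> S G Suc.prems, of j] by auto
  \<comment> \<open>With s = z - 3 + j this is \<rho>^s exp(zG) q / s. Its derivative is the
    integrand plus 1/s times two integrands of the same kind with one more power of \<rho>, for G' q
    (with a factor z) and for q'. The boundary term at 0 vanishes because Re s > 0, and the division
    by s accounts for a possible pole at 3 - j.\<close>
  let ?U = "\<lambda>z \<rho>. of_real \<rho> powr (z - 3 + of_nat j) * (exp (z * of_real (G \<rho>)) * of_real (q \<rho>))
       / (z - 3 + of_nat j) :: complex"
  define Z where "Z = (\<lambda>z. ?U z \<delta> - (z * Z1 z + Z2 z) / (z - 3 + of_nat j))"
  have "Z meromorphic_on {z. 3 - real j - real (Suc n) < Re z}"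
  proof -
    have e: "{z. 3 - real j - real (Suc n) < Re z} = {z. 3 - real (Suc j) - real n < Re z}" by auto
    have "(\<lambda>z. of_real \<delta> powr (z - 3 + of_nat j) * (exp (z * of_real (G \<delta>)) * of_real (q \<delta>))) analytic_on UNIV"
      using \<delta> by (intro analytic_intros) auto
    then have h: "(\<lambda>z. of_real \<delta> powr (z - 3 + of_nat j) * (exp (z * of_real (G \<delta>)) * of_real (q \<delta>)))
        meromorphic_on {z. 3 - real (Suc j) - real n < Re z}"
      by (intro analytic_on_imp_meromorphic_on) (rule analytic_on_subset, auto)
    have m: "(\<lambda>z. z - 3 + of_nat j) meromorphic_on {z. 3 - real (Suc j) - real n < Re z}"
      by (intro meromorphic_intros)
    show ?thesis unfolding Z_def e
      by (rule meromorphic_on_diff[OF meromorphic_on_divide[OF h m] meromorphic_on_divide[OF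
            meromorphic_on_add[OF meromorphic_on_mult[OF meromorphic_on_id Z1(1)] Z2(1)] m]])
  qed
  moreover have "has_bochner_integral ?A (?f j q z) (Z z)" if z: "3 - real j < Re z" for z
  proof -
    define s where "s = z - 3 + of_nat j"
    have s: "Re s > 0" "s \<noteq> 0" using z by (auto simp: s_def complex_eq_iff)
    have b: "has_bochner_integral ?A (\<lambda>\<rho>. ?f j q z \<rho> + (z * ?f (Suc j) (\<lambda>x. G' x * q x) z \<rho> + ?f (Suc j) q' z \<rho>) / s)
        (Z0 z + (z * Z1 z + Z2 z) / s)"
      using Z0(2)[of z] Z1(2)[of z] Z2(2)[of z] z
      by (intro has_bochner_integral_add has_bochner_integral_divide has_bochner_integral_mult_right) auto
    have i: "integrable ?A (\<lambda>\<rho>. ?f j q z \<rho> + (z * ?f (Suc j) (\<lambda>x. G' x * q x) z \<rho> + ?f (Suc j) q' z \<rho>) / s)"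
      using b by (simp add: has_bochner_integral_iff)
    have "has_bochner_integral ?A (\<lambda>\<rho>. ?f j q z \<rho> + (z * ?f (Suc j) (\<lambda>x. G' x * q x) z \<rho> + ?f (Suc j) q' z \<rho>) / s)
        (?U z \<delta> - ?U z 0)"
    proof (rule has_bochner_integral_FTC[OF \<delta> _ _ i])
      have "continuous_on {0..\<delta>} G" "continuous_on {0..\<delta>} q"
        using continuous_on_subset[OF smooth_on_imp_continuous_on S(2)] G Suc.prems by auto
      moreover have "continuous_on {0..\<delta>} (\<lambda>\<rho>. complex_of_real \<rho> powr s)"
        by (rule continuous_on_subset[OF continuous_on_of_real_powr[OF s(1)]]) auto
      ultimately show "continuous_on {0..\<delta>} (?U z)"
        unfolding s_def[symmetric]
        by (intro continuous_on_divide continuous_on_mult continuous_on_exp continuous_on_of_real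
            continuous_on_const) (use s(2) in auto)
      fix \<rho> assume r: "\<rho> \<in> {0<..<\<delta>}"
      then have rS: "\<rho> \<in> S" using S by auto
      have dG: "((\<lambda>\<rho>. complex_of_real (G \<rho>)) has_vector_derivative of_real (G' \<rho>)) (at \<rho>)"
        "((\<lambda>\<rho>. complex_of_real (q \<rho>)) has_vector_derivative of_real (q' \<rho>)) (at \<rho>)"
        unfolding G'_def q'_def
        using der[OF G rS] der[OF Suc.prems rS]
        by (simp_all add: has_vector_derivative_of_real has_real_derivative_iff_has_vector_derivative)
      have "((\<lambda>\<rho>. z * complex_of_real (G \<rho>)) has_vector_derivative z * of_real (G' \<rho>)) (at \<rho>)"
        by (rule has_vector_derivative_mult_right[OF dG(1)])
      then have de: "((\<lambda>\<rho>. exp (z * complex_of_real (G \<rho>))) has_vector_derivative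
           z * of_real (G' \<rho>) * exp (z * of_real (G \<rho>))) (at \<rho>)"
        using field_vector_diff_chain_at[OF _ DERIV_exp] by (simp add: o_def)
      have dp: "((\<lambda>\<rho>. complex_of_real \<rho> powr s) has_vector_derivative s * of_real \<rho> powr (s - 1)) (at \<rho>)"
        using has_vector_derivative_of_real_powr r by simp
      have e: "z - 4 + of_nat (Suc j) = s" "z - 4 + of_nat j = s - 1"
        by (simp_all add: s_def)
      then show "(?U z has_vector_derivative ?f j q z \<rho> + (z * ?f (Suc j) (\<lambda>x. G' x * q x) z \<rho> + ?f (Suc j) q' z \<rho>) / s) (at \<rho>)"
        unfolding s_def[symmetric]
        using has_vector_derivative_divide[OF has_vector_derivative_mult[OF dp has_vector_derivative_mult[OF de dG(2)]], of s] s(2)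
        by (simp add: field_simps)
    qed
    from has_bochner_integral_eq[OF b this] have "Z0 z = Z z"
      unfolding Z_def s_def by (simp add: algebra_simps)
    then show ?thesis using Z0(2)[OF z] by simp
  qed
  ultimately show ?case by blast
qed

section \<open>Riemannian volume as the image of a density in a single chart\<close>

subsection \<open>Change of variables between parametrizations\<close>

text \<open>\<open>has_measure_differentiable_image\<close> settles the case of a finite Jacobian
  integral. If the integral is infinite, an image of finite measure would, by the same equivalence,
  make it finite.\<close>

lemma emeasure_differentiable_image:
  fixes T :: "real^'n::{finite,wellorder} \<Rightarrow> real^'n::_"
  assumes A: "A \<in> sets borel" and TA: "T ` A \<in> sets borel"
    and der: "\<And>x. x \<in> A \<Longrightarrow> (T has_derivative T' x) (at x)" and inj: "inj_on T A"
  shows "emeasure lborel (T ` A) = (\<integral>\<^sup>+x. ennreal (indicator A x * \<bar>det (matrix (T' x))\<bar>) \<partial>lborel)"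
proof -
  have AL: "A \<in> sets lebesgue" using A by (simp add: sets_completionI_sets)
  have dw: "(T has_derivative T' x) (at x within A)" if "x \<in> A" for x
    using der[OF that] has_derivative_at_withinI by blast
  let ?J = "\<lambda>x. \<bar>det (matrix (T' x))\<bar>"
  let ?JA = "\<lambda>x. indicator A x * ?J x"
  have "?J \<in> borel_measurable (lebesgue_on A)"
    using borel_measurable_det_Jacobian[OF AL dw] by measurable
  then have m: "?JA \<in> borel_measurable lebesgue"
    using AL by (simp add: borel_measurable_restrict_space_iff)
  have im: "T ` A \<in> lmeasurable \<and> measure lebesgue (T ` A) = r \<longleftrightarrow> (?J has_integral r) A" for r
    by (rule has_measure_differentiable_image[OF AL dw inj])
  have hu: "(?J has_integral r) A \<longleftrightarrow> (?JA has_integral r) UNIV" for r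
  proof -
    have "?JA = (\<lambda>x. if x \<in> A then ?J x else 0)" by auto
    then show ?thesis by (simp only: has_integral_restrict_UNIV)
  qed
  have el: "emeasure lborel (T ` A) = emeasure lebesgue (T ` A)" using TA by simp
  have N: "nn_integral lebesgue ?JA = nn_integral lborel ?JA" by (rule nn_integral_completion)
  show ?thesis
  proof (cases "nn_integral lborel ?JA" rule: ennreal_cases)
    case (real r)
    then have "(?JA has_integral r) UNIV"
      using m N by (subst has_integral_iff_nn_integral_lebesgue) auto
    then have "T ` A \<in> lmeasurable" "measure lebesgue (T ` A) = r" using im hu by blast+
    then have "emeasure lebesgue (T ` A) = ennreal r" by (metis emeasure_eq_measure2)
    then show ?thesis unfolding el real(2) .
  next
    case top
    have "emeasure lebesgue (T ` A) = \<infinity>"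
    proof (rule ccontr)
      assume "emeasure lebesgue (T ` A) \<noteq> \<infinity>"
      then have "T ` A \<in> lmeasurable" using TA by (simp add: fmeasurable_def top.not_eq_extremum sets_completionI_sets)
      then obtain r where "(?JA has_integral r) UNIV" using im hu by blast
      then have "nn_integral lebesgue ?JA = ennreal r"
        by (subst (asm) has_integral_iff_nn_integral_lebesgue) auto
      then show False using top N by simp
    qed
    then show ?thesis using top el by simp
  qed
qed

lemma nn_integral_differentiable_image:
  fixes T :: "real^'n::{finite,wellorder} \<Rightarrow> real^'n::_"
  assumes A: "A \<in> sets borel" and TA: "T ` A \<in> sets borel"
    and der: "\<And>x. x \<in> A \<Longrightarrow> (T has_derivative T' x) (at x)" and inj: "inj_on T A"
    and f: "f \<in> borel_measurable borel"
  shows "(\<integral>\<^sup>+y. f y * indicator (T ` A) y \<partial>lborel)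
    = (\<integral>\<^sup>+x. f (T x) * (ennreal \<bar>det (matrix (T' x))\<bar> * indicator A x) \<partial>lborel)"
proof -
  have AL: "A \<in> sets lebesgue" using A by (simp add: sets_completionI_sets)
  have "(\<lambda>x. \<bar>det (matrix (T' x))\<bar>) \<in> borel_measurable (lebesgue_on A)"
    using borel_measurable_det_Jacobian[OF AL has_derivative_at_withinI[OF der]] by measurable
  then have "(\<lambda>x. indicator A x * \<bar>det (matrix (T' x))\<bar>) \<in> borel_measurable lebesgue"
    using AL by (simp add: borel_measurable_restrict_space_iff)
  \<comment> \<open>The Jacobian is a priori only Lebesgue measurable; J is a Borel function equal
    to it almost everywhere, as a density over \<open>lborel\<close> requires.\<close>
  then obtain J where J: "J \<in> borel_measurable lborel" "AE x in lborel. indicator A x * \<bar>det (matrix (T' x))\<bar> = J x"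
    using completion_ex_borel_measurable_real by blast
  have cont: "continuous_on A T"
    using der by (intro continuous_at_imp_continuous_on ballI) (metis has_derivative_continuous)
  define S where "S = (\<lambda>x. if x \<in> A then T x else 0)"
  have S [measurable]: "S \<in> borel_measurable borel"
    unfolding S_def using borel_measurable_continuous_on_restrict[OF cont] A
    by (intro measurable_If_restrict_space_iff[THEN iffD2]) auto
  have J' [measurable]: "J \<in> borel_measurable borel" using J(1) by simp
  note [measurable] = f A TA
  have "density lborel (indicator (T ` A)) = distr (density lborel (\<lambda>x. ennreal (J x))) borel S" (is "?L = ?R")
  proof (rule measure_eqI)
    show "sets ?L = sets ?R" by simp
    fix B assume "B \<in> sets ?L"
    then have B [measurable]: "B \<in> sets borel" by simp
    let ?A = "A \<inter> S -` B"
    have TB: "T ` ?A = T ` A \<inter> B" by (auto simp: S_def)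
    have mA: "?A \<in> sets borel"
      using measurable_sets[OF S B] A by simp
    have "emeasure ?L B = emeasure lborel (T ` ?A)"
      unfolding TB by (subst emeasure_density) (auto simp: indicator_inter_arith[symmetric] intro!: nn_integral_indicator)
    also have "\<dots> = (\<integral>\<^sup>+x. ennreal (indicator ?A x * \<bar>det (matrix (T' x))\<bar>) \<partial>lborel)"
      by (rule emeasure_differentiable_image[OF mA]) (use TB inj der in \<open>auto intro: inj_on_subset\<close>)
    also have "\<dots> = (\<integral>\<^sup>+x. ennreal (J x) * indicator (S -` B) x \<partial>lborel)"
      by (rule nn_integral_cong_AE, rule AE_mp[OF J(2)], rule AE_I2) (auto simp: indicator_def split: if_splits)
    also have "\<dots> = emeasure ?R B"
      using measurable_sets[OF S B] by (subst emeasure_distr) (auto simp: emeasure_density)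
    finally show "emeasure ?L B = emeasure ?R B" .
  qed
  then have "nn_integral ?L f = nn_integral ?R f" by simp
  also have "nn_integral ?L f = (\<integral>\<^sup>+y. f y * indicator (T ` A) y \<partial>lborel)"
    by (subst nn_integral_density) (auto simp: mult.commute)
  also have "nn_integral ?R f = (\<integral>\<^sup>+x. ennreal (J x) * f (S x) \<partial>lborel)"
    by (subst nn_integral_distr) (auto simp: nn_integral_density)
  also have "\<dots> = (\<integral>\<^sup>+x. f (T x) * (ennreal \<bar>det (matrix (T' x))\<bar> * indicator A x) \<partial>lborel)"
    by (rule nn_integral_cong_AE, rule AE_mp[OF J(2)], rule AE_I2)
      (auto simp: indicator_def S_def mult.commute split: if_splits)
  finally show ?thesis .
qed

text \<open>\<open>\<Psi>\<close> is a parametrization with an explicit differentiable left inverse \<open>\<chi>\<close>.\<close>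

locale chart =
  fixes M :: "'a::euclidean_space set" and U :: "(real^4) set"
    and \<Psi> :: "real^4 \<Rightarrow> 'a" and D\<Psi> :: "real^4 \<Rightarrow> real^4 \<Rightarrow> 'a" and \<sigma> :: "'a \<Rightarrow> real^4"
  assumes M: "M \<in> sets borel" and U: "open U"
    and der: "\<And>u. u \<in> U \<Longrightarrow> (\<Psi> has_derivative D\<Psi> u) (at u)"
    and img: "openin (top_of_set M) (\<Psi> ` U)"
    and inv: "\<And>u. u \<in> U \<Longrightarrow> \<sigma> (\<Psi> u) = u"
    and inv_diff: "\<And>u. u \<in> U \<Longrightarrow> \<sigma> differentiable (at (\<Psi> u))"
begin

lemma cont: "continuous_on U \<Psi>"
  using der has_derivative_continuous by (blast intro: continuous_at_imp_continuous_on)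

text \<open>The transition map from an arbitrary parametrization \<phi> is \<sigma> after \<phi>. It
  is differentiable because \<sigma> is, and its Jacobian is nonzero because the derivative of
  \<phi> factors through it and is injective. Images of Borel sets under \<phi> are Borel since
  \<phi> is a homeomorphism onto a relatively open subset of M.\<close>

lemma transition:
  assumes "local_param M V \<phi>"
  defines "W \<equiv> {x \<in> V. \<phi> x \<in> \<Psi> ` U}"
  shows "open W \<and> inj_on (\<lambda>x. \<sigma> (\<phi> x)) W \<and> (\<exists>T'. \<forall>x\<in>W. ((\<lambda>x. \<sigma> (\<phi> x)) has_derivative T' x) (at x)
      \<and> frechet_derivative \<phi> (at x) = (\<lambda>v. D\<Psi> (\<sigma> (\<phi> x)) (T' x v))
      \<and> det (matrix (T' x)) \<noteq> 0 \<and> \<sigma> (\<phi> x) \<in> U \<and> \<Psi> (\<sigma> (\<phi> x)) = \<phi> x)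
    \<and> (\<forall>A. A \<in> sets borel \<longrightarrow> A \<subseteq> V \<longrightarrow> \<phi> ` A \<in> sets borel
        \<and> (\<lambda>x. \<sigma> (\<phi> x)) ` (A \<inter> W) = {u \<in> U. \<Psi> u \<in> \<phi> ` A}
        \<and> {u \<in> U. \<Psi> u \<in> \<phi> ` A} \<in> sets borel)"
proof -
  obtain \<psi> where V: "open V" and sm: "smooth_on \<phi> V" and injphi: "\<And>u. u \<in> V \<Longrightarrow> inj (frechet_derivative \<phi> (at u))"
    and op: "openin (top_of_set M) (\<phi> ` V)" and hom: "homeomorphism V (\<phi> ` V) \<phi> \<psi>"
    using assms(1) unfolding local_param_def by blast
  have inv': "\<Psi> (\<sigma> (\<phi> x)) = \<phi> x" "\<sigma> (\<phi> x) \<in> U" if "x \<in> W" for x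
    using that inv by (auto simp: W_def)
  have ip: "\<psi> (\<phi> x) = x" if "x \<in> V" for x using hom that by (simp add: homeomorphism_apply1)
  obtain O1 where O1: "open O1" "\<Psi> ` U = M \<inter> O1" using img by (auto simp: openin_open)
  have pV: "\<phi> ` V \<subseteq> M" using op unfolding openin_open by blast
  have "W = V \<inter> \<phi> -` O1" using pV O1(2) by (auto simp: W_def)
  then have oW: "open W"
    using continuous_open_preimage[OF smooth_on_imp_continuous_on[OF sm] V O1(1)] by (simp add: Int_commute)
  define T' where "T' = (\<lambda>x v. frechet_derivative \<sigma> (at (\<phi> x)) (frechet_derivative \<phi> (at x) v))"
  have dT: "((\<lambda>x. \<sigma> (\<phi> x)) has_derivative T' x) (at x)" if "x \<in> W" for x
  proof -
    have "(\<phi> has_derivative frechet_derivative \<phi> (at x)) (at x)"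
      using smooth_on_has_derivative[OF sm] that by (simp add: W_def)
    moreover have "(\<sigma> has_derivative frechet_derivative \<sigma> (at (\<phi> x))) (at (\<phi> x))"
      using inv_diff[OF inv'(2)[OF that]] inv'(1)[OF that] frechet_derivative_works by auto
    ultimately show ?thesis unfolding T'_def by (rule has_derivative_compose)
  qed
  have dphi: "frechet_derivative \<phi> (at x) = (\<lambda>v. D\<Psi> (\<sigma> (\<phi> x)) (T' x v))" if "x \<in> W" for x
  proof -
    have "((\<lambda>x. \<Psi> (\<sigma> (\<phi> x))) has_derivative (\<lambda>v. D\<Psi> (\<sigma> (\<phi> x)) (T' x v))) (at x)"
      by (rule has_derivative_compose[OF dT[OF that] der[OF inv'(2)[OF that]]])
    then have "(\<phi> has_derivative (\<lambda>v. D\<Psi> (\<sigma> (\<phi> x)) (T' x v))) (at x)"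
      by (rule has_derivative_transform_within_open[OF _ oW that]) (use inv' in auto)
    then show ?thesis by (rule frechet_derivative_at[symmetric])
  qed
  have detT: "det (matrix (T' x)) \<noteq> 0" if "x \<in> W" for x
  proof -
    have lin: "linear (T' x)" using dT[OF that] has_derivative_linear by blast
    have "inj (T' x)"
    proof (rule injI)
      fix a b assume "T' x a = T' x b"
      then have "frechet_derivative \<phi> (at x) a = frechet_derivative \<phi> (at x) b" by (simp add: dphi[OF that])
      moreover have "inj (frechet_derivative \<phi> (at x))" using injphi that by (simp add: W_def)
      ultimately show "a = b" by (rule injD[rotated])
    qed
    then show ?thesis using lin det_nz_iff_inj by blast
  qed
  have inj: "inj_on (\<lambda>x. \<sigma> (\<phi> x)) W"
    by (rule inj_onI) (metis (no_types, lifting) W_def inv'(1) ip mem_Collect_eq)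
  have meas: "\<phi> ` A \<in> sets borel" if A: "A \<in> sets borel" "A \<subseteq> V" for A
  proof -
    have pVb: "\<phi> ` V \<in> sets borel" using op M by (auto simp: openin_open)
    have "\<psi> \<in> borel_measurable (restrict_space borel (\<phi> ` V))"
      using hom by (intro borel_measurable_continuous_on_restrict) (simp add: homeomorphism_def)
    from measurable_sets[OF this A(1)] have "\<psi> -` A \<inter> \<phi> ` V \<in> sets (restrict_space borel (\<phi> ` V))"
      by (simp add: space_restrict_space)
    moreover have "\<psi> -` A \<inter> \<phi> ` V = \<phi> ` A" using A(2) ip by force
    ultimately show ?thesis using pVb by (simp add: sets_restrict_space_iff)
  qed
  have pre: "{u \<in> U. \<Psi> u \<in> B} \<in> sets borel" if "B \<in> sets borel" for B
  proof -
    have "\<Psi> \<in> borel_measurable (restrict_space borel U)"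
      by (rule borel_measurable_continuous_on_restrict[OF cont])
    from measurable_sets[OF this that] have "\<Psi> -` B \<inter> U \<in> sets (restrict_space borel U)"
      by (simp add: space_restrict_space)
    moreover have "\<Psi> -` B \<inter> U = {u \<in> U. \<Psi> u \<in> B}" by auto
    ultimately show ?thesis using U by (simp add: sets_restrict_space_iff)
  qed
  have im: "(\<lambda>x. \<sigma> (\<phi> x)) ` (A \<inter> W) = {u \<in> U. \<Psi> u \<in> \<phi> ` A}" if "A \<subseteq> V" for A
  proof (intro equalityI subsetI)
    fix u assume "u \<in> {u \<in> U. \<Psi> u \<in> \<phi> ` A}"
    then obtain x where x: "u \<in> U" "x \<in> A" "\<Psi> u = \<phi> x" by auto
    then have "x \<in> W" "\<sigma> (\<phi> x) = u" using that inv[of u] by (auto simp: W_def intro!: image_eqI[of _ _ u])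
    then show "u \<in> (\<lambda>x. \<sigma> (\<phi> x)) ` (A \<inter> W)" using x by auto
  qed (use inv' in auto)
  show ?thesis
    using oW inj dT dphi detT inv' meas im pre by (intro conjI exI[of _ T'] ballI allI impI) simp_all
qed

end

subsection \<open>The Riemannian volume in a chart with diagonal metric\<close>

definition volume_formula :: "'a::euclidean_space set \<Rightarrow> 'a metric_field \<Rightarrow> 'a measure \<Rightarrow> bool" where
  "volume_formula M g \<mu> \<longleftrightarrow> space \<mu> = M \<and> sets \<mu> = sets (restrict_space borel M) \<and>
     (\<forall>U \<phi> A. local_param M U \<phi> \<and> A \<in> sets borel \<and> A \<subseteq> U \<longrightarrow>
        emeasure \<mu> (\<phi> ` A) = (\<integral>\<^sup>+u\<in>A. ennreal (sqrt (det (gram g \<phi> u))) \<partial>lborel))"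

text \<open>The defining formula fixes the measure of every Borel set inside one chart image. Two
  charts cover M, so any Borel set is cut along the first chart image into two pieces of known
  measure.\<close>

lemma volume_formula_unique:
  assumes "volume_formula M g \<mu>" "volume_formula M g \<nu>" "M \<in> sets borel"
    and U: "\<And>b::bool. local_param M (U b) (\<phi> b)" and cover: "M \<subseteq> (\<Union>b. \<phi> b ` U b)"
  shows "\<mu> = \<nu>"
proof (rule measure_eqI)
  show s: "sets \<mu> = sets \<nu>" using assms by (simp add: volume_formula_def)
  have sb: "A \<in> sets \<mu> \<longleftrightarrow> A \<subseteq> M \<and> A \<in> sets borel" for A
    using assms(1,3) by (simp add: volume_formula_def sets_restrict_space_iff)
  have V: "\<phi> b ` U b \<in> sets borel" for b
    using U[of b] assms(3) by (auto simp: local_param_def openin_open)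
  have eq: "emeasure \<mu> A = emeasure \<nu> A" if A: "A \<in> sets borel" "A \<subseteq> \<phi> b ` U b" for A b
  proof -
    have oU: "open (U b)" and c: "continuous_on (U b) (\<phi> b)"
      using U[of b] by (auto simp: local_param_def smooth_on_imp_continuous_on)
    have "\<phi> b -` A \<inter> U b \<in> sets (restrict_space borel (U b))"
      using measurable_sets[OF borel_measurable_continuous_on_restrict[OF c] A(1)]
      by (simp add: space_restrict_space)
    then have B: "\<phi> b -` A \<inter> U b \<in> sets borel" using oU by (simp add: sets_restrict_space_iff)
    have *: "A = \<phi> b ` (\<phi> b -` A \<inter> U b)" using A(2) by auto
    show ?thesis
      using assms(1,2)[unfolded volume_formula_def, THEN conjunct2, THEN conjunct2, rule_format,
          of "U b" "\<phi> b" "\<phi> b -` A \<inter> U b"] U[of b] B *[symmetric] by simp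
  qed
  fix A assume "A \<in> sets \<mu>"
  then have A: "A \<subseteq> M" "A \<in> sets borel" using sb by auto
  let ?A1 = "A \<inter> \<phi> True ` U True" and ?A2 = "A - \<phi> True ` U True"
  have m: "?A1 \<in> sets borel" "?A2 \<in> sets borel" using A V by auto
  have sub: "?A2 \<subseteq> \<phi> False ` U False"
  proof
    fix p assume p: "p \<in> ?A2"
    then obtain b where "p \<in> \<phi> b ` U b" using cover A by blast
    with p show "p \<in> \<phi> False ` U False" by (cases b) auto
  qed
  have "emeasure \<xi> A = emeasure \<xi> ?A1 + emeasure \<xi> ?A2" if "sets \<xi> = sets \<mu>" for \<xi> :: "'a measure"
    using m A that sb by (subst plus_emeasure) (auto intro: arg_cong[of _ _ "emeasure \<xi>"])
  then show "emeasure \<mu> A = emeasure \<nu> A" using eq[OF m(1), of True] eq[OF m(2) sub] s by auto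
qed

text \<open>The Gram matrix of another parametrization is L^T diag(d) L with L the derivative of the
  transition map, and its determinant is the square of w det L.\<close>

lemma (in chart) gram_diagonal:
  assumes metric: "\<And>u a b. u \<in> U \<Longrightarrow> g (\<Psi> u) (D\<Psi> u a) (D\<Psi> u b) = (\<Sum>k\<in>UNIV. d u k * a $ k * b $ k)"
    and w: "\<And>u. u \<in> U \<Longrightarrow> 0 \<le> w u \<and> (\<Prod>k\<in>UNIV. d u k) = (w u)\<^sup>2"
    and u: "u \<in> U" "\<phi> x = \<Psi> u" and der: "frechet_derivative \<phi> (at x) = (\<lambda>v. D\<Psi> u (L v))"
  shows "sqrt (det (gram g \<phi> x)) = w u * \<bar>det (matrix L)\<bar>"
proof -
  let ?D = "(\<chi> i j. if i = j then d u i else 0) :: real^4^4"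
  have "gram g \<phi> x $ i $ j = (transpose (matrix L) ** (?D ** matrix L)) $ i $ j" for i j
  proof -
    have "gram g \<phi> x $ i $ j = (\<Sum>k\<in>UNIV. d u k * L (axis i 1) $ k * L (axis j 1) $ k)"
      by (simp add: gram_def u(2) der metric[OF u(1)])
    also have "\<dots> = (transpose (matrix L) ** (?D ** matrix L)) $ i $ j"
      by (simp add: matrix_matrix_mult_def transpose_def matrix_def if_distrib if_distribR sum.delta' mult_ac cong: if_cong)
    finally show ?thesis .
  qed
  then have "gram g \<phi> x = transpose (matrix L) ** (?D ** matrix L)" by (simp add: vec_eq_iff)
  then have "det (gram g \<phi> x) = det (matrix L) * (det ?D * det (matrix L))"
    by (simp add: det_mul)
  moreover have "det ?D = (w u)\<^sup>2" using w[OF u(1)] by (subst det_diagonal) auto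
  ultimately have "det (gram g \<phi> x) = (w u * det (matrix L))\<^sup>2" by (simp add: power2_eq_square mult_ac)
  then show ?thesis using w[OF u(1)] by (simp add: abs_mult)
qed

text \<open>The charts \<open>\<phi> b\<close> cover \<open>M\<close>, and see the complement of the image of \<open>\<Psi>\<close> as part of two hyperplanes.\<close>

lemma (in chart) riemannian_volume_eq:
  fixes V :: "bool \<Rightarrow> (real^4) set" and \<phi> :: "bool \<Rightarrow> real^4 \<Rightarrow> 'a"
  assumes metric: "\<And>u a b. u \<in> U \<Longrightarrow> g (\<Psi> u) (D\<Psi> u a) (D\<Psi> u b) = (\<Sum>k\<in>UNIV. d u k * a $ k * b $ k)"
    and w: "\<And>u. u \<in> U \<Longrightarrow> 0 \<le> w u \<and> (\<Prod>k\<in>UNIV. d u k) = (w u)\<^sup>2"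
    and wm: "w \<in> borel_measurable borel"
    and ch: "\<And>b::bool. chart M (V b) (\<phi> b) (\<lambda>u. frechet_derivative (\<phi> b) (at u)) (\<tau> b)"
    and lp: "\<And>b. local_param M (V b) (\<phi> b)" and cover: "M \<subseteq> (\<Union>b. \<phi> b ` V b)"
    and null: "\<And>b (z::real^4). z \<in> V b \<Longrightarrow> \<phi> b z \<notin> \<Psi> ` U \<Longrightarrow> z $ 2 = 0 \<or> z $ 4 = 0"
  shows "riemannian_volume M g =
    distr (density (restrict_space lborel U) (\<lambda>u. ennreal (w u))) (restrict_space borel M) \<Psi>" (is "_ = ?\<mu>")
proof -
  have sU: "U \<in> sets borel" using U by simp
  have \<Psi>M: "\<Psi> ` U \<subseteq> M" using img unfolding openin_open by blast
  have m\<Psi>: "\<Psi> \<in> measurable (restrict_space lborel U) (restrict_space borel M)"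
  proof (rule measurable_restrict_space2)
    show "\<Psi> \<in> space (restrict_space lborel U) \<rightarrow> M" using \<Psi>M by (auto simp: space_restrict_space)
    show "\<Psi> \<in> borel_measurable (restrict_space lborel U)"
      unfolding measurable_cong_sets[OF sets_restrict_space_cong[OF sets_lborel] refl]
      by (rule borel_measurable_continuous_on_restrict[OF cont])
  qed
  have wm' [measurable]: "(\<lambda>u. ennreal (w u)) \<in> borel_measurable (restrict_space lborel U)"
    using wm by (intro measurable_restrict_space1) simp
  note [measurable] = wm sU
  have formula: "emeasure ?\<mu> (\<psi> ` A) = (\<integral>\<^sup>+u\<in>A. ennreal (sqrt (det (gram g \<psi> u))) \<partial>lborel)"
    if lpX: "local_param M X \<psi>" and A: "A \<in> sets borel" "A \<subseteq> X" for X \<psi> A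
  proof -
    define W where "W = {x \<in> X. \<psi> x \<in> \<Psi> ` U}"
    have t: "open W" and inj: "inj_on (\<lambda>x. \<sigma> (\<psi> x)) W"
      and im: "\<And>A. A \<in> sets borel \<Longrightarrow> A \<subseteq> X \<Longrightarrow> \<psi> ` A \<in> sets borel \<and> (\<lambda>x. \<sigma> (\<psi> x)) ` (A \<inter> W) = {u \<in> U. \<Psi> u \<in> \<psi> ` A}
       \<and> {u \<in> U. \<Psi> u \<in> \<psi> ` A} \<in> sets borel"
      using transition[OF lpX] unfolding W_def by simp_all
    obtain T' where T': "\<forall>x\<in>W. ((\<lambda>x. \<sigma> (\<psi> x)) has_derivative T' x) (at x)
      \<and> frechet_derivative \<psi> (at x) = (\<lambda>v. D\<Psi> (\<sigma> (\<psi> x)) (T' x v))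
      \<and> det (matrix (T' x)) \<noteq> 0 \<and> \<sigma> (\<psi> x) \<in> U \<and> \<Psi> (\<sigma> (\<psi> x)) = \<psi> x"
      using transition[OF lpX, THEN conjunct2, THEN conjunct2, THEN conjunct1] unfolding W_def by (elim exE)
    have W: "open W" and dT: "\<And>x. x \<in> W \<Longrightarrow> ((\<lambda>x. \<sigma> (\<psi> x)) has_derivative T' x) (at x)"
      and d\<psi>: "\<And>x. x \<in> W \<Longrightarrow> frechet_derivative \<psi> (at x) = (\<lambda>v. D\<Psi> (\<sigma> (\<psi> x)) (T' x v))"
      and TW: "\<And>x. x \<in> W \<Longrightarrow> \<sigma> (\<psi> x) \<in> U \<and> \<Psi> (\<sigma> (\<psi> x)) = \<psi> x"
      using t T' by simp_all
    let ?T = "\<lambda>x. \<sigma> (\<psi> x)"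
    have AW: "A \<inter> W \<in> sets borel" using A W by auto
    have "\<psi> ` A \<subseteq> M" using lpX A unfolding local_param_def openin_open by blast
    then have "emeasure ?\<mu> (\<psi> ` A) = emeasure (density (restrict_space lborel U) w) (\<Psi> -` (\<psi> ` A) \<inter> U)"
      using im[OF A] M m\<Psi> by (subst emeasure_distr) (auto simp: sets_restrict_space_iff space_restrict_space)
    also have "\<Psi> -` (\<psi> ` A) \<inter> U = {u \<in> U. \<Psi> u \<in> \<psi> ` A}" by auto
    also have "emeasure (density (restrict_space lborel U) w) {u \<in> U. \<Psi> u \<in> \<psi> ` A}
       = (\<integral>\<^sup>+u. ennreal (w u) * indicator {u \<in> U. \<Psi> u \<in> \<psi> ` A} u \<partial>restrict_space lborel U)"
      using im[OF A] by (intro emeasure_density) (auto simp: sets_restrict_space_iff)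
    also have "\<dots> = (\<integral>\<^sup>+u. ennreal (w u) * indicator (?T ` (A \<inter> W)) u \<partial>lborel)"
      using im[OF A] by (subst nn_integral_restrict_space)
        (auto intro!: nn_integral_cong simp: indicator_def)
    also have "\<dots> = (\<integral>\<^sup>+x. ennreal (w (?T x)) * (ennreal \<bar>det (matrix (T' x))\<bar> * indicator (A \<inter> W) x) \<partial>lborel)"
      by (rule nn_integral_differentiable_image[OF AW]) (use im[OF A] dT inj in \<open>auto intro: inj_on_subset\<close>)
    also have "\<dots> = (\<integral>\<^sup>+u\<in>A. ennreal (sqrt (det (gram g \<psi> u))) \<partial>lborel)"
    proof (rule nn_integral_cong_AE)
      have g: "sqrt (det (gram g \<psi> x)) = w (?T x) * \<bar>det (matrix (T' x))\<bar>" if "x \<in> W" for x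
        by (rule gram_diagonal[where d=d, OF metric w _ _ d\<psi>[OF that]]) (use TW[OF that] in auto)
      \<comment> \<open>Points of A whose image lies outside the chart \<Psi> must form a null set.
        Seen through a covering chart they lie in two hyperplanes; the transition map to that chart
        has nonvanishing Jacobian, so the set upstairs is null as well.\<close>
      have "AE x in lborel. x \<in> A \<longrightarrow> x \<in> W"
      proof -
        have "AE x in lborel. x \<in> A \<longrightarrow> \<psi> x \<in> \<phi> b ` V b \<longrightarrow> x \<in> W" for b
        proof -
          interpret c: chart M "V b" "\<phi> b" "\<lambda>u. frechet_derivative (\<phi> b) (at u)" "\<tau> b" by (rule ch)
          define Wb where "Wb = {x \<in> X. \<psi> x \<in> \<phi> b ` V b}"
          have t: "open Wb" and injS: "inj_on (\<lambda>x. \<tau> b (\<psi> x)) Wb"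
            and imS: "\<And>A. A \<in> sets borel \<Longrightarrow> A \<subseteq> X \<Longrightarrow> \<psi> ` A \<in> sets borel \<and> (\<lambda>x. \<tau> b (\<psi> x)) ` (A \<inter> Wb) = {u \<in> V b. \<phi> b u \<in> \<psi> ` A}
             \<and> {u \<in> V b. \<phi> b u \<in> \<psi> ` A} \<in> sets borel"
            using c.transition[OF lpX] unfolding Wb_def by simp_all
          obtain S' where S': "\<forall>x\<in>Wb. ((\<lambda>x. \<tau> b (\<psi> x)) has_derivative S' x) (at x)
            \<and> frechet_derivative \<psi> (at x) = (\<lambda>v. frechet_derivative (\<phi> b) (at (\<tau> b (\<psi> x))) (S' x v))
            \<and> det (matrix (S' x)) \<noteq> 0 \<and> \<tau> b (\<psi> x) \<in> V b \<and> \<phi> b (\<tau> b (\<psi> x)) = \<psi> x"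
            using c.transition[OF lpX, THEN conjunct2, THEN conjunct2, THEN conjunct1] unfolding Wb_def by (elim exE)
          have Wb: "open Wb" and dS: "\<And>x. x \<in> Wb \<Longrightarrow> ((\<lambda>x. \<tau> b (\<psi> x)) has_derivative S' x) (at x)"
            and det: "\<And>x. x \<in> Wb \<Longrightarrow> det (matrix (S' x)) \<noteq> 0"
            and SW: "\<And>x. x \<in> Wb \<Longrightarrow> \<tau> b (\<psi> x) \<in> V b \<and> \<phi> b (\<tau> b (\<psi> x)) = \<psi> x"
            using t S' by simp_all
          let ?S = "\<lambda>x. \<tau> b (\<psi> x)"
          define N where "N = (A \<inter> Wb) - W"
          have N: "N \<in> sets borel" "N \<subseteq> X" using A W Wb by (auto simp: N_def)
          have NW: "N \<inter> Wb = N" by (auto simp: N_def)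
          have SN: "?S ` N \<in> sets borel" using imS[OF N] NW by simp
          have "?S ` N \<subseteq> {z. z $ 2 = 0} \<union> {z. z $ 4 = 0}"
          proof
            fix z assume "z \<in> ?S ` N"
            then obtain x where x: "x \<in> A" "x \<in> Wb" "x \<notin> W" "z = ?S x" by (auto simp: N_def)
            have "\<psi> x \<notin> \<Psi> ` U" using x A by (auto simp: W_def)
            then have "z $ 2 = 0 \<or> z $ 4 = 0"
              using null[of z b] SW[OF x(2)] x(4) by simp
            then show "z \<in> {z. z $ 2 = 0} \<union> {z. z $ 4 = 0}" by auto
          qed
          then have "negligible (?S ` N)"
            by (rule negligible_subset[OF negligible_Un[OF negligible_standard_hyperplane_cart negligible_standard_hyperplane_cart]])
          then have "emeasure lborel (?S ` N) = 0"
            using SN by (simp add: negligible_iff_emeasure0 sets_completionI_sets)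
          \<comment> \<open>The image of N is null, so the Jacobian integrates to 0 over N; being
            nonzero there, it forces N itself to be null.\<close>
          then have "(\<integral>\<^sup>+x. ennreal (indicator N x * \<bar>det (matrix (S' x))\<bar>) \<partial>lborel) = 0"
            using emeasure_differentiable_image[OF N(1) SN, of S'] dS injS
            by (auto simp: N_def intro: inj_on_subset)
          then have 0: "(\<integral>\<^sup>+x. ennreal (indicator N x * \<bar>det (matrix (S' x))\<bar>) \<partial>lebesgue) = 0"
            by (simp only: nn_integral_completion)
          have NL: "N \<in> sets lebesgue" using N by (simp add: sets_completionI_sets)
          have "(\<lambda>x. \<bar>det (matrix (S' x))\<bar>) \<in> borel_measurable (lebesgue_on N)"
            using borel_measurable_det_Jacobian[OF NL has_derivative_at_withinI[OF dS]]
            by (auto simp: N_def)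
          then have "(\<lambda>x. indicator N x * \<bar>det (matrix (S' x))\<bar>) \<in> borel_measurable lebesgue"
            using NL by (simp add: borel_measurable_restrict_space_iff)
          then have "AE x in lebesgue. ennreal (indicator N x * \<bar>det (matrix (S' x))\<bar>) = 0"
            using 0 by (subst (asm) nn_integral_0_iff_AE) auto
          then have "AE x in lebesgue. x \<notin> N"
            by (rule AE_mp) (rule AE_I2, use det in \<open>auto simp: N_def indicator_def split: if_splits\<close>)
          then have "AE x in lborel. x \<notin> N" by (simp add: AE_completion_iff)
          then show ?thesis
            by (rule AE_mp) (rule AE_I2, use A in \<open>auto simp: N_def Wb_def\<close>)
        qed
        from this[of True] this[of False] have "AE x in lborel. \<forall>b. x \<in> A \<longrightarrow> \<psi> x \<in> \<phi> b ` V b \<longrightarrow> x \<in> W"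
          by eventually_elim (metis (full_types))
        then show ?thesis
        proof (rule AE_mp, intro AE_I2 impI)
          fix x assume "\<forall>b. x \<in> A \<longrightarrow> \<psi> x \<in> \<phi> b ` V b \<longrightarrow> x \<in> W" "x \<in> A"
          moreover have "\<psi> x \<in> M" using \<open>\<psi> ` A \<subseteq> M\<close> \<open>x \<in> A\<close> by auto
          ultimately show "x \<in> W" using cover by blast
        qed
      qed
      then show "AE x in lborel. ennreal (w (?T x)) * (ennreal \<bar>det (matrix (T' x))\<bar> * indicator (A \<inter> W) x)
          = ennreal (sqrt (det (gram g \<psi> x))) * indicator A x"
        by (rule AE_mp) (rule AE_I2, use g w TW in \<open>auto simp: indicator_def ennreal_mult\<close>)
    qed
    finally show ?thesis .
  qed
  have vf: "volume_formula M g ?\<mu>"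
    unfolding volume_formula_def using formula by (auto simp: space_restrict_space)
  have "riemannian_volume M g = (THE \<mu>. volume_formula M g \<mu>)"
    unfolding riemannian_volume_def volume_formula_def ..
  also have "\<dots> = ?\<mu>"
  proof (rule the_equality)
    show "\<mu> = ?\<mu>" if "volume_formula M g \<mu>" for \<mu>
      by (rule volume_formula_unique[OF that vf M lp cover])
  qed (rule vf)
  finally show ?thesis .
qed

section \<open>Polar coordinates on S^2 x S^1 and Lebesgue measure as a product\<close>

subsection \<open>Polar coordinates\<close>

lemma has_derivative_vecI:
  fixes f :: "'a::real_normed_vector \<Rightarrow> real^'n"
  assumes "\<And>i. ((\<lambda>x. f x $ i) has_derivative (\<lambda>v. f' v $ i)) (at a within S)"
  shows "(f has_derivative f') (at a within S)"
  by (subst has_derivative_componentwise_within) (use assms in \<open>auto simp: Basis_vec_def inner_axis\<close>)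

type_synonym coords = "real \<times> real \<times> real"

definition coords_box :: "coords set" where
  "coords_box = {-1<..<1} \<times> {-pi<..<pi} \<times> {-pi<..<pi}"

text \<open>Height and longitude on the sphere (by Archimedes the area form is \<open>ds d\<phi>\<close>), angle on the circle.\<close>

definition polar :: "coords \<Rightarrow> R32" where
  "polar = (\<lambda>(s, \<phi>, \<theta>). (vector [sqrt (1 - s\<^sup>2) * cos \<phi>, sqrt (1 - s\<^sup>2) * sin \<phi>, s], vector [cos \<theta>, sin \<theta>]))"

definition polar_deriv :: "coords \<Rightarrow> coords \<Rightarrow> R32" where
  "polar_deriv = (\<lambda>(s, \<phi>, \<theta>) (ds, d\<phi>, d\<theta>).
     (vector [- s / sqrt (1 - s\<^sup>2) * cos \<phi> * ds - sqrt (1 - s\<^sup>2) * sin \<phi> * d\<phi>,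
        - s / sqrt (1 - s\<^sup>2) * sin \<phi> * ds + sqrt (1 - s\<^sup>2) * cos \<phi> * d\<phi>, ds],
      vector [- sin \<theta> * d\<theta>, cos \<theta> * d\<theta>]))"

definition bdry :: "R32 set" where "bdry = sphere 0 1 \<times> sphere 0 1"

definition tangent_bdry :: "R32 \<Rightarrow> R32 \<Rightarrow> bool" where
  "tangent_bdry y v \<longleftrightarrow> fst y \<bullet> fst v = 0 \<and> snd y \<bullet> snd v = 0"

text \<open>P d\<tau>^2 plus the round metric: the metric on a slice of constant \<rho>, rescaled by
  \<rho>^2, when P is the value of the lapse. It is written in ambient coordinates and meant for
  vectors satisfying \<open>tangent_bdry\<close>.\<close>

definition bdry_metric :: "real \<Rightarrow> real \<Rightarrow> R32 metric_field" where
  "bdry_metric \<beta> P y v v' = P * (dtau \<beta> (snd y) (snd v) * dtau \<beta> (snd y) (snd v')) + fst v \<bullet> fst v'"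

lemma inner3: "x \<bullet> y = x $ 1 * y $ 1 + x $ 2 * y $ 2 + x $ 3 * y $ 3" for x y :: "real^3"
  by (simp add: inner_vec_def sum_3)

lemma inner2: "x \<bullet> y = x $ 1 * y $ 1 + x $ 2 * y $ 2" for x y :: "real^2"
  by (simp add: inner_vec_def sum_2)

lemma sin_times_sin: "sin x * sin x = 1 - cos x * cos x" for x :: real
  using sin_squared_eq[of x] by (simp add: power2_eq_square)

lemma prod_4: "prod f (UNIV :: 4 set) = f 1 * f 2 * f 3 * f 4"
  unfolding UNIV_4 by (simp add: ac_simps)

lemma norm_1_iff: "norm x = 1 \<longleftrightarrow> x \<bullet> x = 1"
  by (simp add: norm_eq_sqrt_inner)

lemma coords_box_sq: "(s, \<phi>, \<theta>) \<in> coords_box \<Longrightarrow> s\<^sup>2 < 1"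
  by (auto simp: coords_box_def abs_square_less_1)

lemma polar_mem_bdry: "\<eta> \<in> coords_box \<Longrightarrow> polar \<eta> \<in> bdry"
  using coords_box_sq[of "fst \<eta>" "fst (snd \<eta>)" "snd (snd \<eta>)"]
  by (cases \<eta>) (auto simp: polar_def bdry_def norm_1_iff inner3 inner2 power2_eq_square[symmetric]
      power_mult_distrib cos_squared_eq algebra_simps)

lemma polar_has_derivative:
  assumes "\<eta> \<in> coords_box"
  shows "(polar has_derivative polar_deriv \<eta>) (at \<eta>)"
proof -
  obtain s \<phi> \<theta> where \<eta>: "\<eta> = (s, \<phi>, \<theta>)" by (cases \<eta>)
  have s: "0 < 1 - s\<^sup>2" using coords_box_sq assms \<eta> by auto
  have q: "((\<lambda>x::coords. sqrt (1 - (fst x)\<^sup>2)) has_derivative (\<lambda>v. - s / sqrt (1 - s\<^sup>2) * fst v)) (at \<eta>)"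
    using s by (auto intro!: derivative_eq_intros ext simp: \<eta> field_simps)
  have f: "((\<lambda>x::coords. fst (snd x)) has_derivative (\<lambda>v. fst (snd v))) (at \<eta>)"
    "((\<lambda>x::coords. snd (snd x)) has_derivative (\<lambda>v. snd (snd v))) (at \<eta>)"
    by (intro has_derivative_fst has_derivative_snd has_derivative_ident)+
  have c: "((\<lambda>x::coords. cos (fst (snd x))) has_derivative (\<lambda>v. - sin \<phi> * fst (snd v))) (at \<eta>)"
    "((\<lambda>x::coords. sin (fst (snd x))) has_derivative (\<lambda>v. cos \<phi> * fst (snd v))) (at \<eta>)"
    "((\<lambda>x::coords. cos (snd (snd x))) has_derivative (\<lambda>v. - sin \<theta> * snd (snd v))) (at \<eta>)"
    "((\<lambda>x::coords. sin (snd (snd x))) has_derivative (\<lambda>v. cos \<theta> * snd (snd v))) (at \<eta>)"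
    using has_derivative_cos[OF f(1)] has_derivative_sin[OF f(1)] has_derivative_cos[OF f(2)] has_derivative_sin[OF f(2)]
    by (simp_all add: \<eta> mult.commute)
  have "((\<lambda>x. fst (polar x)) has_derivative (\<lambda>v. fst (polar_deriv \<eta> v))) (at \<eta>)"
  proof (rule has_derivative_vecI)
    fix i :: 3
    show "((\<lambda>x. fst (polar x) $ i) has_derivative (\<lambda>v. fst (polar_deriv \<eta> v) $ i)) (at \<eta>)"
      using exhaust_3[of i] has_derivative_mult[OF q c(1)] has_derivative_mult[OF q c(2)]
        has_derivative_fst[OF has_derivative_ident, of "at \<eta>"]
      by (elim disjE; simp add: polar_def polar_deriv_def case_prod_unfold)
        (simp add: \<eta> algebra_simps; erule has_derivative_eq_rhs; simp add: fun_eq_iff algebra_simps)+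
  qed
  moreover have "((\<lambda>x. snd (polar x)) has_derivative (\<lambda>v. snd (polar_deriv \<eta> v))) (at \<eta>)"
  proof (rule has_derivative_vecI)
    fix i :: 2
    show "((\<lambda>x. snd (polar x) $ i) has_derivative (\<lambda>v. snd (polar_deriv \<eta> v) $ i)) (at \<eta>)"
      using exhaust_2[of i] c(3,4)
      by (elim disjE; simp add: polar_def polar_deriv_def case_prod_unfold) (simp_all add: \<eta>)
  qed
  ultimately have "((\<lambda>x. (fst (polar x), snd (polar x))) has_derivative
      (\<lambda>v. (fst (polar_deriv \<eta> v), snd (polar_deriv \<eta> v)))) (at \<eta>)"
    by (rule has_derivative_Pair)
  then show ?thesis by simp
qed

lemma polar_deriv_tangent:
  assumes "\<eta> \<in> coords_box"
  shows "tangent_bdry (polar \<eta>) (polar_deriv \<eta> v)"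
proof -
  obtain s \<phi> \<theta> where \<eta>: "\<eta> = (s, \<phi>, \<theta>)" by (cases \<eta>)
  obtain a b c where v: "v = (a, b, c)" by (cases v)
  define q where "q = sqrt (1 - s\<^sup>2)"
  have q: "q > 0" using coords_box_sq assms \<eta> by (auto simp: q_def)
  have "fst (polar \<eta>) \<bullet> fst (polar_deriv \<eta> v) = 0"
  proof -
    have "fst (polar \<eta>) = vector [q * cos \<phi>, q * sin \<phi>, s]" by (simp add: \<eta> polar_def q_def)
    moreover have "fst (polar_deriv \<eta> v) = vector [- s / q * cos \<phi> * a - q * sin \<phi> * b,
        - s / q * sin \<phi> * a + q * cos \<phi> * b, a]"
      by (simp add: \<eta> v polar_deriv_def q_def)
    ultimately show ?thesis using q by (simp add: inner3 field_simps sin_times_sin)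
  qed
  then show ?thesis
    by (simp add: tangent_bdry_def \<eta> v polar_def polar_deriv_def inner2)
qed

text \<open>The coordinates are orthogonal. The two sphere entries multiply to 1, so the determinant
  is P (\<beta>/2\<pi>)^2 and no angular weight appears in the volume.\<close>

lemma bdry_metric_polar:
  assumes "(s, \<phi>, \<theta>) \<in> coords_box"
  shows "bdry_metric \<beta> P (polar (s, \<phi>, \<theta>)) (polar_deriv (s, \<phi>, \<theta>) (a, b, c)) (polar_deriv (s, \<phi>, \<theta>) (a', b', c'))
    = a * a' / (1 - s\<^sup>2) + (1 - s\<^sup>2) * b * b' + P * (\<beta> / (2 * pi))\<^sup>2 * c * c'"
proof -
  define q where "q = sqrt (1 - s\<^sup>2)"
  have q: "q > 0" "q\<^sup>2 = 1 - s\<^sup>2" using coords_box_sq[OF assms] by (auto simp: q_def)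
  have d: "dtau \<beta> (vector [cos \<theta>, sin \<theta>]) (vector [- sin \<theta> * c, cos \<theta> * c]) = \<beta> / (2 * pi) * c" for c
  proof -
    have "norm (vector [cos \<theta>, sin \<theta>] :: real^2) = 1" by (simp add: norm_1_iff inner2 power2_eq_square[symmetric])
    moreover have "cos \<theta> * (cos \<theta> * c) - sin \<theta> * (- sin \<theta> * c) = c"
      by (simp add: algebra_simps sin_times_sin)
    ultimately show ?thesis by (simp only: dtau_def vector_2) simp
  qed
  have pd: "fst (polar_deriv (s, \<phi>, \<theta>) (a, b, c)) = vector [- (s / q) * cos \<phi> * a - q * sin \<phi> * b,
     - (s / q) * sin \<phi> * a + q * cos \<phi> * b, a]" for a b c
    by (simp add: polar_deriv_def q_def)
  define p where "p = s / q"
  have "fst (polar_deriv (s, \<phi>, \<theta>) (a, b, c)) \<bullet> fst (polar_deriv (s, \<phi>, \<theta>) (a', b', c'))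
    = p * p * a * a' + q * q * b * b' + a * a'"
    unfolding pd p_def[symmetric] by (simp add: inner3 algebra_simps sin_times_sin)
  also have "\<dots> = (1 + s\<^sup>2 / q\<^sup>2) * a * a' + q\<^sup>2 * b * b'"
    by (simp add: algebra_simps power2_eq_square p_def)
  also have "1 + s\<^sup>2 / q\<^sup>2 = 1 / q\<^sup>2" using q by (simp add: field_simps)
  finally have "fst (polar_deriv (s, \<phi>, \<theta>) (a, b, c)) \<bullet> fst (polar_deriv (s, \<phi>, \<theta>) (a', b', c'))
      = a * a' / (1 - s\<^sup>2) + (1 - s\<^sup>2) * b * b'" using q(2) by simp
  moreover have "snd (polar (s, \<phi>, \<theta>)) = vector [cos \<theta>, sin \<theta>]"
    "snd (polar_deriv (s, \<phi>, \<theta>) (a, b, c)) = vector [- sin \<theta> * c, cos \<theta> * c]" for a b c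
    by (simp_all add: polar_def polar_deriv_def)
  ultimately show ?thesis
    unfolding bdry_metric_def by (simp only: d) (simp add: power2_eq_square)
qed


subsection \<open>Lebesgue measure in the coordinates\<close>

definition coords_vec :: "real \<times> coords \<Rightarrow> real^4" where
  "coords_vec = (\<lambda>(\<rho>, s, \<phi>, \<theta>). vector [\<rho>, s, \<phi>, \<theta>])"

lemma vector_4 [simp]:
  "(vector [a, b, c, d] :: 'a::zero^4) $ 1 = a" "(vector [a, b, c, d] :: 'a::zero^4) $ 2 = b"
  "(vector [a, b, c, d] :: 'a::zero^4) $ 3 = c" "(vector [a, b, c, d] :: 'a::zero^4) $ 4 = d"
  unfolding vector_def by simp_all

lemma continuous_on_coords_vec: "continuous_on UNIV coords_vec"
proof -
  have eq: "coords_vec = (\<lambda>x. fst x *\<^sub>R axis 1 1 + fst (snd x) *\<^sub>R axis 2 1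
      + fst (snd (snd x)) *\<^sub>R axis 3 1 + snd (snd (snd x)) *\<^sub>R axis 4 1)"
    by (rule ext) (simp add: coords_vec_def case_prod_unfold vec_eq_iff forall_4 axis_def)
  show ?thesis by (subst eq) (intro continuous_intros)
qed

lemma emeasure_lborel_Times:
  fixes A :: "'a::euclidean_space set" and B :: "'b::euclidean_space set"
  assumes "A \<in> sets borel" "B \<in> sets borel"
  shows "emeasure lborel (A \<times> B) = emeasure lborel A * emeasure lborel B"
  using lborel.emeasure_pair_measure_Times[of A lborel B] assms by (simp add: lborel_prod)

lemma lborel_coords_vec: "(lborel :: (real^4) measure) = distr lborel borel coords_vec"
proof (rule lborel_eqI)
  have m: "coords_vec \<in> borel_measurable lborel"
    using borel_measurable_continuous_onI[OF continuous_on_coords_vec] by simp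
  fix l u :: "real^4" assume lu: "\<And>b. b \<in> Basis \<Longrightarrow> l \<bullet> b \<le> u \<bullet> b"
  have le: "l $ i \<le> u $ i" for i using lu[of "axis i 1"] by (simp add: inner_axis axis_in_Basis_iff)
  have pre: "coords_vec -` box l u = {l$1<..<u$1} \<times> {l$2<..<u$2} \<times> {l$3<..<u$3} \<times> {l$4<..<u$4}"
    by (auto simp: coords_vec_def mem_box_cart forall_4)
  have "emeasure (distr lborel borel coords_vec) (box l u) = emeasure lborel (coords_vec -` box l u)"
    using m by (subst emeasure_distr) auto
  also have "\<dots> = ennreal (u$1 - l$1) * (ennreal (u$2 - l$2) * (ennreal (u$3 - l$3) * ennreal (u$4 - l$4)))"
    unfolding pre by (simp add: emeasure_lborel_Times open_Times le)
  also have "\<dots> = ennreal ((u$1 - l$1) * (u$2 - l$2) * (u$3 - l$3) * (u$4 - l$4))"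
    using le by (simp add: ennreal_mult[symmetric] mult.assoc)
  also have "(u$1 - l$1) * (u$2 - l$2) * (u$3 - l$3) * (u$4 - l$4) = (\<Prod>b\<in>Basis. (u - l) \<bullet> b)"
  proof -
    have "(\<Prod>b\<in>Basis. (u - l) \<bullet> b) = (\<Prod>i\<in>UNIV. (u - l) \<bullet> axis i 1)"
      by (rule prod.reindex_bij_betw[symmetric])
        (auto simp: bij_betw_def Basis_vec_def inj_on_def axis_eq_axis)
    then show ?thesis by (simp add: inner_axis prod_4)
  qed
  finally show "emeasure (distr lborel borel coords_vec) (box l u) = ennreal (\<Prod>b\<in>Basis. (u - l) \<bullet> b)" .
qed simp

lemma pair_restrict_space:
  assumes S: "S \<in> sets A" and T: "T \<in> sets N" and A: "sigma_finite_measure A" and N: "sigma_finite_measure N"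
  shows "restrict_space A S \<Otimes>\<^sub>M restrict_space N T = restrict_space (A \<Otimes>\<^sub>M N) (S \<times> T)" (is "?L = ?R")
proof -
  interpret N: sigma_finite_measure N by fact
  have ST: "S \<times> T \<in> sets (A \<Otimes>\<^sub>M N)" using S T by auto
  have sp: "S \<subseteq> space A" "T \<subseteq> space N" by (rule sets.sets_into_space[OF S], rule sets.sets_into_space[OF T])
  have spL: "space ?L = S \<times> T" "space ?R = S \<times> T"
    using sp by (auto simp: space_pair_measure space_restrict_space)
  have se: "sets ?L = sets ?R"
  proof (intro equalityI subsetI)
    let ?G = "{a \<times> b |a b. a \<in> sets (restrict_space A S) \<and> b \<in> sets (restrict_space N T)}"
    have "?G \<subseteq> sets ?R" using S T ST by (auto simp: sets_restrict_space_iff)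
    from sets.sigma_sets_subset[OF this] have "sigma_sets (S \<times> T) ?G \<subseteq> sets ?R" by (simp only: spL)
    moreover have "sets ?L = sigma_sets (S \<times> T) ?G"
      using spL(1) by (simp only: sets_pair_measure space_pair_measure)
    ultimately have "sets ?L \<subseteq> sets ?R" by (simp only:)
    then show "X \<in> sets ?R" if "X \<in> sets ?L" for X using that by blast
  next
    fix X assume "X \<in> sets ?R"
    then have X: "X \<in> sets (A \<Otimes>\<^sub>M N)" "X \<subseteq> S \<times> T" using ST by (auto simp: sets_restrict_space_iff)
    have "(\<lambda>x. (fst x, snd x)) \<in> measurable ?L (A \<Otimes>\<^sub>M N)"
      using measurable_compose[OF measurable_fst measurable_restrict_space1[OF measurable_ident]]
        measurable_compose[OF measurable_snd measurable_restrict_space1[OF measurable_ident]]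
      by (intro measurable_Pair) simp_all
    from measurable_sets[OF this X(1)] have "X \<inter> space ?L \<in> sets ?L" by (simp add: vimage_def Int_commute)
    then show "X \<in> sets ?L" using X(2) spL(1) by (simp add: Int_absorb2)
  qed
  show ?thesis
  proof (rule pair_measure_eqI[OF _ _ se])
    show "sigma_finite_measure (restrict_space A S)" "sigma_finite_measure (restrict_space N T)"
      using A N S T by (simp_all add: sigma_finite_measure_restrict_space)
    fix X Y assume XY: "X \<in> sets (restrict_space A S)" "Y \<in> sets (restrict_space N T)"
    then have XY': "X \<in> sets A" "X \<subseteq> S" "Y \<in> sets N" "Y \<subseteq> T" using S T by (auto simp: sets_restrict_space_iff)
    have "emeasure (restrict_space A S) X = emeasure A X" "emeasure (restrict_space N T) Y = emeasure N Y"
      using S T XY' by (auto intro!: emeasure_restrict_space)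
    moreover have "emeasure ?R (X \<times> Y) = emeasure (A \<Otimes>\<^sub>M N) (X \<times> Y)"
      by (rule emeasure_restrict_space) (use ST XY' in auto)
    ultimately show "emeasure (restrict_space A S) X * emeasure (restrict_space N T) Y = emeasure ?R (X \<times> Y)"
      using N.emeasure_pair_measure_Times[OF XY'(1,3)] by simp
  qed
qed

lemma restrict_space_coords_vec:
  fixes I :: "real set"
  assumes I: "open I"
  defines "U \<equiv> {u::real^4. u $ 1 \<in> I \<and> (u $ 2, u $ 3, u $ 4) \<in> coords_box}"
  shows restrict_space_coords_vec_eq: "restrict_space lborel U =
      distr (restrict_space lborel I \<Otimes>\<^sub>M restrict_space lborel coords_box) (restrict_space lborel U) coords_vec" (is "?U = distr ?R ?U _")
    and coords_vec_measurable: "coords_vec \<in> measurable (restrict_space lborel I \<Otimes>\<^sub>M restrict_space lborel coords_box) (restrict_space lborel U)"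
proof -
  have Q: "open coords_box" unfolding coords_box_def by (intro open_Times) auto
  have pre: "coords_vec -` U = I \<times> coords_box" by (auto simp: U_def coords_vec_def)
  have sU: "U \<in> sets lborel"
  proof -
    have "open ((\<lambda>u::real^4. (u $ 1, u $ 2, u $ 3, u $ 4)) -` (I \<times> coords_box))"
      by (rule open_vimage) (use I Q in \<open>auto intro!: open_Times continuous_intros\<close>)
    moreover have "(\<lambda>u::real^4. (u $ 1, u $ 2, u $ 3, u $ 4)) -` (I \<times> coords_box) = U" by (auto simp: U_def)
    ultimately show ?thesis by simp
  qed
  have R: "?R = restrict_space lborel (I \<times> coords_box)"
    using pair_restrict_space[of I lborel coords_box lborel] I Q by (simp add: lborel_prod lborel.sigma_finite_measure_axioms)
  have IQ: "I \<times> coords_box \<in> sets borel" using I Q by (simp add: open_Times)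
  have bm: "coords_vec \<in> borel_measurable borel"
    by (rule borel_measurable_continuous_onI[OF continuous_on_coords_vec])
  show m: "coords_vec \<in> measurable ?R ?U"
    unfolding R using pre bm
    by (intro measurable_restrict_space2 measurable_restrict_space1) (auto simp: space_restrict_space)
  show "?U = distr ?R ?U coords_vec"
  proof (rule measure_eqI)
    fix X assume "X \<in> sets ?U"
    then have X: "X \<in> sets borel" "X \<subseteq> U" using sU by (auto simp: sets_restrict_space_iff)
    have pX: "coords_vec -` X \<subseteq> I \<times> coords_box" using X(2) pre by blast
    have "emeasure ?U X = emeasure (distr lborel borel coords_vec) X"
      using X sU lborel_coords_vec by (simp add: emeasure_restrict_space)
    also have "\<dots> = emeasure lborel (coords_vec -` X)"
      using X bm by (subst emeasure_distr) auto
    also have "\<dots> = emeasure ?R (coords_vec -` X \<inter> space ?R)"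
      unfolding R using pX IQ by (subst emeasure_restrict_space) (auto simp: space_restrict_space Int_absorb2)
    also have "\<dots> = emeasure (distr ?R ?U coords_vec) X"
      using m \<open>X \<in> sets ?U\<close> by (subst emeasure_distr) auto
    finally show "emeasure ?U X = emeasure (distr ?R ?U coords_vec) X" .
  qed simp
qed

section \<open>The abstract end: \<rho>, boundary directions, and the polar chart of M\<close>

subsection \<open>The end of the two model metrics\<close>

text \<open>The polar angle of (a, b) in (-\<pi>, \<pi>]; going through \<open>Ln\<close> makes it
  differentiable off the slit along the nonpositive reals.\<close>

definition angle :: "real \<Rightarrow> real \<Rightarrow> real" where
  "angle a b = Im (Ln (Complex a b))"

lemma angle_polar:
  assumes "0 < r" "-pi < t" "t < pi"
  shows "Complex (r * cos t) (r * sin t) \<notin> \<real>\<^sub>\<le>\<^sub>0 \<and> angle (r * cos t) (r * sin t) = t"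
proof -
  have z: "Complex (r * cos t) (r * sin t) = exp (Complex (ln r) t)"
    using assms(1) by (simp add: complex_eq_iff Re_exp Im_exp)
  have a: "angle (r * cos t) (r * sin t) = t"
    unfolding angle_def z using assms by simp
  moreover have "Complex (r * cos t) (r * sin t) \<notin> \<real>\<^sub>\<le>\<^sub>0"
  proof
    assume n: "Complex (r * cos t) (r * sin t) \<in> \<real>\<^sub>\<le>\<^sub>0"
    have nz: "Complex (r * cos t) (r * sin t) \<noteq> 0" unfolding z by simp
    have "r * cos t \<le> 0" "r * sin t = 0" using n by (simp_all add: complex_nonpos_Reals_iff)
    moreover have "r * cos t \<noteq> 0" using nz calculation(2) by (auto simp: complex_eq_iff)
    ultimately have "r * cos t < 0 \<and> r * sin t = 0" by linarith
    then have "angle (r * cos t) (r * sin t) = pi"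
      unfolding angle_def by (intro Im_Ln_eq_pi[OF nz, THEN iffD2]) simp
    then show False using a assms by simp
  qed
  ultimately show ?thesis by simp
qed

lemma polar_angle:
  assumes "Complex a b \<notin> \<real>\<^sub>\<le>\<^sub>0"
  shows "-pi < angle a b" "angle a b < pi"
    "a = sqrt (a\<^sup>2 + b\<^sup>2) * cos (angle a b)" "b = sqrt (a\<^sup>2 + b\<^sup>2) * sin (angle a b)" "0 < a\<^sup>2 + b\<^sup>2"
proof -
  have z: "Complex a b \<noteq> 0" using assms by auto
  then show pos: "0 < a\<^sup>2 + b\<^sup>2" by (auto simp: complex_eq_iff sum_power2_gt_zero_iff)
  show "-pi < angle a b" using mpi_less_Im_Ln[OF z] by (simp add: angle_def)
  have "angle a b \<noteq> pi"
    using Im_Ln_eq_pi[OF z] assms by (auto simp: angle_def complex_nonpos_Reals_iff)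
  then show "angle a b < pi" using Im_Ln_le_pi[OF z] by (simp add: angle_def)
  have e: "exp (Ln (Complex a b)) = Complex a b" using z by simp
  have n: "exp (Re (Ln (Complex a b))) = sqrt (a\<^sup>2 + b\<^sup>2)"
    using z pos by (simp add: Re_Ln cmod_def)
  show "a = sqrt (a\<^sup>2 + b\<^sup>2) * cos (angle a b)" "b = sqrt (a\<^sup>2 + b\<^sup>2) * sin (angle a b)"
    using arg_cong[OF e, of Re] arg_cong[OF e, of Im] by (simp_all add: Re_exp Im_exp n angle_def)
qed

lemma angle_differentiable:
  fixes f g :: "'a::real_normed_vector \<Rightarrow> real"
  assumes "f differentiable (at p)" "g differentiable (at p)" "Complex (f p) (g p) \<notin> \<real>\<^sub>\<le>\<^sub>0"
  shows "(\<lambda>p. angle (f p) (g p)) differentiable (at p)"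
proof -
  obtain f' g' where fg: "(f has_derivative f') (at p)" "(g has_derivative g') (at p)"
    using assms(1,2) by (auto simp: differentiable_def)
  have "((\<lambda>p. of_real (f p) + \<i> * of_real (g p)) has_derivative (\<lambda>v. of_real (f' v) + \<i> * of_real (g' v))) (at p)"
    by (intro has_derivative_add has_derivative_mult_right has_derivative_of_real fg)
  then have 1: "((\<lambda>p. Complex (f p) (g p)) has_derivative (\<lambda>v. of_real (f' v) + \<i> * of_real (g' v))) (at p)"
    by (simp add: Complex_eq)
  have 2: "(Ln has_derivative (*) (inverse (Complex (f p) (g p)))) (at (Complex (f p) (g p)))"
    using has_field_derivative_Ln[OF assms(3)] by (simp add: has_field_derivative_def)
  show ?thesis
    unfolding angle_def
    using bounded_linear.has_derivative[OF bounded_linear_Im has_derivative_compose[OF 1 2]]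
    by (rule differentiableI)
qed

lemma differentiable_vecI:
  fixes f :: "'a::real_normed_vector \<Rightarrow> real^'n"
  assumes "\<And>i. (\<lambda>x. f x $ i) differentiable (at p)"
  shows "f differentiable (at p)"
proof -
  have "(\<lambda>x. f x $ i) differentiable (at p)" for i using assms .
  then have "\<exists>D. \<forall>i. ((\<lambda>x. f x $ i) has_derivative D i) (at p)"
    unfolding differentiable_def by metis
  then obtain D where "\<And>i. ((\<lambda>x. f x $ i) has_derivative D i) (at p)" by blast
  then have "(f has_derivative (\<lambda>v. \<chi> i. D i v)) (at p)"
    by (intro has_derivative_vecI) simp
  then show ?thesis by (rule differentiableI)
qed

text \<open>The angular part of a point in both factors; together with the radial function
  \<open>R\<close> of the locale below it inverts \<open>emb\<close>.\<close>

definition directions :: "R32 \<Rightarrow> R32" where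
  "directions p = (sgn (fst p), sgn (snd p))"

text \<open>Excludes the horizon w = 0 of the black hole as well as the axis u = 0 of thermal space,
  so that one set serves both manifolds.\<close>

definition off_core :: "R32 set" where
  "off_core = {p. fst p \<noteq> 0 \<and> snd p \<noteq> 0}"

lemma open_off_core: "open off_core"
proof -
  have "off_core = (- {0}) \<times> (- {0})" by (auto simp: off_core_def)
  moreover have "open ((- {0 :: real^3}) \<times> (- {0 :: real^2}))" by (intro open_Times) auto
  ultimately show ?thesis by metis
qed

lemma smooth_on_directions: "smooth_on directions off_core"
proof -
  have id: "smooth_on (\<lambda>p::R32. p) off_core" by (rule smooth_on_id[OF open_off_core])
  show ?thesis
    unfolding directions_def
    by (intro smooth_on_Pair smooth_on_sgn open_off_core smooth_on_fst smooth_on_snd id)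
      (auto simp: off_core_def)
qed

lemma directions_mem_bdry: "p \<in> off_core \<Longrightarrow> directions p \<in> bdry"
  by (simp add: directions_def bdry_def off_core_def norm_sgn)

lemma directions_bdry: "y \<in> bdry \<Longrightarrow> directions y = y"
  by (cases y) (simp add: directions_def bdry_def sgn_div_norm)

lemma bdry_subset_off_core: "bdry \<subseteq> off_core"
  by (auto simp: bdry_def off_core_def)

lemma compact_bdry: "compact bdry"
  unfolding bdry_def by (intro compact_Times compact_sphere)

text \<open>\<open>emb\<close> maps \<open>I \<times> (S\<^sup>2 \<times> S\<^sup>1)\<close> onto the manifold without its core, \<open>\<rho> = 0\<close> to the boundary;
  \<open>c\<close> is the volume integral of the missing part of the interval \<open>\<rho> > 0\<close>.\<close>

locale ah_end =
  fixes M :: "R32 set" and g :: "R32 metric_field" and \<beta> m c \<delta>0 :: real and I J :: "real set"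
    and al ga :: "real \<Rightarrow> real" and R :: "R32 \<Rightarrow> real"
    and V :: "bool \<Rightarrow> (real^4) set" and \<phi> :: "bool \<Rightarrow> real^4 \<Rightarrow> R32" and \<tau> :: "bool \<Rightarrow> R32 \<Rightarrow> real^4"
  fixes emb demb
  defines "emb \<equiv> \<lambda>\<rho> y. (al \<rho> *\<^sub>R fst y, ga \<rho> *\<^sub>R snd y) :: R32"
    and "demb \<equiv> \<lambda>\<rho> y s v. ((s * frechet_derivative al (at \<rho>) 1) *\<^sub>R fst y + al \<rho> *\<^sub>R fst v,
         (s * frechet_derivative ga (at \<rho>) 1) *\<^sub>R snd y + ga \<rho> *\<^sub>R snd v) :: R32"
  assumes \<beta>: "0 < \<beta>" and I: "open I" "I \<subseteq> {0<..}" and \<delta>0: "0 < \<delta>0" "{0<..\<delta>0} \<subseteq> I"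
    \<comment> \<open>J extends I across the boundary value 0, so that smoothness up to the boundary
      becomes smoothness on an open set.\<close>
    and J: "open J" "insert 0 I \<subseteq> J"
    and lapse_pos: "\<And>\<rho>. \<rho> \<in> I \<Longrightarrow> 0 < lapse m \<rho>"
    and volume: "\<And>\<delta>. 0 < \<delta> \<Longrightarrow> \<delta> \<le> \<delta>0 \<Longrightarrow> 0 \<le> 1 / \<delta> ^ 3 - c \<and>
        (\<integral>\<^sup>+\<rho>. ennreal (1 / \<rho> ^ 4) * indicator (I \<inter> {\<delta>..}) \<rho> \<partial>lborel) = ennreal ((1 / \<delta> ^ 3 - c) / 3)"
    and al: "smooth_on al J" "al 0 = 1" "\<And>\<rho>. \<rho> \<in> J \<Longrightarrow> 0 < al \<rho>"
    and ga: "smooth_on ga J" "ga 0 = 1" "\<And>\<rho>. \<rho> \<in> J \<Longrightarrow> 0 < ga \<rho>"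
    and M: "M \<in> sets borel" and boundary: "manifold_boundary M = bdry"
    and emb_mem: "\<And>\<rho> y. \<rho> \<in> I \<Longrightarrow> y \<in> bdry \<Longrightarrow> emb \<rho> y \<in> M"
    and R: "smooth_on R off_core" "\<And>\<rho> y. \<rho> \<in> insert 0 I \<Longrightarrow> y \<in> bdry \<Longrightarrow> R (emb \<rho> y) = \<rho>"
    and emb_R: "\<And>p. p \<in> closure M \<Longrightarrow> p \<in> off_core \<Longrightarrow> R p \<in> insert 0 I \<and> emb (R p) (directions p) = p"
    \<comment> \<open>In the coordinates (\<rho>, y) this is g = \<rho>^-2 (d\<rho>^2/P + P
      d\<tau>^2 + g_S); \<open>demb\<close> is the differential of \<open>emb\<close>, applied to a
      radial part s and a tangential part v.\<close>
    and metric: "\<And>\<rho> y s v s' v'. \<rho> \<in> I \<Longrightarrow> y \<in> bdry \<Longrightarrow> tangent_bdry y v \<Longrightarrow> tangent_bdry y v' \<Longrightarrow>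
        g (emb \<rho> y) (demb \<rho> y s v) (demb \<rho> y s' v')
          = (s * s' / lapse m \<rho> + bdry_metric \<beta> (lapse m \<rho>) y v v') / \<rho>\<^sup>2"
    \<comment> \<open>Near the core \<rho> is bounded below. This leaves room for a boundary
      defining function that is constant there.\<close>
    and core: "\<exists>r>0. \<exists>W. open W \<and> M - off_core \<subseteq> W \<and> (\<forall>p\<in>W \<inter> off_core \<inter> closure M. r < R p)"
    \<comment> \<open>A compact set containing all points with \<rho> \<ge> \<delta> bounds the
      logarithm of every positive continuous function on that region.\<close>
    and away: "\<And>\<delta>. 0 < \<delta> \<Longrightarrow> \<exists>K. compact K \<and> K \<subseteq> M \<and> (\<forall>\<rho>\<in>I. \<delta> \<le> \<rho> \<longrightarrow> (\<forall>y\<in>bdry. emb \<rho> y \<in> K))"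
    and charts: "\<And>b. chart M (V b) (\<phi> b) (\<lambda>u. frechet_derivative (\<phi> b) (at u)) (\<tau> b)"
      "\<And>b. local_param M (V b) (\<phi> b)" "M \<subseteq> (\<Union>b. \<phi> b ` V b)"
    and charts_null: "\<And>b z. z \<in> V b \<Longrightarrow> (fst (\<phi> b z) $ 2 = 0 \<longrightarrow> z $ (2::4) = 0) \<and> (snd (\<phi> b z) $ 2 = 0 \<longrightarrow> z $ (4::4) = 0)"
begin

lemma zero_notin_I: "0 \<notin> I" using I by auto

lemma closure_M: "closure M = M \<union> bdry"
  using boundary closure_subset[of M] unfolding manifold_boundary_def by blast

lemma M_disjoint_bdry: "M \<inter> bdry = {}"
  using boundary unfolding manifold_boundary_def by blast

lemma emb_0: "emb 0 y = y" by (simp add: emb_def al ga)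

lemma emb_closure: "\<rho> \<in> insert 0 I \<Longrightarrow> y \<in> bdry \<Longrightarrow> emb \<rho> y \<in> closure M"
  using emb_mem[of \<rho> y] emb_0[of y] closure_M by auto

lemma emb_off_core: "\<rho> \<in> J \<Longrightarrow> y \<in> off_core \<Longrightarrow> emb \<rho> y \<in> off_core"
  using al(3)[of \<rho>] ga(3)[of \<rho>] by (auto simp: emb_def off_core_def)

lemma directions_emb: "\<rho> \<in> J \<Longrightarrow> y \<in> bdry \<Longrightarrow> directions (emb \<rho> y) = y"
  using al(3)[of \<rho>] ga(3)[of \<rho>]
  by (cases y) (simp add: emb_def directions_def bdry_def sgn_scaleR sgn_div_norm)

lemma R_pos:
  assumes "p \<in> M" "p \<in> off_core"
  shows "R p \<in> I"
proof (rule ccontr)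
  assume "R p \<notin> I"
  moreover have "p \<in> closure M" using assms(1) closure_subset by blast
  ultimately have "p = directions p" using emb_R[OF _ assms(2)] emb_0[of "directions p"] by auto
  then have "p \<in> bdry" using directions_mem_bdry[OF assms(2)] by simp
  then show False using assms(1) M_disjoint_bdry by blast
qed

lemma smooth_on_emb: "smooth_on (\<lambda>x. emb (fst x) (snd x)) (J \<times> UNIV)"
proof -
  have o: "open (J \<times> (UNIV :: R32 set))" using J by (simp add: open_Times)
  have a: "smooth_on (\<lambda>x::real\<times>R32. al (fst x)) (J \<times> UNIV)" "smooth_on (\<lambda>x::real\<times>R32. ga (fst x)) (J \<times> UNIV)"
    by (rule smooth_on_compose[OF o J(1) _ smooth_on_fst[OF o smooth_on_id[OF o]]], use al ga in auto)+
  show ?thesis unfolding emb_def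
    by (intro smooth_on_Pair smooth_on_scaleR o a smooth_on_fst smooth_on_snd smooth_on_id)
qed

lemma emb_has_derivative:
  assumes "\<rho> \<in> J"
  shows "((\<lambda>x. emb (fst x) (snd x)) has_derivative (\<lambda>x. demb \<rho> y (fst x) (snd x))) (at (\<rho>, y))"
proof -
  have d: "((\<lambda>x. h (fst x)) has_derivative (\<lambda>x. fst x * frechet_derivative h (at \<rho>) 1)) (at (\<rho>, y))"
    if "smooth_on h J" for h :: "real \<Rightarrow> real"
  proof -
    have h: "(h has_derivative frechet_derivative h (at \<rho>)) (at \<rho>)" by (rule smooth_on_has_derivative[OF that assms])
    have "frechet_derivative h (at \<rho>) s = s * frechet_derivative h (at \<rho>) 1" for s
      using linear_scale[OF has_derivative_linear[OF h], of s 1] by simp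
    then have "(h has_derivative (\<lambda>s. s * frechet_derivative h (at \<rho>) 1)) (at \<rho>)"
      by (intro has_derivative_eq_rhs[OF h] ext)
    then show ?thesis
      using has_derivative_compose[OF has_derivative_fst[OF has_derivative_ident], of h _ "(\<rho>, y)" UNIV] by simp
  qed
  have f: "((\<lambda>x::real\<times>R32. fst (snd x)) has_derivative (\<lambda>x. fst (snd x))) (at (\<rho>, y))"
    "((\<lambda>x::real\<times>R32. snd (snd x)) has_derivative (\<lambda>x. snd (snd x))) (at (\<rho>, y))"
    by (intro has_derivative_fst has_derivative_snd has_derivative_ident)+
  have "((\<lambda>x. (al (fst x) *\<^sub>R fst (snd x), ga (fst x) *\<^sub>R snd (snd x))) has_derivative
     (\<lambda>x. (al (fst (\<rho>, y)) *\<^sub>R fst (snd x) + (fst x * frechet_derivative al (at \<rho>) 1) *\<^sub>R fst (snd (\<rho>, y)),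
           ga (fst (\<rho>, y)) *\<^sub>R snd (snd x) + (fst x * frechet_derivative ga (at \<rho>) 1) *\<^sub>R snd (snd (\<rho>, y))))) (at (\<rho>, y))"
    by (intro has_derivative_Pair has_derivative_scaleR d al ga f)
  then show ?thesis by (simp add: emb_def demb_def add.commute)
qed

subsection \<open>Volume in polar coordinates\<close>

definition coords_domain :: "(real^4) set" where
  "coords_domain = {u. u $ 1 \<in> I \<and> (u $ 2, u $ 3, u $ 4) \<in> coords_box}"

definition polar_emb :: "real^4 \<Rightarrow> R32" where
  "polar_emb u = emb (u $ 1) (polar (u $ 2, u $ 3, u $ 4))"

definition polar_demb :: "real^4 \<Rightarrow> real^4 \<Rightarrow> R32" where
  "polar_demb u a = demb (u $ 1) (polar (u $ 2, u $ 3, u $ 4)) (a $ 1) (polar_deriv (u $ 2, u $ 3, u $ 4) (a $ 2, a $ 3, a $ 4))"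

definition polar_inv :: "R32 \<Rightarrow> real^4" where
  "polar_inv p = vector [R p, fst (directions p) $ 3, angle (fst (directions p) $ 1) (fst (directions p) $ 2),
     angle (snd (directions p) $ 1) (snd (directions p) $ 2)]"

text \<open>What remains after removing the points where the longitude or the circle angle would be
  \<pi>, and the poles of the sphere: within M, exactly the image of the polar chart.\<close>

definition off_slits :: "R32 set" where
  "off_slits = {p \<in> off_core. Complex (fst (directions p) $ 1) (fst (directions p) $ 2) \<notin> \<real>\<^sub>\<le>\<^sub>0
      \<and> Complex (snd (directions p) $ 1) (snd (directions p) $ 2) \<notin> \<real>\<^sub>\<le>\<^sub>0}"

lemma open_off_slits: "open off_slits"
proof -
  have d: "continuous_on off_core directions" by (rule smooth_on_imp_continuous_on[OF smooth_on_directions])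
  have "continuous_on off_core (\<lambda>p. (Complex (fst (directions p) $ 1) (fst (directions p) $ 2),
      Complex (snd (directions p) $ 1) (snd (directions p) $ 2)))" (is "continuous_on _ ?f")
    unfolding Complex_eq by (intro continuous_intros d)
  then have "open (off_core \<inter> ?f -` ((- \<real>\<^sub>\<le>\<^sub>0) \<times> (- \<real>\<^sub>\<le>\<^sub>0)))"
    by (intro continuous_open_preimage open_off_core open_Times) (auto simp: closed_nonpos_Reals_complex open_Compl)
  moreover have "off_core \<inter> ?f -` ((- \<real>\<^sub>\<le>\<^sub>0) \<times> (- \<real>\<^sub>\<le>\<^sub>0)) = off_slits"
    by (auto simp: off_slits_def)
  ultimately show ?thesis by simp
qed

lemma polar_emb_inv:
  assumes "p \<in> M" "p \<in> off_slits"
  shows "polar_inv p \<in> coords_domain" "polar_emb (polar_inv p) = p"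
proof -
  have oc: "p \<in> off_core" using assms by (simp add: off_slits_def)
  define u w where "u = fst (directions p)" and "w = snd (directions p)"
  have n: "u $ 1 * u $ 1 + u $ 2 * u $ 2 + u $ 3 * u $ 3 = 1" "w $ 1 * w $ 1 + w $ 2 * w $ 2 = 1"
    using directions_mem_bdry[OF oc] by (auto simp: bdry_def u_def w_def norm_1_iff inner3 inner2)
  have s: "Complex (u $ 1) (u $ 2) \<notin> \<real>\<^sub>\<le>\<^sub>0" "Complex (w $ 1) (w $ 2) \<notin> \<real>\<^sub>\<le>\<^sub>0"
    using assms by (simp_all add: off_slits_def u_def w_def)
  note pa = polar_angle[OF s(1)] polar_angle[OF s(2)]
  have sq: "(u $ 1)\<^sup>2 + (u $ 2)\<^sup>2 = 1 - (u $ 3)\<^sup>2" "(w $ 1)\<^sup>2 + (w $ 2)\<^sup>2 = 1"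
    using n by (simp_all add: power2_eq_square)
  have inv: "polar_inv p = vector [R p, u $ 3, angle (u $ 1) (u $ 2), angle (w $ 1) (w $ 2)]"
    by (simp add: polar_inv_def u_def w_def)
  have "(u $ 3)\<^sup>2 < 1" using pa(5) sq by simp
  then have "\<bar>u $ 3\<bar> < 1" by (simp add: abs_square_less_1)
  then show "polar_inv p \<in> coords_domain"
    using pa R_pos[OF assms(1) oc] by (auto simp: inv coords_domain_def coords_box_def)
  have "polar (u $ 3, angle (u $ 1) (u $ 2), angle (w $ 1) (w $ 2)) = (u, w)"
    using pa(3,4,8,9) sq by (simp add: polar_def vec_eq_iff forall_3 forall_2)
  then have "polar_emb (polar_inv p) = emb (R p) (directions p)"
    by (simp add: polar_emb_def inv u_def w_def)
  then show "polar_emb (polar_inv p) = p" using emb_R[of p] assms oc closure_subset by auto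
qed

lemma polar_inv_emb:
  assumes "u \<in> coords_domain"
  shows "polar_inv (polar_emb u) = u" "polar_emb u \<in> M" "polar_emb u \<in> off_slits"
proof -
  define \<eta> where "\<eta> = (u $ 2, u $ 3, u $ 4)"
  have \<eta>: "\<eta> \<in> coords_box" "u $ 1 \<in> I" using assms by (auto simp: coords_domain_def \<eta>_def)
  have y: "polar \<eta> \<in> bdry" by (rule polar_mem_bdry[OF \<eta>(1)])
  have J1: "u $ 1 \<in> J" using J \<eta> by auto
  have e: "polar_emb u = emb (u $ 1) (polar \<eta>)" by (simp add: polar_emb_def \<eta>_def)
  have d: "directions (polar_emb u) = polar \<eta>" unfolding e by (rule directions_emb[OF J1 y])
  have q: "0 < sqrt (1 - (u $ 2)\<^sup>2)" using coords_box_sq \<eta> by (auto simp: \<eta>_def)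
  have b: "-pi < u $ 3" "u $ 3 < pi" "-pi < u $ 4" "u $ 4 < pi" using \<eta>(1) by (auto simp: \<eta>_def coords_box_def)
  note ap = angle_polar[OF q b(1,2)] angle_polar[OF zero_less_one b(3,4)]
  show "polar_emb u \<in> M" unfolding e by (rule emb_mem[OF \<eta>(2) y])
  show "polar_emb u \<in> off_slits"
    using ap emb_off_core[OF J1, of "polar \<eta>"] bdry_subset_off_core y
    by (auto simp: off_slits_def d e[symmetric]) (auto simp: \<eta>_def polar_def)
  show "polar_inv (polar_emb u) = u"
    using ap R(2)[of "u $ 1" "polar \<eta>"] \<eta>(2) y
    by (simp add: polar_inv_def d e[symmetric] vec_eq_iff forall_4) (simp add: e \<eta>_def polar_def)
qed

lemma polar_emb_image: "polar_emb ` coords_domain = M \<inter> off_slits"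
  using polar_emb_inv polar_inv_emb by (auto simp: image_iff) (metis)

sublocale polar_chart: chart M coords_domain polar_emb polar_demb polar_inv
proof
  show "M \<in> sets borel" by (rule M)
  have Q: "open coords_box" unfolding coords_box_def by (intro open_Times) auto
  have "open ((\<lambda>u::real^4. (u $ 1, u $ 2, u $ 3, u $ 4)) -` (I \<times> coords_box))"
    by (rule open_vimage) (use I Q in \<open>auto intro!: open_Times continuous_intros\<close>)
  moreover have "(\<lambda>u::real^4. (u $ 1, u $ 2, u $ 3, u $ 4)) -` (I \<times> coords_box) = coords_domain"
    by (auto simp: coords_domain_def)
  ultimately show "open coords_domain" by simp
  show "openin (top_of_set M) (polar_emb ` coords_domain)"
    unfolding polar_emb_image by (rule openin_open_Int[OF open_off_slits])
  fix u assume u: "u \<in> coords_domain"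
  show "polar_inv (polar_emb u) = u" by (rule polar_inv_emb(1)[OF u])
  have \<eta>: "(u $ 2, u $ 3, u $ 4) \<in> coords_box" "u $ 1 \<in> J" using u J by (auto simp: coords_domain_def)
  show "(polar_emb has_derivative polar_demb u) (at u)"
  proof -
    have l: "((\<lambda>u::real^4. u $ i) has_derivative (\<lambda>v. v $ i)) (at u)" for i
      by (rule bounded_linear.has_derivative[OF bounded_linear_vec_nth has_derivative_ident])
    have c: "((\<lambda>u::real^4. (u $ 2, u $ 3, u $ 4)) has_derivative (\<lambda>v. (v $ 2, v $ 3, v $ 4))) (at u)"
      by (intro has_derivative_Pair l)
    have p: "((\<lambda>u::real^4. polar (u $ 2, u $ 3, u $ 4)) has_derivative
        (\<lambda>v. polar_deriv (u $ 2, u $ 3, u $ 4) (v $ 2, v $ 3, v $ 4))) (at u)"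
      by (rule has_derivative_compose[OF c polar_has_derivative[OF \<eta>(1)]])
    from has_derivative_compose[OF has_derivative_Pair[OF l[of 1] p] emb_has_derivative[OF \<eta>(2)]]
    show ?thesis by (simp add: polar_emb_def[abs_def] polar_demb_def[abs_def])
  qed
  have os: "polar_emb u \<in> off_slits" by (rule polar_inv_emb(3)[OF u])
  then have oc: "polar_emb u \<in> off_core" by (simp add: off_slits_def)
  have dR: "R differentiable (at (polar_emb u))" "directions differentiable (at (polar_emb u))"
    using smooth_on_has_derivative[OF R(1) oc] smooth_on_has_derivative[OF smooth_on_directions oc]
    by (auto intro: differentiableI)
  have dd: "(\<lambda>p. fst (directions p) $ i) differentiable (at (polar_emb u))"
    "(\<lambda>p. snd (directions p) $ j) differentiable (at (polar_emb u))" for i j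
  proof -
    obtain D where D: "(directions has_derivative D) (at (polar_emb u))"
      using dR(2) by (auto simp: differentiable_def)
    show "(\<lambda>p. fst (directions p) $ i) differentiable (at (polar_emb u))"
      using bounded_linear.has_derivative[OF bounded_linear_vec_nth has_derivative_fst[OF D]] by (rule differentiableI)
    show "(\<lambda>p. snd (directions p) $ j) differentiable (at (polar_emb u))"
      using bounded_linear.has_derivative[OF bounded_linear_vec_nth has_derivative_snd[OF D]] by (rule differentiableI)
  qed
  show "polar_inv differentiable (at (polar_emb u))"
  proof (rule differentiable_vecI)
    fix i :: 4
    show "(\<lambda>p. polar_inv p $ i) differentiable (at (polar_emb u))"
      using exhaust_4[of i] dR dd os
      by (elim disjE) (auto simp: polar_inv_def off_slits_def intro!: angle_differentiable)
  qed
qed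

end

section \<open>The volume form of the end, and the entire part of the zeta function\<close>

context ah_end
begin

text \<open>The lapse enters as 1/P in the radial entry and as P in the circle entry, and the sphere
  entries multiply to 1 up to the power of \<rho>. The product of the four diagonal entries is
  therefore the square of (\<beta>/2\<pi>) \<rho>^-4.\<close>

lemma volume_eq: "riemannian_volume M g =
   distr (density (restrict_space lborel coords_domain) (\<lambda>u. ennreal (\<beta> / (2 * pi) / (u $ 1) ^ 4)))
     (restrict_space borel M) polar_emb"
proof -
  define P where "P = (\<lambda>u::real^4. lapse m (u $ 1))"
  define d where "d = (\<lambda>(u::real^4) (k::4). if k = 1 then 1 / ((u $ 1)\<^sup>2 * P u) else if k = 2 then 1 / ((1 - (u $ 2)\<^sup>2) * (u $ 1)\<^sup>2)
     else if k = 3 then (1 - (u $ 2)\<^sup>2) / (u $ 1)\<^sup>2 else P u * (\<beta> / (2 * pi))\<^sup>2 / (u $ 1)\<^sup>2)"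
  have u: "0 < u $ 1" "u $ 1 \<in> I" "0 < P u" "(u $ 2, u $ 3, u $ 4) \<in> coords_box" "0 < 1 - (u $ 2)\<^sup>2"
    if "u \<in> coords_domain" for u
    using that I lapse_pos coords_box_sq by (auto simp: coords_domain_def P_def)
  show ?thesis
  proof (rule polar_chart.riemannian_volume_eq[where d=d, OF _ _ _ charts])
    fix u a b assume "u \<in> coords_domain"
    note u = u[OF this]
    let ?\<eta> = "(u $ 2, u $ 3, u $ 4)"
    have "g (polar_emb u) (polar_demb u a) (polar_demb u b)
      = (a $ 1 * b $ 1 / P u + bdry_metric \<beta> (P u) (polar ?\<eta>) (polar_deriv ?\<eta> (a $ 2, a $ 3, a $ 4)) (polar_deriv ?\<eta> (b $ 2, b $ 3, b $ 4))) / (u $ 1)\<^sup>2"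
      unfolding polar_emb_def polar_demb_def P_def
      by (rule metric[OF u(2) polar_mem_bdry[OF u(4)] polar_deriv_tangent[OF u(4)] polar_deriv_tangent[OF u(4)]])
    also have "\<dots> = (\<Sum>k\<in>UNIV. d u k * a $ k * b $ k)"
      using u unfolding bdry_metric_polar[OF u(4)] by (simp add: sum_4 d_def add_divide_distrib)
    finally show "g (polar_emb u) (polar_demb u a) (polar_demb u b) = (\<Sum>k\<in>UNIV. d u k * a $ k * b $ k)" .
  next
    fix u assume "u \<in> coords_domain"
    note u = u[OF this]
    have "(\<Prod>k\<in>UNIV. d u k) = (1 / ((u $ 1)\<^sup>2 * P u)) * (1 / ((1 - (u $ 2)\<^sup>2) * (u $ 1)\<^sup>2))
       * ((1 - (u $ 2)\<^sup>2) / (u $ 1)\<^sup>2) * (P u * (\<beta> / (2 * pi))\<^sup>2 / (u $ 1)\<^sup>2)"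
      by (simp add: prod_4 d_def)
    also have "\<dots> = (\<beta> / (2 * pi))\<^sup>2 / ((u $ 1) ^ 4)\<^sup>2"
    proof -
      have "1 / (r\<^sup>2 * p) * (1 / (q * r\<^sup>2)) * (q / r\<^sup>2) * (p * b / r\<^sup>2) = b / (r ^ 4)\<^sup>2"
        if "0 < r" "0 < p" "0 < q" for r p q b :: real
        using that by (simp add: field_simps power2_eq_square power4_eq_xxxx)
      from this[OF u(1,3,5)] show ?thesis .
    qed
    finally have "(\<Prod>k\<in>UNIV. d u k) = (\<beta> / (2 * pi) / (u $ 1) ^ 4)\<^sup>2" by (simp only: power_divide)
    then show "0 \<le> \<beta> / (2 * pi) / (u $ 1) ^ 4 \<and> (\<Prod>k\<in>UNIV. d u k) = (\<beta> / (2 * pi) / (u $ 1) ^ 4)\<^sup>2"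
      using u(1) \<beta> by (intro conjI) simp_all
  next
    show "(\<lambda>u::real^4. \<beta> / (2 * pi) / (u $ 1) ^ 4) \<in> borel_measurable borel"
    proof -
      have "(\<lambda>u::real^4. u $ 1) \<in> borel_measurable borel"
        by (intro borel_measurable_continuous_onI continuous_intros)
      then show ?thesis by measurable
    qed
    fix b and z :: "real^4" assume z: "z \<in> V b" "\<phi> b z \<notin> polar_emb ` coords_domain"
    interpret c: chart M "V b" "\<phi> b" "\<lambda>u. frechet_derivative (\<phi> b) (at u)" "\<tau> b" by (rule charts(1))
    have "\<phi> b z \<in> M" using c.img z(1) unfolding openin_open by blast
    then have n: "\<phi> b z \<notin> off_slits" using z(2) polar_emb_image by blast
    have sl: "a = 0 \<or> b = 0" if "Complex a (k * b) \<in> \<real>\<^sub>\<le>\<^sub>0" "k \<noteq> 0" for a b k :: real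
      using that by (auto simp: complex_nonpos_Reals_iff)
    have i: "fst (directions p) $ 2 = inverse (norm (fst p)) * fst p $ 2" "snd (directions p) $ 2 = inverse (norm (snd p)) * snd p $ 2" for p
      by (simp_all add: directions_def sgn_div_norm)
    \<comment> \<open>A point of M outside the polar image lies on the core or on a slit; in each
      case a second component vanishes, which \<open>charts_null\<close> translates into a chart
      coordinate.\<close>
    have "fst (\<phi> b z) $ 2 = 0 \<or> snd (\<phi> b z) $ 2 = 0"
      using n unfolding off_slits_def off_core_def i by (auto simp: complex_nonpos_Reals_iff)
    then show "z $ 2 = 0 \<or> z $ 4 = 0" using charts_null[OF z(1)] by blast
  qed
qed

lemma continuous_on_polar_emb: "continuous_on (I \<times> coords_box) (\<lambda>(\<rho>, \<eta>). emb \<rho> (polar \<eta>))"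
proof -
  have p: "continuous_on coords_box polar"
    by (intro continuous_at_imp_continuous_on ballI) (rule has_derivative_continuous[OF polar_has_derivative])
  have p': "continuous_on (I \<times> coords_box) (\<lambda>x. polar (snd x))"
    by (rule continuous_on_compose2[OF p continuous_on_snd[OF continuous_on_id]]) auto
  have a: "continuous_on (I \<times> coords_box) (\<lambda>x. (fst x, polar (snd x)))"
    by (intro continuous_on_Pair continuous_on_fst continuous_on_id p')
  have b: "(\<lambda>x. (fst x, polar (snd x))) ` (I \<times> coords_box) \<subseteq> J \<times> UNIV" using J by auto
  show ?thesis
    using continuous_on_compose2[OF smooth_on_imp_continuous_on[OF smooth_on_emb] a b] by (simp add: case_prod_unfold)
qed

lemma volume_integral:
  fixes f :: "R32 \<Rightarrow> complex"
  assumes f: "f \<in> borel_measurable (restrict_space borel M)"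
  shows "has_bochner_integral (riemannian_volume M g) f v \<longleftrightarrow>
    has_bochner_integral (restrict_space lborel I \<Otimes>\<^sub>M restrict_space lborel coords_box)
      (\<lambda>(\<rho>, \<eta>). (\<beta> / (2 * pi) / \<rho> ^ 4) *\<^sub>R f (emb \<rho> (polar \<eta>))) v"
proof -
  let ?U = "restrict_space lborel coords_domain" and ?w = "\<lambda>u::real^4. \<beta> / (2 * pi) / (u $ 1) ^ 4"
  let ?R = "restrict_space lborel I \<Otimes>\<^sub>M restrict_space lborel coords_box"
  have m: "polar_emb \<in> measurable ?U (restrict_space borel M)"
  proof (rule measurable_restrict_space2)
    show "polar_emb \<in> space ?U \<rightarrow> M" using polar_inv_emb by (auto simp: space_restrict_space)
    show "polar_emb \<in> borel_measurable ?U"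
      unfolding measurable_cong_sets[OF sets_restrict_space_cong[OF sets_lborel] refl]
      by (rule borel_measurable_continuous_on_restrict[OF polar_chart.cont])
  qed
  have w: "?w \<in> borel_measurable ?U"
  proof -
    have "(\<lambda>u::real^4. u $ 1) \<in> borel_measurable borel"
      by (intro borel_measurable_continuous_onI continuous_intros)
    then have "?w \<in> borel_measurable borel" by measurable
    then show ?thesis by (intro measurable_restrict_space1) simp
  qed
  have fm: "(\<lambda>u. f (polar_emb u)) \<in> borel_measurable ?U" using measurable_compose[OF m f] .
  have wpos: "AE u in ?U. 0 \<le> ?w u" using \<beta> by (intro AE_I2) auto
  have m': "polar_emb \<in> measurable (density ?U (\<lambda>u. ennreal (?w u))) (restrict_space borel M)" using m by simp
  have cv: "restrict_space lborel coords_domain = distr ?R ?U coords_vec" "coords_vec \<in> measurable ?R ?U"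
    unfolding coords_domain_def by (rule restrict_space_coords_vec_eq[OF I(1)], rule coords_vec_measurable[OF I(1)])
  have F: "(\<lambda>u. ?w u *\<^sub>R f (polar_emb u)) \<in> borel_measurable ?U" using w fm by measurable
  have "has_bochner_integral (riemannian_volume M g) f v
     \<longleftrightarrow> has_bochner_integral ?U (\<lambda>u. ?w u *\<^sub>R f (polar_emb u)) v"
    unfolding volume_eq has_bochner_integral_iff
    using f m' fm w wpos by (simp add: integrable_distr_eq integral_distr integrable_density integral_density)
  also have "\<dots> \<longleftrightarrow> has_bochner_integral (distr ?R ?U coords_vec) (\<lambda>u. ?w u *\<^sub>R f (polar_emb u)) v"
    using cv(1) by simp
  also have "\<dots> \<longleftrightarrow> has_bochner_integral ?R (\<lambda>x. ?w (coords_vec x) *\<^sub>R f (polar_emb (coords_vec x))) v"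
    unfolding has_bochner_integral_iff using F cv(2) by (simp add: integrable_distr_eq integral_distr)
  also have "(\<lambda>x. ?w (coords_vec x) *\<^sub>R f (polar_emb (coords_vec x)))
     = (\<lambda>(\<rho>, \<eta>). (\<beta> / (2 * pi) / \<rho> ^ 4) *\<^sub>R f (emb \<rho> (polar \<eta>)))"
    by (auto simp: coords_vec_def polar_emb_def)
  finally show ?thesis .
qed

lemma restrict_pair_coords:
  assumes "S \<in> sets borel"
  shows "restrict_space lborel S \<Otimes>\<^sub>M restrict_space lborel coords_box = restrict_space lborel (S \<times> coords_box)"
    and "S \<times> coords_box \<in> sets borel"
proof -
  have Q: "open coords_box" unfolding coords_box_def by (intro open_Times) auto
  then show "restrict_space lborel S \<Otimes>\<^sub>M restrict_space lborel coords_box = restrict_space lborel (S \<times> coords_box)"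
    using pair_restrict_space[of S lborel coords_box lborel] assms by (simp add: lborel_prod lborel.sigma_finite_measure_axioms)
  have "S \<times> coords_box \<in> sets (borel \<Otimes>\<^sub>M borel)" using assms Q by simp
  then show "S \<times> coords_box \<in> sets borel" by (simp only: borel_prod)
qed

lemma borel_measurable_pair_coords:
  fixes h :: "real \<times> coords \<Rightarrow> 'b::topological_space"
  assumes "S \<in> sets borel" "continuous_on (S \<times> coords_box) h"
  shows "h \<in> borel_measurable (restrict_space lborel S \<Otimes>\<^sub>M restrict_space lborel coords_box)"
  unfolding restrict_pair_coords(1)[OF assms(1)]
    measurable_cong_sets[OF sets_restrict_space_cong[OF sets_lborel] refl]
  by (rule borel_measurable_continuous_on_restrict[OF assms(2)])

lemma has_bochner_integral_split:
  fixes h :: "real \<times> coords \<Rightarrow> complex"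
  assumes "S \<in> sets borel" "T \<in> sets borel" "S \<inter> T = {}"
    and "has_bochner_integral (restrict_space lborel S \<Otimes>\<^sub>M restrict_space lborel coords_box) h a"
    and "has_bochner_integral (restrict_space lborel T \<Otimes>\<^sub>M restrict_space lborel coords_box) h b"
  shows "has_bochner_integral (restrict_space lborel (S \<union> T) \<Otimes>\<^sub>M restrict_space lborel coords_box) h (a + b)"
proof -
  note r = restrict_pair_coords
  have ST: "S \<union> T \<in> sets borel" using assms by auto
  have "has_bochner_integral lborel (\<lambda>x. indicator (S \<times> coords_box) x *\<^sub>R h x + indicator (T \<times> coords_box) x *\<^sub>R h x) (a + b)"
    using assms(4,5) r[OF assms(1)] r[OF assms(2)]
    by (intro has_bochner_integral_add) (simp_all add: has_bochner_integral_restrict_space)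
  also have "(\<lambda>x. indicator (S \<times> coords_box) x *\<^sub>R h x + indicator (T \<times> coords_box) x *\<^sub>R h x)
      = (\<lambda>x. indicator ((S \<union> T) \<times> coords_box) x *\<^sub>R h x)"
    using assms(3) by (auto simp: indicator_def fun_eq_iff)
  finally show ?thesis
    using r[OF ST] by (simp add: has_bochner_integral_restrict_space)
qed

text \<open>Times the factor \<beta>/2\<pi> of the density this is 4\<pi>\<beta>, the area of the
  sphere times the length of the circle.\<close>

lemma measure_coords_box: "measure (restrict_space lborel coords_box) coords_box = 8 * pi\<^sup>2"
  "emeasure (restrict_space lborel coords_box) coords_box = ennreal (8 * pi\<^sup>2)"
proof -
  have Q: "open coords_box" unfolding coords_box_def by (intro open_Times) auto
  have "emeasure lborel coords_box = ennreal 2 * (ennreal (2 * pi) * ennreal (2 * pi))"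
    unfolding coords_box_def by (simp add: emeasure_lborel_Times open_Times)
  also have "\<dots> = ennreal (2 * (2 * pi * (2 * pi)))"
    by (simp only: ennreal_mult pi_ge_zero mult_nonneg_nonneg zero_le_numeral)
  also have "2 * (2 * pi * (2 * pi)) = 8 * pi\<^sup>2" by (simp add: power2_eq_square)
  finally show e: "emeasure (restrict_space lborel coords_box) coords_box = ennreal (8 * pi\<^sup>2)"
    using Q by (simp add: emeasure_restrict_space)
  show "measure (restrict_space lborel coords_box) coords_box = 8 * pi\<^sup>2"
    unfolding measure_def e by simp
qed

lemma finite_coords_box: "finite_measure (restrict_space lborel coords_box)"
  by (rule finite_measureI) (simp add: space_restrict_space measure_coords_box)

text \<open>The part of the zeta function away from the boundary is entire.\<close>

lemma zeta_away:
  assumes x: "continuous_on M x" "\<And>p. p \<in> M \<Longrightarrow> 0 < x p" and \<delta>: "0 < \<delta>" "\<delta> \<le> \<delta>0"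
  obtains G where "G holomorphic_on UNIV" "G 0 = of_real (8 * pi\<^sup>2 * ((1 / \<delta> ^ 3 - c) / 3))"
    "\<And>z. has_bochner_integral (restrict_space lborel (I \<inter> {\<delta>..}) \<Otimes>\<^sub>M restrict_space lborel coords_box)
       (\<lambda>(\<rho>, \<eta>). of_real (1 / \<rho> ^ 4) * of_real (x (emb \<rho> (polar \<eta>))) powr z) (G z)"
proof -
  let ?S = "I \<inter> {\<delta>..}"
  let ?A = "restrict_space lborel ?S" and ?N = "restrict_space lborel coords_box"
  have S: "?S \<in> sets borel" using I by auto
  have sp: "space (?A \<Otimes>\<^sub>M ?N) = ?S \<times> coords_box" by (simp add: space_pair_measure space_restrict_space)
  define L where "L = (\<lambda>(\<rho>, \<eta>). ln (x (emb \<rho> (polar \<eta>))))"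
  have pos: "0 < x (emb \<rho> (polar \<eta>))" if "\<rho> \<in> I" "\<eta> \<in> coords_box" for \<rho> \<eta>
    by (intro x emb_mem that polar_mem_bdry)
  have cx: "continuous_on (I \<times> coords_box) (\<lambda>y. x (emb (fst y) (polar (snd y))))"
    by (rule continuous_on_compose2[OF x(1) continuous_on_polar_emb[unfolded case_prod_unfold]])
      (use emb_mem[OF _ polar_mem_bdry] in \<open>simp add: image_subset_iff\<close>)
  have "continuous_on (I \<times> coords_box) L"
    unfolding L_def case_prod_unfold
    by (intro continuous_on_ln cx) (auto simp: less_imp_neq[OF pos, symmetric])
  then have L: "L \<in> borel_measurable (?A \<Otimes>\<^sub>M ?N)"
    by (intro borel_measurable_pair_coords S) (auto intro: continuous_on_subset)
  obtain K where K: "compact K" "K \<subseteq> M" "\<And>\<rho> y. \<rho> \<in> I \<Longrightarrow> \<delta> \<le> \<rho> \<Longrightarrow> y \<in> bdry \<Longrightarrow> emb \<rho> y \<in> K"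
    using away[OF \<delta>(1)] by blast
  have "continuous_on K (\<lambda>p. ln (x p))"
    using K(2) x by (intro continuous_on_ln continuous_on_subset[OF x(1)]) force+
  from compact_imp_bounded[OF compact_continuous_image[OF this K(1)]]
  obtain C where "\<forall>y\<in>(\<lambda>p. ln (x p)) ` K. norm y \<le> C" unfolding bounded_iff ..
  then have C: "\<And>p. p \<in> K \<Longrightarrow> \<bar>ln (x p)\<bar> \<le> C" by simp
  have Lb: "\<bar>L y\<bar> \<le> C" if "y \<in> space (?A \<Otimes>\<^sub>M ?N)" for y
  proof -
    obtain \<rho> \<eta> where y: "y = (\<rho>, \<eta>)" by (cases y)
    with that have "\<rho> \<in> I" "\<delta> \<le> \<rho>" "\<eta> \<in> coords_box" by (simp_all add: sp)
    then show ?thesis using C[OF K(3)[OF _ _ polar_mem_bdry]] by (simp add: y L_def)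
  qed
  have A: "has_bochner_integral ?A (\<lambda>\<rho>. 1 / \<rho> ^ 4) ((1 / \<delta> ^ 3 - c) / 3)"
  proof (rule has_bochner_integral_nn_integral)
    show "(\<lambda>\<rho>. 1 / \<rho> ^ 4) \<in> borel_measurable ?A" by (rule measurable_restrict_space1) simp
    show "(\<integral>\<^sup>+\<rho>. ennreal (1 / \<rho> ^ 4) \<partial>?A) = ennreal ((1 / \<delta> ^ 3 - c) / 3)"
      using volume[OF \<delta>] S by (subst nn_integral_restrict_space) auto
  qed (use volume[OF \<delta>] in auto)
  have sA: "sigma_finite_measure ?A"
    using S by (intro sigma_finite_measure_restrict_space[OF lborel.sigma_finite_measure_axioms]) simp
  have sN: "sigma_finite_measure ?N"
    using finite_coords_box by (simp add: finite_measure_def)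
  have N: "has_bochner_integral ?N (\<lambda>_. 1::complex) (of_real (8 * pi\<^sup>2))"
    using finite_measure.integrable_const[OF finite_coords_box, of "1::complex"] measure_coords_box(1)
    by (simp add: has_bochner_integral_iff space_restrict_space scaleR_conv_of_real)
  have a: "has_bochner_integral (?A \<Otimes>\<^sub>M ?N) (\<lambda>(\<rho>, \<eta>). complex_of_real (1 / \<rho> ^ 4) * 1)
     (of_real ((1 / \<delta> ^ 3 - c) / 3) * of_real (8 * pi\<^sup>2))"
    by (rule has_bochner_integral_pair_mult[OF sA sN has_bochner_integral_of_real[OF A] N])
  have ai: "integrable (?A \<Otimes>\<^sub>M ?N) (\<lambda>(\<rho>, \<eta>). complex_of_real (1 / \<rho> ^ 4) * 1)"
    using a by (simp add: has_bochner_integral_iff)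
  note e = entire_integral_exp[OF L ai Lb]
  define G where "G = (\<lambda>z::complex. \<integral>y. exp (z * of_real (L y)) * (case y of (\<rho>, \<eta>) \<Rightarrow> of_real (1 / \<rho> ^ 4) * 1) \<partial>(?A \<Otimes>\<^sub>M ?N))"
  show thesis
  proof (rule that[of G])
    show "G holomorphic_on UNIV" unfolding G_def by (rule e(2))
    show "G 0 = of_real (8 * pi\<^sup>2 * ((1 / \<delta> ^ 3 - c) / 3))"
      using a unfolding G_def by (simp add: has_bochner_integral_iff mult.commute)
    fix z
    have "has_bochner_integral (?A \<Otimes>\<^sub>M ?N) (\<lambda>y. exp (z * of_real (L y)) * (case y of (\<rho>, \<eta>) \<Rightarrow> of_real (1 / \<rho> ^ 4) * 1)) (G z)"
      unfolding G_def by (rule has_bochner_integral_integrable[OF e(1)])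
    then show "has_bochner_integral (?A \<Otimes>\<^sub>M ?N) (\<lambda>(\<rho>, \<eta>). of_real (1 / \<rho> ^ 4) * of_real (x (emb \<rho> (polar \<eta>))) powr z) (G z)"
    proof (rule has_bochner_integral_cong[THEN iffD1, OF refl _ refl, rotated])
      fix y assume "y \<in> space (?A \<Otimes>\<^sub>M ?N)"
      then show "exp (z * of_real (L y)) * (case y of (\<rho>, \<eta>) \<Rightarrow> of_real (1 / \<rho> ^ 4) * 1)
          = (case y of (\<rho>, \<eta>) \<Rightarrow> of_real (1 / \<rho> ^ 4) * of_real (x (emb \<rho> (polar \<eta>))) powr z)"
        using pos[of "fst y" "snd y"] by (auto simp: sp L_def powr_def Ln_of_real mult.commute)
    qed
  qed
qed

end

section \<open>The finite part of the zeta function, from the expansion of ln (x/\<rho>)\<close>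

context ah_end
begin

text \<open>The coefficient \<open>m / 3\<close> of \<open>\<rho>\<^sup>3\<close> is what the eikonal equation forces (see below).\<close>

definition log_expansion :: "(R32 \<Rightarrow> real) \<Rightarrow> real \<Rightarrow> real \<Rightarrow> bool" where
  "log_expansion x \<delta> C \<longleftrightarrow> (\<forall>y\<in>bdry. \<exists>l0 c2. \<bar>l0\<bar> \<le> C \<and> \<bar>c2\<bar> \<le> C \<and>
     (\<forall>\<rho>. 0 < \<rho> \<longrightarrow> \<rho> < \<delta> \<longrightarrow> \<bar>ln (x (emb \<rho> y) / \<rho>) - l0 - (c2 * \<rho>\<^sup>2 + m / 3 * \<rho> ^ 3)\<bar> \<le> C * \<rho> ^ 4))"

text \<open>The integral is split at \<rho> = \<delta>. At z = 0 the inner piece contributes m/3 -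
  1/(3\<delta>^3) and the outer piece (\<delta>^-3 - c)/3 per unit of boundary measure, so the
  dependence on \<delta> drops out.\<close>

lemma zeta_of_expansion:
  assumes x: "continuous_on M x" "\<And>p. p \<in> M \<Longrightarrow> 0 < x p" and \<delta>: "0 < \<delta>" "\<delta> \<le> \<delta>0"
    and ex: "log_expansion x \<delta> C"
  obtains G where "G holomorphic_on ({z. -1 < Re z} - {1, 3})" "G 0 = of_real (4 * pi * \<beta> * (m - c) / 3)"
    "\<And>z. 3 < Re z \<Longrightarrow> has_bochner_integral (riemannian_volume M g) (\<lambda>p. of_real (x p) powr z) (G z)"
proof -
  let ?A = "interval_measure_at_0 \<delta>" and ?N = "restrict_space lborel coords_box"
  define lam where "lam = (\<lambda>\<rho> \<eta>. ln (x (emb \<rho> (polar \<eta>)) / \<rho>))"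
  have sub: "{0<..<\<delta>} \<subseteq> I" using \<delta> \<delta>0 by auto
  have pos: "0 < x (emb \<rho> (polar \<eta>))" if "\<rho> \<in> I" "\<eta> \<in> coords_box" for \<rho> \<eta>
    by (intro x emb_mem that polar_mem_bdry)
  have Ipos: "0 < \<rho>" if "\<rho> \<in> I" for \<rho> using I that by auto
  have cx: "continuous_on (I \<times> coords_box) (\<lambda>y. x (emb (fst y) (polar (snd y))))"
    by (rule continuous_on_compose2[OF x(1) continuous_on_polar_emb[unfolded case_prod_unfold]])
      (use emb_mem[OF _ polar_mem_bdry] in \<open>simp add: image_subset_iff\<close>)
  have cl: "continuous_on (I \<times> coords_box) (\<lambda>(\<rho>, \<eta>). lam \<rho> \<eta>)"
    unfolding lam_def case_prod_unfold
    by (intro continuous_on_ln continuous_on_divide cx continuous_on_fst continuous_on_id)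
      (auto simp: less_imp_neq[OF pos, symmetric] less_imp_neq[OF Ipos, symmetric])
  have lamm: "(\<lambda>(\<rho>, \<eta>). lam \<rho> \<eta>) \<in> borel_measurable (?A \<Otimes>\<^sub>M ?N)"
    by (intro borel_measurable_pair_coords continuous_on_subset[OF cl]) (use sub in auto)
  have lam\<rho>: "lam \<rho> \<in> borel_measurable ?N" if "\<rho> \<in> I" for \<rho>
  proof -
    have "continuous_on coords_box (\<lambda>\<eta>. case (\<rho>, \<eta>) of (\<rho>, \<eta>) \<Rightarrow> lam \<rho> \<eta>)"
      by (rule continuous_on_compose2[OF cl]) (use that in \<open>auto intro!: continuous_intros\<close>)
    then show ?thesis
      unfolding measurable_cong_sets[OF sets_restrict_space_cong[OF sets_lborel] refl]
      by (intro borel_measurable_continuous_on_restrict) simp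
  qed
  have sN: "space ?N = coords_box" by (simp add: space_restrict_space)
  have "\<forall>\<eta>\<in>coords_box. \<exists>l. \<bar>fst l\<bar> \<le> C \<and> \<bar>snd l\<bar> \<le> C \<and> (\<forall>\<rho>. 0 < \<rho> \<longrightarrow> \<rho> < \<delta> \<longrightarrow>
       \<bar>lam \<rho> \<eta> - fst l - (snd l * \<rho>\<^sup>2 + m / 3 * \<rho> ^ 3)\<bar> \<le> C * \<rho> ^ 4)"
  proof
    fix \<eta> assume "\<eta> \<in> coords_box"
    with ex obtain l0 c2 where "\<bar>l0\<bar> \<le> C" "\<bar>c2\<bar> \<le> C" "\<forall>\<rho>. 0 < \<rho> \<longrightarrow> \<rho> < \<delta> \<longrightarrow>
       \<bar>lam \<rho> \<eta> - l0 - (c2 * \<rho>\<^sup>2 + m / 3 * \<rho> ^ 3)\<bar> \<le> C * \<rho> ^ 4"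
      unfolding log_expansion_def lam_def by (metis polar_mem_bdry)
    then show "\<exists>l. \<bar>fst l\<bar> \<le> C \<and> \<bar>snd l\<bar> \<le> C \<and> (\<forall>\<rho>. 0 < \<rho> \<longrightarrow> \<rho> < \<delta> \<longrightarrow>
       \<bar>lam \<rho> \<eta> - fst l - (snd l * \<rho>\<^sup>2 + m / 3 * \<rho> ^ 3)\<bar> \<le> C * \<rho> ^ 4)"
      by (intro exI[of _ "(l0, c2)"]) simp
  qed
  then obtain l where l: "\<forall>\<eta>\<in>coords_box. \<bar>fst (l \<eta>)\<bar> \<le> C \<and> \<bar>snd (l \<eta>)\<bar> \<le> C \<and> (\<forall>\<rho>. 0 < \<rho> \<longrightarrow> \<rho> < \<delta> \<longrightarrow>
       \<bar>lam \<rho> \<eta> - fst (l \<eta>) - (snd (l \<eta>) * \<rho>\<^sup>2 + m / 3 * \<rho> ^ 3)\<bar> \<le> C * \<rho> ^ 4)"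
    by (rule bchoice[THEN exE])
  define l0 c2 where "l0 = (\<lambda>\<eta>. fst (l \<eta>))" and "c2 = (\<lambda>\<eta>. snd (l \<eta>))"
  have lb: "\<bar>l0 \<eta>\<bar> \<le> C" "\<bar>c2 \<eta>\<bar> \<le> C"
    and le: "\<And>\<rho>. 0 < \<rho> \<Longrightarrow> \<rho> < \<delta> \<Longrightarrow> \<bar>lam \<rho> \<eta> - l0 \<eta> - (c2 \<eta> * \<rho>\<^sup>2 + m / 3 * \<rho> ^ 3)\<bar> \<le> C * \<rho> ^ 4"
    if "\<eta> \<in> coords_box" for \<eta>
    using l that by (auto simp: l0_def c2_def)
  \<comment> \<open>l0 and c2 were picked pointwise by choice, so their measurability has to be
    recovered: along the null sequence r, l0 is the limit of lam and c2 the limit of (lam - l0)/r^2,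
    both limits of measurable functions of the angles.\<close>
  define r where "r = (\<lambda>n. \<delta> * inverse (real (Suc (Suc n))))"
  have r: "0 < r n" "r n < \<delta>" "r n \<in> I" for n
  proof -
    show "0 < r n" "r n < \<delta>" using \<delta> by (simp_all add: r_def field_simps add_pos_nonneg)
    then show "r n \<in> I" using sub by auto
  qed
  have r0: "r \<longlonglongrightarrow> 0"
    unfolding r_def by (rule tendsto_mult_right_zero[OF LIMSEQ_Suc[OF LIMSEQ_inverse_real_of_nat]])
  have lim0: "(\<lambda>n. lam (r n) \<eta>) \<longlonglongrightarrow> l0 \<eta>" if "\<eta> \<in> coords_box" for \<eta>
  proof -
    have "(\<lambda>n. lam (r n) \<eta> - l0 \<eta> - (c2 \<eta> * (r n)\<^sup>2 + m / 3 * (r n) ^ 3)) \<longlonglongrightarrow> 0"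
    proof (rule Lim_null_comparison)
      show "\<forall>\<^sub>F n in sequentially. norm (lam (r n) \<eta> - l0 \<eta> - (c2 \<eta> * (r n)\<^sup>2 + m / 3 * (r n) ^ 3)) \<le> C * (r n) ^ 4"
        using le[OF that r(1,2)] by simp
      show "(\<lambda>n. C * (r n) ^ 4) \<longlonglongrightarrow> 0" by (rule tendsto_eq_intros r0 refl)+ simp
    qed
    moreover have "(\<lambda>n. c2 \<eta> * (r n)\<^sup>2 + m / 3 * (r n) ^ 3) \<longlonglongrightarrow> 0" by (rule tendsto_eq_intros r0 refl)+ simp
    ultimately have "(\<lambda>n. (lam (r n) \<eta> - l0 \<eta> - (c2 \<eta> * (r n)\<^sup>2 + m / 3 * (r n) ^ 3))
        + (c2 \<eta> * (r n)\<^sup>2 + m / 3 * (r n) ^ 3) + l0 \<eta>) \<longlonglongrightarrow> 0 + 0 + l0 \<eta>"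
      by (intro tendsto_add tendsto_const)
    then show ?thesis by simp
  qed
  have l0m: "l0 \<in> borel_measurable ?N"
    by (rule borel_measurable_LIMSEQ_metric[of "\<lambda>n. lam (r n)"]) (use lam\<rho>[OF r(3)] lim0 in \<open>auto simp: sN\<close>)
  have lim2: "(\<lambda>n. (lam (r n) \<eta> - l0 \<eta>) / (r n)\<^sup>2) \<longlonglongrightarrow> c2 \<eta>" if "\<eta> \<in> coords_box" for \<eta>
  proof -
    have "(\<lambda>n. (lam (r n) \<eta> - l0 \<eta>) / (r n)\<^sup>2 - c2 \<eta> - m / 3 * r n) \<longlonglongrightarrow> 0"
    proof (rule Lim_null_comparison)
      show "\<forall>\<^sub>F n in sequentially. norm ((lam (r n) \<eta> - l0 \<eta>) / (r n)\<^sup>2 - c2 \<eta> - m / 3 * r n) \<le> C * (r n)\<^sup>2"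
      proof (rule always_eventually, rule allI)
        fix n
        have "(lam (r n) \<eta> - l0 \<eta>) / (r n)\<^sup>2 - c2 \<eta> - m / 3 * r n
          = (lam (r n) \<eta> - l0 \<eta> - (c2 \<eta> * (r n)\<^sup>2 + m / 3 * (r n) ^ 3)) / (r n)\<^sup>2"
          using r(1)[of n] by (simp add: field_simps power2_eq_square power3_eq_cube)
        then have "norm ((lam (r n) \<eta> - l0 \<eta>) / (r n)\<^sup>2 - c2 \<eta> - m / 3 * r n)
          = \<bar>lam (r n) \<eta> - l0 \<eta> - (c2 \<eta> * (r n)\<^sup>2 + m / 3 * (r n) ^ 3)\<bar> / (r n)\<^sup>2"
          by (simp add: abs_divide)
        also have "\<dots> \<le> C * (r n) ^ 4 / (r n)\<^sup>2"
          by (rule divide_right_mono[OF le[OF that r(1,2)]]) simp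
        also have "\<dots> = C * (r n)\<^sup>2" using r(1)[of n] by (simp add: field_simps power2_eq_square power4_eq_xxxx)
        finally show "norm ((lam (r n) \<eta> - l0 \<eta>) / (r n)\<^sup>2 - c2 \<eta> - m / 3 * r n) \<le> C * (r n)\<^sup>2" .
      qed
      show "(\<lambda>n. C * (r n)\<^sup>2) \<longlonglongrightarrow> 0" by (rule tendsto_eq_intros r0 refl)+ simp
    qed
    moreover have "(\<lambda>n. m / 3 * r n) \<longlonglongrightarrow> 0" by (rule tendsto_eq_intros r0 refl)+ simp
    ultimately have "(\<lambda>n. ((lam (r n) \<eta> - l0 \<eta>) / (r n)\<^sup>2 - c2 \<eta> - m / 3 * r n) + m / 3 * r n + c2 \<eta>) \<longlonglongrightarrow> 0 + 0 + c2 \<eta>"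
      by (intro tendsto_add tendsto_const)
    then show ?thesis by simp
  qed
  have c2m: "c2 \<in> borel_measurable ?N"
    by (rule borel_measurable_LIMSEQ_metric[of "\<lambda>n \<eta>. (lam (r n) \<eta> - l0 \<eta>) / (r n)\<^sup>2"])
      (use lam\<rho>[OF r(3)] l0m lim2 in \<open>auto simp: sN intro!: borel_measurable_divide borel_measurable_diff\<close>)
  have "\<exists>G1. G1 holomorphic_on ({z. -1 < Re z} - {1, 3})
    \<and> G1 0 = of_real (measure ?N coords_box * (m / 3 - 1 / (3 * \<delta> ^ 3)))
    \<and> (\<forall>z. 3 < Re z \<longrightarrow> has_bochner_integral (?A \<Otimes>\<^sub>M ?N)
        (\<lambda>(\<rho>, y). of_real \<rho> powr (z - 4) * exp (z * of_real (lam \<rho> y))) (G1 z))" (is "\<exists>G1. ?P G1")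
  proof (rule zeta_near_boundary[OF \<delta>(1) finite_coords_box lamm l0m c2m, of C "m / 3", unfolded sN])
    show "\<bar>lam \<rho> \<eta> - l0 \<eta> - (c2 \<eta> * \<rho>\<^sup>2 + m / 3 * \<rho> ^ 3)\<bar> \<le> C * \<rho> ^ 4"
      if "0 < \<rho>" "\<rho> < \<delta>" "\<eta> \<in> coords_box" for \<rho> \<eta> by (rule le[OF that(3,1,2)])
  qed (use lb in blast)+
  then obtain G1 where "?P G1" ..
  then have G1: "G1 holomorphic_on ({z. -1 < Re z} - {1, 3})"
    "G1 0 = of_real (measure ?N coords_box * (m / 3 - 1 / (3 * \<delta> ^ 3)))"
    "\<And>z. 3 < Re z \<Longrightarrow> has_bochner_integral (?A \<Otimes>\<^sub>M ?N)
        (\<lambda>(\<rho>, y). of_real \<rho> powr (z - 4) * exp (z * of_real (lam \<rho> y))) (G1 z)"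
    by blast+
  obtain G2 where G2: "G2 holomorphic_on UNIV" "G2 0 = of_real (8 * pi\<^sup>2 * ((1 / \<delta> ^ 3 - c) / 3))"
    "\<And>z. has_bochner_integral (restrict_space lborel (I \<inter> {\<delta>..}) \<Otimes>\<^sub>M ?N)
       (\<lambda>(\<rho>, \<eta>). of_real (1 / \<rho> ^ 4) * of_real (x (emb \<rho> (polar \<eta>))) powr z) (G2 z)"
    using zeta_away[OF x \<delta>] by blast
  define G where "G = (\<lambda>z. of_real (\<beta> / (2 * pi)) * (G1 z + G2 z))"
  show thesis
  proof (rule that[of G])
    show "G holomorphic_on ({z. -1 < Re z} - {1, 3})"
      unfolding G_def by (intro holomorphic_intros G1 holomorphic_on_subset[OF G2(1)]) auto
    have "G 0 = of_real (\<beta> / (2 * pi) * (8 * pi\<^sup>2 * (m / 3 - 1 / (3 * \<delta> ^ 3)) + 8 * pi\<^sup>2 * ((1 / \<delta> ^ 3 - c) / 3)))"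
      unfolding G_def G1(2) G2(2) measure_coords_box(1) by simp
    also have "\<beta> / (2 * pi) * (8 * pi\<^sup>2 * (m / 3 - 1 / (3 * \<delta> ^ 3)) + 8 * pi\<^sup>2 * ((1 / \<delta> ^ 3 - c) / 3)) = 4 * pi * \<beta> * (m - c) / 3"
      using \<delta> by (simp add: field_simps power2_eq_square)
    finally show "G 0 = of_real (4 * pi * \<beta> * (m - c) / 3)" .
    fix z :: complex assume z: "3 < Re z"
    let ?h = "\<lambda>(\<rho>, \<eta>). of_real (1 / \<rho> ^ 4) * of_real (x (emb \<rho> (polar \<eta>))) powr z :: complex"
    have "has_bochner_integral (?A \<Otimes>\<^sub>M ?N) ?h (G1 z)"
    proof (rule has_bochner_integral_cong[THEN iffD1, OF refl _ refl G1(3)[OF z]])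
      fix y assume y: "y \<in> space (?A \<Otimes>\<^sub>M ?N)"
      obtain \<rho> \<eta> where y': "y = (\<rho>, \<eta>)" by (cases y)
      with y have \<rho>: "0 < \<rho>" "\<rho> \<in> I" "\<eta> \<in> coords_box" using sub by (auto simp: space_pair_measure space_restrict_space)
      have xp: "0 < x (emb \<rho> (polar \<eta>))" by (rule pos[OF \<rho>(2,3)])
      have "complex_of_real \<rho> powr (z - 4) = of_real \<rho> powr z / of_real \<rho> ^ 4"
        using \<rho>(1) powr_diff[of "complex_of_real \<rho>" z 4] by simp
      moreover have "complex_of_real (x (emb \<rho> (polar \<eta>))) powr z = of_real \<rho> powr z * exp (z * of_real (lam \<rho> \<eta>))"
        using \<rho>(1) xp by (simp add: powr_def Ln_of_real lam_def ln_div exp_add[symmetric] algebra_simps)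
      ultimately show "(case y of (\<rho>, y) \<Rightarrow> of_real \<rho> powr (z - 4) * exp (z * of_real (lam \<rho> y))) = ?h y"
        by (simp add: y')
    qed
    moreover have "restrict_space lborel {0<..<\<delta>} = ?A" ..
    ultimately have "has_bochner_integral (restrict_space lborel ({0<..<\<delta>} \<union> (I \<inter> {\<delta>..})) \<Otimes>\<^sub>M ?N) ?h (G1 z + G2 z)"
      using I by (intro has_bochner_integral_split G2(3)) auto
    moreover have "{0<..<\<delta>} \<union> (I \<inter> {\<delta>..}) = I" using sub Ipos by force
    ultimately have "has_bochner_integral (restrict_space lborel I \<Otimes>\<^sub>M ?N) (\<lambda>y. of_real (\<beta> / (2 * pi)) * ?h y) (G z)"
      unfolding G_def by (intro has_bochner_integral_mult_right) simp
    also have "(\<lambda>y. of_real (\<beta> / (2 * pi)) * ?h y)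
       = (\<lambda>(\<rho>, \<eta>). (\<beta> / (2 * pi) / \<rho> ^ 4) *\<^sub>R of_real (x (emb \<rho> (polar \<eta>))) powr z)"
      by (auto simp: fun_eq_iff scaleR_conv_of_real)
    finally have v: "has_bochner_integral (restrict_space lborel I \<Otimes>\<^sub>M ?N)
      (\<lambda>(\<rho>, \<eta>). (\<beta> / (2 * pi) / \<rho> ^ 4) *\<^sub>R of_real (x (emb \<rho> (polar \<eta>))) powr z) (G z)" .
    have xm: "x \<in> borel_measurable (restrict_space borel M)"
      by (rule borel_measurable_continuous_on_restrict[OF x(1)])
    have "(\<lambda>t::real. complex_of_real t powr z) \<in> borel_measurable borel" by measurable
    from measurable_compose[OF xm this]
    show "has_bochner_integral (riemannian_volume M g) (\<lambda>p. of_real (x p) powr z) (G z)"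
      using volume_integral v by blast
  qed
qed

text \<open>Any continuation Z agrees with G for Re z > 3, hence near 0 by the identity theorem on
  the half plane Re z > -1 without 1 and 3, which is still connected. As G is holomorphic at 0, the
  constant Laurent coefficient is G 0, regardless of the value of Z at the point 0.\<close>

theorem finite_part_of_expansion:
  assumes x: "continuous_on M x" "\<And>p. p \<in> M \<Longrightarrow> 0 < x p" and \<delta>: "0 < \<delta>" "\<delta> \<le> \<delta>0"
    and ex: "log_expansion x \<delta> C" and Z: "volume_zeta_continuation M g x Z"
  shows "fls_nth (laurent_expansion Z 0) 0 = of_real (4 * pi * \<beta> * (m - c) / 3)"
proof -
  obtain G where G: "G holomorphic_on ({z. -1 < Re z} - {1, 3})" "G 0 = of_real (4 * pi * \<beta> * (m - c) / 3)"
    "\<And>z. 3 < Re z \<Longrightarrow> has_bochner_integral (riemannian_volume M g) (\<lambda>p. of_real (x p) powr z) (G z)"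
    using zeta_of_expansion[OF x \<delta> ex] by blast
  let ?S = "{z::complex. -1 < Re z} - {1, 3}"
  have oS: "open ?S" by (intro open_Diff open_halfspace_Re_gt) simp
  have cS: "connected ?S"
    by (rule connected_open_delete_finite) (auto simp: open_halfspace_Re_gt convex_connected convex_halfspace_Re_gt)
  have "\<forall>\<^sub>F z in at 0. Z z = G z"
  proof (rule meromorphic_eventually_eq[OF _ _ oS cS])
    show "Z meromorphic_on ?S" using Z by (auto simp: volume_zeta_continuation_def intro: meromorphic_on_subset)
    show "G meromorphic_on ?S"
      using G(1) oS by (intro analytic_on_imp_meromorphic_on) (simp add: analytic_on_open)
    show "open {z. 3 < Re z}" by (rule open_halfspace_Re_gt)
    show "{z. 3 < Re z} \<noteq> {}" by (rule ex_in_conv[THEN iffD1], rule exI[of _ 4]) simp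
    show "Z z = G z" if "z \<in> {z. 3 < Re z}" for z
      using that G(3)[of z] Z has_bochner_integral_eq unfolding volume_zeta_continuation_def by blast
  qed auto
  then have e: "laurent_expansion Z 0 = laurent_expansion G 0" by (rule laurent_expansion_cong) simp
  have an: "G analytic_on {0}"
    using G(1) oS by (auto simp: analytic_at intro!: exI[of _ ?S])
  have "G has_laurent_expansion fps_to_fls (fps_expansion G 0)"
    using analytic_at_imp_has_fps_expansion_0[OF an] has_laurent_expansion_fps by blast
  then have "laurent_expansion G 0 = fps_to_fls (fps_expansion G 0)"
    by (intro laurent_expansion_eqI) simp
  then show ?thesis using G(2) by (simp add: e fps_expansion_def)
qed

end

section \<open>The expansion that the eikonal equation forces on its solutions\<close>

subsection \<open>Taylor coefficients forced by the eikonal equation\<close>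

lemma taylor_bound:
  fixes D :: "nat \<Rightarrow> real \<Rightarrow> real"
  assumes "0 < \<rho>" "0 < n"
    and "\<And>k t. k < n \<Longrightarrow> 0 \<le> t \<Longrightarrow> t \<le> \<rho> \<Longrightarrow> (D k has_real_derivative D (Suc k) t) (at t)"
    and "\<And>t. 0 \<le> t \<Longrightarrow> t \<le> \<rho> \<Longrightarrow> \<bar>D n t\<bar> \<le> K"
  shows "\<bar>D 0 \<rho> - (\<Sum>k<n. D k 0 / fact k * \<rho> ^ k)\<bar> \<le> K * \<rho> ^ n"
proof -
  have "\<exists>t>0. t < \<rho> \<and> D 0 \<rho> = (\<Sum>k<n. D k 0 / fact k * \<rho> ^ k) + D n t / fact n * \<rho> ^ n"
    by (rule Maclaurin) (use assms in auto)
  then obtain t where t: "0 < t" "t < \<rho>" "D 0 \<rho> = (\<Sum>k<n. D k 0 / fact k * \<rho> ^ k) + D n t / fact n * \<rho> ^ n"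
    by blast
  have "\<bar>D n t / fact n * \<rho> ^ n\<bar> = \<bar>D n t\<bar> / fact n * \<rho> ^ n" using assms(1) by (simp add: abs_mult)
  also have "\<dots> \<le> \<bar>D n t\<bar> * \<rho> ^ n"
    using assms(1) fact_ge_1[of n, where 'a=real]
    by (intro mult_right_mono) (auto simp: divide_le_eq mult_le_cancel_left1)
  also have "\<dots> \<le> K * \<rho> ^ n" using assms(1,4) t by (intro mult_right_mono) auto
  finally show ?thesis using t(3) by simp
qed

lemma tendsto_0_of_bound:
  fixes e :: "real \<Rightarrow> real"
  assumes "0 < r" "\<And>\<rho>. 0 < \<rho> \<Longrightarrow> \<rho> < r \<Longrightarrow> \<bar>e \<rho>\<bar> \<le> K * \<rho>"
  shows "(e \<longlongrightarrow> 0) (at_right 0)"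
proof (rule Lim_null_comparison)
  show "\<forall>\<^sub>F \<rho> in at_right 0. norm (e \<rho>) \<le> K * \<rho>"
    by (rule eventually_at_rightI[of 0 r]) (use assms in auto)
  show "((\<lambda>\<rho>. K * \<rho>) \<longlongrightarrow> 0) (at_right 0)" by (auto intro!: tendsto_eq_intros)
qed

lemma tendsto_lapse: "(lapse m \<longlongrightarrow> 1) (at_right 0)"
  unfolding lapse_def by (auto intro!: tendsto_eq_intros)

text \<open>F and F1 stand for a solution and its radial derivative over one fixed boundary point;
  p, q, f3 and f4 are the radial derivatives of orders 1 to 4 at \<rho> = 0, and S is the tangential
  part of the equation.\<close>

context
  fixes F F1 S :: "real \<Rightarrow> real" and m p q f3 f4 K r :: real
  assumes r: "0 < r" and p: "0 < p"
    and F: "\<And>\<rho>. 0 < \<rho> \<Longrightarrow> \<rho> < r \<Longrightarrow> \<bar>F \<rho> - (p * \<rho> + q / 2 * \<rho>\<^sup>2 + f3 / 6 * \<rho> ^ 3 + f4 / 24 * \<rho> ^ 4)\<bar> \<le> K * \<rho> ^ 5"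
    and F1: "\<And>\<rho>. 0 < \<rho> \<Longrightarrow> \<rho> < r \<Longrightarrow> \<bar>F1 \<rho> - (p + q * \<rho> + f3 / 2 * \<rho>\<^sup>2 + f4 / 6 * \<rho> ^ 3)\<bar> \<le> K * \<rho> ^ 4"
    and eikonal: "\<And>\<rho>. 0 < \<rho> \<Longrightarrow> \<rho> < r \<Longrightarrow> lapse m \<rho> * (F1 \<rho>)\<^sup>2 + S \<rho> = (F \<rho> / \<rho>)\<^sup>2"
begin

lemma remainders:
  obtains E0 E1 where "(E0 \<longlongrightarrow> 0) (at_right 0)" "(E1 \<longlongrightarrow> 0) (at_right 0)"
    "\<And>\<rho>. 0 < \<rho> \<Longrightarrow> F \<rho> / \<rho> = p + q / 2 * \<rho> + \<rho>\<^sup>2 * (f3 / 6 + (f4 / 24 + E0 \<rho>) * \<rho>)"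
    "\<And>\<rho>. 0 < \<rho> \<Longrightarrow> F1 \<rho> = p + q * \<rho> + \<rho>\<^sup>2 * (f3 / 2 + (f4 / 6 + E1 \<rho>) * \<rho>)"
proof
  let ?E0 = "\<lambda>\<rho>. (F \<rho> - (p * \<rho> + q / 2 * \<rho>\<^sup>2 + f3 / 6 * \<rho> ^ 3 + f4 / 24 * \<rho> ^ 4)) / \<rho> ^ 4"
  let ?E1 = "\<lambda>\<rho>. (F1 \<rho> - (p + q * \<rho> + f3 / 2 * \<rho>\<^sup>2 + f4 / 6 * \<rho> ^ 3)) / \<rho> ^ 3"
  show "(?E0 \<longlongrightarrow> 0) (at_right 0)"
  proof (rule tendsto_0_of_bound[OF r])
    fix \<rho> assume \<rho>: "0 < \<rho>" "\<rho> < r"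
    show "\<bar>?E0 \<rho>\<bar> \<le> K * \<rho>"
      using F[OF \<rho>] \<rho> by (simp add: abs_divide divide_le_eq power_Suc[symmetric] mult.assoc del: power_Suc)
  qed
  show "(?E1 \<longlongrightarrow> 0) (at_right 0)"
  proof (rule tendsto_0_of_bound[OF r])
    fix \<rho> assume \<rho>: "0 < \<rho>" "\<rho> < r"
    show "\<bar>?E1 \<rho>\<bar> \<le> K * \<rho>"
      using F1[OF \<rho>] \<rho> by (simp add: abs_divide divide_le_eq)
        (simp add: eval_nat_numeral mult_ac)
  qed
  show "F \<rho> / \<rho> = p + q / 2 * \<rho> + \<rho>\<^sup>2 * (f3 / 6 + (f4 / 24 + ?E0 \<rho>) * \<rho>)" if "0 < \<rho>" for \<rho>
    using that by (simp add: field_simps eval_nat_numeral)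
  show "F1 \<rho> = p + q * \<rho> + \<rho>\<^sup>2 * (f3 / 2 + (f4 / 6 + ?E1 \<rho>) * \<rho>)" if "0 < \<rho>" for \<rho>
    using that by (simp add: field_simps eval_nat_numeral)
qed

text \<open>Writing F/\<rho> = p + \<rho>w and F1 = p + \<rho>u, with w tending to q/2 and u to q,
  the terms of order \<rho> in the equation give 2p (q/2 - q) = 0.\<close>

lemma second_coefficient:
  assumes S: "((\<lambda>\<rho>. S \<rho> / \<rho>) \<longlongrightarrow> 0) (at_right 0)"
  shows "q = 0"
proof -
  obtain E0 E1 where E: "(E0 \<longlongrightarrow> 0) (at_right 0)" "(E1 \<longlongrightarrow> 0) (at_right 0)"
    "\<And>\<rho>. 0 < \<rho> \<Longrightarrow> F \<rho> / \<rho> = p + q / 2 * \<rho> + \<rho>\<^sup>2 * (f3 / 6 + (f4 / 24 + E0 \<rho>) * \<rho>)"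
    "\<And>\<rho>. 0 < \<rho> \<Longrightarrow> F1 \<rho> = p + q * \<rho> + \<rho>\<^sup>2 * (f3 / 2 + (f4 / 6 + E1 \<rho>) * \<rho>)"
    using remainders by blast
  define w u where "w = (\<lambda>\<rho>. q / 2 + \<rho> * (f3 / 6 + (f4 / 24 + E0 \<rho>) * \<rho>))"
    and "u = (\<lambda>\<rho>. q + \<rho> * (f3 / 2 + (f4 / 6 + E1 \<rho>) * \<rho>))"
  have wu: "(w \<longlongrightarrow> q / 2) (at_right 0)" "(u \<longlongrightarrow> q) (at_right 0)"
    unfolding w_def u_def using E(1,2) by (auto intro!: tendsto_eq_intros)
  have "((\<lambda>\<rho>. 2 * p * (w \<rho> - u \<rho>) + \<rho> * ((w \<rho>)\<^sup>2 - (u \<rho>)\<^sup>2) - (\<rho> - 2 * m * \<rho>\<^sup>2) * (p + \<rho> * u \<rho>)\<^sup>2)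
      \<longlongrightarrow> 2 * p * (q / 2 - q)) (at_right 0)"
    by (rule tendsto_eq_intros wu refl | simp)+
  moreover have "\<forall>\<^sub>F \<rho> in at_right 0. 2 * p * (w \<rho> - u \<rho>) + \<rho> * ((w \<rho>)\<^sup>2 - (u \<rho>)\<^sup>2)
      - (\<rho> - 2 * m * \<rho>\<^sup>2) * (p + \<rho> * u \<rho>)\<^sup>2 = S \<rho> / \<rho>"
  proof (rule eventually_at_rightI[OF _ r])
    fix \<rho> assume "\<rho> \<in> {0<..<r}"
    then have \<rho>: "0 < \<rho>" "\<rho> < r" by auto
    have "F \<rho> / \<rho> = p + \<rho> * w \<rho>" "F1 \<rho> = p + \<rho> * u \<rho>"
      using E(3,4)[OF \<rho>(1)] by (simp_all add: w_def u_def algebra_simps power2_eq_square)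
    then have "S \<rho> = (p + \<rho> * w \<rho>)\<^sup>2 - lapse m \<rho> * (p + \<rho> * u \<rho>)\<^sup>2"
      using eikonal[OF \<rho>] by simp
    then show "2 * p * (w \<rho> - u \<rho>) + \<rho> * ((w \<rho>)\<^sup>2 - (u \<rho>)\<^sup>2)
      - (\<rho> - 2 * m * \<rho>\<^sup>2) * (p + \<rho> * u \<rho>)\<^sup>2 = S \<rho> / \<rho>"
      using \<rho> by (simp add: lapse_def field_simps power2_eq_square power3_eq_cube)
  qed
  ultimately have "((\<lambda>\<rho>. S \<rho> / \<rho>) \<longlongrightarrow> 2 * p * (q / 2 - q)) (at_right 0)" by (rule Lim_transform_eventually)
  then have "2 * p * (q / 2 - q) = 0" using S tendsto_unique[OF trivial_limit_at_right_real] by blast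
  then show ?thesis using p by simp
qed

text \<open>Order \<rho>^2 only relates the constant A to f3. At order \<rho>^3 the tangential part
  contributes nothing, by assumption, and the term -2m\<rho>^3 of the lapse enters for the first
  time: 2p (f4/24 - f4/6) + 2mp^2 = 0.\<close>

lemma fourth_coefficient:
  assumes q: "q = 0" and S: "((\<lambda>\<rho>. (S \<rho> / \<rho>\<^sup>2 - A) / \<rho>) \<longlongrightarrow> 0) (at_right 0)"
  shows "f4 = 8 * m * p"
proof -
  obtain E0 E1 where E: "(E0 \<longlongrightarrow> 0) (at_right 0)" "(E1 \<longlongrightarrow> 0) (at_right 0)"
    "\<And>\<rho>. 0 < \<rho> \<Longrightarrow> F \<rho> / \<rho> = p + q / 2 * \<rho> + \<rho>\<^sup>2 * (f3 / 6 + (f4 / 24 + E0 \<rho>) * \<rho>)"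
    "\<And>\<rho>. 0 < \<rho> \<Longrightarrow> F1 \<rho> = p + q * \<rho> + \<rho>\<^sup>2 * (f3 / 2 + (f4 / 6 + E1 \<rho>) * \<rho>)"
    using remainders by blast
  define w u where "w = (\<lambda>\<rho>. f3 / 6 + (f4 / 24 + E0 \<rho>) * \<rho>)" and "u = (\<lambda>\<rho>. f3 / 2 + (f4 / 6 + E1 \<rho>) * \<rho>)"
  have wu: "(w \<longlongrightarrow> f3 / 6) (at_right 0)" "(u \<longlongrightarrow> f3 / 2) (at_right 0)"
    unfolding w_def u_def using E(1,2) by (auto intro!: tendsto_eq_intros)
  have eq: "S \<rho> / \<rho>\<^sup>2 = 2 * p * (w \<rho> - u \<rho>) - (1 - 2 * m * \<rho>) * (p + \<rho>\<^sup>2 * u \<rho>)\<^sup>2 + \<rho>\<^sup>2 * ((w \<rho>)\<^sup>2 - (u \<rho>)\<^sup>2)"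
    if \<rho>: "0 < \<rho>" "\<rho> < r" for \<rho>
  proof -
    have "F \<rho> / \<rho> = p + \<rho>\<^sup>2 * w \<rho>" "F1 \<rho> = p + \<rho>\<^sup>2 * u \<rho>"
      using E(3,4)[OF \<rho>(1)] q by (simp_all add: w_def u_def)
    then have "S \<rho> = (p + \<rho>\<^sup>2 * w \<rho>)\<^sup>2 - lapse m \<rho> * (p + \<rho>\<^sup>2 * u \<rho>)\<^sup>2"
      using eikonal[OF \<rho>] by simp
    then show ?thesis
      using \<rho> by (simp add: lapse_def field_simps power2_eq_square power3_eq_cube)
  qed
  have ev: "\<forall>\<^sub>F \<rho> in at_right 0. 0 < \<rho> \<and> \<rho> < r" by (rule eventually_at_rightI[OF _ r]) auto
  have "((\<lambda>\<rho>. 2 * p * (w \<rho> - u \<rho>) - (1 - 2 * m * \<rho>) * (p + \<rho>\<^sup>2 * u \<rho>)\<^sup>2 + \<rho>\<^sup>2 * ((w \<rho>)\<^sup>2 - (u \<rho>)\<^sup>2))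
     \<longlongrightarrow> 2 * p * (f3 / 6 - f3 / 2) - p\<^sup>2) (at_right 0)"
    by (rule tendsto_eq_intros wu refl | simp)+
  then have 1: "((\<lambda>\<rho>. S \<rho> / \<rho>\<^sup>2) \<longlongrightarrow> 2 * p * (f3 / 6 - f3 / 2) - p\<^sup>2) (at_right 0)"
    by (rule Lim_transform_eventually) (use ev eq in \<open>auto elim: eventually_mono\<close>)
  have "((\<lambda>\<rho>. (S \<rho> / \<rho>\<^sup>2 - A) / \<rho> * \<rho> + A) \<longlongrightarrow> 0 * 0 + A) (at_right 0)"
    by (intro tendsto_add tendsto_mult S tendsto_const tendsto_ident_at)
  then have "((\<lambda>\<rho>. S \<rho> / \<rho>\<^sup>2) \<longlongrightarrow> 0 * 0 + A) (at_right 0)"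
    by (rule Lim_transform_eventually) (rule eventually_mono[OF ev], simp)
  then have A: "A = 2 * p * (f3 / 6 - f3 / 2) - p\<^sup>2"
    using 1 tendsto_unique[OF trivial_limit_at_right_real] by force
  have "((\<lambda>\<rho>. 2 * p * ((f4 / 24 + E0 \<rho>) - (f4 / 6 + E1 \<rho>)) + 2 * m * (p + \<rho>\<^sup>2 * u \<rho>)\<^sup>2
       - \<rho> * u \<rho> * (2 * p + \<rho>\<^sup>2 * u \<rho>) + \<rho> * ((w \<rho>)\<^sup>2 - (u \<rho>)\<^sup>2)) \<longlongrightarrow> 2 * p * (f4 / 24 - f4 / 6) + 2 * m * p\<^sup>2) (at_right 0)"
    by (rule tendsto_eq_intros wu E(1,2) refl | simp)+
  then have "((\<lambda>\<rho>. (S \<rho> / \<rho>\<^sup>2 - A) / \<rho>) \<longlongrightarrow> 2 * p * (f4 / 24 - f4 / 6) + 2 * m * p\<^sup>2) (at_right 0)"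
  proof (rule Lim_transform_eventually, intro eventually_mono[OF ev])
    fix \<rho> assume \<rho>: "0 < \<rho> \<and> \<rho> < r"
    have "S \<rho> / \<rho>\<^sup>2 - A = \<rho> * (2 * p * ((f4 / 24 + E0 \<rho>) - (f4 / 6 + E1 \<rho>)) + 2 * m * (p + \<rho>\<^sup>2 * u \<rho>)\<^sup>2
       - \<rho> * u \<rho> * (2 * p + \<rho>\<^sup>2 * u \<rho>) + \<rho> * ((w \<rho>)\<^sup>2 - (u \<rho>)\<^sup>2))"
    proof -
      have "2 * p * (w \<rho> - u \<rho>) = 2 * p * (f3 / 6 - f3 / 2) + \<rho> * (2 * p * ((f4 / 24 + E0 \<rho>) - (f4 / 6 + E1 \<rho>)))"
        by (simp add: w_def u_def algebra_simps)
      moreover have "(1 - 2 * m * \<rho>) * (p + \<rho>\<^sup>2 * u \<rho>)\<^sup>2 = p\<^sup>2 + \<rho> * (\<rho> * u \<rho> * (2 * p + \<rho>\<^sup>2 * u \<rho>)) - \<rho> * (2 * m * (p + \<rho>\<^sup>2 * u \<rho>)\<^sup>2)"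
        by (simp add: algebra_simps power2_eq_square)
      ultimately show ?thesis using eq[of \<rho>] \<rho> A by (simp add: algebra_simps power2_eq_square)
    qed
    then show "2 * p * ((f4 / 24 + E0 \<rho>) - (f4 / 6 + E1 \<rho>)) + 2 * m * (p + \<rho>\<^sup>2 * u \<rho>)\<^sup>2
       - \<rho> * u \<rho> * (2 * p + \<rho>\<^sup>2 * u \<rho>) + \<rho> * ((w \<rho>)\<^sup>2 - (u \<rho>)\<^sup>2) = (S \<rho> / \<rho>\<^sup>2 - A) / \<rho>"
      using \<rho> by simp
  qed
  then have "2 * p * (f4 / 24 - f4 / 6) + 2 * m * p\<^sup>2 = 0"
    using S tendsto_unique[OF trivial_limit_at_right_real] by blast
  then have "p * (8 * m * p - f4) = 0" by (simp add: algebra_simps power2_eq_square)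
  then show ?thesis using p by simp
qed

end

text \<open>If h has no quadratic term, then h^2/\<rho>^2 has no linear one. Applied to the
  tangential derivatives, this is why S does not interfere with the coefficient of order
  \<rho>^3.\<close>

lemma square_tendsto:
  fixes h :: "real \<Rightarrow> real"
  assumes "0 < r" "\<And>\<rho>. 0 < \<rho> \<Longrightarrow> \<rho> < r \<Longrightarrow> \<bar>h \<rho> - a * \<rho>\<bar> \<le> K * \<rho> ^ 3"
  shows "((\<lambda>\<rho>. ((h \<rho>)\<^sup>2 / \<rho>\<^sup>2 - a\<^sup>2) / \<rho>) \<longlongrightarrow> 0) (at_right 0)"
proof -
  let ?e = "\<lambda>\<rho>. (h \<rho> - a * \<rho>) / \<rho>\<^sup>2"
  have e: "(?e \<longlongrightarrow> 0) (at_right 0)"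
  proof (rule tendsto_0_of_bound[OF assms(1)])
    fix \<rho> assume \<rho>: "0 < \<rho>" "\<rho> < r"
    show "\<bar>?e \<rho>\<bar> \<le> K * \<rho>"
      using assms(2)[OF \<rho>] \<rho> by (simp add: abs_divide divide_le_eq power2_eq_square power3_eq_cube mult_ac)
  qed
  have "((\<lambda>\<rho>. 2 * a * ?e \<rho> + \<rho> * (?e \<rho>)\<^sup>2) \<longlongrightarrow> 0) (at_right 0)"
    by (rule tendsto_eq_intros e refl | simp)+
  then show ?thesis
  proof (rule Lim_transform_eventually, intro eventually_at_rightI[of 0 1])
    fix \<rho> :: real assume \<rho>: "\<rho> \<in> {0<..<1}"
    then have "h \<rho> = \<rho> * (a + \<rho> * ?e \<rho>)" by (simp add: field_simps power2_eq_square)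
    then have "(h \<rho>)\<^sup>2 / \<rho>\<^sup>2 = (a + \<rho> * ?e \<rho>)\<^sup>2" using \<rho> by (metis div_by_1 greaterThanLessThan_iff less_irrefl nonzero_mult_div_cancel_left power_mult_distrib zero_less_power)
    then have "((h \<rho>)\<^sup>2 / \<rho>\<^sup>2 - a\<^sup>2) = \<rho> * (2 * a * ?e \<rho> + \<rho> * (?e \<rho>)\<^sup>2)"
      by (simp only:) (simp add: algebra_simps power2_eq_square)
    then show "2 * a * ?e \<rho> + \<rho> * (?e \<rho>)\<^sup>2 = ((h \<rho>)\<^sup>2 / \<rho>\<^sup>2 - a\<^sup>2) / \<rho>" using \<rho> by simp
  qed simp
qed

text \<open>Division by the lapse preserves the absence of a linear term because the lapse is 1 +
  O(\<rho>^2). Needed for the circle direction, whose inverse metric contains 1/P.\<close>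

lemma square_lapse_tendsto:
  fixes h :: "real \<Rightarrow> real"
  assumes "((\<lambda>\<rho>. ((h \<rho>)\<^sup>2 / \<rho>\<^sup>2 - a\<^sup>2) / \<rho>) \<longlongrightarrow> 0) (at_right 0)"
  shows "((\<lambda>\<rho>. ((h \<rho>)\<^sup>2 / (b * lapse m \<rho>) / \<rho>\<^sup>2 - a\<^sup>2 / b) / \<rho>) \<longlongrightarrow> 0) (at_right 0)"
proof -
  have pos: "\<forall>\<^sub>F \<rho> in at_right 0. 0 < lapse m \<rho>"
    using order_tendstoD(1)[OF tendsto_lapse, of 0 m] by simp
  have 1: "((\<lambda>\<rho>. ((h \<rho>)\<^sup>2 / \<rho>\<^sup>2 - a\<^sup>2) / \<rho> / lapse m \<rho>) \<longlongrightarrow> 0) (at_right 0)"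
    using tendsto_divide[OF assms tendsto_lapse] by simp
  have "((\<lambda>\<rho>. 2 * m * \<rho>\<^sup>2 - \<rho>) \<longlongrightarrow> 0) (at_right 0)" by (auto intro!: tendsto_eq_intros)
  from tendsto_divide[OF this tendsto_lapse]
  have "((\<lambda>\<rho>. a\<^sup>2 / b * ((2 * m * \<rho>\<^sup>2 - \<rho>) / lapse m \<rho>)) \<longlongrightarrow> 0) (at_right 0)"
    by (intro tendsto_mult_right_zero) simp
  from tendsto_add[OF tendsto_mult_left_zero[OF 1, of "inverse b"] this]
  have "((\<lambda>\<rho>. ((h \<rho>)\<^sup>2 / \<rho>\<^sup>2 - a\<^sup>2) / \<rho> / lapse m \<rho> / b + a\<^sup>2 / b * ((2 * m * \<rho>\<^sup>2 - \<rho>) / lapse m \<rho>)) \<longlongrightarrow> 0) (at_right 0)"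
    by (simp add: divide_inverse mult.assoc)
  then show ?thesis
  proof (rule Lim_transform_eventually)
    have "\<forall>\<^sub>F \<rho> in at_right 0. (0::real) < \<rho>" by (rule eventually_at_right_less)
    with pos show "\<forall>\<^sub>F \<rho> in at_right 0. ((h \<rho>)\<^sup>2 / \<rho>\<^sup>2 - a\<^sup>2) / \<rho> / lapse m \<rho> / b + a\<^sup>2 / b * ((2 * m * \<rho>\<^sup>2 - \<rho>) / lapse m \<rho>)
      = ((h \<rho>)\<^sup>2 / (b * lapse m \<rho>) / \<rho>\<^sup>2 - a\<^sup>2 / b) / \<rho>"
    proof eventually_elim
      case (elim \<rho>)
      have l: "(2 * m * \<rho>\<^sup>2 - \<rho>) = (1 - lapse m \<rho>) / \<rho>"
        using elim(2) by (simp add: lapse_def field_simps power2_eq_square power3_eq_cube)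
      show ?case unfolding l using elim by (cases "b = 0") (simp_all add: field_simps)
    qed
  qed
qed

text \<open>Taking the logarithm of p\<rho> (1 + t) with t = O(\<rho>^2): the square of t is already
  O(\<rho>^4), so the expansion of t carries over unchanged. The coefficient mp/3 is f4/24 with f4 =
  8mp, and dividing by p leaves m/3. The constants depend only on the bounds p0 and K, which makes
  them uniform in the boundary point.\<close>

lemma log_expansion_estimate:
  fixes p0 K m :: real
  assumes "0 < p0" "0 < K"
  obtains \<delta> C where "0 < \<delta>"
    "\<And>p f3 F \<rho>. p0 \<le> p \<Longrightarrow> p \<le> K \<Longrightarrow> \<bar>f3\<bar> \<le> K \<Longrightarrow> 0 < \<rho> \<Longrightarrow> \<rho> < \<delta> \<Longrightarrow>
      \<bar>F - (p * \<rho> + f3 / 6 * \<rho> ^ 3 + m * p / 3 * \<rho> ^ 4)\<bar> \<le> K * \<rho> ^ 5 \<Longrightarrow>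
      \<bar>ln p\<bar> \<le> C \<and> \<bar>f3 / (6 * p)\<bar> \<le> C \<and> \<bar>ln (F / \<rho>) - ln p - (f3 / (6 * p) * \<rho>\<^sup>2 + m / 3 * \<rho> ^ 3)\<bar> \<le> C * \<rho> ^ 4"
proof -
  define k where "k = K / p0"
  define B where "B = k + \<bar>m\<bar> + k"
  define C where "C = \<bar>ln p0\<bar> + \<bar>ln K\<bar> + k + 2 * B\<^sup>2"
  \<comment> \<open>Guarantees |t| \<le> B\<rho>^2 \<le> 1/2, the range in which ln (1 + t) - t is
    bounded by 2t^2.\<close>
  define \<delta> where "\<delta> = min 1 (1 / (2 * B))"
  have k: "0 < k" using assms by (simp add: k_def)
  then have B: "0 < B" by (simp add: B_def)
  have \<delta>: "0 < \<delta>" "\<delta> \<le> 1" "\<delta> * B \<le> 1 / 2"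
    using B by (auto simp: \<delta>_def min_def field_simps)
  show thesis
  proof (rule that[OF \<delta>(1)])
    fix p f3 F \<rho> assume h: "p0 \<le> p" "p \<le> K" "\<bar>f3\<bar> \<le> K" "0 < \<rho>" "\<rho> < \<delta>"
      "\<bar>F - (p * \<rho> + f3 / 6 * \<rho> ^ 3 + m * p / 3 * \<rho> ^ 4)\<bar> \<le> K * \<rho> ^ 5"
    have p: "0 < p" using h assms by linarith
    have "ln p0 \<le> ln p" "ln p \<le> ln K" using h p assms by simp_all
    then have lp: "\<bar>ln p\<bar> \<le> \<bar>ln p0\<bar> + \<bar>ln K\<bar>" by linarith
    have Kp: "K / p \<le> k" unfolding k_def using h p assms by (intro divide_left_mono) auto
    have c2: "\<bar>f3 / (6 * p)\<bar> \<le> k"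
    proof -
      have "\<bar>f3 / (6 * p)\<bar> = \<bar>f3\<bar> / (6 * p)" using p by (simp add: abs_divide)
      also have "\<dots> \<le> K / p" using h p by (intro frac_le) auto
      finally show ?thesis using Kp by simp
    qed
    define e where "e = F / (p * \<rho>) - (1 + f3 / (6 * p) * \<rho>\<^sup>2 + m / 3 * \<rho> ^ 3)"
    have "e = (F - (p * \<rho> + f3 / 6 * \<rho> ^ 3 + m * p / 3 * \<rho> ^ 4)) / (p * \<rho>)"
      using p h(4) by (simp add: e_def field_simps eval_nat_numeral)
    then have "\<bar>e\<bar> = \<bar>F - (p * \<rho> + f3 / 6 * \<rho> ^ 3 + m * p / 3 * \<rho> ^ 4)\<bar> / (p * \<rho>)"
      using p h(4) by (simp add: abs_divide)
    also have "\<dots> \<le> K * \<rho> ^ 5 / (p * \<rho>)" using h p by (intro divide_right_mono) auto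
    also have "\<dots> = K / p * \<rho> ^ 4" using p h(4) by (simp add: field_simps eval_nat_numeral)
    also have "\<dots> \<le> k * \<rho> ^ 4" using Kp by (intro mult_right_mono) auto
    finally have e: "\<bar>e\<bar> \<le> k * \<rho> ^ 4" .
    define t where "t = f3 / (6 * p) * \<rho>\<^sup>2 + m / 3 * \<rho> ^ 3 + e"
    have \<rho>1: "\<rho> \<le> 1" using h \<delta> by linarith
    have pw: "\<rho> ^ 3 \<le> \<rho>\<^sup>2" "\<rho> ^ 4 \<le> \<rho>\<^sup>2" "\<rho>\<^sup>2 \<le> \<rho>"
      using h(4) \<rho>1 power_decreasing[of 2 3 \<rho>] power_decreasing[of 2 4 \<rho>] power_decreasing[of 1 2 \<rho>] by auto
    have tb: "\<bar>t\<bar> \<le> B * \<rho>\<^sup>2"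
    proof -
      have "\<bar>t\<bar> \<le> \<bar>f3 / (6 * p)\<bar> * \<rho>\<^sup>2 + \<bar>m\<bar> / 3 * \<rho> ^ 3 + \<bar>e\<bar>"
        unfolding t_def using h(4) by (intro order_trans[OF abs_triangle_ineq] add_mono) (auto simp: abs_mult)
      also have "\<dots> \<le> k * \<rho>\<^sup>2 + \<bar>m\<bar> * \<rho>\<^sup>2 + k * \<rho>\<^sup>2"
      proof (intro add_mono)
        show "\<bar>f3 / (6 * p)\<bar> * \<rho>\<^sup>2 \<le> k * \<rho>\<^sup>2" using c2 by (intro mult_right_mono) auto
        show "\<bar>m\<bar> / 3 * \<rho> ^ 3 \<le> \<bar>m\<bar> * \<rho>\<^sup>2" using pw h(4) by (intro mult_mono) auto
        show "\<bar>e\<bar> \<le> k * \<rho>\<^sup>2" using e pw(2) k by (meson mult_left_mono order_trans less_imp_le)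
      qed
      finally show ?thesis by (simp add: B_def algebra_simps)
    qed
    have "B * \<rho>\<^sup>2 \<le> B * \<delta>" using pw(3) h(5) B by (intro mult_left_mono) auto
    then have th: "\<bar>t\<bar> \<le> 1 / 2" using tb \<delta>(3) by (simp add: mult.commute)
    have F: "F / \<rho> = p * (1 + t)" using p h(4) by (simp add: t_def e_def field_simps)
    have "ln (F / \<rho>) = ln p + ln (1 + t)" unfolding F using p th by (intro ln_mult_pos) auto
    then have "\<bar>ln (F / \<rho>) - ln p - (f3 / (6 * p) * \<rho>\<^sup>2 + m / 3 * \<rho> ^ 3)\<bar> = \<bar>(ln (1 + t) - t) + e\<bar>"
      by (simp add: t_def)
    also have "\<dots> \<le> 2 * t\<^sup>2 + k * \<rho> ^ 4"
      using abs_ln_one_plus_x_minus_x_bound[OF th] e by linarith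
    also have "t\<^sup>2 \<le> (B * \<rho>\<^sup>2)\<^sup>2" using power_mono[OF tb abs_ge_zero, of 2] by simp
    finally have "\<bar>ln (F / \<rho>) - ln p - (f3 / (6 * p) * \<rho>\<^sup>2 + m / 3 * \<rho> ^ 3)\<bar> \<le> (2 * B\<^sup>2 + k) * \<rho> ^ 4"
      by (simp add: algebra_simps power_mult_distrib flip: power_mult)
    also have "\<dots> \<le> C * \<rho> ^ 4" by (intro mult_right_mono) (auto simp: C_def)
    finally have "\<bar>ln (F / \<rho>) - ln p - (f3 / (6 * p) * \<rho>\<^sup>2 + m / 3 * \<rho> ^ 3)\<bar> \<le> C * \<rho> ^ 4" .
    moreover have "\<bar>ln p\<bar> \<le> C" "\<bar>f3 / (6 * p)\<bar> \<le> C"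
      using lp c2 k zero_le_power2[of B] abs_ge_zero[of "ln p0"] abs_ge_zero[of "ln K"] unfolding C_def by linarith+
    ultimately show "\<bar>ln p\<bar> \<le> C \<and> \<bar>f3 / (6 * p)\<bar> \<le> C \<and> \<bar>ln (F / \<rho>) - ln p - (f3 / (6 * p) * \<rho>\<^sup>2 + m / 3 * \<rho> ^ 3)\<bar> \<le> C * \<rho> ^ 4"
      by blast
  qed
qed

abbreviation radial_deriv :: "(real \<times> 'a::real_normed_vector \<Rightarrow> real) \<Rightarrow> real \<times> 'a \<Rightarrow> real" where
  "radial_deriv f \<equiv> \<lambda>x. frechet_derivative f (at x) (1, 0)"

lemma radial_has_derivative:
  fixes f :: "real \<times> 'a::real_normed_vector \<Rightarrow> real"
  assumes "smooth_on f W" "(t, y) \<in> W"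
  shows "((\<lambda>t. f (t, y)) has_real_derivative radial_deriv f (t, y)) (at t)"
proof -
  have d: "(f has_derivative frechet_derivative f (at (t, y))) (at (t, y))" by (rule smooth_on_has_derivative[OF assms])
  have p: "((\<lambda>t. (t, y)) has_derivative (\<lambda>s. (s, 0))) (at t)"
    by (intro has_derivative_Pair has_derivative_ident has_derivative_const)
  have "frechet_derivative f (at (t, y)) (s, 0) = frechet_derivative f (at (t, y)) (1, 0) * s" for s
    using linear_scale[OF has_derivative_linear[OF d], of s "(1, 0)"] by simp
  then show ?thesis
    unfolding has_field_derivative_def by (intro has_derivative_eq_rhs[OF has_derivative_compose[OF p d]] ext)
qed

lemma tangential_derivative_zero:
  fixes f :: "real \<times> 'a::real_normed_vector \<Rightarrow> real"
  assumes "smooth_on f W" "(0, y) \<in> W" "cv 0 = y" "(cv has_vector_derivative v) (at 0)"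
    and "\<forall>\<^sub>F s in nhds 0. f (0, cv s) = 0"
  shows "frechet_derivative f (at (0, y)) (0, v) = 0"
proof -
  have d: "(f has_derivative frechet_derivative f (at (0, y))) (at (0, cv 0))"
    using smooth_on_has_derivative[OF assms(1,2)] assms(3) by simp
  have p: "((\<lambda>s. (0, cv s)) has_derivative (\<lambda>s. (0, s *\<^sub>R v))) (at 0)"
    using assms(4) unfolding has_vector_derivative_def by (intro has_derivative_Pair has_derivative_const)
  have "((\<lambda>s. f (0, cv s)) has_derivative (\<lambda>s. frechet_derivative f (at (0, y)) (0, s *\<^sub>R v))) (at 0)"
    by (rule has_derivative_compose[OF p d])
  moreover have "((\<lambda>s. f (0, cv s)) has_derivative (\<lambda>s. 0)) (at 0)"
    by (rule has_derivative_transform_eventually[OF has_derivative_const[of 0]])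
      (use assms(5) eventually_nhds_x_imp_x[OF assms(5)] in \<open>auto simp: eventually_at_filter elim: eventually_mono\<close>)
  ultimately have "(\<lambda>s. frechet_derivative f (at (0, y)) (0, s *\<^sub>R v)) = (\<lambda>s. 0)"
    by (rule has_derivative_unique)
  from fun_cong[OF this, of 1] show ?thesis by simp
qed

text \<open>The vector fields X i are a frame in which the tangential part of the equation is a sum
  of squares. Since f = 0 on the boundary, its tangential derivatives vanish there, so S =
  O(\<rho>^2) and \<open>second_coefficient\<close> gives a vanishing second radial derivative at
  all nearby boundary points. That in turn may be differentiated along the boundary: the tangential
  derivatives of f have no quadratic term in \<rho>, and \<open>fourth_coefficient\<close>
  applies.\<close>

lemma eikonal_local_expansion:
  fixes f :: "real \<times> 'a::real_normed_vector \<Rightarrow> real" and B :: "'a set" and m b r0 :: real and X :: "nat \<Rightarrow> 'a \<Rightarrow> 'a"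
  assumes W: "open W" and f: "smooth_on f W" and y0: "y0 \<in> B" "(0, y0) \<in> W"
    and zero: "\<And>y. y \<in> B \<Longrightarrow> (0, y) \<in> W \<Longrightarrow> f (0, y) = 0"
    and pos: "0 < radial_deriv f (0, y0)"
    and X: "\<And>i y. i \<le> 3 \<Longrightarrow> y \<in> B \<Longrightarrow> \<exists>cv. cv 0 = y \<and> (\<forall>\<^sub>F s in nhds 0. cv s \<in> B) \<and> (cv has_vector_derivative X i y) (at (0::real))"
    and r0: "0 < r0"
    and eik: "\<And>\<rho> y. 0 < \<rho> \<Longrightarrow> \<rho> < r0 \<Longrightarrow> y \<in> B \<Longrightarrow> (\<rho>, y) \<in> W \<Longrightarrow>
      lapse m \<rho> * (radial_deriv f (\<rho>, y))\<^sup>2 + ((frechet_derivative f (at (\<rho>, y)) (0, X 0 y))\<^sup>2 / (b * lapse m \<rho>)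
        + (frechet_derivative f (at (\<rho>, y)) (0, X 1 y))\<^sup>2 + (frechet_derivative f (at (\<rho>, y)) (0, X 2 y))\<^sup>2
        + (frechet_derivative f (at (\<rho>, y)) (0, X 3 y))\<^sup>2) = (f (\<rho>, y) / \<rho>)\<^sup>2"
  shows "\<exists>N \<delta> C. open N \<and> y0 \<in> N \<and> 0 < \<delta> \<and> (\<forall>y\<in>N \<inter> B. \<exists>l0 c2. \<bar>l0\<bar> \<le> C \<and> \<bar>c2\<bar> \<le> C \<and>
     (\<forall>\<rho>. 0 < \<rho> \<longrightarrow> \<rho> < \<delta> \<longrightarrow> \<bar>ln (f (\<rho>, y) / \<rho>) - l0 - (c2 * \<rho>\<^sup>2 + m / 3 * \<rho> ^ 3)\<bar> \<le> C * \<rho> ^ 4))"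
proof -
  define D where "D = (\<lambda>k. (radial_deriv ^^ k) f)"
  have D0: "D 0 = f" and DS: "D (Suc k) = radial_deriv (D k)" for k by (simp_all add: D_def)
  have sD: "smooth_on (D k) W" for k
  proof (induction k)
    case (Suc k)
    show ?case unfolding DS by (rule smooth_on_dir_deriv[OF Suc])
  qed (simp add: D0 f)
  define p0 where "p0 = D 1 (0, y0)"
  have p0: "0 < p0" using pos by (simp add: p0_def D_def)
  \<comment> \<open>Strict bounds at (0, y0) persist nearby by continuity, so one K serves a whole
    neighbourhood. Order 5 is the Taylor remainder of f that becomes O(\<rho>^4) after division by
    \<rho>.\<close>
  define K where "K = (\<Sum>k\<le>5. \<bar>D k (0, y0)\<bar>) + 1"
  have K: "\<bar>D k (0, y0)\<bar> < K" if "k \<le> 5" for k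
    using member_le_sum[of k "{..5}" "\<lambda>k. \<bar>D k (0, y0)\<bar>"] that by (simp add: K_def)
  then have Kpos: "0 < K" using K[of 0] by linarith
  have tD: "(D k \<longlongrightarrow> D k (0, y0)) (nhds (0, y0))" for k
    using smooth_on_imp_continuous_on[OF sD] W y0(2) continuous_on_eq_continuous_at tendsto_at_iff_tendsto_nhds isCont_def
    by (metis continuous_at)
  have "\<forall>\<^sub>F x in nhds (0, y0). x \<in> W \<and> p0 / 2 < D 1 x \<and> (\<forall>k\<in>{..5}. \<bar>D k x\<bar> < K)"
  proof (intro eventually_conj eventually_ball_finite ballI)
    show "\<forall>\<^sub>F x in nhds (0, y0). x \<in> W" using W y0(2) by (rule eventually_nhds_in_open)
    show "\<forall>\<^sub>F x in nhds (0, y0). p0 / 2 < D 1 x"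
      using order_tendstoD(1)[OF tD[of 1], of "p0 / 2"] p0 by (simp add: p0_def)
    show "\<forall>\<^sub>F x in nhds (0, y0). \<bar>D k x\<bar> < K" if "k \<in> {..5}" for k
      using order_tendstoD(2)[OF tendsto_rabs[OF tD[of k]]] K[of k] that by simp
  qed simp
  then obtain d where d: "0 < d" "\<And>x. dist x (0, y0) < d \<Longrightarrow> x \<in> W \<and> p0 / 2 < D 1 x \<and> (\<forall>k\<in>{..5}. \<bar>D k x\<bar> < K)"
    unfolding eventually_nhds_metric by blast
  define r where "r = min (d / 2) r0"
  have r: "0 < r" "r \<le> r0" using d r0 by (auto simp: r_def)
  define N where "N = ball y0 r"
  have N: "(t, y) \<in> W" "p0 / 2 < D 1 (t, y)" "\<And>k. k \<le> 5 \<Longrightarrow> \<bar>D k (t, y)\<bar> < K" if "\<bar>t\<bar> < r" "y \<in> N" for t y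
  proof -
    have "dist (t, y) (0, y0) \<le> \<bar>t\<bar> + dist y y0"
      unfolding dist_Pair_Pair using sqrt_sum_squares_le_sum_abs[of "dist t 0" "dist y y0"] by (simp add: dist_real_def)
    also have "\<dots> < d" using that by (auto simp: N_def r_def dist_commute)
    finally show "(t, y) \<in> W" "p0 / 2 < D 1 (t, y)" "\<And>k. k \<le> 5 \<Longrightarrow> \<bar>D k (t, y)\<bar> < K" using d(2)[of "(t, y)"] by auto
  qed
  have rad: "((\<lambda>t. D k (t, y)) has_real_derivative D (Suc k) (t, y)) (at t)" if "\<bar>t\<bar> < r" "y \<in> N" for k t y
    unfolding DS by (rule radial_has_derivative[OF sD N(1)[OF that]])
  define T where "T = (\<lambda>k v x. frechet_derivative (D k) (at x) (0, v))"
  have sT: "smooth_on (T k v) W" for k v unfolding T_def by (rule smooth_on_dir_deriv[OF sD])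
  \<comment> \<open>T k v is the derivative along v of the k-th radial derivative; by symmetry of
    second derivatives the radial derivative of T k v is T (k+1) v.\<close>
  have radT: "((\<lambda>t. T k v (t, y)) has_real_derivative T (Suc k) v (t, y)) (at t)" if "\<bar>t\<bar> < r" "y \<in> N" for k v t y
  proof -
    have "radial_deriv (T k v) (t, y) = T (Suc k) v (t, y)"
      unfolding T_def DS by (rule smooth_on_symmetric[OF W sD N(1)[OF that]])
    then show ?thesis using radial_has_derivative[OF sT N(1)[OF that], of k v] by simp
  qed
  \<comment> \<open>This bound may depend on y and v: it is used only for limits over a fixed
    boundary point, unlike the bounds on \<open>D\<close>, which enter the final constant.\<close>
  have T_bound: "\<exists>L. \<forall>t. 0 \<le> t \<longrightarrow> t \<le> r / 2 \<longrightarrow> \<bar>T k v (t, y)\<bar> \<le> L" if "y \<in> N" for k v y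
  proof -
    have "continuous_on {0..r/2} (\<lambda>t. T k v (t, y))"
    proof (intro continuous_at_imp_continuous_on ballI)
      fix t assume "t \<in> {0..r/2}"
      then have "\<bar>t\<bar> < r" using r by auto
      then show "isCont (\<lambda>t. T k v (t, y)) t" by (rule DERIV_isCont[OF radT[OF _ that]])
    qed
    from compact_imp_bounded[OF compact_continuous_image[OF this compact_Icc]]
    obtain L where "\<forall>x\<in>(\<lambda>t. T k v (t, y)) ` {0..r/2}. norm x \<le> L" unfolding bounded_iff ..
    then show ?thesis by (intro exI[of _ L]) simp
  qed
  have T0: "T k (X i y) (0, y) = 0" if i: "i \<le> 3" and y: "y \<in> N" "y \<in> B" and k: "\<And>z. z \<in> N \<Longrightarrow> z \<in> B \<Longrightarrow> D k (0, z) = 0" for k i y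
  proof -
    obtain cv where cv: "cv 0 = y" "\<forall>\<^sub>F s in nhds 0. cv s \<in> B" "(cv has_vector_derivative X i y) (at (0::real))"
      using X[OF i y(2)] by blast
    have "isCont cv 0" using cv(3) has_vector_derivative_continuous by blast
    then have "(cv \<longlongrightarrow> y) (nhds 0)" using cv(1) by (metis isCont_def tendsto_at_iff_tendsto_nhds)
    then have "\<forall>\<^sub>F s in nhds 0. cv s \<in> N"
      by (rule topological_tendstoD) (use y in \<open>auto simp: N_def\<close>)
    with cv(2) have "\<forall>\<^sub>F s in nhds 0. D k (0, cv s) = 0" by eventually_elim (use k in auto)
    then show ?thesis unfolding T_def
      by (intro tangential_derivative_zero[OF sD N(1) cv(1,3)]) (use r y in auto)
  qed
  have Dzero: "D 0 (0, z) = 0" if "z \<in> N" "z \<in> B" for z using zero[OF that(2)] N(1)[of 0 z] that r by (simp add: D0)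
  have F: "\<bar>f (\<rho>, y) - (D 1 (0, y) * \<rho> + D 2 (0, y) / 2 * \<rho>\<^sup>2 + D 3 (0, y) / 6 * \<rho> ^ 3 + D 4 (0, y) / 24 * \<rho> ^ 4)\<bar> \<le> K * \<rho> ^ 5"
    if "0 < \<rho>" "\<rho> < r" "y \<in> N" "y \<in> B" for \<rho> y
  proof -
    have "\<bar>D 0 (\<rho>, y) - (\<Sum>k<5. D k (0, y) / fact k * \<rho> ^ k)\<bar> \<le> K * \<rho> ^ 5"
      by (rule taylor_bound[of \<rho> 5 "\<lambda>k t. D k (t, y)"]) (use that rad N(3)[of _ y 5] in \<open>auto simp: less_imp_le\<close>)
    then show ?thesis using Dzero[OF that(3,4)] by (simp add: D0 eval_nat_numeral lessThan_Suc algebra_simps)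
  qed
  have F1: "\<bar>D 1 (\<rho>, y) - (D 1 (0, y) + D 2 (0, y) * \<rho> + D 3 (0, y) / 2 * \<rho>\<^sup>2 + D 4 (0, y) / 6 * \<rho> ^ 3)\<bar> \<le> K * \<rho> ^ 4"
    if "0 < \<rho>" "\<rho> < r" "y \<in> N" for \<rho> y
  proof -
    have "\<bar>D (Suc 0) (\<rho>, y) - (\<Sum>k<4. D (Suc k) (0, y) / fact k * \<rho> ^ k)\<bar> \<le> K * \<rho> ^ 4"
      by (rule taylor_bound[of \<rho> 4 "\<lambda>k t. D (Suc k) (t, y)"]) (use that rad N(3)[of _ y 5] in \<open>auto simp: less_imp_le\<close>)
    then show ?thesis by (simp add: eval_nat_numeral lessThan_Suc algebra_simps)
  qed
  define S where "S = (\<lambda>y \<rho>. (T 0 (X 0 y) (\<rho>, y))\<^sup>2 / (b * lapse m \<rho>) + (T 0 (X 1 y) (\<rho>, y))\<^sup>2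
     + (T 0 (X 2 y) (\<rho>, y))\<^sup>2 + (T 0 (X 3 y) (\<rho>, y))\<^sup>2)"
  have eik': "lapse m \<rho> * (D 1 (\<rho>, y))\<^sup>2 + S y \<rho> = (f (\<rho>, y) / \<rho>)\<^sup>2" if "0 < \<rho>" "\<rho> < r" "y \<in> N" "y \<in> B" for \<rho> y
    using eik[of \<rho> y] N(1)[of \<rho> y] that r by (simp add: S_def T_def D_def)
  have ppos: "0 < D 1 (0, y)" if "y \<in> N" for y using N(2)[of 0 y] that r p0 by linarith
  have D2: "D 2 (0, y) = 0" if y: "y \<in> N" "y \<in> B" for y
  proof (rule second_coefficient[OF r(1) ppos[OF y(1)] F[OF _ _ y] F1[OF _ _ y(1)] eik'[OF _ _ y]])
    have lin: "((\<lambda>\<rho>. (T 0 (X i y) (\<rho>, y))\<^sup>2 / \<rho>) \<longlongrightarrow> 0) (at_right 0)" if i: "i \<le> 3" for i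
    proof -
      obtain L where L: "\<And>t. 0 \<le> t \<Longrightarrow> t \<le> r / 2 \<Longrightarrow> \<bar>T 1 (X i y) (t, y)\<bar> \<le> L" using T_bound[OF y(1)] by blast
      show ?thesis
      proof (rule tendsto_0_of_bound[of "r / 2" _ "L\<^sup>2"])
        fix \<rho> assume \<rho>: "0 < \<rho>" "\<rho> < r / 2"
        have "\<bar>T 0 (X i y) (\<rho>, y) - (\<Sum>k<1. T k (X i y) (0, y) / fact k * \<rho> ^ k)\<bar> \<le> L * \<rho> ^ 1"
          by (rule taylor_bound[of \<rho> 1 "\<lambda>k t. T k (X i y) (t, y)"]) (use \<rho> radT y L r in auto)
        then have "\<bar>T 0 (X i y) (\<rho>, y)\<bar> \<le> L * \<rho>" using T0[OF i y Dzero] by simp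
        from power_mono[OF this abs_ge_zero, of 2] show "\<bar>(T 0 (X i y) (\<rho>, y))\<^sup>2 / \<rho>\<bar> \<le> L\<^sup>2 * \<rho>"
          using \<rho> by (simp add: divide_le_eq power_mult_distrib power2_eq_square mult_ac)
      qed (use r in simp)
    qed
    have "((\<lambda>\<rho>. (T 0 (X 0 y) (\<rho>, y))\<^sup>2 / \<rho> / lapse m \<rho>) \<longlongrightarrow> 0) (at_right 0)"
      using tendsto_divide[OF lin[of 0] tendsto_lapse[of m]] by simp
    from tendsto_mult_left_zero[OF this, of "inverse b"]
    have "((\<lambda>\<rho>. (T 0 (X 0 y) (\<rho>, y))\<^sup>2 / (b * lapse m \<rho>) / \<rho>) \<longlongrightarrow> 0) (at_right 0)"
      by (simp add: divide_inverse mult_ac)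
    from tendsto_add[OF tendsto_add[OF tendsto_add[OF this lin[of 1]] lin[of 2]] lin[of 3]]
    show "((\<lambda>\<rho>. S y \<rho> / \<rho>) \<longlongrightarrow> 0) (at_right 0)" by (simp add: S_def add_divide_distrib)
  qed
  have D4: "D 4 (0, y) = 8 * m * D 1 (0, y)" if y: "y \<in> N" "y \<in> B" for y
  proof (rule fourth_coefficient[OF r(1) ppos[OF y(1)] F[OF _ _ y] F1[OF _ _ y(1)] eik'[OF _ _ y] D2[OF y]])
    have sq: "((\<lambda>\<rho>. ((T 0 (X i y) (\<rho>, y))\<^sup>2 / \<rho>\<^sup>2 - (T 1 (X i y) (0, y))\<^sup>2) / \<rho>) \<longlongrightarrow> 0) (at_right 0)" if i: "i \<le> 3" for i
    proof -
      obtain L where L: "\<And>t. 0 \<le> t \<Longrightarrow> t \<le> r / 2 \<Longrightarrow> \<bar>T 3 (X i y) (t, y)\<bar> \<le> L" using T_bound[OF y(1)] by blast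
      show ?thesis
      proof (rule square_tendsto[of "r / 2" _ _ L])
        fix \<rho> assume \<rho>: "0 < \<rho>" "\<rho> < r / 2"
        have "\<bar>T 0 (X i y) (\<rho>, y) - (\<Sum>k<3. T k (X i y) (0, y) / fact k * \<rho> ^ k)\<bar> \<le> L * \<rho> ^ 3"
          by (rule taylor_bound[of \<rho> 3 "\<lambda>k t. T k (X i y) (t, y)"]) (use \<rho> radT y L r in auto)
        then show "\<bar>T 0 (X i y) (\<rho>, y) - T 1 (X i y) (0, y) * \<rho>\<bar> \<le> L * \<rho> ^ 3"
          using T0[OF i y Dzero] T0[OF i y D2] by (simp add: eval_nat_numeral lessThan_Suc)
      qed (use r in simp)
    qed
    have s: "((a1 / \<rho>\<^sup>2 - A1) / \<rho> + (a2 / \<rho>\<^sup>2 - A2) / \<rho> + (a3 / \<rho>\<^sup>2 - A3) / \<rho> + (a4 / \<rho>\<^sup>2 - A4) / \<rho>)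
      = ((a1 + a2 + a3 + a4) / \<rho>\<^sup>2 - (A1 + A2 + A3 + A4)) / \<rho>" for a1 a2 a3 a4 A1 A2 A3 A4 \<rho> :: real
      by (simp add: add_divide_distrib diff_divide_distrib)
    from tendsto_add[OF tendsto_add[OF tendsto_add[OF square_lapse_tendsto[OF sq[of 0]] sq[of 1]] sq[of 2]] sq[of 3]]
    show "((\<lambda>\<rho>. (S y \<rho> / \<rho>\<^sup>2 - ((T 1 (X 0 y) (0, y))\<^sup>2 / b + (T 1 (X 1 y) (0, y))\<^sup>2 + (T 1 (X 2 y) (0, y))\<^sup>2
        + (T 1 (X 3 y) (0, y))\<^sup>2)) / \<rho>) \<longlongrightarrow> 0) (at_right 0)"
      unfolding s by (simp add: S_def)
  qed
  obtain \<delta> C where \<delta>: "0 < \<delta>" and est: "\<And>p f3 F \<rho>. p0 / 2 \<le> p \<Longrightarrow> p \<le> K \<Longrightarrow> \<bar>f3\<bar> \<le> K \<Longrightarrow> 0 < \<rho> \<Longrightarrow> \<rho> < \<delta> \<Longrightarrow>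
      \<bar>F - (p * \<rho> + f3 / 6 * \<rho> ^ 3 + m * p / 3 * \<rho> ^ 4)\<bar> \<le> K * \<rho> ^ 5 \<Longrightarrow>
      \<bar>ln p\<bar> \<le> C \<and> \<bar>f3 / (6 * p)\<bar> \<le> C \<and> \<bar>ln (F / \<rho>) - ln p - (f3 / (6 * p) * \<rho>\<^sup>2 + m / 3 * \<rho> ^ 3)\<bar> \<le> C * \<rho> ^ 4"
    using log_expansion_estimate[of "p0 / 2" K m] p0 Kpos by (metis half_gt_zero)
  have main: "\<bar>ln (D 1 (0, y))\<bar> \<le> C \<and> \<bar>D 3 (0, y) / (6 * D 1 (0, y))\<bar> \<le> C \<and>
     \<bar>ln (f (\<rho>, y) / \<rho>) - ln (D 1 (0, y)) - (D 3 (0, y) / (6 * D 1 (0, y)) * \<rho>\<^sup>2 + m / 3 * \<rho> ^ 3)\<bar> \<le> C * \<rho> ^ 4"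
    if y: "y \<in> N" "y \<in> B" and \<rho>: "0 < \<rho>" "\<rho> < min \<delta> r" for y \<rho>
  proof -
    have b: "p0 / 2 \<le> D 1 (0, y)" "D 1 (0, y) \<le> K" "\<bar>D 3 (0, y)\<bar> \<le> K"
      using N(2)[of 0 y] N(3)[of 0 y 1] N(3)[of 0 y 3] y r by auto
    have "\<bar>f (\<rho>, y) - (D 1 (0, y) * \<rho> + D 3 (0, y) / 6 * \<rho> ^ 3 + m * D 1 (0, y) / 3 * \<rho> ^ 4)\<bar> \<le> K * \<rho> ^ 5"
      using F[of \<rho> y] y \<rho> by (simp add: D2[OF y] D4[OF y])
    from est[OF b \<rho>(1) _ this] show ?thesis using \<rho>(2) by simp
  qed
  have "\<forall>y\<in>N \<inter> B. \<exists>l0 c2. \<bar>l0\<bar> \<le> C \<and> \<bar>c2\<bar> \<le> C \<and>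
      (\<forall>\<rho>. 0 < \<rho> \<longrightarrow> \<rho> < min \<delta> r \<longrightarrow> \<bar>ln (f (\<rho>, y) / \<rho>) - l0 - (c2 * \<rho>\<^sup>2 + m / 3 * \<rho> ^ 3)\<bar> \<le> C * \<rho> ^ 4)"
  proof
    fix y assume y: "y \<in> N \<inter> B"
    define \<rho> where "\<rho> = min \<delta> r / 2"
    have "0 < \<rho>" "\<rho> < min \<delta> r" using r \<delta> by (auto simp: \<rho>_def)
    with main[of y \<rho>] main[of y] y show "\<exists>l0 c2. \<bar>l0\<bar> \<le> C \<and> \<bar>c2\<bar> \<le> C \<and>
      (\<forall>\<rho>. 0 < \<rho> \<longrightarrow> \<rho> < min \<delta> r \<longrightarrow> \<bar>ln (f (\<rho>, y) / \<rho>) - l0 - (c2 * \<rho>\<^sup>2 + m / 3 * \<rho> ^ 3)\<bar> \<le> C * \<rho> ^ 4)"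
      by (intro exI[of _ "ln (D 1 (0, y))"] exI[of _ "D 3 (0, y) / (6 * D 1 (0, y))"]) simp
  qed
  moreover have "open N" "y0 \<in> N" "0 < min \<delta> r" using r \<delta> by (auto simp: N_def)
  ultimately show ?thesis by blast
qed

section \<open>From the normal form in a collar to the eikonal equation\<close>

subsection \<open>The eikonal equation for special boundary defining functions\<close>

definition rot90 :: "real^2 \<Rightarrow> real^2" where
  "rot90 w = vector [- w $ 2, w $ 1]"

text \<open>The angular field on the circle and the three rotation fields on the sphere: as a tight frame they
  recover the norm of the differential without local coordinates.\<close>

definition frame :: "nat \<Rightarrow> R32 \<Rightarrow> R32" where
  "frame i y = (if i = 0 then (0, rot90 (snd y)) else if i = 1 then (vector [0, - fst y $ 3, fst y $ 2], 0)
     else if i = 2 then (vector [fst y $ 3, 0, - fst y $ 1], 0) else (vector [- fst y $ 2, fst y $ 1, 0], 0))"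

lemma tangent_frame: "tangent_bdry y (frame i y)"
  by (simp add: tangent_bdry_def frame_def rot90_def inner3 inner2)

text \<open>The three vectors are the cross products of the coordinate axes with u, so the sum is
  the squared length of the cross product of u and x, and Lagrange's identity evaluates it.\<close>

lemma lagrange_identity3:
  fixes u x :: "real^3"
  assumes "u \<bullet> u = 1" "u \<bullet> x = 0"
  shows "(x \<bullet> vector [0, - u $ 3, u $ 2])\<^sup>2 + (x \<bullet> vector [u $ 3, 0, - u $ 1])\<^sup>2 + (x \<bullet> vector [- u $ 2, u $ 1, 0])\<^sup>2 = x \<bullet> x"
proof -
  have "(x \<bullet> vector [0, - u $ 3, u $ 2])\<^sup>2 + (x \<bullet> vector [u $ 3, 0, - u $ 1])\<^sup>2 + (x \<bullet> vector [- u $ 2, u $ 1, 0])\<^sup>2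
    = (u \<bullet> u) * (x \<bullet> x) - (u \<bullet> x)\<^sup>2"
    by (simp add: inner3 power2_eq_square algebra_simps)
  then show ?thesis using assms by simp
qed

text \<open>Parseval's identity for the frame. The circle field has squared length b^2 P, hence the
  divisor in the first term; the rotation fields need none.\<close>

lemma eikonal_frame:
  assumes y: "y \<in> bdry" and v: "tangent_bdry y v" and P: "0 < P" and \<beta>: "0 < \<beta>"
  defines "b \<equiv> \<beta> / (2 * pi)"
  shows "(bdry_metric \<beta> P y v (frame 0 y))\<^sup>2 / (b\<^sup>2 * P) + (bdry_metric \<beta> P y v (frame 1 y))\<^sup>2
    + (bdry_metric \<beta> P y v (frame 2 y))\<^sup>2 + (bdry_metric \<beta> P y v (frame 3 y))\<^sup>2 = bdry_metric \<beta> P y v v"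
proof -
  let ?w = "snd y" and ?u = "fst y"
  have n: "norm ?w = 1" "?w \<bullet> ?w = 1" "?u \<bullet> ?u = 1" using y by (auto simp: bdry_def norm_1_iff)
  have d0: "dtau \<beta> ?w 0 = 0" by (simp add: dtau_def)
  have dJ: "dtau \<beta> ?w (rot90 ?w) = b" using n by (simp add: dtau_def rot90_def inner2 b_def)
  have b: "b > 0" using \<beta> by (simp add: b_def)
  have "(bdry_metric \<beta> P y v (frame 0 y))\<^sup>2 / (b\<^sup>2 * P) = P * (dtau \<beta> ?w (snd v))\<^sup>2"
    using P b by (simp add: bdry_metric_def frame_def dJ power2_eq_square)
  moreover have "(bdry_metric \<beta> P y v (frame 1 y))\<^sup>2 + (bdry_metric \<beta> P y v (frame 2 y))\<^sup>2
      + (bdry_metric \<beta> P y v (frame 3 y))\<^sup>2 = fst v \<bullet> fst v"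
    using lagrange_identity3[OF n(3)] v by (simp add: bdry_metric_def frame_def d0 tangent_bdry_def)
  ultimately show ?thesis by (simp add: bdry_metric_def power2_eq_square)
qed

text \<open>Normalizing the line y + sv in both factors gives a curve in the boundary with velocity
  v, because for tangential v the norms change only to second order.\<close>

lemma bdry_curve:
  assumes y: "y \<in> bdry" and v: "tangent_bdry y v"
  shows "\<exists>cv. cv 0 = y \<and> (\<forall>\<^sub>F s in nhds 0. cv s \<in> bdry) \<and> (cv has_vector_derivative v) (at (0::real))"
proof (intro exI conjI)
  let ?cv = "\<lambda>s::real. directions (y + s *\<^sub>R v)"
  have oc: "y \<in> off_core" using y bdry_subset_off_core by blast
  show "?cv 0 = y" using directions_bdry[OF y] by simp
  have l: "((\<lambda>s::real. y + s *\<^sub>R v) \<longlongrightarrow> y) (nhds 0)"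
    by (auto intro!: tendsto_eq_intros filterlim_ident)
  have "\<forall>\<^sub>F s in nhds 0. y + s *\<^sub>R v \<in> off_core"
    by (rule topological_tendstoD[OF l open_off_core oc])
  then show "\<forall>\<^sub>F s in nhds 0. ?cv s \<in> bdry" by eventually_elim (rule directions_mem_bdry)
  have sg: "((\<lambda>s::real. sgn (a + s *\<^sub>R c)) has_vector_derivative c) (at 0)"
    if "a \<bullet> a = 1" "a \<bullet> c = 0" for a c :: "'b::real_inner"
  proof -
    have n: "((\<lambda>s::real. (a + s *\<^sub>R c) \<bullet> (a + s *\<^sub>R c)) has_real_derivative 0) (at 0)"
      using that by (auto intro!: derivative_eq_intros simp: inner_add_left inner_add_right inner_commute)
    have "((\<lambda>s::real. inverse (sqrt ((a + s *\<^sub>R c) \<bullet> (a + s *\<^sub>R c)))) has_real_derivative 0) (at 0)"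
      using that by (auto intro!: derivative_eq_intros n)
    moreover have "((\<lambda>s::real. a + s *\<^sub>R c) has_vector_derivative c) (at 0)"
      by (auto intro!: derivative_eq_intros)
    ultimately have "((\<lambda>s::real. inverse (sqrt ((a + s *\<^sub>R c) \<bullet> (a + s *\<^sub>R c))) *\<^sub>R (a + s *\<^sub>R c)) has_vector_derivative
        inverse (sqrt ((a + 0 *\<^sub>R c) \<bullet> (a + 0 *\<^sub>R c))) *\<^sub>R c + 0 *\<^sub>R (a + 0 *\<^sub>R c)) (at 0)"
      by (rule has_vector_derivative_scaleR)
    then show ?thesis using that by (simp add: sgn_div_norm norm_eq_sqrt_inner)
  qed
  have n: "fst y \<bullet> fst y = 1" "snd y \<bullet> snd y = 1" using y by (auto simp: bdry_def norm_1_iff)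
  have "((\<lambda>s. (sgn (fst y + s *\<^sub>R fst v), sgn (snd y + s *\<^sub>R snd v))) has_vector_derivative (fst v, snd v)) (at (0::real))"
    by (rule has_vector_derivative_Pair[OF sg[OF n(1)] sg[OF n(2)]]) (use v in \<open>auto simp: tangent_bdry_def\<close>)
  then show "(?cv has_vector_derivative v) (at 0)" by (simp add: directions_def)
qed

lemma tangent_space_bdry:
  assumes "v \<in> tangent_space bdry y"
  shows "tangent_bdry y v"
proof -
  obtain cv :: "real \<Rightarrow> R32" where cv: "cv 0 = y" "\<forall>\<^sub>F t in nhds 0. cv t \<in> bdry" "(cv has_vector_derivative v) (at 0)"
    using assms unfolding tangent_space_def by blast
  have orth: "h 0 \<bullet> d = 0" if h: "\<forall>\<^sub>F t in nhds 0. h t \<bullet> h t = 1" "(h has_vector_derivative d) (at 0)" for h :: "real \<Rightarrow> 'b::real_inner" and d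
  proof -
    have "((\<lambda>t. h t \<bullet> h t) has_derivative (\<lambda>s. h 0 \<bullet> s *\<^sub>R d + s *\<^sub>R d \<bullet> h 0)) (at 0)"
      using h(2) unfolding has_vector_derivative_def by (intro has_derivative_inner)
    moreover have "((\<lambda>t. h t \<bullet> h t) has_derivative (\<lambda>s. 0)) (at 0)"
      by (rule has_derivative_transform_eventually[OF has_derivative_const[of 1]])
        (use h(1) eventually_nhds_x_imp_x[OF h(1)] in \<open>auto simp: eventually_at_filter elim: eventually_mono\<close>)
    ultimately have "(\<lambda>s. h 0 \<bullet> s *\<^sub>R d + s *\<^sub>R d \<bullet> h 0) = (\<lambda>s. 0)" by (rule has_derivative_unique)
    from fun_cong[OF this, of 1] show ?thesis by (simp add: inner_commute)
  qed
  have d: "((\<lambda>t. fst (cv t)) has_vector_derivative fst v) (at 0)" "((\<lambda>t. snd (cv t)) has_vector_derivative snd v) (at 0)"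
    by (rule bounded_linear.has_vector_derivative[OF bounded_linear_fst cv(3)],
        rule bounded_linear.has_vector_derivative[OF bounded_linear_snd cv(3)])
  have "\<forall>\<^sub>F t in nhds 0. fst (cv t) \<bullet> fst (cv t) = 1" "\<forall>\<^sub>F t in nhds 0. snd (cv t) \<bullet> snd (cv t) = 1"
    using cv(2) by (auto elim!: eventually_mono simp: bdry_def norm_1_iff)
  from orth[OF this(1) d(1)] orth[OF this(2) d(2)] show ?thesis
    using cv(1) by (simp add: tangent_bdry_def)
qed

lemma zero_mem_tangent_space: "y \<in> B \<Longrightarrow> 0 \<in> tangent_space B y"
  unfolding tangent_space_def by (auto intro!: exI[of _ "\<lambda>_. y"])

lemma eventually_nhds_of_tendsto:
  fixes c :: "real \<Rightarrow> 'a::real_normed_vector"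
  assumes "(c has_vector_derivative d) (at 0)" "open U" "c 0 \<in> U"
  shows "\<forall>\<^sub>F s in nhds 0. c s \<in> U"
proof -
  have "isCont c 0" using assms(1) has_vector_derivative_continuous by blast
  then have "(c \<longlongrightarrow> c 0) (nhds 0)" by (metis isCont_def tendsto_at_iff_tendsto_nhds)
  then show ?thesis using assms(2,3) by (rule topological_tendstoD)
qed

lemma has_vector_derivative_chain:
  assumes "(c has_vector_derivative d) (at 0)" "(F has_derivative F') (at (c 0))"
  shows "((\<lambda>s. F (c s)) has_vector_derivative F' d) (at (0::real))"
proof -
  have c: "(c has_derivative (\<lambda>s. s *\<^sub>R d)) (at 0)" using assms(1) unfolding has_vector_derivative_def .
  have "((\<lambda>s. F (c s)) has_derivative (\<lambda>s. F' (s *\<^sub>R d))) (at 0)"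
    by (rule has_derivative_compose[OF c assms(2)])
  then show ?thesis
    unfolding has_vector_derivative_def using linear_scale[OF has_derivative_linear[OF assms(2)]] by simp
qed

lemma has_vector_derivative_cong_nhds:
  assumes "(c has_vector_derivative d) (at 0)" "\<forall>\<^sub>F s in nhds 0. c s = e s"
  shows "(e has_vector_derivative d) (at (0::real))"
  using assms(1) unfolding has_vector_derivative_def
  by (rule has_derivative_transform_eventually)
    (use assms(2) eventually_nhds_x_imp_x[OF assms(2)] in \<open>auto simp: eventually_at_filter elim: eventually_mono\<close>)

text \<open>An arbitrary special boundary defining function, with the collar \<Phi> and the slice
  metrics h from its definition fixed.\<close>

locale ah_end_bdf = ah_end +
  fixes x :: "R32 \<Rightarrow> real" and \<epsilon> :: real and \<Phi> :: "real \<times> R32 \<Rightarrow> R32" and h :: "real \<Rightarrow> R32 metric_field" and C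
  defines "C \<equiv> {0..<\<epsilon>} \<times> bdry"
  assumes x: "smooth_map (closure M) x" "\<And>p. p \<in> M \<Longrightarrow> 0 < x p" "\<And>p. p \<in> bdry \<Longrightarrow> x p = 0"
    and \<epsilon>: "0 < \<epsilon>" and \<Phi>: "smooth_map C \<Phi>" "inj_on \<Phi> C" "openin (top_of_set (closure M)) (\<Phi> ` C)"
    and \<Psi>: "smooth_map (\<Phi> ` C) (the_inv_into C \<Phi>)"
    and \<Phi>0: "\<And>y. y \<in> bdry \<Longrightarrow> \<Phi> (0, y) = y"
    and x\<Phi>: "\<And>t y. t \<in> {0..<\<epsilon>} \<Longrightarrow> y \<in> bdry \<Longrightarrow> x (\<Phi> (t, y)) = t"
    and h: "\<And>t y. t \<in> {0..<\<epsilon>} \<Longrightarrow> y \<in> bdry \<Longrightarrow> bilinear (h t y)"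
    and normal_form: "\<And>t y D s s' v v'. t \<in> {0<..<\<epsilon>} \<Longrightarrow> y \<in> bdry \<Longrightarrow> (\<Phi> has_derivative D) (at (t, y) within C) \<Longrightarrow>
        v \<in> tangent_space bdry y \<Longrightarrow> v' \<in> tangent_space bdry y \<Longrightarrow>
        g (\<Phi> (t, y)) (D (s, v)) (D (s', v')) = (s * s' + h t y v v') / t\<^sup>2"
begin

lemma collar_sub: "\<Phi> ` C \<subseteq> closure M" using \<Phi>(3) unfolding openin_open by blast

text \<open>With \<open>T = D (1, 0)\<close> one has \<open>g (T, W) = dx (W) / x\<^sup>2\<close> for all tangent vectors \<open>W\<close>: the collar is the
  flow of the gradient of \<open>x\<close>.\<close>

lemma gradient:
  assumes \<rho>: "\<rho> \<in> I" and y: "y \<in> bdry" and p: "emb \<rho> y \<in> \<Phi> ` C"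
    and U: "open U" "emb \<rho> y \<in> U" "smooth_on X U" "\<And>q. q \<in> U \<inter> closure M \<Longrightarrow> X q = x q"
  obtains s0 v0 where "tangent_bdry y v0"
    "(s0 * s0 / lapse m \<rho> + bdry_metric \<beta> (lapse m \<rho>) y v0 v0) / \<rho>\<^sup>2 = 1 / (x (emb \<rho> y))\<^sup>2"
    "\<And>s v. tangent_bdry y v \<Longrightarrow> frechet_derivative X (at (emb \<rho> y)) (demb \<rho> y s v)
        = (x (emb \<rho> y))\<^sup>2 * ((s0 * s / lapse m \<rho> + bdry_metric \<beta> (lapse m \<rho>) y v0 v) / \<rho>\<^sup>2)"
proof -
  let ?p = "emb \<rho> y"
  have pM: "?p \<in> M" by (rule emb_mem[OF \<rho> y])
  obtain t y' where ty: "t \<in> {0..<\<epsilon>}" "y' \<in> bdry" "\<Phi> (t, y') = ?p" using p by (auto simp: C_def)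
  have xt: "x ?p = t" using x\<Phi>[OF ty(1,2)] ty(3) by simp
  have t: "0 < t" "t < \<epsilon>" using x(2)[OF pM] xt ty(1) by auto
  have tyC: "(t, y') \<in> C" using ty by (simp add: C_def)
  obtain U1 F where F: "open U1" "(t, y') \<in> U1" "smooth_on F U1" "\<And>q. q \<in> U1 \<inter> C \<Longrightarrow> F q = \<Phi> q"
    using \<Phi>(1) tyC unfolding smooth_map_def by meson
  define D where "D = frechet_derivative F (at (t, y'))"
  have dF: "(F has_derivative D) (at (t, y'))" unfolding D_def by (rule smooth_on_has_derivative[OF F(3,2)])
  obtain d where d: "0 < d" "ball (t, y') d \<subseteq> U1" using F(1,2) openE by blast
  have dP: "(\<Phi> has_derivative D) (at (t, y') within C)"
    by (rule has_derivative_transform_within[OF has_derivative_at_withinI[OF dF] d(1) tyC])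
      (use F(4) d(2) in \<open>auto simp: dist_commute\<close>)
  obtain U2 H where H: "open U2" "?p \<in> U2" "smooth_on H U2" "\<And>q. q \<in> U2 \<inter> \<Phi> ` C \<Longrightarrow> H q = the_inv_into C \<Phi> q"
    using \<Psi> p unfolding smooth_map_def by meson
  obtain O3 where O3: "open O3" "\<Phi> ` C = closure M \<inter> O3" using \<Phi>(3) by (auto simp: openin_open)
  have Hp: "H ?p = (t, y')"
    using H(4)[of ?p] H(2) p the_inv_into_f_f[OF \<Phi>(2) tyC] ty(3) by simp
  \<comment> \<open>Every vector tangent to M at this point is the image under D of some (s', v')
    with v' tangent to the boundary, and dx takes the value s' on it, as x is the first coordinate
    of the collar. Both are seen by pulling a curve with the given velocity back through the inverse
    of the collar.\<close>
  have claimA: "\<exists>s' v'. v' \<in> tangent_space bdry y' \<and> D (s', v') = demb \<rho> y s v \<and> frechet_derivative X (at ?p) (demb \<rho> y s v) = s'"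
    if v: "tangent_bdry y v" for s v
  proof -
    obtain cv where cv: "cv 0 = y" "\<forall>\<^sub>F \<sigma> in nhds 0. cv \<sigma> \<in> bdry" "(cv has_vector_derivative v) (at (0::real))"
      using bdry_curve[OF y v] by blast
    define \<gamma> where "\<gamma> = (\<lambda>\<sigma>. emb (\<rho> + \<sigma> * s) (cv \<sigma>))"
    have d1: "((\<lambda>\<sigma>. \<rho> + \<sigma> * s) has_vector_derivative s) (at 0)"
      by (auto intro!: derivative_eq_intros)
    have \<gamma>0: "\<gamma> 0 = ?p" by (simp add: \<gamma>_def cv)
    have "((\<lambda>\<sigma>. (\<rho> + \<sigma> * s, cv \<sigma>)) has_vector_derivative (s, v)) (at 0)"
      by (rule has_vector_derivative_Pair[OF d1 cv(3)])
    from has_vector_derivative_chain[OF this, of "\<lambda>x. emb (fst x) (snd x)" "\<lambda>x. demb \<rho> y (fst x) (snd x)"]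
    have d\<gamma>: "(\<gamma> has_vector_derivative demb \<rho> y s v) (at 0)"
      using emb_has_derivative[of \<rho> y] J \<rho> by (auto simp: \<gamma>_def cv)
    have "\<forall>\<^sub>F \<sigma> in nhds 0. \<rho> + \<sigma> * s \<in> I" by (rule eventually_nhds_of_tendsto[OF d1 I(1)]) (use \<rho> in simp)
    with cv(2) have evM: "\<forall>\<^sub>F \<sigma> in nhds 0. \<gamma> \<sigma> \<in> M" by eventually_elim (simp add: \<gamma>_def emb_mem)
    have evC: "\<forall>\<^sub>F \<sigma> in nhds 0. \<gamma> \<sigma> \<in> \<Phi> ` C"
      using evM eventually_nhds_of_tendsto[OF d\<gamma> O3(1)] O3(2) p closure_subset[of M] by (auto simp: \<gamma>0 elim: eventually_elim2)
    have ev2: "\<forall>\<^sub>F \<sigma> in nhds 0. \<gamma> \<sigma> \<in> U2" by (rule eventually_nhds_of_tendsto[OF d\<gamma> H(1)]) (simp add: \<gamma>0 H)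
    have evU: "\<forall>\<^sub>F \<sigma> in nhds 0. \<gamma> \<sigma> \<in> U" by (rule eventually_nhds_of_tendsto[OF d\<gamma> U(1)]) (simp add: \<gamma>0 U)
    define \<eta> where "\<eta> = (\<lambda>\<sigma>. H (\<gamma> \<sigma>))"
    obtain s' v' where sv: "frechet_derivative H (at ?p) (demb \<rho> y s v) = (s', v')" by (rule prod.exhaust)
    have d\<eta>: "(\<eta> has_vector_derivative (s', v')) (at 0)"
      unfolding \<eta>_def sv[symmetric]
      by (rule has_vector_derivative_chain[OF d\<gamma>]) (simp add: \<gamma>0 smooth_on_has_derivative[OF H(3,2)])
    have \<eta>0: "\<eta> 0 = (t, y')" by (simp add: \<eta>_def \<gamma>0 Hp)
    have ev\<eta>: "\<forall>\<^sub>F \<sigma> in nhds 0. \<eta> \<sigma> \<in> C \<and> \<Phi> (\<eta> \<sigma>) = \<gamma> \<sigma> \<and> x (\<gamma> \<sigma>) = fst (\<eta> \<sigma>)"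
      using evC ev2
    proof eventually_elim
      case (elim \<sigma>)
      then have e: "\<eta> \<sigma> = the_inv_into C \<Phi> (\<gamma> \<sigma>)" using H(4) by (simp add: \<eta>_def)
      have c: "\<eta> \<sigma> \<in> C" unfolding e by (rule the_inv_into_into[OF \<Phi>(2) elim(1)]) simp
      have f: "\<Phi> (\<eta> \<sigma>) = \<gamma> \<sigma>" unfolding e by (rule f_the_inv_into_f[OF \<Phi>(2) elim(1)])
      show ?case using c f x\<Phi>[of "fst (\<eta> \<sigma>)" "snd (\<eta> \<sigma>)"] by (auto simp: C_def)
    qed
    have dfs: "((\<lambda>\<sigma>. fst (\<eta> \<sigma>)) has_vector_derivative s') (at 0)" "((\<lambda>\<sigma>. snd (\<eta> \<sigma>)) has_vector_derivative v') (at 0)"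
      using bounded_linear.has_vector_derivative[OF bounded_linear_fst d\<eta>] bounded_linear.has_vector_derivative[OF bounded_linear_snd d\<eta>] by simp_all
    have 1: "v' \<in> tangent_space bdry y'"
      unfolding tangent_space_def using dfs(2) \<eta>0 ev\<eta>
      by (auto intro!: exI[of _ "\<lambda>\<sigma>. snd (\<eta> \<sigma>)"] elim!: eventually_mono simp: C_def)
    have evU1: "\<forall>\<^sub>F \<sigma> in nhds 0. \<eta> \<sigma> \<in> U1" by (rule eventually_nhds_of_tendsto[OF d\<eta> F(1)]) (simp add: \<eta>0 F)
    have "((\<lambda>\<sigma>. F (\<eta> \<sigma>)) has_vector_derivative D (s', v')) (at 0)"
      by (rule has_vector_derivative_chain[OF d\<eta>]) (simp add: \<eta>0 dF)
    moreover have "\<forall>\<^sub>F \<sigma> in nhds 0. F (\<eta> \<sigma>) = \<gamma> \<sigma>"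
      using ev\<eta> evU1
    proof eventually_elim
      case (elim \<sigma>)
      then show ?case using F(4)[of "\<eta> \<sigma>"] by simp
    qed
    ultimately have "(\<gamma> has_vector_derivative D (s', v')) (at 0)" by (rule has_vector_derivative_cong_nhds)
    then have 2: "D (s', v') = demb \<rho> y s v" using d\<gamma> by (rule vector_derivative_unique_at)
    have "((\<lambda>\<sigma>. X (\<gamma> \<sigma>)) has_vector_derivative frechet_derivative X (at ?p) (demb \<rho> y s v)) (at 0)"
      by (rule has_vector_derivative_chain[OF d\<gamma>]) (simp add: \<gamma>0 smooth_on_has_derivative[OF U(3,2)])
    moreover have "\<forall>\<^sub>F \<sigma> in nhds 0. X (\<gamma> \<sigma>) = fst (\<eta> \<sigma>)"
      using ev\<eta> evU evM
    proof eventually_elim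
      case (elim \<sigma>)
      then show ?case using U(4)[of "\<gamma> \<sigma>"] closure_subset[of M] by auto
    qed
    ultimately have "((\<lambda>\<sigma>. fst (\<eta> \<sigma>)) has_vector_derivative frechet_derivative X (at ?p) (demb \<rho> y s v)) (at 0)"
      by (rule has_vector_derivative_cong_nhds)
    then have 3: "frechet_derivative X (at ?p) (demb \<rho> y s v) = s'" using dfs(1) by (rule vector_derivative_unique_at)
    show ?thesis using 1 2 3 by blast
  qed
  \<comment> \<open>Conversely the radial vector of the collar is expressed in the coordinates
    (\<rho>, y), by following the collar line through y' with \<open>R\<close> and
    \<open>directions\<close>.\<close>
  have claimB: "\<exists>s0 v0. tangent_bdry y v0 \<and> D (1, 0) = demb \<rho> y s0 v0"
  proof -
    let ?c = "\<lambda>\<sigma>. (t + \<sigma>, y')"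
    have d1: "((\<lambda>\<sigma>. t + \<sigma>) has_vector_derivative 1) (at 0)" by (auto intro!: derivative_eq_intros)
    have dc: "(?c has_vector_derivative (1, 0)) (at 0)"
      by (rule has_vector_derivative_Pair[OF d1 has_vector_derivative_const])
    define \<gamma> where "\<gamma> = (\<lambda>\<sigma>. F (?c \<sigma>))"
    have d\<gamma>: "(\<gamma> has_vector_derivative D (1, 0)) (at 0)"
      unfolding \<gamma>_def by (rule has_vector_derivative_chain[OF dc]) (simp add: dF)
    have \<gamma>0: "\<gamma> 0 = ?p" using F(2,4) tyC ty(3) by (simp add: \<gamma>_def)
    have oc: "?p \<in> off_core" using emb_off_core[of \<rho> y] J \<rho> y bdry_subset_off_core by auto
    have "\<forall>\<^sub>F \<sigma> in nhds 0. t + \<sigma> \<in> {0<..<\<epsilon>}" by (rule eventually_nhds_of_tendsto[OF d1]) (use t in auto)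
    moreover have "\<forall>\<^sub>F \<sigma> in nhds 0. ?c \<sigma> \<in> U1" by (rule eventually_nhds_of_tendsto[OF dc F(1)]) (simp add: F)
    ultimately have "\<forall>\<^sub>F \<sigma> in nhds 0. \<gamma> \<sigma> \<in> \<Phi> ` C"
    proof eventually_elim
      case (elim \<sigma>)
      then have "?c \<sigma> \<in> U1 \<inter> C" using ty(2) by (simp add: C_def)
      then show ?case using F(4) by (metis \<gamma>_def IntD2 image_eqI)
    qed
    then have evcl: "\<forall>\<^sub>F \<sigma> in nhds 0. \<gamma> \<sigma> \<in> closure M"
      by (rule eventually_mono) (use collar_sub in blast)
    have evoc: "\<forall>\<^sub>F \<sigma> in nhds 0. \<gamma> \<sigma> \<in> off_core"
      by (rule eventually_nhds_of_tendsto[OF d\<gamma> open_off_core]) (simp add: \<gamma>0 oc)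
    define s0 where "s0 = frechet_derivative R (at ?p) (D (1, 0))"
    define v0 where "v0 = frechet_derivative directions (at ?p) (D (1, 0))"
    have dR: "((\<lambda>\<sigma>. R (\<gamma> \<sigma>)) has_vector_derivative s0) (at 0)"
      unfolding s0_def by (rule has_vector_derivative_chain[OF d\<gamma>]) (simp add: \<gamma>0 smooth_on_has_derivative[OF R(1) oc])
    have dd: "((\<lambda>\<sigma>. directions (\<gamma> \<sigma>)) has_vector_derivative v0) (at 0)"
      unfolding v0_def by (rule has_vector_derivative_chain[OF d\<gamma>]) (simp add: \<gamma>0 smooth_on_has_derivative[OF smooth_on_directions oc])
    have p0: "R (\<gamma> 0) = \<rho>" "directions (\<gamma> 0) = y"
      using R(2)[of \<rho> y] directions_emb[of \<rho> y] \<rho> y J by (auto simp: \<gamma>0)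
    have "v0 \<in> tangent_space bdry y"
      unfolding tangent_space_def
    proof (intro CollectI exI[of _ "\<lambda>\<sigma>. directions (\<gamma> \<sigma>)"] conjI)
      show "\<forall>\<^sub>F \<sigma> in nhds 0. directions (\<gamma> \<sigma>) \<in> bdry"
        using evoc by (rule eventually_mono) (rule directions_mem_bdry)
    qed (use dd p0(2) in simp_all)
    then have tv: "tangent_bdry y v0" by (rule tangent_space_bdry)
    have "((\<lambda>\<sigma>. (R (\<gamma> \<sigma>), directions (\<gamma> \<sigma>))) has_vector_derivative (s0, v0)) (at 0)"
      by (rule has_vector_derivative_Pair[OF dR dd])
    from has_vector_derivative_chain[OF this, of "\<lambda>x. emb (fst x) (snd x)" "\<lambda>x. demb \<rho> y (fst x) (snd x)"]
    have "((\<lambda>\<sigma>. emb (R (\<gamma> \<sigma>)) (directions (\<gamma> \<sigma>))) has_vector_derivative demb \<rho> y s0 v0) (at 0)"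
      using emb_has_derivative[of \<rho> y] J \<rho> by (auto simp: p0)
    moreover have "\<forall>\<^sub>F \<sigma> in nhds 0. emb (R (\<gamma> \<sigma>)) (directions (\<gamma> \<sigma>)) = \<gamma> \<sigma>"
      using evcl evoc by eventually_elim (simp add: emb_R)
    ultimately have "(\<gamma> has_vector_derivative demb \<rho> y s0 v0) (at 0)" by (rule has_vector_derivative_cong_nhds)
    then have "D (1, 0) = demb \<rho> y s0 v0" using d\<gamma> vector_derivative_unique_at by blast
    then show ?thesis using tv by blast
  qed
  obtain s0 v0 where sv0: "tangent_bdry y v0" "D (1, 0) = demb \<rho> y s0 v0" using claimB by blast
  \<comment> \<open>Against the radial vector only s' survives in the normal form, since h vanishes
    when one argument is 0.\<close>
  have gT: "g ?p (D (1, 0)) (D (s', v')) = s' / t\<^sup>2" if "v' \<in> tangent_space bdry y'" for s' v'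
  proof -
    have "h t y' 0 v' = 0" using bilinear_lzero[OF h[OF ty(1,2)]] .
    then show ?thesis
      using normal_form[of t y' D 0 v' 1 s'] t ty dP that zero_mem_tangent_space[OF ty(2)] by simp
  qed
  show thesis
  proof (rule that[OF sv0(1)])
    have "g ?p (D (1, 0)) (D (1, 0)) = 1 / t\<^sup>2" by (rule gT[OF zero_mem_tangent_space[OF ty(2)]])
    then show "(s0 * s0 / lapse m \<rho> + bdry_metric \<beta> (lapse m \<rho>) y v0 v0) / \<rho>\<^sup>2 = 1 / (x ?p)\<^sup>2"
      using metric[OF \<rho> y sv0(1,1), of s0 s0] by (simp add: sv0(2) xt)
    fix s v assume v: "tangent_bdry y v"
    obtain s' v' where sv: "v' \<in> tangent_space bdry y'" "D (s', v') = demb \<rho> y s v"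
      "frechet_derivative X (at ?p) (demb \<rho> y s v) = s'" using claimA[OF v, of s] by blast
    have "s' / t\<^sup>2 = (s0 * s / lapse m \<rho> + bdry_metric \<beta> (lapse m \<rho>) y v0 v) / \<rho>\<^sup>2"
      using gT[OF sv(1), of s'] metric[OF \<rho> y sv0(1) v, of s0 s] by (simp add: sv0(2) sv(2))
    then show "frechet_derivative X (at ?p) (demb \<rho> y s v)
        = (x ?p)\<^sup>2 * ((s0 * s / lapse m \<rho> + bdry_metric \<beta> (lapse m \<rho>) y v0 v) / \<rho>\<^sup>2)"
      using t by (simp add: sv(3) xt field_simps)
  qed
qed

end

section \<open>The logarithmic expansion of an arbitrary special boundary defining function\<close>

context ah_end_bdf
begin

text \<open>In the coordinates (\<rho>, y) a smooth extension of x becomes a function f on an open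
  set reaching across \<rho> = 0. It vanishes on the boundary, has positive radial derivative there,
  and satisfies the eikonal equation by \<open>gradient\<close> and \<open>eikonal_frame\<close>;
  \<open>eikonal_local_expansion\<close> does the rest.\<close>

lemma local_expansion:
  assumes y0: "y0 \<in> bdry"
  shows "\<exists>N \<delta> C. open N \<and> y0 \<in> N \<and> 0 < \<delta> \<and> (\<forall>y\<in>N \<inter> bdry. \<exists>l0 c2. \<bar>l0\<bar> \<le> C \<and> \<bar>c2\<bar> \<le> C \<and>
     (\<forall>\<rho>. 0 < \<rho> \<longrightarrow> \<rho> < \<delta> \<longrightarrow> \<bar>ln (x (emb \<rho> y) / \<rho>) - l0 - (c2 * \<rho>\<^sup>2 + m / 3 * \<rho> ^ 3)\<bar> \<le> C * \<rho> ^ 4))"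
proof -
  have y0cl: "y0 \<in> closure M" using y0 closure_M by blast
  have y0C: "(0, y0) \<in> C" using y0 \<epsilon> by (simp add: C_def)
  have y0\<Phi>: "y0 \<in> \<Phi> ` C" using \<Phi>0[OF y0] y0C by (metis image_eqI)
  obtain U1 X where X: "open U1" "y0 \<in> U1" "smooth_on X U1" "\<And>q. q \<in> U1 \<inter> closure M \<Longrightarrow> X q = x q"
    using x(1) y0cl unfolding smooth_map_def by meson
  obtain O3 where O3: "open O3" "\<Phi> ` C = closure M \<inter> O3" using \<Phi>(3) by (auto simp: openin_open)
  define U where "U = U1 \<inter> O3"
  have U: "open U" "y0 \<in> U" "smooth_on X U" "\<And>q. q \<in> U \<inter> closure M \<Longrightarrow> X q = x q \<and> q \<in> \<Phi> ` C"
    using X O3 y0\<Phi> by (auto simp: U_def intro: smooth_on_subset)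
  let ?e = "\<lambda>z. emb (fst z) (snd z)"
  have oJ: "open (J \<times> (UNIV :: R32 set))" using J by (simp add: open_Times)
  define W where "W = (J \<times> UNIV) \<inter> ?e -` U"
  have W: "open W" unfolding W_def
    by (rule continuous_open_preimage[OF smooth_on_imp_continuous_on[OF smooth_on_emb] oJ U(1)])
  define f where "f = (\<lambda>z. X (?e z))"
  have sf: "smooth_on f W" unfolding f_def
    by (rule smooth_on_compose[OF W U(1) _ smooth_on_subset[OF smooth_on_emb] U(3)]) (auto simp: W_def)
  have J0: "0 \<in> J" using J by auto
  have W0: "(0, y) \<in> W \<longleftrightarrow> y \<in> U" for y using J0 by (simp add: W_def emb_0)
  have fx: "f (\<rho>, y) = x (emb \<rho> y)" "emb \<rho> y \<in> \<Phi> ` C" "emb \<rho> y \<in> U"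
    if "(\<rho>, y) \<in> W" "\<rho> \<in> insert 0 I" "y \<in> bdry" for \<rho> y
    using U(4)[of "emb \<rho> y"] that emb_closure[of \<rho> y] by (auto simp: f_def W_def)
  have zero: "f (0, y) = 0" if "y \<in> bdry" "(0, y) \<in> W" for y
    using fx(1)[of 0 y] that x(3) by (simp add: emb_0)
  have df: "frechet_derivative f (at (\<rho>, y)) (s, v) = frechet_derivative X (at (emb \<rho> y)) (demb \<rho> y s v)"
    if "(\<rho>, y) \<in> W" for \<rho> y s v
  proof -
    have \<rho>: "\<rho> \<in> J" "emb \<rho> y \<in> U" using that by (auto simp: W_def)
    have "(f has_derivative (\<lambda>z. frechet_derivative X (at (emb \<rho> y)) (demb \<rho> y (fst z) (snd z)))) (at (\<rho>, y))"
      unfolding f_def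
      by (rule has_derivative_compose[OF emb_has_derivative[OF \<rho>(1)]]) (simp add: smooth_on_has_derivative[OF U(3) \<rho>(2)])
    then show ?thesis by (simp add: frechet_derivative_at[symmetric])
  qed
  \<comment> \<open>Along the collar line from y0 the function x grows with speed 1. Its derivative
    in the tangential part of that velocity is 0 because x vanishes on the boundary, so the radial
    derivative cannot vanish; its sign is that of x in the interior.\<close>
  have pos: "0 < radial_deriv f (0, y0)"
  proof -
    have W00: "(0, y0) \<in> W" using W0 U by simp
    obtain V F where F: "open V" "(0, y0) \<in> V" "smooth_on F V" "\<And>q. q \<in> V \<inter> C \<Longrightarrow> F q = \<Phi> q"
      using \<Phi>(1) y0C unfolding smooth_map_def by meson
    let ?c = "\<lambda>\<sigma>::real. (\<sigma>, y0)"
    have dc: "(?c has_vector_derivative (1, 0)) (at 0)"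
      by (rule has_vector_derivative_Pair[OF has_vector_derivative_id has_vector_derivative_const])
    define \<gamma> where "\<gamma> = (\<lambda>\<sigma>. F (?c \<sigma>))"
    define d where "d = frechet_derivative F (at (0, y0)) (1, 0)"
    have d\<gamma>: "(\<gamma> has_vector_derivative d) (at 0)"
      unfolding \<gamma>_def d_def by (rule has_vector_derivative_chain[OF dc]) (simp add: smooth_on_has_derivative[OF F(3,2)])
    have \<gamma>0: "\<gamma> 0 = y0" using F(2,4) y0C \<Phi>0[OF y0] by (simp add: \<gamma>_def)
    have oc: "y0 \<in> off_core" using y0 bdry_subset_off_core by blast
    have evoc: "\<forall>\<^sub>F \<sigma> in nhds 0. \<gamma> \<sigma> \<in> off_core"
      by (rule eventually_nhds_of_tendsto[OF d\<gamma> open_off_core]) (simp add: \<gamma>0 oc)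
    define v where "v = frechet_derivative directions (at y0) d"
    have dR: "((\<lambda>\<sigma>. R (\<gamma> \<sigma>)) has_vector_derivative frechet_derivative R (at y0) d) (at 0)"
      by (rule has_vector_derivative_chain[OF d\<gamma>]) (simp add: \<gamma>0 smooth_on_has_derivative[OF R(1) oc])
    have dd: "((\<lambda>\<sigma>. directions (\<gamma> \<sigma>)) has_vector_derivative v) (at 0)"
      unfolding v_def by (rule has_vector_derivative_chain[OF d\<gamma>]) (simp add: \<gamma>0 smooth_on_has_derivative[OF smooth_on_directions oc])
    have R0: "R y0 = 0" "directions y0 = y0"
      using R(2)[of 0 y0] directions_bdry[OF y0] y0 by (auto simp: emb_0)
    let ?k = "\<lambda>\<sigma>. (R (\<gamma> \<sigma>), directions (\<gamma> \<sigma>))"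
    have dk: "(?k has_vector_derivative (frechet_derivative R (at y0) d, v)) (at 0)"
      by (rule has_vector_derivative_Pair[OF dR dd])
    have evW: "\<forall>\<^sub>F \<sigma> in nhds 0. ?k \<sigma> \<in> W" by (rule eventually_nhds_of_tendsto[OF dk W]) (simp add: \<gamma>0 R0 W00)
    have evV: "\<forall>\<^sub>F \<sigma> in nhds 0. ?c \<sigma> \<in> V" by (rule eventually_nhds_of_tendsto[OF dc F(1)]) (simp add: F)
    have ev\<epsilon>: "\<forall>\<^sub>F \<sigma> in nhds 0. \<sigma> < \<epsilon>" using eventually_nhds_in_open[of "{..<\<epsilon>}" 0] \<epsilon> by simp
    have dfk: "((\<lambda>\<sigma>. f (?k \<sigma>)) has_vector_derivative frechet_derivative f (at (0, y0)) (frechet_derivative R (at y0) d, v)) (at 0)"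
      by (rule has_vector_derivative_chain[OF dk]) (simp add: \<gamma>0 R0 smooth_on_has_derivative[OF sf W00])
    \<comment> \<open>For negative \<sigma> the curve follows an extension of \<Phi> that has no
      relation to x, so the derivative is read off from the right.\<close>
    have "\<forall>\<^sub>F \<sigma> in nhds 0. 0 < \<sigma> \<longrightarrow> f (?k \<sigma>) = \<sigma>"
      using evW evV evoc ev\<epsilon>
    proof eventually_elim
      case (elim \<sigma>)
      show ?case
      proof
        assume s: "0 < \<sigma>"
        have c: "?c \<sigma> \<in> C" using s elim(4) y0 by (simp add: C_def)
        have g: "\<gamma> \<sigma> = \<Phi> (\<sigma>, y0)" using F(4)[of "?c \<sigma>"] c elim(2) by (simp add: \<gamma>_def)
        have cl: "\<gamma> \<sigma> \<in> closure M" using collar_sub c g by auto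
        have e: "R (\<gamma> \<sigma>) \<in> insert 0 I" "emb (R (\<gamma> \<sigma>)) (directions (\<gamma> \<sigma>)) = \<gamma> \<sigma>" using emb_R[OF cl elim(3)] by auto
        have "f (?k \<sigma>) = x (\<gamma> \<sigma>)" using fx(1)[OF elim(1) e(1) directions_mem_bdry[OF elim(3)]] e(2) by simp
        also have "\<dots> = \<sigma>" using x\<Phi>[of \<sigma> y0] s elim(4) y0 g by simp
        finally show "f (?k \<sigma>) = \<sigma>" .
      qed
    qed
    then have evr: "\<forall>\<^sub>F \<sigma> in at_right 0. f (?k \<sigma>) / \<sigma> = 1"
      by (auto simp: eventually_at_filter elim: eventually_mono)
    have k0: "f (?k 0) = 0" using zero[OF y0 W00] by (simp add: \<gamma>0 R0)
    have "((\<lambda>\<sigma>. f (?k \<sigma>) / \<sigma>) \<longlongrightarrow> frechet_derivative f (at (0, y0)) (frechet_derivative R (at y0) d, v)) (at 0)"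
      using dfk k0 by (simp add: has_real_derivative_iff_has_vector_derivative[symmetric] has_field_derivative_iff)
    then have "((\<lambda>\<sigma>. f (?k \<sigma>) / \<sigma>) \<longlongrightarrow> frechet_derivative f (at (0, y0)) (frechet_derivative R (at y0) d, v)) (at_right 0)"
      by (rule filterlim_mono) (simp_all add: at_le)
    then have "((\<lambda>\<sigma>::real. 1::real) \<longlongrightarrow> frechet_derivative f (at (0, y0)) (frechet_derivative R (at y0) d, v)) (at_right 0)"
      by (rule Lim_transform_eventually) (rule evr)
    then have one: "frechet_derivative f (at (0, y0)) (frechet_derivative R (at y0) d, v) = 1"
      using tendsto_unique[OF trivial_limit_at_right_real _ tendsto_const] by blast
    have "frechet_derivative f (at (0, y0)) (0, v) = 0"
    proof (rule tangential_derivative_zero[OF sf W00 _ dd])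
      show "directions (\<gamma> 0) = y0" by (simp add: \<gamma>0 R0)
      have "\<forall>\<^sub>F \<sigma> in nhds 0. directions (\<gamma> \<sigma>) \<in> U"
        by (rule eventually_nhds_of_tendsto[OF dd U(1)]) (simp add: \<gamma>0 R0 U)
      with evoc show "\<forall>\<^sub>F \<sigma> in nhds 0. f (0, directions (\<gamma> \<sigma>)) = 0"
        by eventually_elim (rule zero, simp_all add: directions_mem_bdry W0)
    qed
    moreover have lin: "linear (frechet_derivative f (at (0, y0)))"
      by (rule has_derivative_linear[OF smooth_on_has_derivative[OF sf W00]])
    ultimately have "frechet_derivative f (at (0, y0)) (frechet_derivative R (at y0) d, 0) = 1"
      using one linear_add[OF lin, of "(frechet_derivative R (at y0) d, 0)" "(0, v)"] by simp
    then have ne: "radial_deriv f (0, y0) \<noteq> 0"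
      using linear_scale[OF lin, of "frechet_derivative R (at y0) d" "(1, 0)"] by auto
    have "((\<lambda>t. f (t, y0)) has_real_derivative radial_deriv f (0, y0)) (at 0)" by (rule radial_has_derivative[OF sf W00])
    then have "((\<lambda>t. f (t, y0) / t) \<longlongrightarrow> radial_deriv f (0, y0)) (at 0)"
      using zero[OF y0 W00] by (simp add: has_field_derivative_iff)
    then have lim: "((\<lambda>t. f (t, y0) / t) \<longlongrightarrow> radial_deriv f (0, y0)) (at_right 0)"
      by (rule filterlim_mono) (simp_all add: at_le)
    have "((\<lambda>t::real. (t, y0)) has_vector_derivative (1, 0)) (at 0)" by (rule dc)
    then have "\<forall>\<^sub>F t in nhds 0. (t, y0) \<in> W" by (rule eventually_nhds_of_tendsto[OF _ W]) (simp add: W00)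
    then have "\<forall>\<^sub>F t in at_right 0. (t, y0) \<in> W" by (auto simp: eventually_at_filter elim: eventually_mono)
    moreover have "\<forall>\<^sub>F t in at_right 0. t \<in> I \<and> 0 < t"
      by (rule eventually_at_rightI[OF _ \<delta>0(1)]) (use \<delta>0 in auto)
    ultimately have "\<forall>\<^sub>F t in at_right 0. 0 \<le> f (t, y0) / t"
    proof eventually_elim
      case (elim t)
      then show ?case using fx(1)[OF elim(1) _ y0] x(2)[OF emb_mem[OF _ y0, of t]] by (simp add: less_imp_le)
    qed
    then have "0 \<le> radial_deriv f (0, y0)"
      using tendsto_lowerbound[OF lim] by simp
    then show ?thesis using ne by simp
  qed
  have ex: "\<exists>N \<delta> C. open N \<and> y0 \<in> N \<and> 0 < \<delta> \<and> (\<forall>y\<in>N \<inter> bdry. \<exists>l0 c2. \<bar>l0\<bar> \<le> C \<and> \<bar>c2\<bar> \<le> C \<and>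
     (\<forall>\<rho>. 0 < \<rho> \<longrightarrow> \<rho> < \<delta> \<longrightarrow> \<bar>ln (f (\<rho>, y) / \<rho>) - l0 - (c2 * \<rho>\<^sup>2 + m / 3 * \<rho> ^ 3)\<bar> \<le> C * \<rho> ^ 4))"
  proof (rule eikonal_local_expansion[OF W sf y0 _ zero pos, of frame \<delta>0 m "(\<beta> / (2 * pi))\<^sup>2"])
    show "(0, y0) \<in> W" using W0 U by simp
    show "\<exists>cv. cv 0 = y \<and> (\<forall>\<^sub>F s in nhds 0. cv s \<in> bdry) \<and> (cv has_vector_derivative frame i y) (at (0::real))"
      if "y \<in> bdry" for i y by (rule bdry_curve[OF that tangent_frame])
    show "0 < \<delta>0" by (rule \<delta>0)
    fix \<rho> y assume \<rho>: "0 < \<rho>" "\<rho> < \<delta>0" and y: "y \<in> bdry" and w: "(\<rho>, y) \<in> W"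
    have \<rho>I: "\<rho> \<in> I" using \<rho> \<delta>0 by auto
    note P = lapse_pos[OF \<rho>I]
    have fx': "f (\<rho>, y) = x (emb \<rho> y)" "emb \<rho> y \<in> \<Phi> ` C" "emb \<rho> y \<in> U" using fx[OF w _ y] \<rho>I by auto
    obtain s0 v0 where v0: "tangent_bdry y v0"
      and nrm: "(s0 * s0 / lapse m \<rho> + bdry_metric \<beta> (lapse m \<rho>) y v0 v0) / \<rho>\<^sup>2 = 1 / (x (emb \<rho> y))\<^sup>2"
      and gr: "\<And>s v. tangent_bdry y v \<Longrightarrow> frechet_derivative X (at (emb \<rho> y)) (demb \<rho> y s v)
        = (x (emb \<rho> y))\<^sup>2 * ((s0 * s / lapse m \<rho> + bdry_metric \<beta> (lapse m \<rho>) y v0 v) / \<rho>\<^sup>2)"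
      by (rule gradient[OF \<rho>I y fx'(2) U(1) fx'(3) U(3) conjunct1[OF U(4)]]) (assumption, rule that)
    \<comment> \<open>By \<open>gradient\<close>, df is q times the covector dual to (s0, v0) for
      the metric d\<rho>^2/P + P d\<tau>^2 + g_S, and that vector has squared length \<rho>^2/x^2.
      The left side of the eikonal equation is therefore q^2 \<rho>^2/x^2 = x^2/\<rho>^2.\<close>
    define q where "q = (x (emb \<rho> y))\<^sup>2 / \<rho>\<^sup>2"
    have bz: "bdry_metric \<beta> (lapse m \<rho>) y v0 0 = 0" by (simp add: bdry_metric_def dtau_def)
    have t0: "tangent_bdry y 0" by (simp add: tangent_bdry_def)
    have r: "radial_deriv f (\<rho>, y) = q * (s0 / lapse m \<rho>)"
      unfolding df[OF w] gr[OF t0] by (simp add: bz q_def)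
    have fr: "frechet_derivative f (at (\<rho>, y)) (0, frame i y) = q * bdry_metric \<beta> (lapse m \<rho>) y v0 (frame i y)" for i
      unfolding df[OF w] gr[OF tangent_frame] by (simp add: q_def)
    have xp: "0 < x (emb \<rho> y)" by (intro x(2) emb_mem \<rho>I y)
    have "lapse m \<rho> * (radial_deriv f (\<rho>, y))\<^sup>2 + ((frechet_derivative f (at (\<rho>, y)) (0, frame 0 y))\<^sup>2 / ((\<beta> / (2 * pi))\<^sup>2 * lapse m \<rho>)
        + (frechet_derivative f (at (\<rho>, y)) (0, frame 1 y))\<^sup>2 + (frechet_derivative f (at (\<rho>, y)) (0, frame 2 y))\<^sup>2
        + (frechet_derivative f (at (\<rho>, y)) (0, frame 3 y))\<^sup>2)
      = q\<^sup>2 * (s0 * s0 / lapse m \<rho> + ((bdry_metric \<beta> (lapse m \<rho>) y v0 (frame 0 y))\<^sup>2 / ((\<beta> / (2 * pi))\<^sup>2 * lapse m \<rho>)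
        + (bdry_metric \<beta> (lapse m \<rho>) y v0 (frame 1 y))\<^sup>2 + (bdry_metric \<beta> (lapse m \<rho>) y v0 (frame 2 y))\<^sup>2
        + (bdry_metric \<beta> (lapse m \<rho>) y v0 (frame 3 y))\<^sup>2))"
      unfolding r fr using P by (simp add: power_mult_distrib power_divide algebra_simps) (simp add: power2_eq_square)
    also have "\<dots> = q\<^sup>2 * (\<rho>\<^sup>2 / (x (emb \<rho> y))\<^sup>2)"
      unfolding eikonal_frame[OF y v0 P \<beta>] using nrm \<rho>(1) by (simp add: field_simps)
    also have "\<dots> = (f (\<rho>, y) / \<rho>)\<^sup>2"
      using \<rho>(1) xp by (simp add: fx'(1) q_def power_divide field_simps)
    finally show "lapse m \<rho> * (radial_deriv f (\<rho>, y))\<^sup>2 + ((frechet_derivative f (at (\<rho>, y)) (0, frame 0 y))\<^sup>2 / ((\<beta> / (2 * pi))\<^sup>2 * lapse m \<rho>)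
        + (frechet_derivative f (at (\<rho>, y)) (0, frame 1 y))\<^sup>2 + (frechet_derivative f (at (\<rho>, y)) (0, frame 2 y))\<^sup>2
        + (frechet_derivative f (at (\<rho>, y)) (0, frame 3 y))\<^sup>2) = (f (\<rho>, y) / \<rho>)\<^sup>2" .
  qed
  then obtain N \<delta> C' where N: "open N" "y0 \<in> N" "0 < \<delta>" and e: "\<forall>y\<in>N \<inter> bdry. \<exists>l0 c2. \<bar>l0\<bar> \<le> C' \<and> \<bar>c2\<bar> \<le> C' \<and>
     (\<forall>\<rho>. 0 < \<rho> \<longrightarrow> \<rho> < \<delta> \<longrightarrow> \<bar>ln (f (\<rho>, y) / \<rho>) - l0 - (c2 * \<rho>\<^sup>2 + m / 3 * \<rho> ^ 3)\<bar> \<le> C' * \<rho> ^ 4)" by blast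
  have "\<forall>\<^sub>F z in nhds (0, y0). z \<in> W" using W W0 U by (intro eventually_nhds_in_open) auto
  then obtain d where d: "0 < d" "\<And>z. dist z (0, y0) < d \<Longrightarrow> z \<in> W" unfolding eventually_nhds_metric by blast
  define N' \<delta>' where "N' = N \<inter> ball y0 (d / 2)" and "\<delta>' = Min {\<delta>, d / 2, \<delta>0}"
  have \<delta>': "0 < \<delta>'" "\<delta>' \<le> \<delta>" "\<delta>' \<le> d / 2" "\<delta>' \<le> \<delta>0" using N d \<delta>0 by (auto simp: \<delta>'_def)
  have ff: "f (\<rho>, y) = x (emb \<rho> y)" if "0 < \<rho>" "\<rho> < \<delta>'" "y \<in> N' \<inter> bdry" for \<rho> y
  proof -
    have "dist (\<rho>, y) (0, y0) \<le> \<bar>\<rho>\<bar> + dist y y0"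
      unfolding dist_Pair_Pair using sqrt_sum_squares_le_sum_abs[of "dist \<rho> 0" "dist y y0"] by (simp add: dist_real_def)
    also have "\<dots> < d" using that \<delta>' by (auto simp: N'_def dist_commute)
    finally have "(\<rho>, y) \<in> W" by (rule d(2))
    moreover have "\<rho> \<in> I" using that \<delta>' \<delta>0 by auto
    ultimately show ?thesis using fx(1) that by auto
  qed
  have "\<forall>y\<in>N' \<inter> bdry. \<exists>l0 c2. \<bar>l0\<bar> \<le> C' \<and> \<bar>c2\<bar> \<le> C' \<and>
     (\<forall>\<rho>. 0 < \<rho> \<longrightarrow> \<rho> < \<delta>' \<longrightarrow> \<bar>ln (x (emb \<rho> y) / \<rho>) - l0 - (c2 * \<rho>\<^sup>2 + m / 3 * \<rho> ^ 3)\<bar> \<le> C' * \<rho> ^ 4)"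
  proof
    fix y assume y: "y \<in> N' \<inter> bdry"
    then obtain l0 c2 where l: "\<bar>l0\<bar> \<le> C'" "\<bar>c2\<bar> \<le> C'"
      "\<And>\<rho>. 0 < \<rho> \<Longrightarrow> \<rho> < \<delta> \<Longrightarrow> \<bar>ln (f (\<rho>, y) / \<rho>) - l0 - (c2 * \<rho>\<^sup>2 + m / 3 * \<rho> ^ 3)\<bar> \<le> C' * \<rho> ^ 4"
      using e unfolding N'_def by blast
    show "\<exists>l0 c2. \<bar>l0\<bar> \<le> C' \<and> \<bar>c2\<bar> \<le> C' \<and>
     (\<forall>\<rho>. 0 < \<rho> \<longrightarrow> \<rho> < \<delta>' \<longrightarrow> \<bar>ln (x (emb \<rho> y) / \<rho>) - l0 - (c2 * \<rho>\<^sup>2 + m / 3 * \<rho> ^ 3)\<bar> \<le> C' * \<rho> ^ 4)"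
      using l ff[OF _ _ y] \<delta>'(2) by (intro exI[of _ l0] exI[of _ c2]) fastforce
  qed
  moreover have "open N'" "y0 \<in> N'" using N d by (auto simp: N'_def)
  ultimately show ?thesis using \<delta>'(1) by blast
qed

text \<open>Compactness of the boundary: finitely many of the local neighbourhoods cover it, and one
  takes the least \<delta> and the largest C.\<close>

lemma log_expansion_exists: "\<exists>\<delta> C. 0 < \<delta> \<and> \<delta> \<le> \<delta>0 \<and> log_expansion x \<delta> C"
proof -
  let ?P = "\<lambda>N \<delta> C. \<forall>y\<in>N \<inter> bdry. \<exists>l0 c2. \<bar>l0\<bar> \<le> C \<and> \<bar>c2\<bar> \<le> C \<and>
     (\<forall>\<rho>. 0 < \<rho> \<longrightarrow> \<rho> < \<delta> \<longrightarrow> \<bar>ln (x (emb \<rho> y) / \<rho>) - l0 - (c2 * \<rho>\<^sup>2 + m / 3 * \<rho> ^ 3)\<bar> \<le> C * \<rho> ^ 4)"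
  define \<N> where "\<N> = {N. open N \<and> (\<exists>\<delta>>0. \<exists>C. ?P N \<delta> C)}"
  have "bdry \<subseteq> \<Union>\<N>"
  proof
    fix y assume "y \<in> bdry"
    from local_expansion[OF this] obtain N \<delta> C where "open N" "y \<in> N" "0 < \<delta>" "?P N \<delta> C" by blast
    then show "y \<in> \<Union>\<N>" unfolding \<N>_def by blast
  qed
  then obtain \<F> where F: "\<F> \<subseteq> \<N>" "finite \<F>" "bdry \<subseteq> \<Union>\<F>"
    using compactE[OF compact_bdry, of \<N>] unfolding \<N>_def by blast
  have "\<forall>N\<in>\<F>. \<exists>r. 0 < fst r \<and> ?P N (fst r) (snd r)"
  proof
    fix N assume "N \<in> \<F>"
    then obtain \<delta> C where "0 < \<delta>" "?P N \<delta> C" using F(1) unfolding \<N>_def by blast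
    then show "\<exists>r. 0 < fst r \<and> ?P N (fst r) (snd r)" by (intro exI[of _ "(\<delta>, C)"]) simp
  qed
  then obtain r where r: "\<forall>N\<in>\<F>. 0 < fst (r N) \<and> ?P N (fst (r N)) (snd (r N))" by (rule bchoice[THEN exE])
  define \<delta> where "\<delta> = Min (insert \<delta>0 ((\<lambda>N. fst (r N)) ` \<F>))"
  define C' where "C' = Max (insert 0 ((\<lambda>N. snd (r N)) ` \<F>))"
  have \<delta>: "0 < \<delta>" "\<delta> \<le> \<delta>0" "\<And>N. N \<in> \<F> \<Longrightarrow> \<delta> \<le> fst (r N)"
    using F(2) r \<delta>0 by (auto simp: \<delta>_def)
  have C': "\<And>N. N \<in> \<F> \<Longrightarrow> snd (r N) \<le> C'" using F(2) by (simp add: C'_def)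
  have "log_expansion x \<delta> C'"
    unfolding log_expansion_def
  proof
    fix y assume y: "y \<in> bdry"
    then obtain N where N: "N \<in> \<F>" "y \<in> N" using F(3) by blast
    with r y obtain l0 c2 where l: "\<bar>l0\<bar> \<le> snd (r N)" "\<bar>c2\<bar> \<le> snd (r N)"
      "\<And>\<rho>. 0 < \<rho> \<Longrightarrow> \<rho> < fst (r N) \<Longrightarrow> \<bar>ln (x (emb \<rho> y) / \<rho>) - l0 - (c2 * \<rho>\<^sup>2 + m / 3 * \<rho> ^ 3)\<bar> \<le> snd (r N) * \<rho> ^ 4"
      by (metis IntI)
    show "\<exists>l0 c2. \<bar>l0\<bar> \<le> C' \<and> \<bar>c2\<bar> \<le> C' \<and>
     (\<forall>\<rho>. 0 < \<rho> \<longrightarrow> \<rho> < \<delta> \<longrightarrow> \<bar>ln (x (emb \<rho> y) / \<rho>) - l0 - (c2 * \<rho>\<^sup>2 + m / 3 * \<rho> ^ 3)\<bar> \<le> C' * \<rho> ^ 4)"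
    proof (intro exI conjI allI impI)
      show "\<bar>l0\<bar> \<le> C'" "\<bar>c2\<bar> \<le> C'" using l(1,2) C'[OF N(1)] by linarith+
      fix \<rho> assume \<rho>: "0 < \<rho>" "\<rho> < \<delta>"
      have "\<bar>ln (x (emb \<rho> y) / \<rho>) - l0 - (c2 * \<rho>\<^sup>2 + m / 3 * \<rho> ^ 3)\<bar> \<le> snd (r N) * \<rho> ^ 4"
        using l(3) \<rho> \<delta>(3)[OF N(1)] by auto
      also have "\<dots> \<le> C' * \<rho> ^ 4" using C'[OF N(1)] by (intro mult_right_mono) auto
      finally show "\<bar>ln (x (emb \<rho> y) / \<rho>) - l0 - (c2 * \<rho>\<^sup>2 + m / 3 * \<rho> ^ 3)\<bar> \<le> C' * \<rho> ^ 4" .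
    qed
  qed
  then show ?thesis using \<delta> by blast
qed

end

theorem (in ah_end) finite_part_special_bdf:
  assumes x: "special_bdf M g x" and Z: "volume_zeta_continuation M g x Z"
  shows "fls_nth (laurent_expansion Z 0) 0 = of_real (4 * pi * \<beta> * (m - c) / 3)"
proof -
  from x obtain \<epsilon> \<Phi> h where *: "0 < \<epsilon>"
     "smooth_map ({0..<\<epsilon>} \<times> bdry) \<Phi>" "inj_on \<Phi> ({0..<\<epsilon>} \<times> bdry)" "openin (top_of_set (closure M)) (\<Phi> ` ({0..<\<epsilon>} \<times> bdry))"
     "smooth_map (\<Phi> ` ({0..<\<epsilon>} \<times> bdry)) (the_inv_into ({0..<\<epsilon>} \<times> bdry) \<Phi>)"
     "\<forall>y\<in>bdry. \<Phi> (0, y) = y" "\<forall>t\<in>{0..<\<epsilon>}. \<forall>y\<in>bdry. x (\<Phi> (t, y)) = t"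
     "\<forall>t\<in>{0..<\<epsilon>}. \<forall>y\<in>bdry. bilinear (h t y) \<and> (\<forall>v w. h t y v w = h t y w v) \<and>
        (\<forall>v\<in>tangent_space bdry y - {0}. 0 < h t y v v)"
     "\<forall>t\<in>{0<..<\<epsilon>}. \<forall>y\<in>bdry. \<forall>D. (\<Phi> has_derivative D) (at (t, y) within {0..<\<epsilon>} \<times> bdry) \<longrightarrow>
           (\<forall>s s'. \<forall>v\<in>tangent_space bdry y. \<forall>v'\<in>tangent_space bdry y.
              g (\<Phi> (t, y)) (D (s, v)) (D (s', v')) = (s * s' + h t y v v') / t\<^sup>2)"
    unfolding special_bdf_def boundary Let_def by (elim conjE exE) (rule that)
  interpret ah_end_bdf M g \<beta> m c \<delta>0 I J al ga R V \<phi> \<tau> emb demb x \<epsilon> \<Phi> h "{0..<\<epsilon>} \<times> bdry"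
  proof (unfold_locales)
    show "smooth_map (closure M) x" "\<And>p. p \<in> M \<Longrightarrow> 0 < x p" "\<And>p. p \<in> bdry \<Longrightarrow> x p = 0"
      using x unfolding special_bdf_def boundary by blast+
    show "\<And>t y. t \<in> {0..<\<epsilon>} \<Longrightarrow> y \<in> bdry \<Longrightarrow> x (\<Phi> (t, y)) = t" using *(7) by blast
    show "\<And>t y. t \<in> {0..<\<epsilon>} \<Longrightarrow> y \<in> bdry \<Longrightarrow> bilinear (h t y)" using *(8) by blast
    show "\<And>t y D s s' v v'. t \<in> {0<..<\<epsilon>} \<Longrightarrow> y \<in> bdry \<Longrightarrow> (\<Phi> has_derivative D) (at (t, y) within {0..<\<epsilon>} \<times> bdry) \<Longrightarrow>
        v \<in> tangent_space bdry y \<Longrightarrow> v' \<in> tangent_space bdry y \<Longrightarrow>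
        g (\<Phi> (t, y)) (D (s, v)) (D (s', v')) = (s * s' + h t y v v') / t\<^sup>2" using *(9) by blast
  qed (rule *(1-5) *(6)[rule_format], assumption?)+
  obtain \<delta> C where "0 < \<delta>" "\<delta> \<le> \<delta>0" "log_expansion x \<delta> C" using log_expansion_exists by blast
  then show ?thesis
    by (intro finite_part_of_expansion[OF continuous_on_subset[OF smooth_map_imp_continuous_on closure_subset] _ _ _ _ Z])
      (use x in \<open>auto simp: special_bdf_def\<close>)
qed

section \<open>Existence: the radial solution, its collar and its normal form\<close>

subsection \<open>A special boundary defining function\<close>

text \<open>\<open>special_bdf\<close> refers to derivatives of the collar within a set that is not
  open in the ambient space. A curve staying in that set turns them into ordinary
  velocities.\<close>

lemma has_derivative_within_curve:
  assumes F: "(F has_derivative D) (at (c 0) within C)" and c: "(c has_vector_derivative w) (at (0::real))"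
    and ev: "\<forall>\<^sub>F s in nhds 0. c s \<in> C"
  shows "((\<lambda>s. F (c s)) has_vector_derivative D w) (at 0)"
proof -
  obtain T where T: "open T" "0 \<in> T" "c ` T \<subseteq> C" using ev unfolding eventually_nhds by blast
  have "(c has_derivative (\<lambda>s. s *\<^sub>R w)) (at 0 within T)"
    using c unfolding has_vector_derivative_def by (rule has_derivative_at_withinI)
  then have "((\<lambda>s. F (c s)) has_derivative (\<lambda>s. D (s *\<^sub>R w))) (at 0 within T)"
    by (rule has_derivative_in_compose) (rule has_derivative_subset[OF F T(3)])
  then show ?thesis
    unfolding has_vector_derivative_def at_within_open[OF T(2,1)]
    using linear_scale[OF has_derivative_linear[OF F]] by simp
qed

lemma bilinear_bdry_metric: "bilinear (\<lambda>v v'. a * bdry_metric \<beta> P y v v')"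
proof -
  have l: "dtau \<beta> w (x + z) = dtau \<beta> w x + dtau \<beta> w z" "dtau \<beta> w (r *\<^sub>R x) = r * dtau \<beta> w x" for w x z r
    by (simp_all add: dtau_def algebra_simps add_divide_distrib diff_divide_distrib)
  show ?thesis
    unfolding bilinear_def linear_iff by (simp add: bdry_metric_def l algebra_simps)
qed

lemma bdry_metric_pos:
  assumes y: "y \<in> bdry" and v: "tangent_bdry y v" "v \<noteq> 0" and P: "0 < P" and \<beta>: "0 < \<beta>"
  shows "0 < bdry_metric \<beta> P y v v"
proof (cases "fst v = 0")
  case True
  let ?w = "snd y" and ?v = "snd v"
  have n: "norm ?w = 1" "?w \<bullet> ?w = 1" "?w \<bullet> ?v = 0" "?v \<bullet> ?v \<noteq> 0"
    using y v True by (auto simp: bdry_def norm_1_iff tangent_bdry_def prod_eq_iff)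
  have "(?w $ 1 * ?v $ 2 - ?w $ 2 * ?v $ 1)\<^sup>2 = (?w \<bullet> ?w) * (?v \<bullet> ?v) - (?w \<bullet> ?v)\<^sup>2"
    unfolding inner2 by algebra
  then have "?w $ 1 * ?v $ 2 - ?w $ 2 * ?v $ 1 \<noteq> 0" using n by auto
  then have "dtau \<beta> ?w ?v \<noteq> 0" using \<beta> by (simp add: dtau_def n(1))
  then have "0 < (dtau \<beta> ?w ?v)\<^sup>2" by simp
  then show ?thesis using P True by (simp add: bdry_metric_def power2_eq_square)
next
  case False
  then have "0 < fst v \<bullet> fst v" by simp
  moreover have "0 \<le> P * (dtau \<beta> (snd y) (snd v) * dtau \<beta> (snd y) (snd v))"
    using P by (intro mult_nonneg_nonneg zero_le_square) simp
  ultimately show ?thesis unfolding bdry_metric_def by linarith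
qed

text \<open>The function \<open>\<rho> * exp (G \<rho>)\<close> of \<open>\<rho>\<close> satisfies the eikonal equation near the boundary; it is
  interpolated to the constant 1, and \<open>k\<close> is its inverse near 0.\<close>

locale ah_end_profile = ah_end +
  fixes \<eta> \<epsilon> :: real and G k cut :: "real \<Rightarrow> real" and W
  assumes \<eta>: "0 < \<eta>" "\<eta> \<le> \<delta>0"
    and lapse_\<eta>: "\<And>\<rho>. \<bar>\<rho>\<bar> < \<eta> \<Longrightarrow> 0 < lapse m \<rho>"
    and G: "smooth_on G {-\<eta><..<\<eta>}"
    and \<epsilon>: "0 < \<epsilon>" and k: "smooth_on k {-\<epsilon><..<\<epsilon>}" "k 0 = 0"
      "\<And>t. \<bar>t\<bar> < \<epsilon> \<Longrightarrow> \<bar>k t\<bar> < \<eta> / 2 \<and> k t * exp (G (k t)) = t"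
      "\<And>\<rho>. \<bar>\<rho>\<bar> < \<eta> \<Longrightarrow> \<bar>\<rho> * exp (G \<rho>)\<bar> < \<epsilon> \<Longrightarrow> k (\<rho> * exp (G \<rho>)) = \<rho>"
      "\<And>t. \<bar>t\<bar> < \<epsilon> \<Longrightarrow> (k has_real_derivative sqrt (lapse m (k t)) * exp (- G (k t))) (at t)"
    and cut: "smooth_on cut UNIV" "\<And>t. t \<le> \<eta> / 2 \<Longrightarrow> cut t = 0" "\<And>t. 3 * \<eta> / 4 \<le> t \<Longrightarrow> cut t = 1"
      "\<And>t. 0 \<le> cut t" "\<And>t. cut t \<le> 1"
    and W: "open W" "M - off_core \<subseteq> W" "\<And>p. p \<in> W \<Longrightarrow> p \<in> off_core \<Longrightarrow> p \<in> closure M \<Longrightarrow> \<eta> \<le> R p"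
begin

definition prof :: "real \<Rightarrow> real" where
  "prof \<rho> = (1 - cut \<rho>) * (\<rho> * exp (G \<rho>)) + cut \<rho>"

definition bdf :: "R32 \<Rightarrow> real" where
  "bdf p = (if p \<in> off_core then prof (R p) else 1)"

definition collar :: "real \<times> R32 \<Rightarrow> R32" where
  "collar = (\<lambda>(t, y). emb (k t) y)"

abbreviation "C \<equiv> {0..<\<epsilon>} \<times> bdry"

text \<open>G is smooth only on (-\<eta>, \<eta>). Beyond 3\<eta>/4 the function is constant 1, so
  two overlapping open sets suffice.\<close>

lemma smooth_prof: "smooth_on prof {-\<eta><..}"
proof (rule smooth_on_UN)
  fix \<rho> assume \<rho>: "\<rho> \<in> {-\<eta><..}"
  show "\<exists>U. open U \<and> \<rho> \<in> U \<and> smooth_on prof U"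
  proof (cases "\<rho> < \<eta>")
    case True
    let ?U = "{-\<eta><..<\<eta>}"
    have o: "open ?U" by simp
    have "smooth_on prof ?U"
      unfolding prof_def
      by (intro smooth_on_add smooth_on_mult smooth_on_diff smooth_on_exp smooth_on_const smooth_on_id o G
          smooth_on_subset[OF cut(1)]) auto
    then show ?thesis using True \<rho> o by (intro exI[of _ ?U]) auto
  next
    case False
    let ?U = "{3 * \<eta> / 4<..}"
    have o: "open ?U" by simp
    have "smooth_on prof ?U"
      by (rule smooth_on_cong[OF o smooth_on_const[OF o, of 1]]) (simp add: prof_def cut)
    then show ?thesis using False \<eta> o by (intro exI[of _ ?U]) auto
  qed
qed

lemma prof_small: "\<rho> \<le> \<eta> / 2 \<Longrightarrow> prof \<rho> = \<rho> * exp (G \<rho>)"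
  by (simp add: prof_def cut)

lemma prof_pos:
  assumes "0 < \<rho>"
  shows "0 < prof \<rho>"
proof (cases "cut \<rho> = 1")
  case False
  then have "0 < 1 - cut \<rho>" using cut(5)[of \<rho>] by simp
  then have "0 < (1 - cut \<rho>) * (\<rho> * exp (G \<rho>))" using assms by simp
  then show ?thesis using cut(4)[of \<rho>] by (simp add: prof_def)
qed (simp add: prof_def)

lemma k_mem:
  assumes "0 \<le> t" "t < \<epsilon>"
  shows "0 \<le> k t" "k t < \<eta> / 2" "0 < t \<Longrightarrow> 0 < k t" "k t \<in> insert 0 I" "0 < t \<Longrightarrow> k t \<in> I"
proof -
  have k': "\<bar>k t\<bar> < \<eta> / 2" "k t * exp (G (k t)) = t" using k(3)[of t] assms by auto
  show p: "0 < k t" if "0 < t"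
  proof (rule ccontr)
    assume "\<not> 0 < k t"
    then have "k t * exp (G (k t)) \<le> 0" by (intro mult_nonpos_nonneg) auto
    then show False using that k'(2) by simp
  qed
  show lt: "k t < \<eta> / 2" using k'(1) by simp
  show i: "k t \<in> I" if "0 < t" using p[OF that] lt \<eta> \<delta>0 by auto
  show "0 \<le> k t" "k t \<in> insert 0 I" using p i k(2) assms by (cases "t = 0"; auto)+
qed

lemma smooth_bdf: "smooth_map (closure M) bdf"
  unfolding smooth_map_def
proof
  fix p assume p: "p \<in> closure M"
  show "\<exists>U h. open U \<and> p \<in> U \<and> smooth_on h U \<and> (\<forall>q\<in>U \<inter> closure M. h q = bdf q)"
  proof (cases "p \<in> off_core")
    case True
    let ?U = "off_core \<inter> R -` {-\<eta><..}"
    have o: "open ?U"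
      by (rule continuous_open_preimage[OF smooth_on_imp_continuous_on[OF R(1)] open_off_core]) simp
    have "R p \<in> insert 0 I" using emb_R[OF p True] by blast
    then have "p \<in> ?U" using True I \<eta> by auto
    moreover have "smooth_on (\<lambda>p. prof (R p)) ?U"
      by (rule smooth_on_compose[OF o _ _ smooth_on_subset[OF R(1)] smooth_prof]) auto
    moreover have "\<forall>q\<in>?U \<inter> closure M. prof (R q) = bdf q" by (simp add: bdf_def)
    ultimately show ?thesis using o by (intro exI[of _ ?U] exI[of _ "\<lambda>p. prof (R p)"]) blast
  next
    case False
    then have "p \<in> W" using p W(2) closure_M bdry_subset_off_core by blast
    \<comment> \<open>On W and off the core \<rho> is at least \<eta>, where the cut-off has reached
      1. Thus the function is constant near the core, across which R is not assumed smooth.\<close>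
    moreover have "1 = bdf q" if "q \<in> W \<inter> closure M" for q
      using W(3)[of q] that \<eta> by (auto simp: bdf_def prof_def cut(3))
    ultimately show ?thesis
      using W(1) smooth_on_const[OF W(1), of "1::real"] by (intro exI[of _ W] exI[of _ "\<lambda>_. 1"]) blast
  qed
qed

lemma bdf_pos: "p \<in> M \<Longrightarrow> 0 < bdf p"
  using R_pos[of p] I by (auto simp: bdf_def intro: prof_pos)

lemma bdf_emb: "\<rho> \<in> insert 0 I \<Longrightarrow> y \<in> bdry \<Longrightarrow> bdf (emb \<rho> y) = prof \<rho>"
  using emb_off_core[of \<rho> y] J bdry_subset_off_core R(2)[of \<rho> y] by (auto simp: bdf_def)

lemma bdf_bdry: "y \<in> bdry \<Longrightarrow> bdf y = 0"
  using bdf_emb[of 0 y] \<eta> by (simp add: emb_0 prof_small)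

lemma bdf_collar: "t \<in> {0..<\<epsilon>} \<Longrightarrow> y \<in> bdry \<Longrightarrow> bdf (collar (t, y)) = t"
  using bdf_emb[of "k t" y] k_mem[of t] k(3)[of t] by (auto simp: collar_def prof_small)

definition collar_inv :: "R32 \<Rightarrow> real \<times> R32" where
  "collar_inv p = (R p * exp (G (R p)), directions p)"

definition collar_domain :: "real set" where
  "collar_domain = {-\<eta><..<\<eta>} \<inter> (\<lambda>\<rho>. \<rho> * exp (G \<rho>)) -` {-\<epsilon><..<\<epsilon>}"

lemma open_collar_domain: "open collar_domain"
proof -
  have "continuous_on {-\<eta><..<\<eta>} (\<lambda>\<rho>. \<rho> * exp (G \<rho>))"
    by (intro continuous_intros smooth_on_imp_continuous_on[OF G])
  then show ?thesis unfolding collar_domain_def by (rule continuous_open_preimage) auto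
qed

lemma open_collar_image: "open (off_core \<inter> R -` collar_domain)"
  by (rule continuous_open_preimage[OF smooth_on_imp_continuous_on[OF R(1)] open_off_core open_collar_domain])

lemma collar_inv_collar:
  assumes "z \<in> C"
  shows "collar_inv (collar z) = z" "collar z \<in> closure M \<inter> (off_core \<inter> R -` collar_domain)"
proof -
  obtain t y where z: "z = (t, y)" "0 \<le> t" "t < \<epsilon>" "y \<in> bdry" using assms by auto
  note km = k_mem[OF z(2,3)]
  have k': "\<bar>k t\<bar> < \<eta> / 2" "k t * exp (G (k t)) = t" using k(3)[of t] z by auto
  have kJ: "k t \<in> J" using km(4) J by auto
  have Rk: "R (emb (k t) y) = k t" by (rule R(2)[OF km(4) z(4)])
  have dk: "directions (emb (k t) y) = y" by (rule directions_emb[OF kJ z(4)])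
  have oc: "emb (k t) y \<in> off_core" using emb_off_core[OF kJ] z(4) bdry_subset_off_core by blast
  have cl: "emb (k t) y \<in> closure M" by (rule emb_closure[OF km(4) z(4)])
  show "collar_inv (collar z) = z" by (simp add: z(1) collar_def collar_inv_def Rk dk k')
  show "collar z \<in> closure M \<inter> (off_core \<inter> R -` collar_domain)"
    using oc cl k' z by (auto simp: z(1) collar_def collar_domain_def Rk)
qed

lemma collar_collar_inv:
  assumes "p \<in> closure M" "p \<in> off_core" "R p \<in> collar_domain"
  shows "collar_inv p \<in> C" "collar (collar_inv p) = p"
proof -
  have R': "R p \<in> insert 0 I" "emb (R p) (directions p) = p" using emb_R[OF assms(1,2)] by auto
  have p: "0 \<le> R p" using R'(1) I by auto
  have r: "\<bar>R p\<bar> < \<eta>" "\<bar>R p * exp (G (R p))\<bar> < \<epsilon>" using assms(3) by (auto simp: collar_domain_def)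
  have "0 \<le> R p * exp (G (R p))" using p by simp
  with r(2) have "R p * exp (G (R p)) \<in> {0..<\<epsilon>}" by simp
  then show "collar_inv p \<in> C" unfolding collar_inv_def using directions_mem_bdry[OF assms(2)] by blast
  show "collar (collar_inv p) = p" by (simp add: collar_inv_def collar_def k(4)[OF r] R'(2))
qed

lemma collar_image: "collar ` C = closure M \<inter> (off_core \<inter> R -` collar_domain)"
  using collar_inv_collar(2) collar_collar_inv by (safe; force)

lemma inj_collar: "inj_on collar C"
  by (rule inj_on_inverseI[of _ collar_inv]) (rule collar_inv_collar)

definition collar_nhd :: "(real \<times> R32) set" where
  "collar_nhd = ({-\<epsilon><..<\<epsilon>} \<inter> k -` J) \<times> UNIV"

lemma open_collar_nhd: "open collar_nhd"
  unfolding collar_nhd_def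
  by (intro open_Times continuous_open_preimage smooth_on_imp_continuous_on[OF k(1)] J(1)) auto

lemma C_collar_nhd: "z \<in> C \<Longrightarrow> z \<in> collar_nhd"
  using k_mem(4) J by (fastforce simp: collar_nhd_def)

lemma smooth_k_fst: "smooth_on (\<lambda>z. k (fst z)) collar_nhd"
  by (rule smooth_on_compose[OF open_collar_nhd _ _ smooth_on_fst[OF open_collar_nhd smooth_on_id[OF open_collar_nhd]] k(1)])
    (auto simp: collar_nhd_def)

lemma smooth_collar_nhd: "smooth_on collar collar_nhd"
proof -
  have "smooth_on (\<lambda>z. (k (fst z), snd z)) collar_nhd"
    by (intro smooth_on_Pair smooth_k_fst smooth_on_snd smooth_on_id open_collar_nhd)
  from smooth_on_compose[OF open_collar_nhd open_Times[OF J(1) open_UNIV] _ this smooth_on_emb]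
  show ?thesis by (auto simp: collar_def case_prod_unfold collar_nhd_def)
qed

lemma smooth_collar: "smooth_map C collar"
  by (rule smooth_mapI[OF C_collar_nhd open_collar_nhd smooth_collar_nhd]) auto

lemma smooth_collar_inv: "smooth_map (collar ` C) (the_inv_into C collar)"
proof (rule smooth_mapI)
  let ?U = "off_core \<inter> R -` collar_domain"
  show "open ?U" by (rule open_collar_image)
  have s: "smooth_on (\<lambda>\<rho>. \<rho> * exp (G \<rho>)) {-\<eta><..<\<eta>}"
    by (intro smooth_on_mult smooth_on_exp smooth_on_id G) auto
  have "smooth_on (\<lambda>p. R p * exp (G (R p))) ?U"
    by (rule smooth_on_compose[OF open_collar_image _ _ smooth_on_subset[OF R(1)] s]) (auto simp: collar_domain_def)
  then have "smooth_on (\<lambda>p. (R p * exp (G (R p)), directions p)) ?U"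
    by (intro smooth_on_Pair open_collar_image smooth_on_subset[OF smooth_on_directions]) auto
  then show "smooth_on collar_inv ?U" by (simp add: collar_inv_def[abs_def])
  fix p assume p: "p \<in> collar ` C"
  then show "p \<in> ?U" using collar_image by blast
  obtain z where z: "z \<in> C" "p = collar z" using p by blast
  show "collar_inv p = the_inv_into C collar p"
    unfolding z(2) the_inv_into_f_f[OF inj_collar z(1)] by (rule collar_inv_collar(1)[OF z(1)])
qed

text \<open>With t = \<rho> exp(G(\<rho>)) one has t^2 g = dt^2 + exp(2G) (P d\<tau>^2 + g_S), and
  this is the second summand with \<rho> = k t.\<close>

definition slice :: "real \<Rightarrow> R32 metric_field" where
  "slice t y v w = exp (2 * G (k t)) * bdry_metric \<beta> (lapse m (k t)) y v w"

lemma smooth_slice: "smooth_map C (\<lambda>(t, y). slice t y v w)"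
proof (rule smooth_mapI)
  let ?U = "collar_nhd \<inter> ({-\<epsilon><..<\<epsilon>} \<times> off_core)"
  have o: "open ?U" by (intro open_Int open_Times open_collar_nhd open_off_core) auto
  then show "open ?U" .
  show "p \<in> ?U" if "p \<in> C" for p using C_collar_nhd[OF that] that bdry_subset_off_core by auto
  have kf: "smooth_on (\<lambda>z. k (fst z)) ?U" by (rule smooth_on_subset[OF smooth_k_fst]) auto
  have g: "smooth_on (\<lambda>z. G (k (fst z))) ?U"
    by (rule smooth_on_compose[OF o _ _ kf G]) (use k(3) in \<open>fastforce simp: abs_less_iff\<close>)+
  have ss: "smooth_on (\<lambda>z. snd (snd z)) ?U" by (intro smooth_on_snd smooth_on_id o)
  have c: "smooth_on (\<lambda>z. snd (snd z) $ i) ?U" for i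
    by (rule smooth_on_bounded_linear[OF o bounded_linear_vec_nth ss])
  have n: "smooth_on (\<lambda>z. norm (snd (snd z))) ?U"
    by (rule smooth_on_norm[OF o ss]) (auto simp: off_core_def)
  have d: "smooth_on (\<lambda>z. dtau \<beta> (snd (snd z)) u) ?U" for u
    unfolding dtau_def
    by (intro smooth_on_mult smooth_on_divide smooth_on_diff smooth_on_power smooth_on_const c n o)
      (auto simp: off_core_def)
  show "smooth_on (\<lambda>z. slice (fst z) (snd z) v w) ?U"
    unfolding slice_def bdry_metric_def
    by (intro smooth_on_mult smooth_on_add smooth_on_exp smooth_on_lapse smooth_on_const o g kf d)
qed auto

lemma slice_pos:
  assumes "t \<in> {0..<\<epsilon>}" "y \<in> bdry" "v \<in> tangent_space bdry y - {0}"
  shows "0 < slice t y v v"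
  unfolding slice_def
  using assms tangent_space_bdry[of v y] \<beta> lapse_\<eta>[of "k t"] k_mem[of t] \<eta>
  by (intro mult_pos_pos bdry_metric_pos) auto

text \<open>A derivative within C is determined only in directions tangent to C, so D (s, v) is
  evaluated on a curve in C with that velocity and compared with the chain rule for
  \<open>emb\<close>.\<close>

lemma collar_derivative:
  assumes t: "t \<in> {0<..<\<epsilon>}" and y: "y \<in> bdry" and D: "(collar has_derivative D) (at (t, y) within C)"
    and v: "v \<in> tangent_space bdry y"
  shows "D (s, v) = demb (k t) y (s * (sqrt (lapse m (k t)) * exp (- G (k t)))) v"
proof -
  obtain c :: "real \<Rightarrow> R32" where c: "c 0 = y" "\<forall>\<^sub>F \<sigma> in nhds 0. c \<sigma> \<in> bdry" "(c has_vector_derivative v) (at 0)"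
    using v unfolding tangent_space_def by blast
  define k' where "k' = sqrt (lapse m (k t)) * exp (- G (k t))"
  define ch where "ch = (\<lambda>\<sigma>. (t + \<sigma> * s, c \<sigma>))"
  have d1: "((\<lambda>\<sigma>. t + \<sigma> * s) has_vector_derivative s) (at 0)" by (auto intro!: derivative_eq_intros)
  have dch: "(ch has_vector_derivative (s, v)) (at 0)"
    unfolding ch_def by (rule has_vector_derivative_Pair[OF d1 c(3)])
  have ch0: "ch 0 = (t, y)" by (simp add: ch_def c)
  have "\<forall>\<^sub>F \<sigma> in nhds 0. t + \<sigma> * s \<in> {0<..<\<epsilon>}"
    by (rule eventually_nhds_of_tendsto[OF d1]) (use t in auto)
  with c(2) have ev: "\<forall>\<^sub>F \<sigma> in nhds 0. ch \<sigma> \<in> C" by eventually_elim (simp add: ch_def)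
  have 1: "((\<lambda>\<sigma>. collar (ch \<sigma>)) has_vector_derivative D (s, v)) (at 0)"
    by (rule has_derivative_within_curve[OF _ dch ev]) (simp add: ch0 D)
  have "(k has_real_derivative k') (at (t + 0 * s))" unfolding k'_def using k(5)[of t] t by simp
  then have dk: "((\<lambda>\<sigma>. k (t + \<sigma> * s)) has_vector_derivative s * k') (at 0)"
    using has_vector_derivative_chain[OF d1, of k "(*) k'"] by (simp add: has_field_derivative_def mult.commute)
  have kJ: "k (t + 0 * s) \<in> J" using k_mem(4)[of t] t J by auto
  have "((\<lambda>\<sigma>. (k (t + \<sigma> * s), c \<sigma>)) has_vector_derivative (s * k', v)) (at 0)"
    by (rule has_vector_derivative_Pair[OF dk c(3)])
  from has_vector_derivative_chain[OF this, of "\<lambda>x. emb (fst x) (snd x)" "\<lambda>x. demb (k t) y (fst x) (snd x)"]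
  have "((\<lambda>\<sigma>. collar (ch \<sigma>)) has_vector_derivative demb (k t) y (s * k') v) (at 0)"
    using emb_has_derivative[OF kJ, of y] by (simp add: collar_def ch_def c(1))
  then show ?thesis using vector_derivative_unique_at[OF 1] by (simp add: k'_def)
qed

text \<open>The square of k' is P exp(-2G): the factor P cancels the 1/P of the metric, and exp(-2G)
  turns \<rho>^-2 into t^-2.\<close>

lemma collar_normal_form:
  assumes t: "t \<in> {0<..<\<epsilon>}" and y: "y \<in> bdry" and D: "(collar has_derivative D) (at (t, y) within C)"
    and v: "v \<in> tangent_space bdry y" "v' \<in> tangent_space bdry y"
  shows "g (collar (t, y)) (D (s, v)) (D (s', v')) = (s * s' + slice t y v v') / t\<^sup>2"
proof -
  have km: "k t \<in> I" "0 < k t" using k_mem[of t] t by auto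
  have tk: "t = k t * exp (G (k t))" using k(3)[of t] t by simp
  let ?P = "lapse m (k t)" and ?E = "exp (G (k t))"
  have P: "0 < ?P" by (rule lapse_pos[OF km(1)])
  have "g (collar (t, y)) (D (s, v)) (D (s', v'))
    = (s * (sqrt ?P * exp (- G (k t))) * (s' * (sqrt ?P * exp (- G (k t)))) / ?P + bdry_metric \<beta> ?P y v v') / (k t)\<^sup>2"
    unfolding collar_derivative[OF t y D v(1)] collar_derivative[OF t y D v(2)]
    using metric[OF km(1) y tangent_space_bdry[OF v(1)] tangent_space_bdry[OF v(2)]] by (simp add: collar_def)
  also have "s * (sqrt ?P * exp (- G (k t))) * (s' * (sqrt ?P * exp (- G (k t)))) / ?P = s * s' * (sqrt ?P)\<^sup>2 / ?P / ?E\<^sup>2"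
    by (simp add: exp_minus power2_eq_square divide_inverse mult_ac)
  also have "\<dots> = s * s' / ?E\<^sup>2" using P by simp
  also have "(s * s' / ?E\<^sup>2 + bdry_metric \<beta> ?P y v v') / (k t)\<^sup>2 = (s * s' + ?E\<^sup>2 * bdry_metric \<beta> ?P y v v') / (k t * ?E)\<^sup>2"
    using km(2) by (simp add: field_simps)
  also have "\<dots> = (s * s' + slice t y v v') / t\<^sup>2"
    unfolding tk[symmetric] by (simp add: slice_def exp_double)
  finally show ?thesis .
qed

theorem special_bdf_bdf: "special_bdf M g bdf"
  unfolding special_bdf_def boundary Let_def
proof (intro conjI exI[of _ \<epsilon>] exI[of _ collar] exI[of _ slice] allI ballI impI)
  show "openin (top_of_set (closure M)) (collar ` C)"
    unfolding collar_image using open_collar_image by blast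
  show "collar (0, y) = y" if "y \<in> bdry" for y by (simp add: collar_def k(2) emb_0)
  show "bilinear (slice t y)" for t y unfolding slice_def[abs_def] by (rule bilinear_bdry_metric)
  show "slice t y v w = slice t y w v" for t y v w
    by (simp add: slice_def bdry_metric_def mult.commute inner_commute)
  show "bdf (collar (t, y)) = t" if "t \<in> {0..<\<epsilon>}" "y \<in> bdry" for t y by (rule bdf_collar[OF that])
  show "0 < slice t y v v" if "t \<in> {0..<\<epsilon>}" "y \<in> bdry" "v \<in> tangent_space bdry y - {0}" for t y v
    by (rule slice_pos[OF that])
  show "g (collar (t, y)) (D (s, v)) (D (s', v')) = (s * s' + slice t y v v') / t\<^sup>2"
    if "t \<in> {0<..<\<epsilon>}" "y \<in> bdry" "(collar has_derivative D) (at (t, y) within C)"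
      "v \<in> tangent_space bdry y" "v' \<in> tangent_space bdry y" for t y D s s' v v'
    by (rule collar_normal_form[OF that])
qed (rule \<epsilon> smooth_bdf smooth_collar inj_collar smooth_collar_inv smooth_slice | rule bdf_pos bdf_bdry, assumption)+

end

section \<open>Meromorphic continuation of the zeta function of the radial solution\<close>

context ah_end_profile
begin

text \<open>Below \<eta>/2 the function equals \<rho> exp(G(\<rho>)), independent of the boundary
  point, so the integral near the boundary is 8\<pi>^2 times a one-dimensional one. That is
  continued to each half plane Re z > 3 - n and glued; the part with \<rho> \<ge> \<eta>/2 is
  entire.\<close>

lemma bdf_zeta_continuation: "\<exists>Z. volume_zeta_continuation M g bdf Z"
proof -
  define \<delta> where "\<delta> = \<eta> / 2"
  have \<delta>: "0 < \<delta>" "\<delta> \<le> \<delta>0" "\<delta> < \<eta>" using \<eta> by (auto simp: \<delta>_def)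
  let ?A = "interval_measure_at_0 \<delta>" and ?N = "restrict_space lborel coords_box"
  have cont: "continuous_on M bdf"
    by (rule continuous_on_subset[OF smooth_map_imp_continuous_on[OF smooth_bdf] closure_subset])
  define u where "u = (\<lambda>z \<rho>. of_real \<rho> powr (z - 4) * exp (z * of_real (G \<rho>)) :: complex)"
  have "\<forall>n. \<exists>Z. Z meromorphic_on {z. 3 - real n < Re z} \<and> (\<forall>z. 3 < Re z \<longrightarrow> has_bochner_integral ?A (u z) (Z z))"
  proof
    fix n
    have S: "open {-\<eta><..<\<eta>}" "{0..\<delta>} \<subseteq> {-\<eta><..<\<eta>}" using \<delta> by auto
    show "\<exists>Z. Z meromorphic_on {z. 3 - real n < Re z} \<and> (\<forall>z. 3 < Re z \<longrightarrow> has_bochner_integral ?A (u z) (Z z))"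
      using zeta_integrals_continue[OF \<delta>(1) S G smooth_on_const[OF S(1), of 1], of 0 n] by (simp add: u_def)
  qed
  then obtain Y0 where Y0: "\<And>n. Y0 n meromorphic_on {z. 3 - real n < Re z}"
    "\<And>n z. 3 < Re z \<Longrightarrow> has_bochner_integral ?A (u z) (Y0 n z)" by metis
  have eq: "Y0 n z = integral\<^sup>L ?A (u z)" if "3 < Re z" for n z
    using has_bochner_integral_integral_eq[OF Y0(2)[OF that, of n]] by simp
  obtain Y where Y: "Y meromorphic_on UNIV" "\<And>n w. 3 - real n < Re w \<Longrightarrow> \<forall>\<^sub>F z in at w. Y z = Y0 n z"
    using meromorphic_glue[of Y0 3 "\<lambda>z. integral\<^sup>L ?A (u z)", OF Y0(1) eq] by blast
  \<comment> \<open>Gluing determines Y only on punctured neighbourhoods, whereas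
    \<open>volume_zeta_continuation\<close> demands the value of the integral at every single z with
    Re z > 3. Resetting the values there does not affect meromorphy.\<close>
  define G1 where "G1 = (\<lambda>z. if 3 < Re z then integral\<^sup>L ?A (u z) else Y z)"
  have "\<forall>\<^sub>F z in at w. Y z = G1 z" for w
  proof -
    obtain n where "3 - Re w < real n" using reals_Archimedean2 by blast
    then have "\<forall>\<^sub>F z in at w. Y z = Y0 n z" by (intro Y(2)) simp
    then show ?thesis by eventually_elim (simp add: G1_def eq)
  qed
  then have G1: "G1 meromorphic_on UNIV" using Y(1) meromorphic_on_cong[of UNIV Y G1 UNIV] by blast
  obtain G2 where G2: "G2 holomorphic_on UNIV"
    "\<And>z. has_bochner_integral (restrict_space lborel (I \<inter> {\<delta>..}) \<Otimes>\<^sub>M ?N)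
       (\<lambda>(\<rho>, \<eta>). of_real (1 / \<rho> ^ 4) * of_real (bdf (emb \<rho> (polar \<eta>))) powr z) (G2 z)"
    using zeta_away[OF cont bdf_pos \<delta>(1,2)] by blast
  define Z where "Z = (\<lambda>z. of_real (\<beta> / (2 * pi)) * (G1 z * of_real (8 * pi\<^sup>2) + G2 z))"
  have "Z meromorphic_on UNIV"
    unfolding Z_def using G2(1)
    by (intro meromorphic_intros G1 analytic_on_imp_meromorphic_on) (simp add: analytic_on_open)
  moreover have "has_bochner_integral (riemannian_volume M g) (\<lambda>p. of_real (bdf p) powr z) (Z z)" if z: "3 < Re z" for z
  proof -
    let ?h = "\<lambda>(\<rho>, \<eta>). of_real (1 / \<rho> ^ 4) * of_real (bdf (emb \<rho> (polar \<eta>))) powr z :: complex"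
    have sub: "{0<..<\<delta>} \<subseteq> I" using \<delta> \<delta>0 by auto
    interpret N: finite_measure ?N by (rule finite_coords_box)
    have "has_bochner_integral ?A (u z) (G1 z)"
      using Y0(2)[OF z, of 0] eq[OF z, of 0] z by (simp add: G1_def)
    moreover have "has_bochner_integral ?N (\<lambda>_. 1::complex) (of_real (8 * pi\<^sup>2))"
      using measure_coords_box(1) N.integrable_const[of "1::complex"]
      by (simp add: has_bochner_integral_iff space_restrict_space scaleR_conv_of_real)
    ultimately have ch: "has_bochner_integral (?A \<Otimes>\<^sub>M ?N) (\<lambda>(\<rho>, \<eta>). u z \<rho> * 1) (G1 z * of_real (8 * pi\<^sup>2))"
      by (intro has_bochner_integral_pair_mult sigma_finite_interval_measure_at_0 N.sigma_finite_measure_axioms)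
    have "has_bochner_integral (?A \<Otimes>\<^sub>M ?N) ?h (G1 z * of_real (8 * pi\<^sup>2))"
    proof (rule has_bochner_integral_cong[THEN iffD1, OF refl _ refl ch])
      fix y assume y: "y \<in> space (?A \<Otimes>\<^sub>M ?N)"
      obtain \<rho> \<eta>' where y': "y = (\<rho>, \<eta>')" by (cases y)
      with y have \<rho>: "0 < \<rho>" "\<rho> < \<delta>" "\<rho> \<in> I" "\<eta>' \<in> coords_box"
        using sub by (auto simp: space_pair_measure space_restrict_space)
      have b: "bdf (emb \<rho> (polar \<eta>')) = \<rho> * exp (G \<rho>)"
        using bdf_emb[of \<rho> "polar \<eta>'"] \<rho> polar_mem_bdry prof_small[of \<rho>] by (simp add: \<delta>_def)
      have "complex_of_real \<rho> powr (z - 4) = of_real \<rho> powr z / of_real \<rho> ^ 4"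
        using \<rho>(1) powr_diff[of "complex_of_real \<rho>" z 4] by simp
      moreover have "complex_of_real (\<rho> * exp (G \<rho>)) powr z = of_real \<rho> powr z * exp (z * of_real (G \<rho>))"
        using \<rho>(1) by (simp add: powr_def Ln_of_real ln_mult exp_add[symmetric] algebra_simps exp_of_real[symmetric] del: of_real_mult)
      ultimately show "(case y of (\<rho>, \<eta>) \<Rightarrow> u z \<rho> * 1) = ?h y" by (simp add: y' b u_def)
    qed
    then have "has_bochner_integral (restrict_space lborel ({0<..<\<delta>} \<union> (I \<inter> {\<delta>..})) \<Otimes>\<^sub>M ?N) ?h (G1 z * of_real (8 * pi\<^sup>2) + G2 z)"
      using I by (intro has_bochner_integral_split G2(2)) auto
    moreover have "{0<..<\<delta>} \<union> (I \<inter> {\<delta>..}) = I" using sub I by force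
    ultimately have "has_bochner_integral (restrict_space lborel I \<Otimes>\<^sub>M ?N) ?h (G1 z * of_real (8 * pi\<^sup>2) + G2 z)"
      by simp
    then have "has_bochner_integral (restrict_space lborel I \<Otimes>\<^sub>M ?N) (\<lambda>y. of_real (\<beta> / (2 * pi)) * ?h y) (Z z)"
      unfolding Z_def by (intro has_bochner_integral_mult_right) simp
    also have "(\<lambda>y. of_real (\<beta> / (2 * pi)) * ?h y)
       = (\<lambda>(\<rho>, \<eta>). (\<beta> / (2 * pi) / \<rho> ^ 4) *\<^sub>R of_real (bdf (emb \<rho> (polar \<eta>))) powr z)"
      by (auto simp: fun_eq_iff scaleR_conv_of_real)
    finally have v: "has_bochner_integral (restrict_space lborel I \<Otimes>\<^sub>M ?N)
      (\<lambda>(\<rho>, \<eta>). (\<beta> / (2 * pi) / \<rho> ^ 4) *\<^sub>R of_real (bdf (emb \<rho> (polar \<eta>))) powr z) (Z z)" .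
    have xm: "bdf \<in> borel_measurable (restrict_space borel M)"
      by (rule borel_measurable_continuous_on_restrict[OF cont])
    have "(\<lambda>t::real. complex_of_real t powr z) \<in> borel_measurable borel" by measurable
    from measurable_compose[OF xm this]
    show ?thesis using volume_integral v by blast
  qed
  ultimately show ?thesis unfolding volume_zeta_continuation_def by blast
qed

end

lemma (in ah_end) special_bdf_exists: "\<exists>x Z. special_bdf M g x \<and> volume_zeta_continuation M g x Z"
proof -
  obtain r W where r: "0 < r" and W: "open W" "M - off_core \<subseteq> W" "\<forall>p\<in>W \<inter> off_core \<inter> closure M. r < R p"
    using core by blast
  \<comment> \<open>\<eta> has to stay below \<delta>0, so that the interval of interpolation lies
    in I, and below r, so that the interpolation is complete on the neighbourhood W of the
    core.\<close>
  have pos: "0 < min \<delta>0 r" using \<delta>0 r by simp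
  obtain \<eta> G where \<eta>: "0 < \<eta>" "\<eta> \<le> min \<delta>0 r" and P: "\<And>\<rho>. \<bar>\<rho>\<bar> < \<eta> \<Longrightarrow> 0 < lapse m \<rho>"
    and G: "smooth_on G {-\<eta><..<\<eta>}" "G 0 = 0"
    and dG: "\<And>\<rho>. \<bar>\<rho>\<bar> < \<eta> \<Longrightarrow> ((\<lambda>\<rho>. \<rho> * exp (G \<rho>)) has_real_derivative exp (G \<rho>) / sqrt (lapse m \<rho>)) (at \<rho>)"
    by (rule profile_exists[OF pos, of m], rule that)
  obtain \<epsilon> k where k: "0 < \<epsilon>" "smooth_on k {-\<epsilon><..<\<epsilon>}" "k 0 = 0"
    "\<And>t. \<bar>t\<bar> < \<epsilon> \<Longrightarrow> \<bar>k t\<bar> < \<eta> / 2 \<and> k t * exp (G (k t)) = t"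
    "\<And>\<rho>. \<bar>\<rho>\<bar> < \<eta> \<Longrightarrow> \<bar>\<rho> * exp (G \<rho>)\<bar> < \<epsilon> \<Longrightarrow> k (\<rho> * exp (G \<rho>)) = \<rho>"
    "\<And>t. \<bar>t\<bar> < \<epsilon> \<Longrightarrow> (k has_real_derivative sqrt (lapse m (k t)) * exp (- G (k t))) (at t)"
    by (rule profile_inverse_exists[OF \<eta>(1) P G(1) dG], assumption, assumption, rule that)
  have \<eta>': "\<eta> \<le> \<delta>0" using \<eta>(2) by simp
  have lt: "\<eta> / 2 < 3 * \<eta> / 4" using \<eta> by simp
  obtain cut :: "real \<Rightarrow> real" where cut: "smooth_on cut UNIV" "\<And>t. t \<le> \<eta> / 2 \<Longrightarrow> cut t = 0"
    "\<And>t. 3 * \<eta> / 4 \<le> t \<Longrightarrow> cut t = 1" "\<And>t. 0 \<le> cut t" "\<And>t. cut t \<le> 1"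
    by (rule smooth_transition_exists[OF lt], rule that)
  interpret ah_end_profile M g \<beta> m c \<delta>0 I J al ga R V \<phi> \<tau> emb demb \<eta> \<epsilon> G k cut W
  proof (unfold_locales, goal_cases)
    case (18 p)
    then have "r < R p" using W(3) by blast
    then show ?case using \<eta> by simp
  qed (rule \<eta>(1) \<eta>' G(1) k(1-3) cut(1,4,5) W(1,2) | (rule P k(4,6) cut(2,3), assumption) | (rule k(5), assumption, assumption))+
  show ?thesis using special_bdf_bdf bdf_zeta_continuation by blast
qed

section \<open>The renormalized volume of an abstract end\<close>

theorem (in ah_end) RenV_eq: "RenV M g = 4 * pi * \<beta> * (m - c) / 3"
  unfolding RenV_def
proof (rule the_equality)
  show "\<exists>x Z. special_bdf M g x \<and> volume_zeta_continuation M g x Z \<and>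
      complex_of_real (4 * pi * \<beta> * (m - c) / 3) = fls_nth (laurent_expansion Z 0) 0"
    using special_bdf_exists finite_part_special_bdf by metis
  show "V = 4 * pi * \<beta> * (m - c) / 3" if "\<exists>x Z. special_bdf M g x \<and> volume_zeta_continuation M g x Z \<and>
      complex_of_real V = fls_nth (laurent_expansion Z 0) 0" for V
    using that finite_part_special_bdf by (metis of_real_eq_iff)
qed

section \<open>Stereographic charts covering the two model manifolds\<close>

subsection \<open>Stereographic charts\<close>

lemma smooth_on_vec:
  fixes f :: "'a::real_normed_vector \<Rightarrow> real^'n"
  assumes S: "open S" and f: "\<And>i. smooth_on (\<lambda>x. f x $ i) S"
  shows "smooth_on f S"
proof -
  have t: "smooth_on (\<lambda>x. (f x $ i) *\<^sub>R axis i (1::real)) S" for i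
    by (rule smooth_on_scaleR[OF S f smooth_on_const[OF S]])
  have "smooth_on (\<lambda>x. \<Sum>i\<in>UNIV. (f x $ i) *\<^sub>R axis i (1::real)) S"
    unfolding smooth_on_def by (intro allI C_k_on_sum S t[unfolded smooth_on_def, rule_format])
  moreover have "(\<lambda>x. \<Sum>i\<in>UNIV. (f x $ i) *\<^sub>R axis i (1::real)) = f"
    by (rule ext) (simp add: vec_eq_iff axis_def if_distrib[of "(*) _"] cong: if_cong)
  ultimately show ?thesis by simp
qed

lemma smooth_on_nth:
  fixes f :: "'a::real_normed_vector \<Rightarrow> real^'n"
  shows "open S \<Longrightarrow> smooth_on f S \<Longrightarrow> smooth_on (\<lambda>x. f x $ i) S"
  by (rule smooth_on_bounded_linear[OF _ bounded_linear_vec_nth])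

lemma chart_of_smooth_inverse:
  fixes \<phi> :: "real^4 \<Rightarrow> 'a::euclidean_space"
  assumes M: "M \<in> sets borel" and V: "open V" and \<phi>: "smooth_on \<phi> V" and W: "open W" and im: "\<phi> ` V = M \<inter> W"
    and \<tau>: "smooth_on \<tau> W" and inv: "\<And>u. u \<in> V \<Longrightarrow> \<tau> (\<phi> u) = u"
  shows "chart M V \<phi> (\<lambda>u. frechet_derivative \<phi> (at u)) \<tau>" and "local_param M V \<phi>"
proof -
  have d: "(\<phi> has_derivative frechet_derivative \<phi> (at u)) (at u)" if "u \<in> V" for u
    by (rule smooth_on_has_derivative[OF \<phi> that])
  have W': "\<phi> u \<in> W" if "u \<in> V" for u using im that by blast
  have d\<tau>: "(\<tau> has_derivative frechet_derivative \<tau> (at (\<phi> u))) (at (\<phi> u))" if "u \<in> V" for u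
    by (rule smooth_on_has_derivative[OF \<tau> W'[OF that]])
  have op: "openin (top_of_set M) (\<phi> ` V)" unfolding im using W by blast
  show "chart M V \<phi> (\<lambda>u. frechet_derivative \<phi> (at u)) \<tau>"
    by unfold_locales (use M V d op inv d\<tau> in \<open>auto intro: differentiableI\<close>)
  have "inj (frechet_derivative \<phi> (at u))" if u: "u \<in> V" for u
  proof -
    have "((\<lambda>u. \<tau> (\<phi> u)) has_derivative (\<lambda>v. frechet_derivative \<tau> (at (\<phi> u)) (frechet_derivative \<phi> (at u) v))) (at u)"
      by (rule has_derivative_compose[OF d[OF u] d\<tau>[OF u]])
    moreover have "((\<lambda>u. \<tau> (\<phi> u)) has_derivative (\<lambda>v. v)) (at u)"
      by (rule has_derivative_transform_within_open[OF has_derivative_ident V u]) (simp add: inv)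
    ultimately have "(\<lambda>v. frechet_derivative \<tau> (at (\<phi> u)) (frechet_derivative \<phi> (at u) v)) = (\<lambda>v. v)"
      by (rule has_derivative_unique)
    then show ?thesis by (intro inj_on_inverseI[of _ "frechet_derivative \<tau> (at (\<phi> u))"]) (simp add: fun_eq_iff)
  qed
  moreover have "homeomorphism V (\<phi> ` V) \<phi> \<tau>"
  proof (rule homeomorphismI)
    show "continuous_on V \<phi>" by (rule smooth_on_imp_continuous_on[OF \<phi>])
    show "continuous_on (\<phi> ` V) \<tau>"
      by (rule continuous_on_subset[OF smooth_on_imp_continuous_on[OF \<tau>]]) (use im in blast)
  qed (use inv in auto)
  ultimately show "local_param M V \<phi>" unfolding local_param_def using V \<phi> op by blast
qed

text \<open>The position, on the axis of projection, of the point that chart \<open>b\<close>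
  omits.\<close>

definition pole :: "bool \<Rightarrow> real" where "pole b = (if b then 1 else -1)"

lemma pole_sq: "pole b * pole b = 1" by (simp add: pole_def)

text \<open>q is the squared norm of the stereographic coordinate; in this form the identities serve
  the sphere and the circle alike.\<close>

lemma stereographic:
  fixes q :: real
  assumes "0 \<le> q"
  shows "1 - pole b * (pole b * (q - 1) / (1 + q)) = 2 / (1 + q)" "4 * q / (1 + q)\<^sup>2 + (pole b * (q - 1) / (1 + q))\<^sup>2 = 1"
proof -
  have q: "1 + q \<noteq> 0" using assms by simp
  show "1 - pole b * (pole b * (q - 1) / (1 + q)) = 2 / (1 + q)"
    using q by (cases b) (simp_all add: pole_def field_simps)
  have "(pole b)\<^sup>2 = 1" by (simp add: pole_def)
  then have "4 * q / (1 + q)\<^sup>2 + (pole b * (q - 1) / (1 + q))\<^sup>2 = (4 * q + (q - 1)\<^sup>2) / (1 + q)\<^sup>2"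
    by (simp add: power_divide power_mult_distrib add_divide_distrib)
  also have "4 * q + (q - 1)\<^sup>2 = (1 + q)\<^sup>2" by algebra
  finally show "4 * q / (1 + q)\<^sup>2 + (pole b * (q - 1) / (1 + q))\<^sup>2 = 1" using q by simp
qed

lemma stereographic_inverse:
  fixes s t d :: real
  assumes "s + t\<^sup>2 = 1" and d: "d = 1 - pole b * t" "d \<noteq> 0"
  shows "1 + s / d\<^sup>2 = 2 / d" "pole b * (s / d\<^sup>2 - 1) = 2 * t / d"
proof -
  have "s = d * (2 - d)" using assms(1) pole_sq[of b] unfolding d(1) by algebra
  then have e: "s / d\<^sup>2 = 2 / d - 1" using d(2) by (simp add: field_simps power2_eq_square)
  then show "1 + s / d\<^sup>2 = 2 / d" by simp
  have t: "t = pole b * (1 - d)" using pole_sq[of b] unfolding d(1) by algebra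
  show "pole b * (s / d\<^sup>2 - 1) = 2 * t / d" unfolding e using d(2) by (subst t) (simp add: field_simps)
qed

lemma norm_less_1_iff: "norm x < 1 \<longleftrightarrow> x \<bullet> x < 1" and norm_le_1_iff: "norm x \<le> 1 \<longleftrightarrow> x \<bullet> x \<le> 1"
  by (simp_all add: norm_eq_sqrt_inner)

lemma nn_integral_inverse_power4:
  assumes "0 < \<delta>"
  shows "(\<integral>\<^sup>+\<rho>. ennreal (1 / \<rho> ^ 4) * indicator {\<delta>..} \<rho> \<partial>lborel) = ennreal (1 / (3 * \<delta> ^ 3))"
proof -
  have "(\<integral>\<^sup>+\<rho>. ennreal (1 / \<rho> ^ 4) * indicator {\<delta>..} \<rho> \<partial>lborel) = ennreal (0 - (- (1 / (3 * \<delta> ^ 3))))"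
  proof (rule nn_integral_FTC_atLeast)
    show "((\<lambda>\<rho>. - (1 / (3 * \<rho> ^ 3))) has_real_derivative 1 / x ^ 4) (at x)" if "\<delta> \<le> x" for x :: real
      using that assms by (auto intro!: derivative_eq_intros simp: field_simps power2_eq_square power3_eq_cube power4_eq_xxxx)
    show "((\<lambda>\<rho>::real. - (1 / (3 * \<rho> ^ 3))) \<longlongrightarrow> 0) at_top" by real_asymp
  qed (use assms in auto)
  then show ?thesis by simp
qed

subsection \<open>Black holes\<close>

text \<open>z1 and z2 are stereographic coordinates on the sphere, z3 and z4 coordinates of the
  disc. The order makes the second components of both factors positive multiples of z2 and z4, as
  \<open>charts_null\<close> requires.\<close>

definition bh_chart :: "bool \<Rightarrow> real^4 \<Rightarrow> R32" where
  "bh_chart b z = (let q = (z $ 1)\<^sup>2 + (z $ 2)\<^sup>2 in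
     (vector [2 * z $ 1 / (1 + q), 2 * z $ 2 / (1 + q), pole b * (q - 1) / (1 + q)], vector [z $ 3, z $ 4]))"

definition bh_coords :: "bool \<Rightarrow> R32 \<Rightarrow> real^4" where
  "bh_coords b p = (let d = 1 - pole b * fst p $ 3 in vector [fst p $ 1 / d, fst p $ 2 / d, snd p $ 1, snd p $ 2])"

definition bh_chart_domain :: "(real^4) set" where
  "bh_chart_domain = {z. (z $ 3)\<^sup>2 + (z $ 4)\<^sup>2 < 1}"

lemma bh_space_iff: "p \<in> bh_space \<longleftrightarrow>
    (fst p $ 1)\<^sup>2 + (fst p $ 2)\<^sup>2 + (fst p $ 3)\<^sup>2 = 1 \<and> (snd p $ 1)\<^sup>2 + (snd p $ 2)\<^sup>2 < 1"
  by (cases p) (simp add: bh_space_def norm_1_iff norm_less_1_iff inner3 inner2 power2_eq_square)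

lemma bh_space_borel: "bh_space \<in> sets borel"
  unfolding bh_space_def by (intro borel_Times) auto

lemma bh_charts:
  shows "chart bh_space bh_chart_domain (bh_chart b) (\<lambda>u. frechet_derivative (bh_chart b) (at u)) (bh_coords b)" (is ?A)
    and "local_param bh_space bh_chart_domain (bh_chart b)" (is ?B)
    and "bh_chart b ` bh_chart_domain = bh_space \<inter> {p. 0 < 1 - pole b * fst p $ 3}"
proof -
  let ?W = "{p::R32. 0 < 1 - pole b * fst p $ 3}"
  have W: "open ?W" by (intro open_Collect_less continuous_intros)
  have V: "open bh_chart_domain" unfolding bh_chart_domain_def by (intro open_Collect_less continuous_intros)
  have q: "0 \<le> (z $ 1)\<^sup>2 + (z $ 2)\<^sup>2" for z :: "real^4" by simp
  have q': "1 + ((z $ 1)\<^sup>2 + (z $ 2)\<^sup>2) \<noteq> 0" for z :: "real^4" using q[of z] by linarith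
  have mem: "bh_chart b z \<in> bh_space \<inter> ?W" if "z \<in> bh_chart_domain" for z
  proof -
    define q where "q = (z $ 1)\<^sup>2 + (z $ 2)\<^sup>2"
    have q: "0 \<le> q" by (simp add: q_def)
    have "(2 * z $ 1 / (1 + q))\<^sup>2 + (2 * z $ 2 / (1 + q))\<^sup>2 = 4 * q / (1 + q)\<^sup>2"
      by (simp add: q_def power_divide power_mult_distrib add_divide_distrib)
    then have "bh_chart b z \<in> bh_space"
      using that stereographic(2)[OF q, of b]
      by (simp add: bh_space_iff bh_chart_def bh_chart_domain_def Let_def q_def[symmetric])
    moreover have e: "fst (bh_chart b z) $ 3 = pole b * (q - 1) / (1 + q)"
      by (simp add: bh_chart_def Let_def q_def)
    have "0 < 1 - pole b * fst (bh_chart b z) $ 3" unfolding e stereographic(1)[OF q, of b] using q by simp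
    ultimately show ?thesis by blast
  qed
  have inv: "bh_coords b (bh_chart b z) = z" for z
  proof -
    define q where "q = (z $ 1)\<^sup>2 + (z $ 2)\<^sup>2"
    have q: "0 \<le> q" "1 + q \<noteq> 0" "2 + q * 2 \<noteq> 0" by (simp_all add: q_def add_nonneg_eq_0_iff)
    then show ?thesis
      using stereographic(1)[OF q(1), of b]
      by (simp add: bh_coords_def bh_chart_def Let_def q_def[symmetric] vec_eq_iff forall_4) (simp add: field_simps)
  qed
  have inv': "bh_chart b (bh_coords b p) = p \<and> bh_coords b p \<in> bh_chart_domain" if p: "p \<in> bh_space" "p \<in> ?W" for p
  proof -
    define d where "d = 1 - pole b * fst p $ 3"
    have d: "d > 0" using p by (simp add: d_def)
    have s: "((fst p $ 1)\<^sup>2 + (fst p $ 2)\<^sup>2) + (fst p $ 3)\<^sup>2 = 1" using p(1) by (simp add: bh_space_iff)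
    have e: "(fst p $ 1 / d)\<^sup>2 + (fst p $ 2 / d)\<^sup>2 = ((fst p $ 1)\<^sup>2 + (fst p $ 2)\<^sup>2) / d\<^sup>2"
      by (simp add: power_divide add_divide_distrib)
    note st = stereographic_inverse[OF s d_def]
    have "bh_chart b (bh_coords b p) = p"
      using d by (simp add: bh_chart_def bh_coords_def Let_def d_def[symmetric] e st prod_eq_iff vec_eq_iff forall_3 forall_2)
    then show ?thesis using p(1) by (simp add: bh_coords_def Let_def bh_chart_domain_def bh_space_iff)
  qed
  show im: "bh_chart b ` bh_chart_domain = bh_space \<inter> ?W"
  proof
    show "bh_chart b ` bh_chart_domain \<subseteq> bh_space \<inter> ?W" using mem by blast
    show "bh_space \<inter> ?W \<subseteq> bh_chart b ` bh_chart_domain" using inv' by (metis (lifting) IntE image_eqI subsetI)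
  qed
  have zi: "smooth_on (\<lambda>z::real^4. z $ i) bh_chart_domain" for i
    by (rule smooth_on_nth[OF V smooth_on_id[OF V]])
  have s1: "smooth_on (bh_chart b) bh_chart_domain"
    unfolding bh_chart_def Let_def
  proof (intro smooth_on_Pair V)
    show "smooth_on (\<lambda>z. vector [2 * z $ 1 / (1 + ((z $ 1)\<^sup>2 + (z $ 2)\<^sup>2)), 2 * z $ 2 / (1 + ((z $ 1)\<^sup>2 + (z $ 2)\<^sup>2)),
        pole b * ((z $ 1)\<^sup>2 + (z $ 2)\<^sup>2 - 1) / (1 + ((z $ 1)\<^sup>2 + (z $ 2)\<^sup>2))] :: real^3) bh_chart_domain"
    proof (rule smooth_on_vec[OF V])
      fix i :: 3
      show "smooth_on (\<lambda>z. vector [2 * z $ 1 / (1 + ((z $ 1)\<^sup>2 + (z $ 2)\<^sup>2)), 2 * z $ 2 / (1 + ((z $ 1)\<^sup>2 + (z $ 2)\<^sup>2)),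
        pole b * ((z $ 1)\<^sup>2 + (z $ 2)\<^sup>2 - 1) / (1 + ((z $ 1)\<^sup>2 + (z $ 2)\<^sup>2))] $ i) bh_chart_domain"
        using exhaust_3[of i] q'
        by (elim disjE; simp; intro smooth_on_divide smooth_on_mult smooth_on_add smooth_on_diff smooth_on_power smooth_on_const zi V; blast)
    qed
    show "smooth_on (\<lambda>z. vector [z $ 3, z $ 4] :: real^2) bh_chart_domain"
    proof (rule smooth_on_vec[OF V])
      fix i :: 2
      show "smooth_on (\<lambda>z. vector [z $ 3, z $ 4] $ i) bh_chart_domain"
        using exhaust_2[of i] by (elim disjE; simp add: zi)
    qed
  qed
  have pi: "smooth_on (\<lambda>p::R32. fst p $ i) ?W" "smooth_on (\<lambda>p::R32. snd p $ j) ?W" for i j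
    by (intro smooth_on_nth smooth_on_fst smooth_on_snd smooth_on_id W)+
  have s2: "smooth_on (bh_coords b) ?W"
    unfolding bh_coords_def Let_def
  proof (rule smooth_on_vec[OF W])
    fix i :: 4
    show "smooth_on (\<lambda>p. vector [fst p $ 1 / (1 - pole b * fst p $ 3), fst p $ 2 / (1 - pole b * fst p $ 3), snd p $ 1, snd p $ 2] $ i) ?W"
      using exhaust_4[of i]
      by (elim disjE; simp only: vector_4; intro smooth_on_divide smooth_on_mult smooth_on_diff smooth_on_const pi W; auto)
  qed
  show ?A ?B
    by (rule chart_of_smooth_inverse[OF bh_space_borel V s1 W im s2 inv])+
qed

subsection \<open>Thermal hyperbolic space\<close>

text \<open>z1, z2, z3 are coordinates of the ball. The circle is projected from a point of its
  first axis, so that its second component is a positive multiple of z4, as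
  \<open>charts_null\<close> requires.\<close>

definition thermal_chart :: "bool \<Rightarrow> real^4 \<Rightarrow> R32" where
  "thermal_chart b z = (vector [z $ 1, z $ 2, z $ 3],
     vector [pole b * ((z $ 4)\<^sup>2 - 1) / (1 + (z $ 4)\<^sup>2), 2 * z $ 4 / (1 + (z $ 4)\<^sup>2)])"

definition thermal_coords :: "bool \<Rightarrow> R32 \<Rightarrow> real^4" where
  "thermal_coords b p = vector [fst p $ 1, fst p $ 2, fst p $ 3, snd p $ 2 / (1 - pole b * snd p $ 1)]"

definition thermal_chart_domain :: "(real^4) set" where
  "thermal_chart_domain = {z. (z $ 1)\<^sup>2 + (z $ 2)\<^sup>2 + (z $ 3)\<^sup>2 < 1}"

lemma thermal_space_iff: "p \<in> thermal_space \<longleftrightarrow>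
    (fst p $ 1)\<^sup>2 + (fst p $ 2)\<^sup>2 + (fst p $ 3)\<^sup>2 < 1 \<and> (snd p $ 2)\<^sup>2 + (snd p $ 1)\<^sup>2 = 1"
  by (cases p) (simp add: thermal_space_def norm_1_iff norm_less_1_iff inner3 inner2 power2_eq_square add.commute)

lemma thermal_space_borel: "thermal_space \<in> sets borel"
  unfolding thermal_space_def by (intro borel_Times) auto

lemma thermal_charts:
  shows "chart thermal_space thermal_chart_domain (thermal_chart b) (\<lambda>u. frechet_derivative (thermal_chart b) (at u)) (thermal_coords b)" (is ?A)
    and "local_param thermal_space thermal_chart_domain (thermal_chart b)" (is ?B)
    and "thermal_chart b ` thermal_chart_domain = thermal_space \<inter> {p. 0 < 1 - pole b * snd p $ 1}"
proof -
  let ?W = "{p::R32. 0 < 1 - pole b * snd p $ 1}"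
  have W: "open ?W" by (intro open_Collect_less continuous_intros)
  have V: "open thermal_chart_domain" unfolding thermal_chart_domain_def by (intro open_Collect_less continuous_intros)
  have q': "1 + (t::real)\<^sup>2 \<noteq> 0" for t by (simp add: add_nonneg_eq_0_iff)
  have mem: "thermal_chart b z \<in> thermal_space \<inter> ?W" if "z \<in> thermal_chart_domain" for z
  proof -
    let ?q = "(z $ 4)\<^sup>2"
    have q: "0 \<le> ?q" by simp
    have "(2 * z $ 4 / (1 + ?q))\<^sup>2 = 4 * ?q / (1 + ?q)\<^sup>2" by (simp add: power_divide power_mult_distrib)
    then have "thermal_chart b z \<in> thermal_space"
      using that stereographic(2)[OF q, of b] by (simp add: thermal_space_iff thermal_chart_def thermal_chart_domain_def)
    moreover have e: "snd (thermal_chart b z) $ 1 = pole b * (?q - 1) / (1 + ?q)" by (simp add: thermal_chart_def)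
    have "0 < 1 - pole b * snd (thermal_chart b z) $ 1"
      unfolding e stereographic(1)[OF q, of b] using q by (simp add: add_pos_nonneg)
    ultimately show ?thesis by blast
  qed
  have inv: "thermal_coords b (thermal_chart b z) = z" for z
  proof -
    define q where "q = (z $ 4)\<^sup>2"
    have q: "0 \<le> q" "1 + q \<noteq> 0" "2 + q * 2 \<noteq> 0" by (simp_all add: q_def add_nonneg_eq_0_iff)
    then show ?thesis
      using stereographic(1)[OF q(1), of b]
      by (simp add: thermal_coords_def thermal_chart_def q_def[symmetric] vec_eq_iff forall_4)
  qed
  have inv': "thermal_chart b (thermal_coords b p) = p \<and> thermal_coords b p \<in> thermal_chart_domain"
    if p: "p \<in> thermal_space" "p \<in> ?W" for p
  proof -
    define d where "d = 1 - pole b * snd p $ 1"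
    have d: "d > 0" using p by (simp add: d_def)
    have s: "(snd p $ 2)\<^sup>2 + (snd p $ 1)\<^sup>2 = 1" using p(1) by (simp add: thermal_space_iff)
    note st = stereographic_inverse[OF s d_def]
    have "thermal_chart b (thermal_coords b p) = p"
      using d by (simp add: thermal_chart_def thermal_coords_def d_def[symmetric] power_divide st prod_eq_iff vec_eq_iff forall_3 forall_2)
    then show ?thesis using p(1) by (simp add: thermal_coords_def thermal_chart_domain_def thermal_space_iff)
  qed
  show im: "thermal_chart b ` thermal_chart_domain = thermal_space \<inter> ?W"
  proof
    show "thermal_chart b ` thermal_chart_domain \<subseteq> thermal_space \<inter> ?W" using mem by blast
    show "thermal_space \<inter> ?W \<subseteq> thermal_chart b ` thermal_chart_domain" using inv' by (metis (lifting) IntE image_eqI subsetI)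
  qed
  have zi: "smooth_on (\<lambda>z::real^4. z $ i) thermal_chart_domain" for i
    by (rule smooth_on_nth[OF V smooth_on_id[OF V]])
  have s1: "smooth_on (thermal_chart b) thermal_chart_domain"
    unfolding thermal_chart_def
  proof (intro smooth_on_Pair V)
    show "smooth_on (\<lambda>z. vector [z $ 1, z $ 2, z $ 3] :: real^3) thermal_chart_domain"
    proof (rule smooth_on_vec[OF V])
      fix i :: 3
      show "smooth_on (\<lambda>z. vector [z $ 1, z $ 2, z $ 3] $ i) thermal_chart_domain"
        using exhaust_3[of i] by (elim disjE; simp add: zi)
    qed
    show "smooth_on (\<lambda>z. vector [pole b * ((z $ 4)\<^sup>2 - 1) / (1 + (z $ 4)\<^sup>2), 2 * z $ 4 / (1 + (z $ 4)\<^sup>2)] :: real^2) thermal_chart_domain"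
    proof (rule smooth_on_vec[OF V])
      fix i :: 2
      show "smooth_on (\<lambda>z. vector [pole b * ((z $ 4)\<^sup>2 - 1) / (1 + (z $ 4)\<^sup>2), 2 * z $ 4 / (1 + (z $ 4)\<^sup>2)] $ i) thermal_chart_domain"
        using exhaust_2[of i] q'
        by (elim disjE; simp; intro smooth_on_divide smooth_on_mult smooth_on_add smooth_on_diff smooth_on_power smooth_on_const zi V; blast)
    qed
  qed
  have pi: "smooth_on (\<lambda>p::R32. fst p $ i) ?W" "smooth_on (\<lambda>p::R32. snd p $ j) ?W" for i j
    by (intro smooth_on_nth smooth_on_fst smooth_on_snd smooth_on_id W)+
  have s2: "smooth_on (thermal_coords b) ?W"
    unfolding thermal_coords_def
  proof (rule smooth_on_vec[OF W])
    fix i :: 4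
    show "smooth_on (\<lambda>p. vector [fst p $ 1, fst p $ 2, fst p $ 3, snd p $ 2 / (1 - pole b * snd p $ 1)] $ i) ?W"
      using exhaust_4[of i]
      by (elim disjE; simp only: vector_4; intro smooth_on_divide smooth_on_mult smooth_on_diff smooth_on_const pi W; auto)
  qed
  show ?A ?B
    by (rule chart_of_smooth_inverse[OF thermal_space_borel V s1 W im s2 inv])+
qed

section \<open>The black hole as an instance of the abstract end\<close>

lemma lapse_bh_pos:
  assumes "0 < a" "0 < \<rho>" "\<rho> < 1 / a"
  shows "0 < lapse (bh_mass a) \<rho>"
proof -
  have x: "0 < a * \<rho>" "a * \<rho> < 1" using assms by (simp_all add: field_simps)
  \<comment> \<open>The lapse vanishes at the horizon \<rho> = 1/a; distributing 2m = a^3 + a over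
    the two other terms exhibits it as a sum of two positive ones before that.\<close>
  have "lapse (bh_mass a) \<rho> = (1 - (a * \<rho>) ^ 3) + \<rho>\<^sup>2 * (1 - a * \<rho>)"
    by (simp add: lapse_def bh_mass_def algebra_simps power2_eq_square power3_eq_cube)
  moreover have "(a * \<rho>) ^ 3 < 1" using x by (intro power_Suc_less_one[of _ 2, simplified numeral_3_eq_3[symmetric]] | simp add: power_less_one_iff)+
  ultimately show ?thesis using x assms(2) by (simp add: add_pos_pos)
qed

lemma dtau_scaled:
  assumes "norm \<gamma> = 1" "r \<noteq> 0"
  shows "dtau \<beta> (r *\<^sub>R \<gamma>) (s *\<^sub>R \<gamma> + r *\<^sub>R \<omega>) = dtau \<beta> \<gamma> \<omega>"
proof -
  have "r * \<gamma> $ 1 * (s * \<gamma> $ 2 + r * \<omega> $ 2) - r * \<gamma> $ 2 * (s * \<gamma> $ 1 + r * \<omega> $ 1) = r\<^sup>2 * (\<gamma> $ 1 * \<omega> $ 2 - \<gamma> $ 2 * \<omega> $ 1)"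
    by algebra
  then show ?thesis using assms by (simp add: dtau_def power_mult_distrib)
qed

lemma bh_radius_derivative:
  assumes "norm w \<noteq> 1"
  shows "frechet_derivative (bh_radius a) (at w) v = 2 * a * (w \<bullet> v) / (1 - (norm w)\<^sup>2)\<^sup>2"
proof -
  have n: "1 - w \<bullet> w \<noteq> 0" using assms by (simp add: norm_1_iff)
  have "(bh_radius a has_derivative (\<lambda>v. 2 * a * (w \<bullet> v) / (1 - w \<bullet> w)\<^sup>2)) (at w)"
    unfolding bh_radius_def[abs_def] power2_norm_eq_inner using n
    by (auto intro!: derivative_eq_intros simp: inner_commute power2_eq_square divide_simps)
  from frechet_derivative_at[OF this] show ?thesis by (metis power2_norm_eq_inner)
qed

text \<open>At the point of the disc with |w|^2 = 1 - a\<rho> the areal radius is 1/\<rho>, and its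
  differential is -d\<rho>/\<rho>^2. The local name r is the disc radius |w|, and e is its
  derivative with respect to \<rho>.\<close>

lemma bh_metric_polar:
  assumes a: "0 < a" and \<rho>: "0 < \<rho>" "\<rho> < 1 / a" and y: "y \<in> bdry" and v: "tangent_bdry y v" "tangent_bdry y v'"
  defines "r \<equiv> sqrt (1 - a * \<rho>)"
  assumes e: "e = - a / (2 * r)"
  shows "bh_metric \<beta> a (fst y, r *\<^sub>R snd y) (fst v, (s * e) *\<^sub>R snd y + r *\<^sub>R snd v) (fst v', (s' * e) *\<^sub>R snd y + r *\<^sub>R snd v')
    = (s * s' / lapse (bh_mass a) \<rho> + bdry_metric \<beta> (lapse (bh_mass a) \<rho>) y v v') / \<rho>\<^sup>2"
proof -
  let ?w = "r *\<^sub>R snd y" and ?P = "lapse (bh_mass a) \<rho>"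
  have ar: "0 < a * \<rho>" "a * \<rho> < 1" using a \<rho> by (simp_all add: field_simps)
  have r: "0 < r" "r\<^sup>2 = 1 - a * \<rho>" "r < 1" using ar by (auto simp: r_def)
  have n: "norm (fst y) = 1" "norm (snd y) = 1" "snd y \<bullet> snd y = 1" "snd y \<noteq> 0" using y by (auto simp: bdry_def norm_1_iff)
  have nw: "norm ?w = r" using r n by simp
  have mem: "(fst y, ?w) \<in> {(\<omega>, w) \<in> bh_space. w \<noteq> 0}" using r n by (auto simp: bh_space_def)
  have rad: "bh_radius a ?w = 1 / \<rho>" unfolding bh_radius_def nw r(2) using a by simp
  have F: "bh_F (bh_mass a) (1 / \<rho>) = ?P / \<rho>\<^sup>2"
    using \<rho>(1) by (simp add: bh_F_def lapse_def field_simps power2_eq_square power3_eq_cube)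
  have dr: "frechet_derivative (bh_radius a) (at ?w) ((s * e) *\<^sub>R snd y + r *\<^sub>R snd v) = - s / \<rho>\<^sup>2" if "tangent_bdry y v" for s v
  proof -
    have "?w \<bullet> ((s * e) *\<^sub>R snd y + r *\<^sub>R snd v) = r * (s * e)"
      using that n(3) by (simp add: inner_add_right tangent_bdry_def)
    also have "\<dots> = - (a * s / 2)" using r(1) by (simp add: e)
    finally have i: "?w \<bullet> ((s * e) *\<^sub>R snd y + r *\<^sub>R snd v) = - (a * s / 2)" .
    have "norm ?w \<noteq> 1" using r(3) nw by simp
    then show ?thesis
      unfolding bh_radius_derivative[OF \<open>norm ?w \<noteq> 1\<close>] i nw r(2) using a \<rho>(1) by (simp add: field_simps power2_eq_square)
  qed
  have P: "0 < ?P" by (rule lapse_bh_pos[OF a \<rho>])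
  have "bh_metric \<beta> a (fst y, ?w) (fst v, (s * e) *\<^sub>R snd y + r *\<^sub>R snd v) (fst v', (s' * e) *\<^sub>R snd y + r *\<^sub>R snd v')
    = ?P / \<rho>\<^sup>2 * (dtau \<beta> (snd y) (snd v) * dtau \<beta> (snd y) (snd v')) + (- s / \<rho>\<^sup>2) * (- s' / \<rho>\<^sup>2) / (?P / \<rho>\<^sup>2) + (1 / \<rho>)\<^sup>2 * (fst v \<bullet> fst v')"
    unfolding bh_metric_def extend_metric_def if_P[OF mem] bh_metric_off_horizon_def
    using dtau_scaled[OF n(2), of r] r(1) by (simp add: Let_def rad F dr[OF v(1)] dr[OF v(2)])
      (use \<rho>(1) in \<open>simp add: field_simps power2_eq_square power4_eq_xxxx\<close>)
  also have "\<dots> = (s * s' / ?P + bdry_metric \<beta> ?P y v v') / \<rho>\<^sup>2"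
    unfolding bdry_metric_def using P \<rho>(1) by (simp add: field_simps)
  finally show ?thesis .
qed

lemma ah_end_bh:
  assumes a: "0 < a" and \<beta>: "0 < \<beta>"
  shows "ah_end bh_space (bh_metric \<beta> a) \<beta> (bh_mass a) (a ^ 3) (1 / (2 * a)) {0<..<1 / a} {..<1 / a}
    (\<lambda>_. 1) (\<lambda>\<rho>. sqrt (1 - a * \<rho>)) (\<lambda>p. (1 - (norm (snd p))\<^sup>2) / a) (\<lambda>_. bh_chart_domain) bh_chart bh_coords"
proof (rule ah_end.intro)
  have sq: "0 < 1 - a * \<rho>" if "\<rho> < 1 / a" for \<rho> using that a by (simp add: field_simps)
  have oc: "open off_core" by (rule open_off_core)
  have oJ: "open {..<1 / a}" by simp
  show sqs: "smooth_on (\<lambda>\<rho>. sqrt (1 - a * \<rho>)) {..<1 / a}"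
    by (intro smooth_on_sqrt smooth_on_diff smooth_on_mult smooth_on_const smooth_on_id oJ) (use sq in auto)
  show "{0<..1 / (2 * a)} \<subseteq> {0<..<1 / a}" using a by (auto simp: field_simps)
  show "{0<..<1 / a} \<subseteq> {0<..}" by auto
  show "insert 0 {0<..<1 / a} \<subseteq> {..<1 / a}" using a by auto
  show "0 < lapse (bh_mass a) \<rho>" if "\<rho> \<in> {0<..<1 / a}" for \<rho> using that lapse_bh_pos[OF a] by auto
  show "0 \<le> 1 / \<delta> ^ 3 - a ^ 3 \<and>
      (\<integral>\<^sup>+\<rho>. ennreal (1 / \<rho> ^ 4) * indicator ({0<..<1 / a} \<inter> {\<delta>..}) \<rho> \<partial>lborel) = ennreal ((1 / \<delta> ^ 3 - a ^ 3) / 3)"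
    if \<delta>: "0 < \<delta>" "\<delta> \<le> 1 / (2 * a)" for \<delta>
  proof -
    have la: "a \<le> 1 / \<delta>" "\<delta> < 1 / a" using \<delta> a by (auto simp: field_simps)
    have le: "a ^ 3 \<le> (1 / \<delta>) ^ 3" by (rule power_mono[OF la(1)]) (use a in simp)
    let ?X = "\<integral>\<^sup>+\<rho>. ennreal (1 / \<rho> ^ 4) * indicator ({0<..<1 / a} \<inter> {\<delta>..}) \<rho> \<partial>lborel"
    \<comment> \<open>The integral over all \<rho> \<ge> \<delta> is cut at the horizon 1/a; the
      part beyond the horizon is a^3/3, which explains c = a^3.\<close>
    have "ennreal (1 / (3 * \<delta> ^ 3)) = (\<integral>\<^sup>+\<rho>. ennreal (1 / \<rho> ^ 4) * indicator ({0<..<1 / a} \<inter> {\<delta>..}) \<rho>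
        + ennreal (1 / \<rho> ^ 4) * indicator {1 / a..} \<rho> \<partial>lborel)"
      unfolding nn_integral_inverse_power4[OF \<delta>(1), symmetric]
      by (intro nn_integral_cong) (use \<delta>(1) la(2) in \<open>auto simp: indicator_def\<close>)
    also have "\<dots> = ?X + ennreal (1 / (3 * (1 / a) ^ 3))"
      using a by (subst nn_integral_add) (simp_all add: nn_integral_inverse_power4)
    finally have e: "?X + ennreal (a ^ 3 / 3) = ennreal (1 / (3 * \<delta> ^ 3))" using a by (simp add: power_divide)
    also have "\<dots> = ennreal ((1 / \<delta> ^ 3 - a ^ 3) / 3) + ennreal (a ^ 3 / 3)"
      using le a \<delta>(1) by (subst ennreal_plus[symmetric]) (simp_all add: power_divide field_simps)
    finally have "ennreal (a ^ 3 / 3) + ?X = ennreal (a ^ 3 / 3) + ennreal ((1 / \<delta> ^ 3 - a ^ 3) / 3)"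
      by (simp only: add.commute)
    then have "?X = ennreal ((1 / \<delta> ^ 3 - a ^ 3) / 3)" unfolding ennreal_add_left_cancel by simp
    then show ?thesis using le by (simp add: power_divide)
  qed
  show "0 < sqrt (1 - a * \<rho>)" if "\<rho> \<in> {..<1 / a}" for \<rho> using that sq by simp
  show "manifold_boundary bh_space = bdry"
    unfolding manifold_boundary_def bh_space_def bdry_def by (auto simp: closure_Times)
  show "(1 *\<^sub>R fst y, sqrt (1 - a * \<rho>) *\<^sub>R snd y) \<in> bh_space" if "\<rho> \<in> {0<..<1 / a}" "y \<in> bdry" for \<rho> and y :: R32
    using that sq[of \<rho>] a by (auto simp: bh_space_def bdry_def)
  show "smooth_on (\<lambda>p::R32. (1 - (norm (snd p))\<^sup>2) / a) off_core"
    unfolding power2_norm_eq_inner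
    by (intro smooth_on_divide smooth_on_diff smooth_on_inner smooth_on_snd smooth_on_id smooth_on_const oc) (use a in simp)
  show "(1 - (norm (snd (1 *\<^sub>R fst y, sqrt (1 - a * \<rho>) *\<^sub>R snd y)))\<^sup>2) / a = \<rho>"
    if "\<rho> \<in> insert 0 {0<..<1 / a}" "y \<in> bdry" for \<rho> and y :: R32
  proof -
    have "norm (snd y) = 1" "0 < 1 - a * \<rho>" using that sq[of \<rho>] a by (auto simp: bdry_def)
    then show ?thesis using a by simp
  qed
  show "(1 - (norm (snd p))\<^sup>2) / a \<in> insert 0 {0<..<1 / a} \<and>
      (1 *\<^sub>R fst (directions p), sqrt (1 - a * ((1 - (norm (snd p))\<^sup>2) / a)) *\<^sub>R snd (directions p)) = p"
    if "p \<in> closure bh_space" "p \<in> off_core" for p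
  proof -
    have p: "norm (fst p) = 1" "norm (snd p) \<le> 1" "snd p \<noteq> 0"
      using that by (auto simp: bh_space_def closure_Times off_core_def)
    have "(norm (snd p))\<^sup>2 \<le> 1" "0 < (norm (snd p))\<^sup>2" using p(2,3) by (simp_all add: power_le_one)
    then show ?thesis
      using a p(1,3) by (auto simp: directions_def sgn_div_norm prod_eq_iff divide_simps)
  qed
  show "\<exists>r>0. \<exists>W. open W \<and> bh_space - off_core \<subseteq> W \<and>
      (\<forall>p\<in>W \<inter> off_core \<inter> closure bh_space. r < (1 - (norm (snd p))\<^sup>2) / a)"
  proof (intro exI[of _ "1 / (2 * a)"] exI[of _ "{p::R32. (norm (snd p))\<^sup>2 < 1 / 2}"] conjI)
    show "open {p::R32. (norm (snd p))\<^sup>2 < 1 / 2}" by (intro open_Collect_less continuous_intros)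
  qed (use a in \<open>auto simp: bh_space_def off_core_def field_simps\<close>)
  show "\<exists>K. compact K \<and> K \<subseteq> bh_space \<and>
      (\<forall>\<rho>\<in>{0<..<1 / a}. \<delta> \<le> \<rho> \<longrightarrow> (\<forall>y\<in>bdry. (1 *\<^sub>R fst y, sqrt (1 - a * \<rho>) *\<^sub>R snd y) \<in> K))" if \<delta>: "0 < \<delta>" for \<delta>
  proof (cases "\<delta> < 1 / a")
    case True
    have s: "sqrt (1 - a * \<delta>) < 1" using a \<delta> by simp
    show ?thesis
    proof (intro exI[of _ "sphere 0 1 \<times> cball 0 (sqrt (1 - a * \<delta>))"] conjI ballI impI)
      show "sphere 0 1 \<times> cball 0 (sqrt (1 - a * \<delta>)) \<subseteq> bh_space"
        using order.strict_trans1[OF _ s] by (auto simp: bh_space_def)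
      fix \<rho> and y :: R32 assume \<rho>: "\<rho> \<in> {0<..<1 / a}" "\<delta> \<le> \<rho>" and y: "y \<in> bdry"
      have "a * \<delta> \<le> a * \<rho>" using \<rho>(2) a by simp
      then have "sqrt (1 - a * \<rho>) \<le> sqrt (1 - a * \<delta>)" by simp
      then show "(1 *\<^sub>R fst y, sqrt (1 - a * \<rho>) *\<^sub>R snd y) \<in> sphere 0 1 \<times> cball 0 (sqrt (1 - a * \<delta>))"
        using y sq[of \<rho>] \<rho> by (auto simp: bdry_def)
    qed (intro compact_Times compact_sphere compact_cball)
  qed (auto intro!: exI[of _ "{}"])
  show "bh_space \<subseteq> (\<Union>b. bh_chart b ` bh_chart_domain)"
  proof
    fix p assume p: "p \<in> bh_space"
    have "0 < 1 - pole (fst p $ 3 < 0) * fst p $ 3" by (simp add: pole_def)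
    then have "p \<in> bh_chart (fst p $ 3 < 0) ` bh_chart_domain" unfolding bh_charts(3) using p by simp
    then show "p \<in> (\<Union>b. bh_chart b ` bh_chart_domain)" by blast
  qed
  show "(fst (bh_chart b z) $ 2 = 0 \<longrightarrow> z $ 2 = 0) \<and> (snd (bh_chart b z) $ 2 = 0 \<longrightarrow> z $ 4 = 0)" for b z
  proof -
    have "1 + ((z $ 1)\<^sup>2 + (z $ 2)\<^sup>2) \<noteq> 0" by (simp add: add_nonneg_eq_0_iff)
    then show ?thesis by (simp add: bh_chart_def Let_def)
  qed
  show "bh_metric \<beta> a (1 *\<^sub>R fst y, sqrt (1 - a * \<rho>) *\<^sub>R snd y)
      ((s * frechet_derivative (\<lambda>_. 1) (at \<rho>) 1) *\<^sub>R fst y + 1 *\<^sub>R fst v,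
       (s * frechet_derivative (\<lambda>\<rho>. sqrt (1 - a * \<rho>)) (at \<rho>) 1) *\<^sub>R snd y + sqrt (1 - a * \<rho>) *\<^sub>R snd v)
      ((s' * frechet_derivative (\<lambda>_. 1) (at \<rho>) 1) *\<^sub>R fst y + 1 *\<^sub>R fst v',
       (s' * frechet_derivative (\<lambda>\<rho>. sqrt (1 - a * \<rho>)) (at \<rho>) 1) *\<^sub>R snd y + sqrt (1 - a * \<rho>) *\<^sub>R snd v')
    = (s * s' / lapse (bh_mass a) \<rho> + bdry_metric \<beta> (lapse (bh_mass a) \<rho>) y v v') / \<rho>\<^sup>2"
    if "\<rho> \<in> {0<..<1 / a}" "y \<in> bdry" "tangent_bdry y v" "tangent_bdry y v'" for \<rho> s s' :: real and y v v' :: R32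
  proof -
    have "0 < sqrt (1 - a * \<rho>)" "0 < 1 - a * \<rho>" using sq[of \<rho>] that by auto
    then have "((\<lambda>\<rho>. sqrt (1 - a * \<rho>)) has_derivative (\<lambda>t. t * (- a / (2 * sqrt (1 - a * \<rho>))))) (at \<rho>)"
      by (auto intro!: derivative_eq_intros simp: field_simps)
    from frechet_derivative_at[OF this]
    have e: "frechet_derivative (\<lambda>\<rho>. sqrt (1 - a * \<rho>)) (at \<rho>) 1 = - a / (2 * sqrt (1 - a * \<rho>))" by (metis mult_1)
    have c: "frechet_derivative (\<lambda>_. 1::real) (at \<rho>) 1 = 0" by (simp add: frechet_derivative_const)
    show ?thesis
      using bh_metric_polar[OF a _ _ that(2-4) e] that(1) by (simp add: c)
  qed
qed (use a \<beta> bh_space_borel bh_charts(1,2) smooth_on_const[of "{..<1 / a}"] in simp_all)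

lemma RenV_bh:
  assumes "0 < a" "0 < \<beta>"
  shows "RenV bh_space (bh_metric \<beta> a) = 4 * pi * \<beta> * (bh_mass a - a ^ 3) / 3"
  by (rule ah_end.RenV_eq[OF ah_end_bh[OF assms]])

section \<open>Thermal hyperbolic space as an instance of the abstract end\<close>

lemma norm_derivative: "u \<noteq> 0 \<Longrightarrow> (norm has_derivative (\<lambda>v. u \<bullet> v / norm u)) (at u)" for u :: "'a::real_inner"
  unfolding norm_eq_sqrt_inner[abs_def]
  by (auto intro!: derivative_eq_intros simp: inner_commute divide_simps)

lemma sgn_derivative:
  fixes \<omega> \<xi> :: "'a::real_inner"
  assumes "norm \<omega> = 1" "\<omega> \<bullet> \<xi> = 0" "0 < t"
  shows "frechet_derivative sgn (at (t *\<^sub>R \<omega>)) (c *\<^sub>R \<omega> + t *\<^sub>R \<xi>) = \<xi>"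
proof -
  let ?u = "t *\<^sub>R \<omega>"
  have u: "?u \<noteq> 0" "norm ?u = t" "norm ?u \<noteq> 0" using assms by auto
  have "((\<lambda>x. inverse (norm x) *\<^sub>R x) has_derivative
      (\<lambda>v. inverse (norm ?u) *\<^sub>R v + (- (inverse (norm ?u) * (?u \<bullet> v / norm ?u) * inverse (norm ?u))) *\<^sub>R ?u)) (at ?u)"
    by (rule has_derivative_scaleR[OF Deriv.has_derivative_inverse[OF u(3) norm_derivative[OF u(1)]] has_derivative_ident])
  moreover have "(\<lambda>x::'a. inverse (norm x) *\<^sub>R x) = sgn" by (simp add: sgn_div_norm fun_eq_iff)
  ultimately have "(sgn has_derivative
      (\<lambda>v. inverse t *\<^sub>R v + (- (inverse t * (?u \<bullet> v / t) * inverse t)) *\<^sub>R ?u)) (at ?u)" by (simp only: u(2))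
  from frechet_derivative_at[OF this, symmetric]
  have "frechet_derivative sgn (at ?u) (c *\<^sub>R \<omega> + t *\<^sub>R \<xi>)
    = inverse t *\<^sub>R (c *\<^sub>R \<omega> + t *\<^sub>R \<xi>) + (- (inverse t * (?u \<bullet> (c *\<^sub>R \<omega> + t *\<^sub>R \<xi>) / t) * inverse t)) *\<^sub>R ?u" by simp
  moreover have "?u \<bullet> (c *\<^sub>R \<omega> + t *\<^sub>R \<xi>) = t * c"
    using assms by (simp add: inner_add_right norm_1_iff)
  ultimately show ?thesis using assms(3) by (simp add: scaleR_add_right)
qed

lemma thermal_radius_derivative:
  assumes "0 < norm u" "norm u < 1"
  shows "frechet_derivative thermal_radius (at u) v = 2 * (1 + (norm u)\<^sup>2) / (1 - (norm u)\<^sup>2)\<^sup>2 * (u \<bullet> v / norm u)"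
proof -
  let ?n = "norm u"
  have n: "1 - ?n\<^sup>2 \<noteq> 0" using assms abs_square_less_1[of ?n] by simp
  have "((\<lambda>n. 2 * n / (1 - n\<^sup>2)) has_real_derivative 2 * (1 + ?n\<^sup>2) / (1 - ?n\<^sup>2)\<^sup>2) (at ?n)"
    using n by (auto intro!: derivative_eq_intros simp: power2_eq_square algebra_simps)
  then have "((\<lambda>n. 2 * n / (1 - n\<^sup>2)) has_derivative (*) (2 * (1 + ?n\<^sup>2) / (1 - ?n\<^sup>2)\<^sup>2)) (at ?n)"
    unfolding has_field_derivative_def .
  moreover have "u \<noteq> 0" using assms by auto
  ultimately have "((\<lambda>u. 2 * norm u / (1 - (norm u)\<^sup>2)) has_derivative
      (\<lambda>v. 2 * (1 + ?n\<^sup>2) / (1 - ?n\<^sup>2)\<^sup>2 * (u \<bullet> v / ?n))) (at u)"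
    by (intro has_derivative_compose[OF norm_derivative])
  then have "(thermal_radius has_derivative (\<lambda>v. 2 * (1 + ?n\<^sup>2) / (1 - ?n\<^sup>2)\<^sup>2 * (u \<bullet> v / ?n))) (at u)"
    unfolding thermal_radius_def[abs_def] .
  from frechet_derivative_at[OF this, symmetric] show ?thesis by simp
qed

text \<open>t is the ball radius |u| with 2t/(1 - t^2) = 1/\<rho>, that is, the positive root of t^2
  + 2\<rho>t - 1 = 0.\<close>

lemma thermal_profile:
  fixes \<rho> :: real
  defines "S \<equiv> sqrt (1 + \<rho>\<^sup>2)"
  defines "t \<equiv> S - \<rho>"
  shows "0 < t" "0 < S" "1 - t\<^sup>2 = 2 * \<rho> * t" "1 + t\<^sup>2 = 2 * t * S" "S\<^sup>2 = 1 + \<rho>\<^sup>2"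
proof -
  show "0 < t" unfolding t_def S_def using real_less_rsqrt[of \<rho> "1 + \<rho>\<^sup>2"] by simp
  show "0 < S" unfolding S_def by (simp add: add_pos_nonneg)
  show S: "S\<^sup>2 = 1 + \<rho>\<^sup>2" unfolding S_def by (simp add: add_nonneg_nonneg)
  show "1 - t\<^sup>2 = 2 * \<rho> * t" "1 + t\<^sup>2 = 2 * t * S" using S unfolding t_def by algebra+
qed

lemma thermal_profile_less_1:
  fixes \<rho> :: real
  assumes "0 < \<rho>"
  shows "sqrt (1 + \<rho>\<^sup>2) - \<rho> < 1"
proof -
  have "sqrt (1 + \<rho>\<^sup>2) < 1 + \<rho>" using assms by (intro real_less_lsqrt) (auto simp: power2_eq_square algebra_simps)
  then show ?thesis by simp
qed

text \<open>With r = 1/\<rho> one has 1 + r^2 = P/\<rho>^2 for P = 1 + \<rho>^2, the lapse of mass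
  0; e is the derivative of the ball radius t with respect to \<rho>.\<close>

lemma thermal_metric_polar:
  fixes \<rho> s s' :: real
  assumes \<rho>: "0 < \<rho>" and y: "y \<in> bdry" and v: "tangent_bdry y v" "tangent_bdry y v'"
  defines "t \<equiv> sqrt (1 + \<rho>\<^sup>2) - \<rho>"
  assumes e: "e = - t / sqrt (1 + \<rho>\<^sup>2)"
  shows "thermal_metric \<beta> (t *\<^sub>R fst y, snd y) ((s * e) *\<^sub>R fst y + t *\<^sub>R fst v, snd v) ((s' * e) *\<^sub>R fst y + t *\<^sub>R fst v', snd v')
    = (s * s' / lapse 0 \<rho> + bdry_metric \<beta> (lapse 0 \<rho>) y v v') / \<rho>\<^sup>2"
proof -
  let ?u = "t *\<^sub>R fst y" and ?P = "lapse 0 \<rho>" and ?S = "sqrt (1 + \<rho>\<^sup>2)"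
  note tp = thermal_profile[of \<rho>, folded t_def]
  have t1: "t < 1" unfolding t_def by (rule thermal_profile_less_1[OF \<rho>])
  have n: "norm (fst y) = 1" "fst y \<bullet> fst y = 1" "norm (snd y) = 1" "fst y \<noteq> 0" using y by (auto simp: bdry_def norm_1_iff)
  have nu: "norm ?u = t" using tp n by simp
  have mem: "(?u, snd y) \<in> {(u, w) \<in> thermal_space. u \<noteq> 0}" using tp(1) t1 n by (auto simp: thermal_space_def)
  have rad: "thermal_radius ?u = 1 / \<rho>" unfolding thermal_radius_def nu tp(3) using tp(1) by simp
  have P: "?P = 1 + \<rho>\<^sup>2" "0 < ?P" by (simp_all add: lapse_def add_pos_nonneg)
  have F: "1 + (1 / \<rho>)\<^sup>2 = ?P / \<rho>\<^sup>2" using \<rho> by (simp add: P field_simps)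
  have tan: "fst y \<bullet> fst v = 0" if "tangent_bdry y v" for v using that by (simp add: tangent_bdry_def)
  have dr: "frechet_derivative thermal_radius (at ?u) ((s * e) *\<^sub>R fst y + t *\<^sub>R fst v) = - s / \<rho>\<^sup>2"
    if "tangent_bdry y v" for s v
  proof -
    have i: "?u \<bullet> ((s * e) *\<^sub>R fst y + t *\<^sub>R fst v) / t = s * e"
      using tan[OF that] tp(1) n(2) by (simp add: inner_add_right)
    have h: "0 < norm ?u" "norm ?u < 1" unfolding nu by (rule tp(1) t1)+
    have "frechet_derivative thermal_radius (at ?u) ((s * e) *\<^sub>R fst y + t *\<^sub>R fst v)
      = 2 * (1 + t\<^sup>2) / (1 - t\<^sup>2)\<^sup>2 * (s * e)"
      using thermal_radius_derivative[OF h] by (simp only: nu i)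
    also have "\<dots> = - s / \<rho>\<^sup>2"
      unfolding tp(3,4) e using tp(1,2) \<rho> by (simp add: field_simps power2_eq_square)
    finally show ?thesis .
  qed
  have "thermal_metric \<beta> (?u, snd y) ((s * e) *\<^sub>R fst y + t *\<^sub>R fst v, snd v) ((s' * e) *\<^sub>R fst y + t *\<^sub>R fst v', snd v')
    = ?P / \<rho>\<^sup>2 * (dtau \<beta> (snd y) (snd v) * dtau \<beta> (snd y) (snd v')) + (- s / \<rho>\<^sup>2) * (- s' / \<rho>\<^sup>2) / (?P / \<rho>\<^sup>2) + (1 / \<rho>)\<^sup>2 * (fst v \<bullet> fst v')"
    unfolding thermal_metric_def extend_metric_def if_P[OF mem] thermal_metric_off_axis_def
    by (simp only: Let_def case_prod_conv rad F dr[OF v(1)] dr[OF v(2)]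
        sgn_derivative[OF n(1) tan[OF v(1)] tp(1)] sgn_derivative[OF n(1) tan[OF v(2)] tp(1)])
  also have "\<dots> = (s * s' / ?P + bdry_metric \<beta> ?P y v v') / \<rho>\<^sup>2"
    unfolding bdry_metric_def using P(2) \<rho> by (simp add: field_simps power2_eq_square power4_eq_xxxx)
  finally show ?thesis .
qed

lemma ah_end_thermal:
  assumes \<beta>: "0 < \<beta>"
  shows "ah_end thermal_space (thermal_metric \<beta>) \<beta> 0 0 1 {0<..} UNIV
    (\<lambda>\<rho>. sqrt (1 + \<rho>\<^sup>2) - \<rho>) (\<lambda>_. 1) (\<lambda>p. (1 - (norm (fst p))\<^sup>2) / (2 * norm (fst p))) (\<lambda>_. thermal_chart_domain)
    thermal_chart thermal_coords"
proof (rule ah_end.intro)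
  let ?al = "\<lambda>\<rho>::real. sqrt (1 + \<rho>\<^sup>2) - \<rho>"
  have oc: "open off_core" by (rule open_off_core)
  have p1: "0 < 1 + \<rho>\<^sup>2" for \<rho> :: real by (simp add: add_pos_nonneg)
  show sa: "smooth_on ?al UNIV"
    by (intro smooth_on_diff smooth_on_sqrt smooth_on_add smooth_on_power smooth_on_const smooth_on_id) (use p1 in auto)
  show "0 < lapse 0 \<rho>" for \<rho> by (simp add: lapse_def add_pos_nonneg)
  show "0 \<le> 1 / \<delta> ^ 3 - 0 \<and>
      (\<integral>\<^sup>+\<rho>. ennreal (1 / \<rho> ^ 4) * indicator ({0<..} \<inter> {\<delta>..}) \<rho> \<partial>lborel) = ennreal ((1 / \<delta> ^ 3 - 0) / 3)"
    if \<delta>: "0 < \<delta>" for \<delta> :: real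
  proof -
    have "{0<..} \<inter> {\<delta>..} = {\<delta>..}" using \<delta> by auto
    then show ?thesis using nn_integral_inverse_power4[OF \<delta>] \<delta> by (simp add: mult.commute)
  qed
  show "0 < ?al \<rho>" for \<rho> by (rule thermal_profile(1))
  show "manifold_boundary thermal_space = bdry"
    unfolding manifold_boundary_def thermal_space_def bdry_def by (auto simp: closure_Times)
  show "(?al \<rho> *\<^sub>R fst y, 1 *\<^sub>R snd y) \<in> thermal_space" if "\<rho> \<in> {0<..}" "y \<in> bdry" for \<rho> and y :: R32
    using that thermal_profile(1)[of \<rho>] thermal_profile_less_1[of \<rho>] by (auto simp: thermal_space_def bdry_def)
  have nz: "p \<in> off_core \<Longrightarrow> fst p \<noteq> 0" for p by (simp add: off_core_def)
  have sf: "smooth_on (\<lambda>p::R32. norm (fst p)) off_core"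
    by (rule smooth_on_norm[OF oc smooth_on_fst[OF oc smooth_on_id[OF oc]] nz])
  show "smooth_on (\<lambda>p::R32. (1 - (norm (fst p))\<^sup>2) / (2 * norm (fst p))) off_core"
    by (intro smooth_on_divide smooth_on_diff smooth_on_mult smooth_on_power smooth_on_const oc sf) (simp add: nz)
  show "(1 - (norm (fst (?al \<rho> *\<^sub>R fst y, 1 *\<^sub>R snd y)))\<^sup>2) / (2 * norm (fst (?al \<rho> *\<^sub>R fst y, 1 *\<^sub>R snd y))) = \<rho>"
    if "y \<in> bdry" for \<rho> and y :: R32
  proof -
    have d: "2 * \<rho> * t / (2 * t) = \<rho>" if "0 < t" for t using that by simp
    have n: "norm (fst (?al \<rho> *\<^sub>R fst y, 1 *\<^sub>R snd y)) = ?al \<rho>"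
      using that thermal_profile(1)[of \<rho>] by (simp add: bdry_def mem_Times_iff)
    show ?thesis unfolding n thermal_profile(3) by (rule d[OF thermal_profile(1)])
  qed
  show "(1 - (norm (fst p))\<^sup>2) / (2 * norm (fst p)) \<in> insert 0 {0<..} \<and>
      (?al ((1 - (norm (fst p))\<^sup>2) / (2 * norm (fst p))) *\<^sub>R fst (directions p), 1 *\<^sub>R snd (directions p)) = p"
    if "p \<in> closure thermal_space" "p \<in> off_core" for p
  proof -
    define t where "t = norm (fst p)"
    have t: "0 < t" "t \<le> 1" and w: "norm (snd p) = 1"
      using that by (auto simp: t_def thermal_space_def closure_Times off_core_def)
    have "0 \<le> (1 - t\<^sup>2) / (2 * t)" using t by (simp add: power_le_one)
    then have 1: "(1 - t\<^sup>2) / (2 * t) \<in> insert 0 {0<..}" by auto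
    have "1 + ((1 - t\<^sup>2) / (2 * t))\<^sup>2 = ((1 + t\<^sup>2) / (2 * t))\<^sup>2" using t by (simp add: field_simps power2_eq_square)
    then have "sqrt (1 + ((1 - t\<^sup>2) / (2 * t))\<^sup>2) = (1 + t\<^sup>2) / (2 * t)" using t by (simp add: real_sqrt_unique)
    then have "?al ((1 - t\<^sup>2) / (2 * t)) = t" using t by (simp add: field_simps power2_eq_square)
    then show ?thesis unfolding t_def[symmetric] using 1 t(1) w
      by (auto simp: directions_def sgn_div_norm prod_eq_iff t_def)
  qed
  show "\<exists>r>0. \<exists>W. open W \<and> thermal_space - off_core \<subseteq> W \<and>
      (\<forall>p\<in>W \<inter> off_core \<inter> closure thermal_space. r < (1 - (norm (fst p))\<^sup>2) / (2 * norm (fst p)))"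
  proof (intro exI[of _ "1 / 4"] exI[of _ "{p::R32. norm (fst p) < 1 / 2}"] conjI ballI)
    show "open {p::R32. norm (fst p) < 1 / 2}" by (intro open_Collect_less continuous_intros)
    show "thermal_space - off_core \<subseteq> {p. norm (fst p) < 1 / 2}" by (auto simp: thermal_space_def off_core_def)
    fix p :: R32 assume p: "p \<in> {p. norm (fst p) < 1 / 2} \<inter> off_core \<inter> closure thermal_space"
    have t: "0 < norm (fst p)" "norm (fst p) < 1 / 2" using p nz by auto
    have "(norm (fst p))\<^sup>2 < (1 / 2)\<^sup>2" using t by (intro power_strict_mono) auto
    then show "1 / 4 < (1 - (norm (fst p))\<^sup>2) / (2 * norm (fst p))" using t by (simp add: field_simps power2_eq_square)
  qed simp
  show "\<exists>K. compact K \<and> K \<subseteq> thermal_space \<and>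
      (\<forall>\<rho>\<in>{0<..}. \<delta> \<le> \<rho> \<longrightarrow> (\<forall>y\<in>bdry. (?al \<rho> *\<^sub>R fst y, 1 *\<^sub>R snd y) \<in> K))" if \<delta>: "0 < \<delta>" for \<delta> :: real
  proof (intro exI[of _ "cball 0 (?al \<delta>) \<times> sphere 0 1"] conjI ballI impI)
    show "cball 0 (?al \<delta>) \<times> sphere 0 1 \<subseteq> thermal_space"
      using order.strict_trans1[OF _ thermal_profile_less_1[OF \<delta>]] by (auto simp: thermal_space_def)
    fix \<rho> and y :: R32 assume \<rho>: "\<delta> \<le> \<rho>" and y: "y \<in> bdry"
    \<comment> \<open>The conjugate form shows that the ball radius decreases as \<rho> grows, so
      the points with \<rho> \<ge> \<delta> lie in a smaller closed ball.\<close>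
    have q: "?al r = inverse (sqrt (1 + r\<^sup>2) + r)" if "0 < r" for r :: real
    proof -
      have "?al r * (sqrt (1 + r\<^sup>2) + r) = 1" using thermal_profile(5)[of r] by algebra
      then show ?thesis by (metis inverse_unique mult.commute)
    qed
    have sq: "sqrt (1 + \<delta>\<^sup>2) \<le> sqrt (1 + \<rho>\<^sup>2)" using \<rho> \<delta> by (simp add: power_mono)
    then have "?al \<rho> \<le> ?al \<delta>"
      unfolding q[OF \<delta>] q[OF less_le_trans[OF \<delta> \<rho>]] by (intro le_imp_inverse_le add_mono add_pos_pos sq \<rho> \<delta> thermal_profile(2))
    then show "(?al \<rho> *\<^sub>R fst y, 1 *\<^sub>R snd y) \<in> cball 0 (?al \<delta>) \<times> sphere 0 1"
      using y thermal_profile(1)[of \<rho>] by (auto simp: bdry_def)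
  qed (intro compact_Times compact_sphere compact_cball)
  show "thermal_space \<subseteq> (\<Union>b. thermal_chart b ` thermal_chart_domain)"
  proof
    fix p assume p: "p \<in> thermal_space"
    have "0 < 1 - pole (snd p $ 1 < 0) * snd p $ 1" by (simp add: pole_def)
    then have "p \<in> thermal_chart (snd p $ 1 < 0) ` thermal_chart_domain" unfolding thermal_charts(3) using p by simp
    then show "p \<in> (\<Union>b. thermal_chart b ` thermal_chart_domain)" by blast
  qed
  show "(fst (thermal_chart b z) $ 2 = 0 \<longrightarrow> z $ 2 = 0) \<and> (snd (thermal_chart b z) $ 2 = 0 \<longrightarrow> z $ 4 = 0)" for b z
  proof -
    have "1 + (z $ 4)\<^sup>2 \<noteq> 0" by (simp add: add_nonneg_eq_0_iff)
    then show ?thesis by (simp add: thermal_chart_def)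
  qed
  show "thermal_metric \<beta> (?al \<rho> *\<^sub>R fst y, 1 *\<^sub>R snd y)
      ((s * frechet_derivative ?al (at \<rho>) 1) *\<^sub>R fst y + ?al \<rho> *\<^sub>R fst v, (s * frechet_derivative (\<lambda>_. 1) (at \<rho>) 1) *\<^sub>R snd y + 1 *\<^sub>R snd v)
      ((s' * frechet_derivative ?al (at \<rho>) 1) *\<^sub>R fst y + ?al \<rho> *\<^sub>R fst v', (s' * frechet_derivative (\<lambda>_. 1) (at \<rho>) 1) *\<^sub>R snd y + 1 *\<^sub>R snd v')
    = (s * s' / lapse 0 \<rho> + bdry_metric \<beta> (lapse 0 \<rho>) y v v') / \<rho>\<^sup>2"
    if "\<rho> \<in> {0<..}" "y \<in> bdry" "tangent_bdry y v" "tangent_bdry y v'" for \<rho> s s' :: real and y v v' :: R32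
  proof -
    have S: "0 < sqrt (1 + \<rho>\<^sup>2)" by (rule thermal_profile(2))
    have "(?al has_derivative (\<lambda>h. h * (- ?al \<rho> / sqrt (1 + \<rho>\<^sup>2)))) (at \<rho>)"
      using p1[of \<rho>] S by (auto intro!: derivative_eq_intros simp: field_simps)
    from frechet_derivative_at[OF this, symmetric]
    have e: "frechet_derivative ?al (at \<rho>) 1 = - ?al \<rho> / sqrt (1 + \<rho>\<^sup>2)" by simp
    have c: "frechet_derivative (\<lambda>_. 1::real) (at \<rho>) 1 = 0" by (simp add: frechet_derivative_const)
    show ?thesis
      using thermal_metric_polar[OF _ that(2-4) e] that(1) by (simp add: c)
  qed
qed (use \<beta> thermal_space_borel thermal_charts(1,2) smooth_on_const[of "UNIV :: real set"] in \<open>(simp; fail) | force\<close>)+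

lemma RenV_thermal:
  assumes "0 < \<beta>"
  shows "RenV thermal_space (thermal_metric \<beta>) = 0"
  using ah_end.RenV_eq[OF ah_end_thermal[OF assms]] by simp

section \<open>Evaluation at the roots of the quadratic equation and comparison of signs\<close>

lemma RenV_bh_smooth:
  assumes a: "0 < a" and \<beta>: "0 < \<beta>" and h: "3 * a\<^sup>2 - 4 * pi / \<beta> * a + 1 = 0"
  shows "RenV bh_space (bh_metric \<beta> a) = 8 * pi\<^sup>2 / 3 * (a\<^sup>2 * (1 - a\<^sup>2) / (1 + 3 * a\<^sup>2))"
proof -
  have p: "0 < 1 + 3 * a\<^sup>2" by (simp add: add_pos_nonneg)
  \<comment> \<open>The condition for the metric to close up smoothly at the horizon, solved for the
    period.\<close>
  have b: "\<beta> * (1 + 3 * a\<^sup>2) = 4 * pi * a" using h \<beta> by (simp add: field_simps)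
  have "RenV bh_space (bh_metric \<beta> a) * (1 + 3 * a\<^sup>2) = 2 * pi / 3 * (\<beta> * (1 + 3 * a\<^sup>2)) * (a * (1 - a\<^sup>2))"
    unfolding RenV_bh[OF a \<beta>] bh_mass_def by (simp add: field_simps power2_eq_square power3_eq_cube)
  also have "\<dots> = 8 * pi\<^sup>2 / 3 * (a\<^sup>2 * (1 - a\<^sup>2))" unfolding b by (simp add: power2_eq_square)
  finally show ?thesis using p by (simp add: field_simps)
qed

theorem mainTheorem6:
  fixes \<beta> a_minus a_plus :: real
  assumes "0 < \<beta>" and "\<beta> < 2 * pi / sqrt 3"
    and "a_minus < a_plus"
    and "3 * a_minus\<^sup>2 - 4 * pi / \<beta> * a_minus + 1 = 0"
    and "3 * a_plus\<^sup>2 - 4 * pi / \<beta> * a_plus + 1 = 0"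
  shows "RenV thermal_space (thermal_metric \<beta>) = 0
    \<and> RenV bh_space (bh_metric \<beta> a_plus)
        = 8 * pi\<^sup>2 / 3 * (a_plus\<^sup>2 * (1 - a_plus\<^sup>2) / (1 + 3 * a_plus\<^sup>2))
    \<and> RenV bh_space (bh_metric \<beta> a_minus)
        = 8 * pi\<^sup>2 / 3 * (a_minus\<^sup>2 * (1 - a_minus\<^sup>2) / (1 + 3 * a_minus\<^sup>2))
    \<and> (\<beta> < pi \<longrightarrow>
        RenV bh_space (bh_metric \<beta> a_plus) < RenV thermal_space (thermal_metric \<beta>)
        \<and> RenV thermal_space (thermal_metric \<beta>) = 0
        \<and> 0 < RenV bh_space (bh_metric \<beta> a_minus))
    \<and> (pi < \<beta> \<longrightarrow>
        RenV thermal_space (thermal_metric \<beta>) < RenV bh_space (bh_metric \<beta> a_plus)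
        \<and> RenV thermal_space (thermal_metric \<beta>) < RenV bh_space (bh_metric \<beta> a_minus))
    \<and> (\<forall>a\<in>{a_minus, a_plus}. \<forall>m. a ^ 3 + a - 2 * m = 0 \<longrightarrow>
        3 / (8 * pi * \<beta>) * RenV bh_space (bh_metric \<beta> a) = m - 1 / \<beta> * (pi * a\<^sup>2))"
proof -
  define K where "K = 4 * pi / \<beta>"
  have \<beta>: "0 < \<beta>" by fact
  have pos: "0 < a" if "3 * a\<^sup>2 - 4 * pi / \<beta> * a + 1 = 0" for a
  proof (rule ccontr)
    assume "\<not> 0 < a"
    then have "4 * pi / \<beta> * a \<le> 0" using \<beta> by (intro mult_nonneg_nonpos) auto
    moreover have "0 \<le> a\<^sup>2" by simp
    ultimately show False using that by linarith
  qed
  have ap: "0 < a_plus" and am: "0 < a_minus" using assms pos by blast+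
  \<comment> \<open>The difference of the two quadratic equations; cancelling the nonzero factor
    a_plus - a_minus gives the sum of the roots.\<close>
  have "(a_plus - a_minus) * (3 * (a_plus + a_minus) - K) = 0"
    using assms(4,5) unfolding K_def[symmetric] by algebra
  then have sum: "3 * (a_plus + a_minus) = K" using assms(3) by simp
  have prod: "3 * (a_plus * a_minus) = 1"
    using assms(5) unfolding K_def[symmetric] sum[symmetric] by algebra
  \<comment> \<open>The value of the quadratic polynomial at 1, whose sign decides on which side of
    1 the larger root lies.\<close>
  have vieta: "3 * ((a_plus - 1) * (a_minus - 1)) = 4 - K"
    unfolding sum[symmetric] using prod by (simp add: algebra_simps)
  have sm: "a_minus * a_minus < a_plus * a_minus" using am assms(3) by simp
  \<comment> \<open>Otherwise the product of the roots would exceed 1, but it is 1/3.\<close>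
  have am1: "a_minus < 1"
  proof (rule ccontr)
    assume "\<not> a_minus < 1"
    then have "1 * 1 \<le> a_minus * a_minus" by (intro mult_mono) auto
    then show False using sm prod by linarith
  qed
  have R: "RenV bh_space (bh_metric \<beta> a) = 2 * pi * \<beta> / 3 * a * (1 - a\<^sup>2)" if "0 < a" for a
    unfolding RenV_bh[OF that \<beta>] bh_mass_def by (simp add: field_simps power2_eq_square power3_eq_cube)
  have Rp: "0 < RenV bh_space (bh_metric \<beta> a)" if "0 < a" "a < 1" for a
    unfolding R[OF that(1)] using that \<beta> abs_square_less_1[of a] by (intro mult_pos_pos) auto
  have Rn: "RenV bh_space (bh_metric \<beta> a) < 0" if "1 < a" for a
  proof -
    have "0 < a" using that by simp
    have "1 < a\<^sup>2" using that by (simp add: one_less_power)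
    then show ?thesis unfolding R[OF \<open>0 < a\<close>] using that \<beta> by (intro mult_pos_neg mult_pos_pos) auto
  qed
  have T: "RenV thermal_space (thermal_metric \<beta>) = 0" by (rule RenV_thermal[OF \<beta>])
  have low: "1 < a_plus" if "\<beta> < pi"
  proof -
    have "4 < K" using that \<beta> by (simp add: K_def field_simps)
    then have "(a_plus - 1) * (a_minus - 1) < 0" using vieta by linarith
    then show ?thesis using am1 by (simp add: mult_less_0_iff)
  qed
  have high: "a_plus < 1" if "pi < \<beta>"
  proof -
    have "K < 4" using that \<beta> by (simp add: K_def field_simps)
    then have "0 < (a_plus - 1) * (a_minus - 1)" using vieta by linarith
    then show ?thesis using am1 by (simp add: zero_less_mult_iff)
  qed
  \<comment> \<open>Both sides equal a (1 - a^2)/4: on the right, \<pi>a^2/\<beta> becomes a (3a^2 +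
    1)/4 by the quadratic equation and m is (a^3 + a)/2.\<close>
  have id: "3 / (8 * pi * \<beta>) * RenV bh_space (bh_metric \<beta> a) = m - 1 / \<beta> * (pi * a\<^sup>2)"
    if h: "3 * a\<^sup>2 - 4 * pi / \<beta> * a + 1 = 0" and m: "a ^ 3 + a - 2 * m = 0" for a m
  proof -
    have 1: "3 / (8 * pi * \<beta>) * RenV bh_space (bh_metric \<beta> a) = a * (1 - a\<^sup>2) / 4"
      unfolding R[OF pos[OF h]] using \<beta> by (simp add: field_simps)
    have 2: "1 / \<beta> * (pi * a\<^sup>2) = (4 * pi / \<beta> * a) * a / 4" by (simp add: power2_eq_square)
    have 3: "4 * pi / \<beta> * a = 3 * a\<^sup>2 + 1" using h by simp
    have 4: "m = (a ^ 3 + a) / 2" using m by simp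
    show ?thesis unfolding 1 2 3 4 by (simp add: field_simps power2_eq_square power3_eq_cube)
  qed
  show ?thesis
    using T RenV_bh_smooth[OF ap \<beta> assms(5)] RenV_bh_smooth[OF am \<beta> assms(4)] Rn[OF low] Rp[OF am am1] Rp[OF ap high]
      id[OF assms(4)] id[OF assms(5)] by auto
qed

end
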